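(* For $n\ge1$ let $R_n:\mathcal{BC}_n\to\exp\mathcal L_n\subset\mathcal O_n$ be the representation given by $R_n(a_{ij})=\exp(v_{ij})$ ($1\le i\ne j\le n$), let $R_n\otimes\mathrm{id}:\mathcal{BP}_n=\mathcal{BC}_n\rtimes\Sigma_n\to\exp\mathcal L_n\rtimes\Sigma_n\subset\mathcal O_n\rtimes\mathbb Q[\Sigma_n]$ be the induced representation $c\cdot s\mapsto R_n(c)\otimes s$ ($c\in\mathcal{BC}_n$, $s\in\Sigma_n$), and let $\rho'_n:\mathcal B_n\to\mathcal O_n\rtimes\mathbb Q[\Sigma_n]$ be the restriction of $R_n\otimes\mathrm{id}$ to the Artin braid group $\mathcal B_n\subset\mathcal{BP}_n$. Then both families $\{R_n\otimes\mathrm{id}\}_n$ and $\{\rho'_n\}_n$ have the following properties. (1) They satisfy: (E) each $R_n\otimes\mathrm{id}$ and each $\rho'_n$ takes values in the subgroup $\exp\mathcal L_n\rtimes\Sigma_n$; ($\Sigma$) composing $R_n\otimes\mathrm{id}$ (respectively $\rho'_n$) with the projection $\exp\mathcal L_n\rtimes\Sigma_n\to\Sigma_n$ gives the canonical projection $\mathcal{BP}_n\to\Sigma_n$ (respectively $\mathcal B_n\to\Sigma_n$); (S) the restriction of $R_n\otimes\mathrm{id}$ to $\mathcal{BP}_{n-1}$ (respectively of $\rho'_n$ to $\mathcal B_{n-1}$) equals $R_{n-1}\otimes\mathrm{id}$ (respectively $\rho'_{n-1}$) followed by the canonical embedding $\exp\mathcal L_{n-1}\rtimes\Sigma_{n-1}\hookrightarrow\exp\mathcal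 L_n\rtimes\Sigma_n$. (2) They consist of faithful representations. (3) They are normalized by: $(R_n\otimes\mathrm{id})(a_{ij})\equiv_2 1+v_{ij}$ for $1\le i\ne j\le n$, respectively $\rho'_n(\sigma_i)=u_i\otimes s_i$, where $u_i\in\exp\mathcal L_n$ and $u_i\equiv_2 1+v_{i,i+1}$, for $1\le i<n$.
   Context: $\mathbb F_n$ is the free group on $x_1,\dots,x_n$. The braid-permutation (welded braid) group $\mathcal{BP}_n\subset\mathrm{Aut}(\mathbb F_n)$ consists of the automorphisms $a$ with $a(x_i)=y_i^{-1}x_{s(i)}y_i$ for $1\le i\le n$, for some $y_i\in\mathbb F_n$ and $s\in\Sigma_n$; the product is composition of automorphisms. Sending $a$ to $s$ gives a surjection $\mathcal{BP}_n\to\Sigma_n$ with kernel the McCool group $\mathcal{BC}_n$, split by the permutation action of $\Sigma_n$ on $\{x_1,\dots,x_n\}$. For $1\le i\ne j\le n$, $a_{ij}\in\mathcal{BC}_n$ sends $x_i$ to $x_j^{-1}x_ix_j$ and fixes $x_k$ for $k\ne i$. By McCool, $\mathcal{BC}_n$ is generated by the $a_{ij}$ with defining relations, for pairwise distinct indices, $(a_{ik},a_{jk})=1$, $(a_{ij},a_{ik}a_{jk})=1$, $(a_{ij},a_{kl})=1$, where $(x,y)=xyx^{-1}y^{-1}$. One has $sa_{ij}s^{-1}=a_{s(i),s(j)}$ for $s\in\Sigma_n$, and $\mathcal{BP}_n=\mathcal{BC}_n\rtimes\Sigma_n$. The embedding $\mathcal{BP}_{n-1}\hookrightarrow\mathcal{BP}_n$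 extends automorphisms by $a(x_n)=x_n$. The Artin braid group $\mathcal B_n$ (generators $\sigma_1,\dots,\sigma_{n-1}$, relations $\sigma_i\sigma_j=\sigma_j\sigma_i$ for $|i-j|\ge2$ and $\sigma_{i+1}\sigma_i\sigma_{i+1}=\sigma_i\sigma_{i+1}\sigma_i$) is embedded in $\mathcal{BP}_n$ by $\sigma_i=a_{i,i+1}s_i$, $s_i=(i,i+1)$; its canonical projection to $\Sigma_n$ is $\sigma_i\mapsto s_i$, and $\mathcal B_{n-1}\hookrightarrow\mathcal B_n$ by $\sigma_i\mapsto\sigma_i$. The oriented Artin Hopf algebra $\mathcal O_n$ is the complete Hopf algebra, the quotient of the completed free associative algebra $\mathbb Q\langle\langle v_{ij}\mid1\le i\ne j\le n\rangle\rangle$ ($v_{ij}$ primitive of degree $1$) by the relations, for pairwise distinct indices, $[v_{ik},v_{jk}]=0$, $[v_{ij},v_{ik}+v_{jk}]=0$, $[v_{ij},v_{kl}]=0$. The oriented Artin Lie algebra $\mathcal L_n$ is the complete Lie algebra of primitive elements of $\mathcal O_n$, i.e. the quotient of the complete free Lie algebra on the $v_{ij}$ by the same relations. $\Sigma_n$ acts by ${}^{\pi}v_{ij}=v_{\pi(i),\pi(j)}$. The oriented braid algebra $\mathcal O_n\rtimes\mathbb Q[\Sigma_n]$ is $\mathcal O_n\otimes\mathbb Q[\Sigma_n]$ with product $(a\otimes x)(b\otimes y)=a\cdot{}^{x}b\otimes xy$; it contains the multiplicative subgroup $\exp\mathcal L_n\rtimes\Sigma_n$. An element $u\otimes\mathrm{id}$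 is abbreviated $u$. The relation $f\equiv_2g$ in $\mathcal O_n$ means that $f$ and $g$ have the same constant term and the same linear part. *)

theory Defs
  imports
    Complex_Main
    "HOL-Algebra.Sym_Groups"
    "HOL-Algebra.Bij"
    "HOL-Algebra.QuotRing"
begin

section \<open>Groups given by generators and relations\<close>

text \<open>A letter \<open>(x, True)\<close> stands for the generator \<open>x\<close>, a letter \<open>(x, False)\<close> for its inverse.\<close>

type_synonym 'a gword = "('a \<times> bool) list"

definition gwords :: "'a set \<Rightarrow> 'a gword set" where
  "gwords X = lists (X \<times> UNIV)"

inductive word_eq :: "'a set \<Rightarrow> ('a gword \<times> 'a gword) set \<Rightarrow> 'a gword \<Rightarrow> 'a gword \<Rightarrow> bool"
  for X :: "'a set" and E :: "('a gword \<times> 'a gword) set" where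
  refl: "w \<in> gwords X \<Longrightarrow> word_eq X E w w"
| sym: "word_eq X E u v \<Longrightarrow> word_eq X E v u"
| trans: "word_eq X E u v \<Longrightarrow> word_eq X E v w \<Longrightarrow> word_eq X E u w"
| append: "word_eq X E u u' \<Longrightarrow> word_eq X E v v' \<Longrightarrow> word_eq X E (u @ v) (u' @ v')"
| cancel: "x \<in> X \<Longrightarrow> word_eq X E [(x, b), (x, \<not> b)] []"
| relation: "(u, v) \<in> E \<Longrightarrow> u \<in> gwords X \<Longrightarrow> v \<in> gwords X \<Longrightarrow> word_eq X E u v"

definition word_rel :: "'a set \<Rightarrow> ('a gword \<times> 'a gword) set \<Rightarrow> ('a gword \<times> 'a gword) set" where
  "word_rel X E = {(u, v). word_eq X E u v}"

definition presented_group ::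
    "'a set \<Rightarrow> ('a gword \<times> 'a gword) set \<Rightarrow> 'a gword set monoid" where
  "presented_group X E =
     \<lparr> carrier = gwords X // word_rel X E,
       mult = (\<lambda>A B. \<Union>u\<in>A. \<Union>v\<in>B. word_rel X E `` {u @ v}),
       one = word_rel X E `` {[]} \<rparr>"

definition word_value :: "('b, 'm) monoid_scheme \<Rightarrow> ('a \<Rightarrow> 'b) \<Rightarrow> 'a gword \<Rightarrow> 'b" where
  "word_value G f w =
     foldr (\<lambda>(x, b) g. (if b then f x else inv\<^bsub>G\<^esub> (f x)) \<otimes>\<^bsub>G\<^esub> g) w \<one>\<^bsub>G\<^esub>"

text \<open>The homomorphism from a presented group to \<open>G\<close> that sends each generator \<open>x\<close> to \<open>f x\<close>
  (meaningful when the images satisfy the relations, so that all representatives of a class have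
  the same value).\<close>

definition pres_hom ::
    "('b, 'm) monoid_scheme \<Rightarrow> ('a \<Rightarrow> 'b) \<Rightarrow> 'a gword set \<Rightarrow> 'b" where
  "pres_hom G f A = the_elem (word_value G f ` A)"


section \<open>Free groups and braid-permutation groups\<close>

type_synonym fg_elem = "nat gword set"
type_synonym fg_aut = "fg_elem \<Rightarrow> fg_elem"

definition FG :: "nat \<Rightarrow> fg_elem monoid" where
  "FG n = presented_group {1..n} {}"

definition gen :: "nat \<Rightarrow> nat \<Rightarrow> fg_elem" where
  "gen n i = word_rel {1..n} {} `` {[(i, True)]}"

definition free_endo :: "nat \<Rightarrow> (nat \<Rightarrow> fg_elem) \<Rightarrow> fg_aut" where
  "free_endo n f = restrict (pres_hom (FG n) f) (carrier (FG n))"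

definition is_bp_perm :: "nat \<Rightarrow> fg_aut \<Rightarrow> (nat \<Rightarrow> nat) \<Rightarrow> bool" where
  "is_bp_perm n a s \<longleftrightarrow> s permutes {1..n} \<and>
     (\<forall>i\<in>{1..n}. \<exists>y\<in>carrier (FG n).
        a (gen n i) = inv\<^bsub>FG n\<^esub> y \<otimes>\<^bsub>FG n\<^esub> gen n (s i) \<otimes>\<^bsub>FG n\<^esub> y)"

definition BP :: "nat \<Rightarrow> fg_aut monoid" where
  "BP n = AutoGroup (FG n) \<lparr> carrier := {a \<in> auto (FG n). \<exists>s. is_bp_perm n a s} \<rparr>"

definition bp_perm :: "nat \<Rightarrow> fg_aut \<Rightarrow> nat \<Rightarrow> nat" where
  "bp_perm n a = (THE s. is_bp_perm n a s)"

definition BC :: "nat \<Rightarrow> fg_aut monoid" where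
  "BC n = BP n \<lparr> carrier := kernel (BP n) (sym_group n) (bp_perm n) \<rparr>"

definition aut_gen :: "nat \<Rightarrow> nat \<Rightarrow> nat \<Rightarrow> fg_aut" where
  "aut_gen n i j = free_endo n (\<lambda>k.
     if k = i then inv\<^bsub>FG n\<^esub> (gen n j) \<otimes>\<^bsub>FG n\<^esub> gen n i \<otimes>\<^bsub>FG n\<^esub> gen n j else gen n k)"

definition perm_aut :: "nat \<Rightarrow> (nat \<Rightarrow> nat) \<Rightarrow> fg_aut" where
  "perm_aut n s = free_endo n (\<lambda>i. gen n (s i))"

text \<open>The embedding of \<open>BP n\<close> into \<open>BP (Suc n)\<close>; the map \<open>pres_hom (FG (Suc n)) (gen (Suc n))\<close> is
  the inclusion of \<open>FG n\<close> into \<open>FG (Suc n)\<close>.\<close>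

definition bp_embed :: "nat \<Rightarrow> fg_aut \<Rightarrow> fg_aut" where
  "bp_embed n a = free_endo (Suc n) (\<lambda>i.
     if i \<le> n then pres_hom (FG (Suc n)) (gen (Suc n)) (a (gen n i)) else gen (Suc n) i)"


section \<open>Artin braid groups\<close>

definition braid_relations :: "nat \<Rightarrow> (nat gword \<times> nat gword) set" where
  "braid_relations n =
     {([(i, True), (j, True)], [(j, True), (i, True)]) | i j.
        i \<in> {1..<n} \<and> j \<in> {1..<n} \<and> (i + 2 \<le> j \<or> j + 2 \<le> i)} \<union>
     {([(Suc i, True), (i, True), (Suc i, True)], [(i, True), (Suc i, True), (i, True)]) | i.
        i \<in> {1..<n} \<and> Suc i \<in> {1..<n}}"

definition Braid :: "nat \<Rightarrow> nat gword set monoid" where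
  "Braid n = presented_group {1..<n} (braid_relations n)"

definition sigma :: "nat \<Rightarrow> nat \<Rightarrow> nat gword set" where
  "sigma n i = word_rel {1..<n} (braid_relations n) `` {[(i, True)]}"

definition braid_to_bp :: "nat \<Rightarrow> nat gword set \<Rightarrow> fg_aut" where
  "braid_to_bp n = pres_hom (BP n) (\<lambda>i.
     aut_gen n i (Suc i) \<otimes>\<^bsub>BP n\<^esub> perm_aut n (transpose i (Suc i)))"

definition braid_perm :: "nat \<Rightarrow> nat gword set \<Rightarrow> nat \<Rightarrow> nat" where
  "braid_perm n = pres_hom (sym_group n) (\<lambda>i. transpose i (Suc i))"

definition braid_embed :: "nat \<Rightarrow> nat gword set \<Rightarrow> nat gword set" where
  "braid_embed n = pres_hom (Braid (Suc n)) (sigma (Suc n))"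


section \<open>Completed free associative algebras\<close>

text \<open>A noncommutative formal power series is given by its coefficients at all words.\<close>

type_synonym 'a ncps = "'a list \<Rightarrow> rat"
type_synonym 'a ncps2 = "'a list \<times> 'a list \<Rightarrow> rat"

definition ncps_ring :: "'a set \<Rightarrow> 'a ncps ring" where
  "ncps_ring X =
     \<lparr> carrier = {f. \<forall>w. f w \<noteq> 0 \<longrightarrow> w \<in> lists X},
       mult = (\<lambda>f g w. \<Sum>k\<le>length w. f (take k w) * g (drop k w)),
       one = (\<lambda>w. if w = [] then 1 else 0),
       zero = (\<lambda>w. 0),
       add = (\<lambda>f g w. f w + g w) \<rparr>"

definition ncps_gen :: "'a \<Rightarrow> 'a ncps" where
  "ncps_gen x = (\<lambda>w. if w = [x] then 1 else 0)"

text \<open>The completed tensor square of \<open>ncps_ring X\<close>: the coefficient at \<open>(u, v)\<close> is that of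
  \<open>u \<otimes> v\<close>.\<close>

definition ncps2_ring :: "'a set \<Rightarrow> 'a ncps2 ring" where
  "ncps2_ring X =
     \<lparr> carrier = {f. \<forall>u v. f (u, v) \<noteq> 0 \<longrightarrow> u \<in> lists X \<and> v \<in> lists X},
       mult = (\<lambda>f g (u, v). \<Sum>i\<le>length u. \<Sum>j\<le>length v.
                  f (take i u, take j v) * g (drop i u, drop j v)),
       one = (\<lambda>(u, v). if u = [] \<and> v = [] then 1 else 0),
       zero = (\<lambda>p. 0),
       add = (\<lambda>f g p. f p + g p) \<rparr>"

definition ncps_tensor :: "'a ncps \<Rightarrow> 'a ncps \<Rightarrow> 'a ncps2" where
  "ncps_tensor f g = (\<lambda>(u, v). f u * g v)"

text \<open>All shuffles of two words, listed with multiplicity (unlike the library's \<^const>\<open>shuffles\<close>,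
  which is a set).\<close>

fun shuffle_list :: "'a list \<Rightarrow> 'a list \<Rightarrow> 'a list list" where
  "shuffle_list [] v = [v]"
| "shuffle_list u [] = [u]"
| "shuffle_list (x # u) (y # v) =
     map ((#) x) (shuffle_list u (y # v)) @ map ((#) y) (shuffle_list (x # u) v)"

text \<open>The continuous algebra homomorphism for which every generator is primitive: expanding
  \<open>\<Prod>\<^sub>k (x\<^sub>k \<otimes> 1 + 1 \<otimes> x\<^sub>k)\<close>, the coefficient of \<open>u \<otimes> v\<close> in the coproduct of the word \<open>w\<close> is the
  number of ways in which \<open>w\<close> arises as a shuffle of \<open>u\<close> and \<open>v\<close>.\<close>

definition ncps_coproduct :: "'a ncps \<Rightarrow> 'a ncps2" where
  "ncps_coproduct f = (\<lambda>(u, v). \<Sum>w\<leftarrow>shuffle_list u v. f w)"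

text \<open>The exponential series; only used for series with vanishing constant term, where the
  \<open>k\<close>-th power does not contribute to words shorter than \<open>k\<close>.\<close>

definition ncps_exp :: "'a set \<Rightarrow> 'a ncps \<Rightarrow> 'a ncps" where
  "ncps_exp X f = (\<lambda>w. \<Sum>k\<le>length w. (f [^]\<^bsub>ncps_ring X\<^esub> k) w / fact k)"

text \<open>The smallest two-sided ideal containing \<open>S\<close> that is closed in the topology defined by the
  degree filtration.\<close>

definition closed_ideal ::
    "('w \<Rightarrow> rat) ring \<Rightarrow> ('w \<Rightarrow> nat) \<Rightarrow> ('w \<Rightarrow> rat) set \<Rightarrow> ('w \<Rightarrow> rat) set" where
  "closed_ideal A deg S = \<Inter>{J. ideal J A \<and> S \<subseteq> J \<and>
     (\<forall>f\<in>carrier A. (\<forall>d. \<exists>g\<in>J. \<forall>w. deg w \<le> d \<longrightarrow> g w = f w) \<longrightarrow> f \<in> J)}"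

text \<open>The map on cosets that a map \<open>h\<close> on representatives induces, with values in \<open>A Quot J\<close>.\<close>

definition coset_map ::
    "('b, 'm) ring_scheme \<Rightarrow> 'b set \<Rightarrow> ('a \<Rightarrow> 'b) \<Rightarrow> 'a set \<Rightarrow> 'b set" where
  "coset_map A J h C = the_elem ((\<lambda>f. J +>\<^bsub>A\<^esub> h f) ` C)"


section \<open>The oriented Artin Hopf algebra and its primitive elements\<close>

type_synonym idx = "nat \<times> nat"
type_synonym oalg = "idx ncps set"

definition pairs :: "nat \<Rightarrow> idx set" where
  "pairs n = {(i, j). i \<in> {1..n} \<and> j \<in> {1..n} \<and> i \<noteq> j}"

abbreviation FA :: "nat \<Rightarrow> idx ncps ring" where
  "FA n \<equiv> ncps_ring (pairs n)"

definition commutator :: "('a, 'm) ring_scheme \<Rightarrow> 'a \<Rightarrow> 'a \<Rightarrow> 'a" where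
  "commutator A a b = (a \<otimes>\<^bsub>A\<^esub> b) \<ominus>\<^bsub>A\<^esub> (b \<otimes>\<^bsub>A\<^esub> a)"

definition oriented_relators :: "nat \<Rightarrow> idx ncps set" where
  "oriented_relators n =
     {commutator (FA n) (ncps_gen (i, k)) (ncps_gen (j, k)) | i j k.
        {i, j, k} \<subseteq> {1..n} \<and> distinct [i, j, k]} \<union>
     {commutator (FA n) (ncps_gen (i, j)) (ncps_gen (i, k) \<oplus>\<^bsub>FA n\<^esub> ncps_gen (j, k)) | i j k.
        {i, j, k} \<subseteq> {1..n} \<and> distinct [i, j, k]} \<union>
     {commutator (FA n) (ncps_gen (i, j)) (ncps_gen (k, l)) | i j k l.
        {i, j, k, l} \<subseteq> {1..n} \<and> distinct [i, j, k, l]}"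

definition rel_ideal :: "nat \<Rightarrow> idx ncps set" where
  "rel_ideal n = closed_ideal (FA n) length (oriented_relators n)"

definition OA :: "nat \<Rightarrow> oalg ring" where
  "OA n = FA n Quot rel_ideal n"

definition vgen :: "nat \<Rightarrow> nat \<Rightarrow> nat \<Rightarrow> oalg" where
  "vgen n i j = rel_ideal n +>\<^bsub>FA n\<^esub> ncps_gen (i, j)"

text \<open>The completed tensor square of \<open>OA n\<close> is the quotient of the completed tensor square of
  \<open>FA n\<close> by the closure of \<open>rel_ideal n \<otimes> FA n + FA n \<otimes> rel_ideal n\<close>.\<close>

definition rel_ideal2 :: "nat \<Rightarrow> idx ncps2 set" where
  "rel_ideal2 n = closed_ideal (ncps2_ring (pairs n)) (\<lambda>(u, v). length u + length v)
     {ncps_tensor f g | f g.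
        f \<in> carrier (FA n) \<and> g \<in> carrier (FA n) \<and> (f \<in> rel_ideal n \<or> g \<in> rel_ideal n)}"

definition OA2 :: "nat \<Rightarrow> idx ncps2 set ring" where
  "OA2 n = ncps2_ring (pairs n) Quot rel_ideal2 n"

definition o_tensor :: "nat \<Rightarrow> oalg \<Rightarrow> oalg \<Rightarrow> idx ncps2 set" where
  "o_tensor n a b =
     coset_map (ncps2_ring (pairs n)) (rel_ideal2 n) (\<lambda>(f, g). ncps_tensor f g) (a \<times> b)"

definition o_coproduct :: "nat \<Rightarrow> oalg \<Rightarrow> idx ncps2 set" where
  "o_coproduct n = coset_map (ncps2_ring (pairs n)) (rel_ideal2 n) ncps_coproduct"

definition oriented_lie :: "nat \<Rightarrow> oalg set" where
  "oriented_lie n = {a \<in> carrier (OA n).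
     o_coproduct n a = o_tensor n a \<one>\<^bsub>OA n\<^esub> \<oplus>\<^bsub>OA2 n\<^esub> o_tensor n \<one>\<^bsub>OA n\<^esub> a}"

definition o_exp :: "nat \<Rightarrow> oalg \<Rightarrow> oalg" where
  "o_exp n = coset_map (FA n) (rel_ideal n) (ncps_exp (pairs n))"

definition exp_lie :: "nat \<Rightarrow> oalg monoid" where
  "exp_lie n = \<lparr> carrier = o_exp n ` oriented_lie n, mult = mult (OA n), one = one (OA n) \<rparr>"

text \<open>Constant term and linear part of a coset; the relators are homogeneous of degree two, so
  these do not depend on the representative.\<close>

definition const_term :: "oalg \<Rightarrow> rat" where
  "const_term a = the_elem ((\<lambda>f. f []) ` a)"

definition linear_part :: "oalg \<Rightarrow> idx \<Rightarrow> rat" where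
  "linear_part a = the_elem ((\<lambda>f p. f [p]) ` a)"

definition equiv2 :: "oalg \<Rightarrow> oalg \<Rightarrow> bool" (infix \<open>\<equiv>\<^sub>2\<close> 50) where
  "a \<equiv>\<^sub>2 b \<longleftrightarrow> const_term a = const_term b \<and> linear_part a = linear_part b"


section \<open>The oriented braid algebra\<close>

text \<open>The action with \<open>vgen n i j\<close> mapped to \<open>vgen n (\<pi> i) (\<pi> j)\<close>: the coefficient of the image at a
  word \<open>w\<close> is the coefficient at the word obtained by applying the inverse of \<open>\<pi>\<close> to all
  indices in \<open>w\<close>.\<close>

definition o_act :: "nat \<Rightarrow> (nat \<Rightarrow> nat) \<Rightarrow> oalg \<Rightarrow> oalg" where
  "o_act n \<pi> = coset_map (FA n) (rel_ideal n)
     (\<lambda>f w. f (map (map_prod (inv_into UNIV \<pi>) (inv_into UNIV \<pi>)) w))"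

text \<open>An element \<open>\<Sum>\<^sub>x a\<^sub>x \<otimes> x\<close> of the tensor product of \<open>OA n\<close> with the group algebra of
  the (finite) symmetric group is represented by its coefficient function \<open>x \<mapsto> a\<^sub>x\<close>.\<close>

type_synonym balg = "(nat \<Rightarrow> nat) \<Rightarrow> oalg"

definition braid_algebra :: "nat \<Rightarrow> balg ring" where
  "braid_algebra n =
     \<lparr> carrier = carrier (sym_group n) \<rightarrow>\<^sub>E carrier (OA n),
       mult = (\<lambda>F G. \<lambda>p\<in>carrier (sym_group n).
                 \<Oplus>\<^bsub>OA n\<^esub>x\<in>carrier (sym_group n).
                   F x \<otimes>\<^bsub>OA n\<^esub> o_act n x (G (inv\<^bsub>sym_group n\<^esub> x \<otimes>\<^bsub>sym_group n\<^esub> p))),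
       one = (\<lambda>p\<in>carrier (sym_group n). if p = id then \<one>\<^bsub>OA n\<^esub> else \<zero>\<^bsub>OA n\<^esub>),
       zero = (\<lambda>p\<in>carrier (sym_group n). \<zero>\<^bsub>OA n\<^esub>),
       add = (\<lambda>F G. \<lambda>p\<in>carrier (sym_group n). F p \<oplus>\<^bsub>OA n\<^esub> G p) \<rparr>"

definition pure_elem :: "nat \<Rightarrow> oalg \<Rightarrow> (nat \<Rightarrow> nat) \<Rightarrow> balg" where
  "pure_elem n a s = (\<lambda>p\<in>carrier (sym_group n). if p = s then a else \<zero>\<^bsub>OA n\<^esub>)"

definition exp_semidirect :: "nat \<Rightarrow> balg set" where
  "exp_semidirect n =
     {pure_elem n u s | u s. u \<in> carrier (exp_lie n) \<and> s \<in> carrier (sym_group n)}"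

definition semidirect_perm :: "nat \<Rightarrow> balg \<Rightarrow> nat \<Rightarrow> nat" where
  "semidirect_perm n F = (THE s. s \<in> carrier (sym_group n) \<and>
     (\<exists>u\<in>carrier (exp_lie n). F = pure_elem n u s))"

text \<open>The embedding of the oriented braid algebra on \<open>n\<close> strands into the one on \<open>Suc n\<close> strands,
  \<open>vgen n i j \<otimes> s \<mapsto> vgen (Suc n) i j \<otimes> s\<close>. A power series in the generators with indices up to \<open>n\<close> and
  a permutation of \<open>{1..n}\<close> are literally also such objects for \<open>Suc n\<close>.\<close>

definition o_embed :: "nat \<Rightarrow> oalg \<Rightarrow> oalg" where
  "o_embed n = coset_map (FA (Suc n)) (rel_ideal (Suc n)) (\<lambda>f. f)"

definition algebra_embed :: "nat \<Rightarrow> balg \<Rightarrow> balg" where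
  "algebra_embed n F = (\<lambda>p\<in>carrier (sym_group (Suc n)).
     if p \<in> carrier (sym_group n) then o_embed n (F p) else \<zero>\<^bsub>OA (Suc n)\<^esub>)"


section \<open>The representations\<close>

definition is_R :: "nat \<Rightarrow> (fg_aut \<Rightarrow> oalg) \<Rightarrow> bool" where
  "is_R n R \<longleftrightarrow> R \<in> hom (BC n) (exp_lie n) \<and>
     (\<forall>(i, j)\<in>pairs n. R (aut_gen n i j) = o_exp n (vgen n i j))"

text \<open>The map \<open>c \<cdot> s \<mapsto> R c \<otimes> s\<close>: the factors of \<open>b\<close> are \<open>s = bp_perm n b\<close> and \<open>c = b s\<^sup>-\<^sup>1\<close>.\<close>

definition R_id :: "nat \<Rightarrow> (fg_aut \<Rightarrow> oalg) \<Rightarrow> fg_aut \<Rightarrow> balg" where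
  "R_id n R b =
     pure_elem n (R (b \<otimes>\<^bsub>BP n\<^esub> inv\<^bsub>BP n\<^esub> (perm_aut n (bp_perm n b)))) (bp_perm n b)"

definition rho' :: "nat \<Rightarrow> (fg_aut \<Rightarrow> oalg) \<Rightarrow> nat gword set \<Rightarrow> balg" where
  "rho' n R \<beta> = R_id n R (braid_to_bp n \<beta>)"

end

theory Submission
  imports Defs "HOL-Computational_Algebra.Formal_Power_Series"
begin

text \<open>Why the theorem holds. Write \<open>F\<^sub>n\<close> for the free group, \<open>X\<^sub>1, \<dots>, X\<^sub>n\<close> for noncommuting variables, and let
\<open>v\<^sub>i\<^sub>j\<close> act on \<open>\<rat>\<langle>\<langle>X\<^sub>1, \<dots>, X\<^sub>n\<rangle>\<rangle>\<close> as the continuous derivation with \<open>X\<^sub>i \<mapsto> X\<^sub>i X\<^sub>j - X\<^sub>j X\<^sub>i\<close> that kills the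
other variables.

\<^item> \<^emph>\<open>The representation exists.\<close> If \<open>a\<close> and \<open>b\<close> commute then \<open>exp (a + b) = exp a exp b\<close>, and exponentials
  of commuting elements commute; hence the defining relations between the \<open>v\<^sub>i\<^sub>j\<close> give McCool's relations
  between the \<open>exp v\<^sub>i\<^sub>j\<close> (\<open>mccool_relations_exp_lie\<close>). It remains to know that McCool's relations
  present the group of basis-conjugating automorphisms (\<open>mccool_universal\<close>). An automorphism with
  \<open>x\<^sub>i \<mapsto> y\<^sub>i\<^sup>-\<^sup>1 x\<^sub>i y\<^sub>i\<close> is reduced to the identity by right multiplications with generators that shorten
  some \<open>y\<^sub>i\<close>: Nielsen's cancellation argument shows that only the identity cannot be shortened
  (\<open>irreducible_eq_one\<close>). Shortening is confluent up to McCool's relations (\<open>descends_unique\<close>), so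
  replaying it in a group in which the relations hold is well defined, and multiplicative.

\<^item> \<^emph>\<open>It takes values in a group.\<close> The exponentials of primitive elements are precisely the group-like
  elements (\<open>exp_lie_carrier\<close>), and these are visibly closed under products and inverses, whence no
  Baker-Campbell-Hausdorff formula is needed.

\<^item> \<^emph>\<open>It is faithful.\<close> The derivations satisfy the relations of the oriented Artin algebra (\<open>act_J\<close>),
  so the algebra acts on power series. The exponential of a derivation is an algebra automorphism, and
  \<open>exp v\<^sub>i\<^sub>j\<close> maps \<open>exp X\<^sub>i\<close> to \<open>exp (- X\<^sub>j) exp X\<^sub>i exp X\<^sub>j\<close>. Under the Magnus embedding \<open>x\<^sub>i \<mapsto> exp X\<^sub>i\<close>, which
  is injective (\<open>magnus_inj\<close>), the action of \<open>R c\<close> therefore restricts to the automorphism \<open>c\<close>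
  itself (\<open>R_acts\<close>), and \<open>c\<close> can be recovered from \<open>R c\<close> (\<open>R_inj\<close>).

\<^item> \<^emph>\<open>It extends to the braid-permutation group.\<close> Conjugation by a permutation renames the indices on
  both sides (\<open>R_equivariant\<close>), which is what makes \<open>c s \<mapsto> R c \<otimes> s\<close> multiplicative, and an element
  \<open>u \<otimes> s\<close> determines \<open>u\<close> and \<open>s\<close>.

\<^item> \<^emph>\<open>It restricts faithfully to the braid groups.\<close> This needs Artin's theorem that the braid group acts
  faithfully on \<open>F\<^sub>n\<close> (\<open>braid_to_bp_inj\<close>), which is proved by combing: every braid on \<open>n + 1\<close> strands is a
  product of a word in the braids that wind the last strand around another one, a braid on the first
  \<open>n\<close> strands, and a braid that moves one strand to the end (\<open>Braid_combed\<close>). Each of the three factors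
  can be read off from the action, so induction on \<open>n\<close> applies.

Stability under adding a strand, the underlying permutations, and the normalization are read off on
generators.\<close>

section \<open>Noncommutative power series as a ring\<close>

text \<open>Series indexed by words form the free algebra, and series indexed by pairs of words its completed
tensor square. Both are instances of one construction; all that the Cauchy product needs is that an
index has finitely many factorizations.\<close>
class graded_monoid =
  fixes mcat :: "'a \<Rightarrow> 'a \<Rightarrow> 'a" and mnil :: 'a and mdeg :: "'a \<Rightarrow> nat"
  assumes mcat_assoc: "mcat (mcat a b) c = mcat a (mcat b c)"
    and mcat_nil [simp]: "mcat mnil a = a" "mcat a mnil = a"
    and mdeg_mcat [simp]: "mdeg (mcat a b) = mdeg a + mdeg b"
    and mdeg_eq_0_iff [simp]: "mdeg a = 0 \<longleftrightarrow> a = mnil"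
    and finite_factorizations: "finite {p. mcat (fst p) (snd p) = w}"

context graded_monoid begin
lemma mdeg_mnil [simp]: "mdeg mnil = 0" by simp
end

instantiation list :: (type) graded_monoid
begin
definition mcat_list_def [simp]: "mcat = (@)"
definition mnil_list_def [simp]: "mnil = []"
definition mdeg_list_def [simp]: "mdeg = length"

lemma splits_list: "{p :: 'a list \<times> 'a list. fst p @ snd p = w} = (\<lambda>k. (take k w, drop k w)) ` {..length w}"
proof (intro Set.set_eqI iffI)
  fix p :: "'a list \<times> 'a list" assume "p \<in> {p. fst p @ snd p = w}"
  then have "p = (take (length (fst p)) w, drop (length (fst p)) w)" "length (fst p) \<le> length w"
    by (auto simp: prod_eq_iff)
  then show "p \<in> (\<lambda>k. (take k w, drop k w)) ` {..length w}" by blast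
qed auto

instance by standard (simp_all add: splits_list)
end

instantiation prod :: (graded_monoid, graded_monoid) graded_monoid
begin
definition mcat_prod_def: "mcat p q = (mcat (fst p) (fst q), mcat (snd p) (snd q))"
definition mnil_prod_def: "mnil = (mnil, mnil)"
definition mdeg_prod_def: "mdeg p = mdeg (fst p) + mdeg (snd p)"
instance
proof
  fix w :: "'a \<times> 'b"
  have "{p. mcat (fst p) (snd p) = w} \<subseteq>
    (\<lambda>(p, q). ((fst p, fst q), (snd p, snd q))) `
      ({p. mcat (fst p) (snd p) = fst w} \<times> {p. mcat (fst p) (snd p) = snd w})"
  proof
    fix p assume "p \<in> {p. mcat (fst p) (snd p) = w}"
    then have "mcat (fst p) (snd p) = w" by simp
    then show "p \<in> (\<lambda>(p, q). ((fst p, fst q), (snd p, snd q))) `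
      ({p. mcat (fst p) (snd p) = fst w} \<times> {p. mcat (fst p) (snd p) = snd w})"
      by (intro image_eqI[of _ _ "((fst (fst p), fst (snd p)), (snd (fst p), snd (snd p)))"])
         (auto simp: mcat_prod_def)
  qed
  then show "finite {p. mcat (fst p) (snd p) = w}"
    by (rule finite_subset) (intro finite_imageI finite_cartesian_product finite_factorizations)
qed (auto simp: mcat_prod_def mnil_prod_def mdeg_prod_def mcat_assoc prod_eq_iff)
end

definition splits :: "'a::graded_monoid \<Rightarrow> ('a \<times> 'a) set" where
  "splits w = {p. mcat (fst p) (snd p) = w}"

lemma finite_splits [simp]: "finite (splits w)"
  by (simp add: splits_def finite_factorizations)

text \<open>With the Cauchy product as multiplication of the function type, the simplifier's ring arithmetic is
available for series; the records of algebra theory only enter through \<open>sring\<close> below.\<close>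
instantiation "fun" :: (graded_monoid, comm_ring_1) ring_1
begin
definition zero_series_def: "0 = (\<lambda>_. 0)"
definition one_series_def: "1 = (\<lambda>w. if w = mnil then 1 else 0)"
definition plus_series_def: "f + g = (\<lambda>w. f w + g w)"
definition times_series_def: "f * g = (\<lambda>w. \<Sum>p\<in>splits w. f (fst p) * g (snd p))"

instance
proof
  fix f g h :: "'a \<Rightarrow> 'b"
  show "f * g * h = f * (g * h)"
  proof
    fix w
    have "(f * g * h) w = (\<Sum>(p, q)\<in>Sigma (splits w) (\<lambda>p. splits (fst p)).
        f (fst q) * g (snd q) * h (snd p))"
      by (simp add: times_series_def sum_distrib_right sum.Sigma)
    also have "\<dots> = (\<Sum>(p, q)\<in>Sigma (splits w) (\<lambda>p. splits (snd p)).
        f (fst p) * (g (fst q) * h (snd q)))"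
      by (rule sum.reindex_bij_witness[of _
            "\<lambda>(p, q). ((mcat (fst p) (fst q), snd q), (fst p, fst q))"
            "\<lambda>(p, q). ((fst q, mcat (snd q) (snd p)), (snd q, snd p))"])
         (auto simp: splits_def mcat_assoc mult.assoc)
    also have "\<dots> = (f * (g * h)) w"
      by (simp add: times_series_def sum_distrib_left sum.Sigma)
    finally show "(f * g * h) w = (f * (g * h)) w" .
  qed
  show "1 * f = f"
  proof
    fix w
    have "(1 * f) w = (\<Sum>p\<in>splits w. if p = (mnil, w) then f w else 0)"
      unfolding times_series_def one_series_def by (rule sum.cong) (auto simp: splits_def)
    then show "(1 * f) w = f w"
      by (simp add: sum.delta[OF finite_splits]) (simp add: splits_def)
  qed
  show "f * 1 = f"
  proof
    fix w
    have "(f * 1) w = (\<Sum>p\<in>splits w. if p = (w, mnil) then f w else 0)"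
      unfolding times_series_def one_series_def by (rule sum.cong) (auto simp: splits_def)
    then show "(f * 1) w = f w"
      by (simp add: sum.delta[OF finite_splits]) (simp add: splits_def)
  qed
  show "(0::'a \<Rightarrow> 'b) \<noteq> 1" by (auto simp: zero_series_def one_series_def fun_eq_iff)
qed (auto simp: plus_series_def zero_series_def times_series_def fun_eq_iff algebra_simps sum.distrib)
end

lemma series_apply [simp]:
  "(0 :: 'a::graded_monoid \<Rightarrow> 'b::comm_ring_1) w = 0"
  "(f + g) w = f w + g w" for f g :: "'a::graded_monoid \<Rightarrow> 'b::comm_ring_1"
  by (simp_all add: zero_series_def plus_series_def)

lemma zero_series_fold [simp]: "(\<lambda>_::'a::graded_monoid. 0::'b::comm_ring_1) = 0"
  by (simp add: fun_eq_iff)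

lemma series_sum_apply:
  "sum F A w = (\<Sum>x\<in>A. F x w)" for F :: "'i \<Rightarrow> 'a::graded_monoid \<Rightarrow> 'b::comm_ring_1"
  by (induction A rule: infinite_finite_induct) auto

type_synonym 'm ser = "'m \<Rightarrow> rat"

lemma times_mnil [simp]: "(f * g) mnil = f mnil * (g mnil)" for f g :: "'m::graded_monoid ser"
proof -
  have "mcat a b = mnil \<longleftrightarrow> a = mnil \<and> b = mnil" for a b :: 'm
    by (metis add_is_0 mdeg_eq_0_iff mdeg_mcat)
  then have "splits (mnil::'m) = {(mnil, mnil)}"
    by (auto simp: splits_def)
  then show ?thesis by (simp add: times_series_def)
qed

lemma one_mnil [simp]: "(1 :: 'm::graded_monoid ser) mnil = 1"
  by (simp add: one_series_def)

definition sc :: "rat \<Rightarrow> 'm::graded_monoid ser \<Rightarrow> 'm ser" where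
  "sc c f = (\<lambda>w. c * f w)"

lemma sc_apply: "sc c f w = c * f w"
  by (simp add: sc_def)

lemmas ser_simps = sc_apply series_sum_apply

lemma sc_simps [simp]:
  "sc 0 f = 0" "sc 1 f = f" "sc c 0 = 0" "sc a (sc b f) = sc (a * b) f"
  "sc a f * g = sc a (f * g)" "f * sc a g = sc a (f * g)"
  "sc (- 1) f = - f"
  by (auto simp: fun_eq_iff times_series_def sum_distrib_left mult_ac sc_apply)

lemma sc_add: "sc c (f + g) = sc c f + sc c g" "sc (a + b) f = sc a f + sc b f"
  by (auto simp: fun_eq_iff algebra_simps sc_apply)

lemma sc_diff: "sc c (f - g) = sc c f - sc c g"
  by (auto simp: fun_eq_iff algebra_simps sc_apply)

lemma sc_sum: "sc c (sum F A) = (\<Sum>x\<in>A. sc c (F x))"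
  by (induction A rule: infinite_finite_induct)
     (simp_all only: sum.infinite sum.empty sum.insert sc_add sc_simps not_False_eq_True)

text \<open>The filtration by degree, which defines the topology.\<close>
definition low :: "nat \<Rightarrow> 'm::graded_monoid ser \<Rightarrow> bool" where
  "low d f \<longleftrightarrow> (\<forall>w. mdeg w < d \<longrightarrow> f w = 0)"

lemma low_0 [simp]: "low 0 f" by (simp add: low_def)
lemma low_Suc_0 [simp]: "low (Suc 0) f \<longleftrightarrow> f mnil = 0" by (simp add: low_def)
lemma low_add: "low d f \<Longrightarrow> low d g \<Longrightarrow> low d (f + g)" by (simp add: low_def)
lemma low_sc: "low d f \<Longrightarrow> low d (sc c f)" by (simp add: low_def sc_apply)
lemma low_diff: "low d f \<Longrightarrow> low d g \<Longrightarrow> low d (f - g)" by (simp add: low_def)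
lemma low_sum: "(\<And>x. x \<in> A \<Longrightarrow> low d (F x)) \<Longrightarrow> low d (sum F A)" by (simp add: low_def ser_simps)

lemma low_mult: "low d f \<Longrightarrow> low e g \<Longrightarrow> low (d + e) (f * g)"
  unfolding low_def times_series_def
proof (intro allI impI sum.neutral ballI)
  fix w and p :: "'a \<times> 'a"
  assume *: "\<forall>w. mdeg w < d \<longrightarrow> f w = 0" "\<forall>w. mdeg w < e \<longrightarrow> g w = 0" "mdeg w < d + e" "p \<in> splits w"
  then have "mdeg (fst p) < d \<or> mdeg (snd p) < e" by (auto simp: splits_def)
  then show "f (fst p) * g (snd p) = 0" using * by auto
qed

lemma low_power: "f mnil = 0 \<Longrightarrow> low k (f ^ k)"
  by (induction k) (use low_mult[of "Suc 0" f] in auto)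

text \<open>The sum of a sequence whose \<open>k\<close>-th term has degree at J_induct \<open>k\<close>.\<close>
definition ssum :: "(nat \<Rightarrow> 'm::graded_monoid ser) \<Rightarrow> 'm ser" where
  "ssum p = (\<lambda>w. \<Sum>k\<le>mdeg w. p k w)"

lemma ssum_apply_ge:
  assumes "\<And>k. low k (p k)" "mdeg w \<le> N"
  shows "ssum p w = (\<Sum>k\<le>N. p k w)"
  unfolding ssum_def by (rule sum.mono_neutral_left) (use assms in \<open>auto simp: low_def\<close>)

lemma ssum_mult:
  fixes p q :: "nat \<Rightarrow> 'm::graded_monoid ser"
  assumes p: "\<And>k. low k (p k)" and q: "\<And>k. low k (q k)"
  shows "ssum p * ssum q = ssum (\<lambda>k. \<Sum>i\<le>k. p i * q (k - i))"
proof
  fix w :: 'm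
  let ?N = "mdeg w"
  have "(ssum p * ssum q) w = (\<Sum>s\<in>splits w. (\<Sum>i\<le>?N. p i (fst s)) * (\<Sum>j\<le>?N. q j (snd s)))"
    unfolding times_series_def
    by (intro sum.cong refl arg_cong2[of _ _ _ _ times] ssum_apply_ge p q) (auto simp: splits_def)
  also have "\<dots> = (\<Sum>s\<in>splits w. \<Sum>(i, j)\<in>{..?N} \<times> {..?N}. p i (fst s) * q j (snd s))"
    by (simp add: sum_product sum.cartesian_product)
  also have "\<dots> = (\<Sum>(i, j)\<in>{..?N} \<times> {..?N}. (p i * q j) w)"
    by (subst sum.swap) (simp add: times_series_def case_prod_unfold)
  also have "\<dots> = (\<Sum>(i, j)\<in>{(i, j). i + j \<le> ?N}. (p i * q j) w)"
  proof -
    have "(p i * q j) w = 0" if "\<not> i + j \<le> ?N" for i j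
      using low_mult[OF p[of i] q[of j]] that by (auto simp: low_def)
    then show ?thesis by (intro sum.mono_neutral_right) auto
  qed
  also have "\<dots> = ssum (\<lambda>k. \<Sum>i\<le>k. p i * q (k - i)) w"
    by (simp add: sum.triangle_reindex_eq ssum_def ser_simps)
  finally show "(ssum p * ssum q) w = ssum (\<lambda>k. \<Sum>i\<le>k. p i * q (k - i)) w" .
qed

text \<open>Continuous linear maps commute with such sums.\<close>
definition cont_lin :: "('m::graded_monoid ser \<Rightarrow> 'k::graded_monoid ser) \<Rightarrow> bool" where
  "cont_lin h \<longleftrightarrow> (\<forall>f g. h (f + g) = h f + h g) \<and> (\<forall>c f. h (sc c f) = sc c (h f)) \<and>
     (\<forall>d f. low d f \<longrightarrow> low d (h f))"

lemma cont_linD: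
  assumes "cont_lin h"
  shows "h (f + g) = h f + h g" "h (sc c f) = sc c (h f)" "low d f \<Longrightarrow> low d (h f)"
    "h 0 = 0" "h (- f) = - h f" "h (f - g) = h f - h g"
proof -
  show *: "h (f + g) = h f + h g" "h (sc c f) = sc c (h f)" "low d f \<Longrightarrow> low d (h f)" for f g c d
    using assms by (auto simp: cont_lin_def)
  show "h 0 = 0" using *(2)[of 0] by simp
  show m: "h (- f) = - h f" for f using *(2)[of "-1"] by simp
  show "h (f - g) = h f - h g" using *(1)[of f "- g"] m by simp
qed

lemma cont_lin_sum: "cont_lin h \<Longrightarrow> h (sum F A) = (\<Sum>x\<in>A. h (F x))"
  by (induction A rule: infinite_finite_induct)
     (simp_all only: sum.infinite sum.empty sum.insert cont_linD not_False_eq_True)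

text \<open>A map that respects the filtration computes each coefficient from finitely many degrees. This is what
reduces statements about infinite sums to finite ones.\<close>
lemma cont_lin_agree:
  assumes "cont_lin h" "\<And>w. mdeg w \<le> N \<Longrightarrow> f w = g w" "mdeg u \<le> N"
  shows "h f u = h g u"
proof -
  have "low (Suc N) (f - g)" using assms(2) by (auto simp: low_def)
  then have "low (Suc N) (h f - h g)" using assms(1) by (metis cont_linD(3,6))
  then show ?thesis using assms(3) by (simp add: low_def)
qed

lemma cont_lin_ssum:
  assumes h: "cont_lin h" and p: "\<And>k. low k (p k)"
  shows "h (ssum p) = ssum (\<lambda>k. h (p k))"
proof
  fix u
  have "h (ssum p) u = h (\<Sum>k\<le>mdeg u. p k) u"
    by (rule cont_lin_agree[OF h _ order_refl]) (simp add: ssum_apply_ge[of p, OF p] ser_simps)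
  then show "h (ssum p) u = ssum (\<lambda>k. h (p k)) u"
    by (simp add: cont_lin_sum[OF h] ssum_def ser_simps)
qed

lemma cont_lin_mult: "cont_lin (\<lambda>f. g * f)" "cont_lin (\<lambda>f. f * g)"
  using low_mult[of 0 g] low_mult[of _ _ 0 g] by (auto simp: cont_lin_def algebra_simps)

lemma cont_lin_compose: "cont_lin h \<Longrightarrow> cont_lin k \<Longrightarrow> cont_lin (\<lambda>f. h (k f))"
  by (auto simp: cont_lin_def)

lemma cont_lin_diff: "cont_lin h \<Longrightarrow> cont_lin k \<Longrightarrow> cont_lin (\<lambda>f. h f - k f)"
  unfolding cont_lin_def by (auto simp: low_def algebra_simps fun_eq_iff sc_apply)

subsection \<open>Substitution into power series in one variable\<close>

text \<open>Substitution of \<open>f\<close>, without constant term, for the variable of a one-variable power series. It is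
multiplicative and compatible with composition, so that identities between \<open>exp\<close> and \<open>log\<close> carry over
from one-variable power series.\<close>
definition psub :: "rat fps \<Rightarrow> 'm::graded_monoid ser \<Rightarrow> 'm ser" where
  "psub c f = ssum (\<lambda>k. sc (fps_nth c k) (f ^ k))"

lemma psub_low: "f mnil = 0 \<Longrightarrow> low k (sc (fps_nth c k) (f ^ k))"
  by (intro low_sc low_power)

lemma psub_mnil [simp]: "psub c f mnil = fps_nth c 0"
proof -
  have "{..mdeg (mnil :: 'a)} = {0}" by auto
  then show ?thesis by (simp add: psub_def ssum_def ser_simps)
qed

lemma psub_mult:
  assumes "f mnil = 0"
  shows "psub (c * d) f = psub c f * psub d f"
proof -
  have "(\<Sum>i\<le>k. sc (fps_nth c i) (f ^ i) * sc (fps_nth d (k - i)) (f ^ (k - i))) =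
      sc (fps_nth (c * d) k) (f ^ k)" for k
  proof -
    have "(\<Sum>i\<le>k. sc (fps_nth c i) (f ^ i) * sc (fps_nth d (k - i)) (f ^ (k - i))) =
       (\<Sum>i\<le>k. sc (fps_nth c i * fps_nth d (k - i)) (f ^ k))"
      by (intro sum.cong refl) (simp, simp add: mult.commute flip: power_add)
    also have "\<dots> = sc (fps_nth (c * d) k) (f ^ k)"
      by (auto simp: fun_eq_iff fps_mult_nth sum_distrib_right atLeast0AtMost ser_simps)
    finally show ?thesis .
  qed
  then show ?thesis
    unfolding psub_def by (simp add: ssum_mult psub_low assms)
qed

lemma psub_1 [simp]: "psub 1 f = 1"
proof
  fix w
  have "psub 1 f w = (\<Sum>k\<le>mdeg w. if k = 0 then 1 w else 0)"
    unfolding psub_def ssum_def by (rule sum.cong) (auto simp: ser_simps)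
  then show "psub 1 f w = 1 w" by simp
qed

lemma psub_power: "f mnil = 0 \<Longrightarrow> psub (c ^ k) f = psub c f ^ k"
  by (induction k) (auto simp: psub_mult)

lemma psub_X [simp]:
  assumes "f mnil = 0"
  shows "psub fps_X f = f"
proof
  fix w
  have "psub fps_X f w = (\<Sum>k\<le>mdeg w. if k = 1 then f w else 0)"
    unfolding psub_def ssum_def by (rule sum.cong) (auto simp: ser_simps)
  also have "\<dots> = f w" using assms by (cases "mdeg w") (auto simp: sum.delta)
  finally show "psub fps_X f w = f w" .
qed

lemma psub_diff: "psub (c - d) f = psub c f - psub d f"
  by (auto simp: psub_def ssum_def fun_eq_iff algebra_simps sum_subtractf ser_simps)

text \<open>In degree \<open>N\<close> only the first \<open>N\<close> coefficients of either series matter, so this is an exchange of two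
finite sums.\<close>
lemma psub_compose:
  fixes f :: "'m::graded_monoid ser"
  assumes f: "f mnil = 0" and d: "fps_nth d 0 = 0"
  shows "psub c (psub d f) = psub (c oo d) f"
proof
  fix w :: 'm
  let ?N = "mdeg w"
  have "psub c (psub d f) w = (\<Sum>i\<le>?N. \<Sum>k\<le>?N. fps_nth c i * fps_nth (d ^ i) k * (f ^ k) w)"
    by (simp add: psub_def[of c] ssum_def psub_power[where f = f and c = d, OF f, symmetric] ser_simps)
       (simp add: psub_def ssum_def sum_distrib_left mult.assoc ser_simps cong: sum.cong)
  also have "\<dots> = (\<Sum>k\<le>?N. (\<Sum>i\<le>?N. fps_nth c i * fps_nth (d ^ i) k) * (f ^ k) w)"
    by (subst sum.swap) (simp add: sum_distrib_right)
  also have "\<dots> = (\<Sum>k\<le>?N. fps_nth (c oo d) k * (f ^ k) w)"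
  proof (intro sum.cong refl arg_cong2[of _ _ _ _ times])
    fix k assume "k \<in> {..?N}"
    then show "(\<Sum>i\<le>?N. fps_nth c i * fps_nth (d ^ i) k) = fps_nth (c oo d) k"
      unfolding fps_compose_nth
      by (intro sum.mono_neutral_right) (auto simp: startsby_zero_power_prefix[OF d])
  qed auto
  also have "\<dots> = psub (c oo d) f w" by (simp add: psub_def ssum_def ser_simps)
  finally show "psub c (psub d f) w = psub (c oo d) f w" .
qed

definition exps :: "'m::graded_monoid ser \<Rightarrow> 'm ser" where
  "exps f = psub (fps_exp 1) f"

definition logs :: "'m::graded_monoid ser \<Rightarrow> 'm ser" where
  "logs f = psub (fps_ln 1) (f - 1)"

lemma exps_eq_ssum: "exps f = ssum (\<lambda>k. sc (1 / fact k) (f ^ k))"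
  by (simp add: exps_def psub_def)

lemma exps_mnil [simp]: "exps f mnil = 1"
  by (simp add: exps_def)

lemma logs_mnil [simp]: "logs f mnil = 0"
  by (simp add: logs_def fps_ln_def)

lemma exps_logs:
  assumes "f mnil = 1"
  shows "exps (logs f) = f"
proof -
  have *: "fps_exp 1 oo fps_ln 1 = 1 + (fps_X :: rat fps)"
  proof -
    have "(fps_exp 1 - 1) oo fps_inv (fps_exp (1::rat) - 1) = fps_X"
      by (rule fps_inv_right) auto
    then have "(fps_exp 1 oo fps_ln 1) - 1 = (fps_X :: rat fps)"
      by (simp add: fps_compose_sub_distrib fps_ln_fps_exp_inv)
    then show ?thesis by (simp add: algebra_simps)
  qed
  have "exps (logs f) = psub (fps_X - (0 - 1)) (f - 1)"
    unfolding exps_def logs_def using assms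
    by (subst psub_compose) (simp_all add: *, simp_all add: fps_ln_def algebra_simps)
  also have "\<dots> = psub fps_X (f - 1) - psub (0 - 1) (f - 1)"
    by (simp only: psub_diff)
  also have "psub 0 (f - 1) = 0"
    by (simp add: psub_def ssum_def fun_eq_iff)
  then have "psub fps_X (f - 1) - psub (0 - 1) (f - 1) = f"
    using assms by (simp only: psub_diff psub_1) simp
  finally show ?thesis .
qed

lemma logs_exps:
  assumes "f mnil = 0"
  shows "logs (exps f) = f"
proof -
  have "fps_ln 1 oo (fps_exp 1 - 1) = (fps_X :: rat fps)"
    using fps_inv[of "fps_exp (1::rat) - 1"] by (simp add: fps_ln_fps_exp_inv)
  moreover have "exps f - 1 = psub (fps_exp 1 - 1) f"
    by (simp add: exps_def psub_diff)
  ultimately show ?thesis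
    using assms by (simp add: logs_def psub_compose)
qed

text \<open>The binomial theorem in the form that gives both \<open>exp (a + b) = exp a exp b\<close> for commuting
  \<open>a\<close>, \<open>b\<close> and the multiplicativity of the exponential of a derivation. Equality is taken modulo
  an \<open>h\<close>-stable subspace \<open>N\<close>, because generators of a quotient algebra commute only modulo the
  relations.\<close>
lemma binomial_iterate_mod:
  fixes T :: "nat \<Rightarrow> nat \<Rightarrow> 'm::graded_monoid ser"
  assumes h: "cont_lin h" and T: "\<And>i j. h (T i j) - (T (Suc i) j + T i (Suc j)) \<in> N"
    and N: "0 \<in> N" "\<And>f g. f \<in> N \<Longrightarrow> g \<in> N \<Longrightarrow> f + g \<in> N" "\<And>c f. f \<in> N \<Longrightarrow> sc c f \<in> N"
      "\<And>f. f \<in> N \<Longrightarrow> h f \<in> N"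
  shows "sc (1 / fact k) ((h ^^ k) (T 0 0)) -
    (\<Sum>i\<le>k. sc (1 / fact i * (1 / fact (k - i))) (T i (k - i))) \<in> N"
proof -
  have sumN: "(\<Sum>i\<in>A. F i) \<in> N" if "\<And>i. F i \<in> N" for F :: "nat \<Rightarrow> 'm ser" and A
    using that N(1,2) by (induction A rule: infinite_finite_induct) auto
  let ?c = "\<lambda>k i. rat_of_nat (k choose i)"
  have *: "(h ^^ k) (T 0 0) - (\<Sum>i\<le>k. sc (?c k i) (T i (k - i))) \<in> N"
  proof (induction k)
    case (Suc k)
    have "(\<Sum>i\<le>k. sc (?c k i) (T (Suc i) (k - i) + T i (Suc (k - i)))) =
        (\<Sum>i\<le>k. sc (?c k i) (T (Suc i) (k - i))) + (\<Sum>i\<le>k. sc (?c k i) (T i (Suc k - i)))"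
      by (simp add: sc_add sum.distrib Suc_diff_le cong: sum.cong_simp)
    also have "(\<Sum>i\<le>k. sc (?c k i) (T i (Suc k - i))) = (\<Sum>i\<le>Suc k. sc (?c k i) (T i (Suc k - i)))"
      by (simp add: binomial_eq_0)
    also have "\<dots> = T 0 (Suc k) + (\<Sum>i\<le>k. sc (?c k (Suc i)) (T (Suc i) (k - i)))"
      by (subst sum.atMost_Suc_shift) simp
    also have "(\<Sum>i\<le>k. sc (?c k i) (T (Suc i) (k - i))) + \<dots> =
        T 0 (Suc k) + (\<Sum>i\<le>k. sc (?c (Suc k) (Suc i)) (T (Suc i) (k - i)))"
      by (simp add: sc_add sum.distrib add_ac)
    also have "\<dots> = (\<Sum>i\<le>Suc k. sc (?c (Suc k) i) (T i (Suc k - i)))"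
      by (subst sum.atMost_Suc_shift) simp
    finally have pascal: "(\<Sum>i\<le>k. sc (?c k i) (T (Suc i) (k - i) + T i (Suc (k - i)))) =
        (\<Sum>i\<le>Suc k. sc (?c (Suc k) i) (T i (Suc k - i)))" .
    have "h ((h ^^ k) (T 0 0) - (\<Sum>i\<le>k. sc (?c k i) (T i (k - i)))) +
       (\<Sum>i\<le>k. sc (?c k i) (h (T i (k - i)) - (T (Suc i) (k - i) + T i (Suc (k - i))))) \<in> N"
      by (intro N sumN T Suc)
    also have "h ((h ^^ k) (T 0 0) - (\<Sum>i\<le>k. sc (?c k i) (T i (k - i)))) +
       (\<Sum>i\<le>k. sc (?c k i) (h (T i (k - i)) - (T (Suc i) (k - i) + T i (Suc (k - i))))) =
       (h ^^ Suc k) (T 0 0) - (\<Sum>i\<le>k. sc (?c k i) (T (Suc i) (k - i) + T i (Suc (k - i))))"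
      by (simp add: cont_linD[OF h] cont_lin_sum[OF h] sc_diff sum_subtractf)
    finally show ?case by (simp only: pascal)
  qed (simp add: N)
  have "sc (1 / fact k) ((h ^^ k) (T 0 0)) -
      (\<Sum>i\<le>k. sc (1 / fact i * (1 / fact (k - i))) (T i (k - i))) =
     sc (1 / fact k) ((h ^^ k) (T 0 0) - (\<Sum>i\<le>k. sc (?c k i) (T i (k - i))))"
    by (auto simp: sc_diff sc_sum binomial_fact intro!: sum.cong arg_cong2[of _ _ _ _ sc])
  then show ?thesis using N(3)[OF *] by simp
qed

lemma binomial_iterate:
  fixes T :: "nat \<Rightarrow> nat \<Rightarrow> 'm::graded_monoid ser"
  assumes "cont_lin h" "\<And>i j. h (T i j) = T (Suc i) j + T i (Suc j)"
  shows "sc (1 / fact k) ((h ^^ k) (T 0 0)) = (\<Sum>i\<le>k. sc (1 / fact i * (1 / fact (k - i))) (T i (k - i)))"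
  using binomial_iterate_mod[where N = "{0}" and h = h and T = T and k = k] assms
  by (simp add: cont_linD)

lemma exps_zero [simp]: "exps 0 = 1"
proof
  fix w :: 'a
  have "exps 0 w = (\<Sum>k\<le>mdeg w. if k = 0 then 1 w else 0)"
    unfolding exps_eq_ssum ssum_def by (intro sum.cong refl) (auto simp: power_0_left ser_simps)
  then show "exps 0 w = 1 w" by simp
qed

lemma cont_lin_power:
  assumes "\<And>f g. h (f * g) = h f * h g" "h 1 = 1"
  shows "h (f ^ k) = h f ^ k"
  by (induction k) (auto simp: assms)

lemma cont_lin_psub:
  assumes "cont_lin h" "\<And>f g. h (f * g) = h f * h g" "h 1 = 1" "f mnil = 0"
  shows "h (psub c f) = psub c (h f)"
  unfolding psub_def
  by (subst cont_lin_ssum[OF assms(1) psub_low[where f = f, OF assms(4)]])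
     (simp add: cont_linD[OF assms(1)] cont_lin_power[of h, OF assms(2,3)])

section \<open>Closed ideals and quotients of power series rings\<close>

definition sring :: "'m::graded_monoid set \<Rightarrow> 'm ser ring" where
  "sring S = \<lparr>carrier = {f. \<forall>w. f w \<noteq> 0 \<longrightarrow> w \<in> S}, mult = (*), one = 1, zero = 0, add = (+)\<rparr>"

lemma sring_simps [simp]:
  "mult (sring S) = (*)" "one (sring S) = 1" "zero (sring S) = 0" "add (sring S) = (+)"
  by (simp_all add: sring_def)

lemma sring_carrier: "f \<in> carrier (sring S) \<longleftrightarrow> (\<forall>w. f w \<noteq> 0 \<longrightarrow> w \<in> S)"
  by (simp add: sring_def)

lemma sring_pow [simp]: "f [^]\<^bsub>sring S\<^esub> (k::nat) = f ^ k"
  by (induction k) (simp_all add: nat_pow_def power_commutes)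

lemma ncps_ring_eq_sring: "ncps_ring X = sring (lists X)"
proof -
  have "(\<Sum>k\<le>length w. f (take k w) * g (drop k w)) = (f * g) w" for f g :: "'a ncps" and w
    unfolding times_series_def splits_def mcat_list_def splits_list
    by (subst sum.reindex) (auto intro!: inj_onI simp: min_def dest!: arg_cong[of _ _ length])
  then show ?thesis
    by (auto simp: ncps_ring_def sring_def fun_eq_iff one_series_def)
qed

lemma ncps2_ring_eq_sring: "ncps2_ring X = sring (lists X \<times> lists X)"
proof -
  have "(case w of (u, v) \<Rightarrow> \<Sum>i\<le>length u. \<Sum>j\<le>length v.
      f (take i u, take j v) * g (drop i u, drop j v)) = (f * g) w" for f g :: "'a ncps2" and w
  proof -
    obtain u v where w: "w = (u, v)" by fastforce
    have "(f * g) w = (\<Sum>(s, t)\<in>splits u \<times> splits v. f (fst s, fst t) * g (snd s, snd t))"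
      unfolding times_series_def w
      by (rule sum.reindex_bij_witness[of _ "\<lambda>(p, q). ((fst p, fst q), (snd p, snd q))"
            "\<lambda>p. ((fst (fst p), fst (snd p)), (snd (fst p), snd (snd p)))"])
         (auto simp: splits_def mcat_prod_def)
    also have "\<dots> = (\<Sum>s\<in>splits u. \<Sum>t\<in>splits v. f (fst s, fst t) * g (snd s, snd t))"
      by (simp add: sum.cartesian_product)
    also have "\<dots> = (\<Sum>i\<le>length u. \<Sum>j\<le>length v. f (take i u, take j v) * g (drop i u, drop j v))"
    proof -
      have inj: "inj_on (\<lambda>k. (take k z, drop k z)) {..length z}" for z :: "'a list"
        by (auto intro!: inj_onI simp: min_def dest!: arg_cong[of _ _ length])
      show ?thesis
        unfolding splits_def mcat_list_def splits_list
        by (simp add: sum.reindex[OF inj])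
    qed
    finally show ?thesis by (simp add: w)
  qed
  then show ?thesis
    by (auto simp: ncps2_ring_def sring_def fun_eq_iff one_series_def mnil_prod_def)
qed

text \<open>A completed algebra given by generators and relations: the series supported on the words \<open>S\<close>, modulo
the closed ideal that the relators \<open>G\<close> generate. The condition on \<open>S\<close> makes it a submonoid that
contains the factors of its elements, such as the words over a subset of the alphabet.\<close>
locale series_quotient =
  fixes S :: "'m::graded_monoid set" and G :: "'m ser set"
  assumes mnil_S [simp]: "mnil \<in> S" and mcat_S [simp]: "mcat a b \<in> S \<longleftrightarrow> a \<in> S \<and> b \<in> S"
    and G_carrier: "G \<subseteq> carrier (sring S)"
begin

abbreviation "C \<equiv> carrier (sring S)"

definition "J = closed_ideal (sring S) mdeg G"

lemma C_D: "f \<in> C \<Longrightarrow> w \<notin> S \<Longrightarrow> f w = 0"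
  by (auto simp: sring_carrier)

lemma C_closed [simp, intro]:
  "0 \<in> C" "1 \<in> C"
  "f \<in> C \<Longrightarrow> g \<in> C \<Longrightarrow> f + g \<in> C" "f \<in> C \<Longrightarrow> g \<in> C \<Longrightarrow> f - g \<in> C"
  "f \<in> C \<Longrightarrow> - f \<in> C" "f \<in> C \<Longrightarrow> sc c f \<in> C"
  by (force simp: sring_carrier one_series_def sc_apply)+

lemma C_mult [simp, intro]:
  assumes "f \<in> C" "g \<in> C" shows "f * g \<in> C"
  unfolding sring_carrier
proof (intro allI impI)
  fix w assume "(f * g) w \<noteq> 0"
  then obtain p where "p \<in> splits w" "f (fst p) * g (snd p) \<noteq> 0"
    unfolding times_series_def by (metis (no_types, lifting) sum.neutral)
  then show "w \<in> S" using assms by (auto simp: splits_def sring_carrier)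
qed

lemma C_power [simp, intro]: "f \<in> C \<Longrightarrow> f ^ k \<in> C"
  by (induction k) auto

lemma C_sum [intro]: "(\<And>x. x \<in> A \<Longrightarrow> F x \<in> C) \<Longrightarrow> sum F A \<in> C"
  by (induction A rule: infinite_finite_induct) auto

lemma C_ssum [intro]:
  assumes "\<And>k. p k \<in> C" shows "ssum p \<in> C"
  unfolding sring_carrier ssum_def
proof (intro allI impI)
  fix w assume "(\<Sum>k\<le>mdeg w. p k w) \<noteq> 0"
  then obtain k where "p k w \<noteq> 0" by (metis (no_types, lifting) sum.neutral)
  then show "w \<in> S" using assms by (auto simp: sring_carrier)
qed

lemma C_psub [intro]: "f \<in> C \<Longrightarrow> psub c f \<in> C"
  unfolding psub_def by auto

lemma ring_A: "ring (sring S)"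
proof (rule ringI)
  show "abelian_group (sring S)"
  proof (rule abelian_groupI)
    fix x assume "x \<in> C"
    then show "\<exists>y\<in>C. y \<oplus>\<^bsub>sring S\<^esub> x = \<zero>\<^bsub>sring S\<^esub>" by (intro bexI[of _ "- x"]) auto
  qed (auto simp: add_ac)
  show "monoid (sring S)" by (rule monoidI) (auto simp: mult.assoc)
qed (auto simp: algebra_simps)

lemma a_inv_A: "f \<in> C \<Longrightarrow> \<ominus>\<^bsub>sring S\<^esub> f = - f"
  using abelian_group.minus_equality[of "sring S" "- f" f] ring_A
  by (auto simp: ring_def)

lemma minus_A: "f \<in> C \<Longrightarrow> g \<in> C \<Longrightarrow> f \<ominus>\<^bsub>sring S\<^esub> g = f - g"
  by (simp add: a_minus_def a_inv_A)

lemma ideal_of_predicate: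
  assumes "P 0" "\<And>f g. f \<in> C \<Longrightarrow> g \<in> C \<Longrightarrow> P f \<Longrightarrow> P g \<Longrightarrow> P (f - g)"
    "\<And>f g. f \<in> C \<Longrightarrow> g \<in> C \<Longrightarrow> P f \<Longrightarrow> P (f * g)"
    "\<And>f g. f \<in> C \<Longrightarrow> g \<in> C \<Longrightarrow> P f \<Longrightarrow> P (g * f)"
  shows "ideal {f \<in> C. P f} (sring S)"
proof (rule idealI[OF ring_A])
  have n: "P (- f)" if "f \<in> C" "P f" for f
    using assms(2)[of 0 f] that assms(1) by simp
  have "P (f + g)" if "f \<in> C" "g \<in> C" "P f" "P g" for f g
    using assms(2)[of f "- g"] n[of g] that by simp
  moreover have "inv\<^bsub>add_monoid (sring S)\<^esub> f = - f" if "f \<in> C" for f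
    using a_inv_A[OF that] by (simp add: a_inv_def)
  ultimately show "subgroup {f \<in> C. P f} (add_monoid (sring S))"
    by unfold_locales (use assms(1) n in auto)
qed (use assms in auto)

lemma idealD:
  assumes "ideal I (sring S)"
  shows "I \<subseteq> C" "0 \<in> I" "f \<in> I \<Longrightarrow> g \<in> I \<Longrightarrow> f + g \<in> I" "f \<in> I \<Longrightarrow> - f \<in> I"
    "f \<in> I \<Longrightarrow> g \<in> C \<Longrightarrow> f * g \<in> I" "f \<in> I \<Longrightarrow> g \<in> C \<Longrightarrow> g * f \<in> I"
proof -
  interpret I: ideal I "sring S" by fact
  show sub: "I \<subseteq> C" using I.a_subset .
  show "0 \<in> I" using additive_subgroup.zero_closed[OF I.is_additive_subgroup] by (simp only: sring_simps)
  show "f + g \<in> I" if "f \<in> I" "g \<in> I" using additive_subgroup.a_closed[OF I.is_additive_subgroup that] by simp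
  show "f * g \<in> I" "g * f \<in> I" if "f \<in> I" "g \<in> C" for f g
    using I.I_r_closed I.I_l_closed that by simp_all
  from this(1)[of f "- 1"] show "- f \<in> I" if "f \<in> I" using that by simp
qed

text \<open>Induction over the closed ideal, with one case for each of its closure properties, limits included.\<close>
lemma J_induct:
  assumes "f \<in> J" "\<And>g. g \<in> G \<Longrightarrow> P g" "P 0" "\<And>f g. f \<in> C \<Longrightarrow> g \<in> C \<Longrightarrow> P f \<Longrightarrow> P g \<Longrightarrow> P (f - g)"
    "\<And>f g. f \<in> C \<Longrightarrow> g \<in> C \<Longrightarrow> P f \<Longrightarrow> P (f * g)"
    "\<And>f g. f \<in> C \<Longrightarrow> g \<in> C \<Longrightarrow> P f \<Longrightarrow> P (g * f)"
    "\<And>f. f \<in> C \<Longrightarrow> (\<And>d. \<exists>g\<in>C. P g \<and> (\<forall>w. mdeg w \<le> d \<longrightarrow> g w = f w)) \<Longrightarrow> P f"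
  shows "P f"
proof -
  have "{f \<in> C. P f} \<in> {J. ideal J (sring S) \<and> G \<subseteq> J \<and>
     (\<forall>f\<in>C. (\<forall>d. \<exists>g\<in>J. \<forall>w. mdeg w \<le> d \<longrightarrow> g w = f w) \<longrightarrow> f \<in> J)}"
  proof (intro CollectI conjI ballI impI)
    show "ideal {f \<in> C. P f} (sring S)" by (rule ideal_of_predicate) (fact assms)+
    show "G \<subseteq> {f \<in> C. P f}" using G_carrier assms(2) by auto
    fix f assume "f \<in> C" "\<forall>d. \<exists>g\<in>{f \<in> C. P f}. \<forall>w. mdeg w \<le> d \<longrightarrow> g w = f w"
    then show "f \<in> C" "P f" using assms(7)[of f] by blast+
  qed
  then show ?thesis using assms(1) unfolding J_def closed_ideal_def by blast
qed

lemma J_C: "f \<in> J \<Longrightarrow> f \<in> C"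
  unfolding J_def closed_ideal_def
  by (drule InterD[of _ _ C])
     (use ideal_of_predicate[of "\<lambda>_. True"] G_carrier in auto)

lemma J_closed:
  "0 \<in> J" "f \<in> J \<Longrightarrow> g \<in> J \<Longrightarrow> f + g \<in> J" "f \<in> J \<Longrightarrow> - f \<in> J"
  "f \<in> J \<Longrightarrow> g \<in> C \<Longrightarrow> f * g \<in> J" "f \<in> J \<Longrightarrow> g \<in> C \<Longrightarrow> g * f \<in> J"
  unfolding J_def closed_ideal_def
  by (auto dest: idealD)

lemma J_diff: "f \<in> J \<Longrightarrow> g \<in> J \<Longrightarrow> f - g \<in> J"
  using J_closed(2)[of f "- g"] J_closed(3)[of g] by simp

lemma J_limit:
  assumes "f \<in> C" "\<And>d. \<exists>g\<in>J. \<forall>w. mdeg w \<le> d \<longrightarrow> g w = f w"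
  shows "f \<in> J"
  unfolding J_def closed_ideal_def
proof (rule InterI, safe)
  fix I assume *: "\<forall>f\<in>C. (\<forall>d. \<exists>g\<in>I. \<forall>w. mdeg w \<le> d \<longrightarrow> g w = f w) \<longrightarrow> f \<in> I"
    "ideal I (sring S)" "G \<subseteq> I"
  then have "J \<subseteq> I" unfolding J_def closed_ideal_def by (intro Inter_lower) auto
  then show "f \<in> I" using * assms by blast
qed

lemma G_J: "g \<in> G \<Longrightarrow> g \<in> J"
  unfolding J_def closed_ideal_def by auto

lemma J_sc: "f \<in> J \<Longrightarrow> sc c f \<in> J"
  using J_closed(5)[of f "sc c 1"] by simp

lemma J_sum: "(\<And>x. x \<in> A \<Longrightarrow> F x \<in> J) \<Longrightarrow> sum F A \<in> J"
  by (induction A rule: infinite_finite_induct) (auto simp: J_closed)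

lemma J_ssum:
  assumes "\<And>k. p k \<in> J" "\<And>k. low k (p k)"
  shows "ssum p \<in> J"
proof (rule J_limit)
  show "ssum p \<in> C" using J_C assms by auto
  fix d
  show "\<exists>g\<in>J. \<forall>w. mdeg w \<le> d \<longrightarrow> g w = ssum p w"
    by (rule bexI[of _ "\<Sum>k\<le>d. p k"])
       (auto simp: ssum_apply_ge[of p, OF assms(2)] ser_simps intro!: J_sum assms)
qed

lemma J_low:
  assumes "\<And>g. g \<in> G \<Longrightarrow> low d g" "f \<in> J"
  shows "low d f"
proof (rule J_induct[OF assms(2)])
  fix f g assume "low d f"
  then show "low d (f * g)" "low d (g * f)" using low_mult[of d f 0 g] low_mult[of 0 g d f] by auto
next
  fix f assume *: "\<And>e. \<exists>g\<in>C. low d g \<and> (\<forall>w. mdeg w \<le> e \<longrightarrow> g w = f w)"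
  show "low d f"
    unfolding low_def
  proof (intro allI impI)
    fix w :: 'm assume "mdeg w < d"
    then show "f w = 0" using *[of "mdeg w"] by (metis low_def order_refl)
  qed
qed (use assms(1) in \<open>auto simp: low_def\<close>)

text \<open>Calculations in the quotient are done with representatives, as congruences modulo \<open>J\<close>.\<close>
definition eqJ :: "'m ser \<Rightarrow> 'm ser \<Rightarrow> bool" (infix \<open>\<approx>\<close> 50) where
  "f \<approx> g \<longleftrightarrow> f \<in> C \<and> g \<in> C \<and> f - g \<in> J"

lemma eqJ_refl: "f \<in> C \<Longrightarrow> f \<approx> f" by (simp add: eqJ_def J_closed)
lemma eqJ_sym: "f \<approx> g \<Longrightarrow> g \<approx> f"
  using J_closed(3)[of "f - g"] by (auto simp: eqJ_def)
lemma eqJ_trans [trans]: "f \<approx> g \<Longrightarrow> g \<approx> h \<Longrightarrow> f \<approx> h"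
  using J_closed(2)[of "f - g" "g - h"] by (auto simp: eqJ_def)
lemma eqJ_add: "f \<approx> f' \<Longrightarrow> g \<approx> g' \<Longrightarrow> f + g \<approx> f' + g'"
  using J_closed(2)[of "f - f'" "g - g'"] by (auto simp: eqJ_def algebra_simps)
lemma eqJ_minus: "f \<approx> f' \<Longrightarrow> - f \<approx> - f'"
  using J_closed(3)[of "f - f'"] by (auto simp: eqJ_def)
lemma eqJ_sc:
  assumes "f \<approx> f'" shows "sc c f \<approx> sc c f'"
proof -
  have "sc c f - sc c f' = sc c (f - f')" by (auto simp: fun_eq_iff sc_apply algebra_simps)
  then show ?thesis using assms J_sc[of "f - f'" c] by (auto simp: eqJ_def)
qed
lemma eqJ_mult:
  assumes "f \<approx> f'" "g \<approx> g'" shows "f * g \<approx> f' * g'"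
proof -
  have "(f - f') * g \<in> J" "f' * (g - g') \<in> J"
    using assms J_closed by (auto simp: eqJ_def)
  from J_closed(2)[OF this] show ?thesis
    using assms by (auto simp: eqJ_def algebra_simps)
qed
lemma eqJ_power: "f \<approx> f' \<Longrightarrow> f ^ k \<approx> f' ^ k"
  by (induction k) (auto simp: eqJ_mult eqJ_refl)

lemma eqJ_psub:
  assumes "f \<approx> g" "f mnil = 0" "g mnil = 0"
  shows "psub c f \<approx> psub c g"
proof -
  let ?p = "\<lambda>k. sc (fps_nth c k) (f ^ k) - sc (fps_nth c k) (g ^ k)"
  have "?p k \<in> J" for k using eqJ_sc[OF eqJ_power[OF assms(1)]] by (auto simp: eqJ_def)
  moreover have "low k (?p k)" for k
    using psub_low[of f k c] psub_low[of g k c] assms by (auto simp: low_def)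
  ultimately have "ssum ?p \<in> J" by (rule J_ssum)
  moreover have "ssum ?p = psub c f - psub c g"
    by (auto simp: ssum_def psub_def fun_eq_iff sum_subtractf)
  ultimately show ?thesis using assms(1) by (simp add: eqJ_def C_psub)
qed

lemma ideal_J: "ideal J (sring S)"
proof -
  have "ideal {f \<in> C. f \<in> J} (sring S)"
    by (rule ideal_of_predicate) (simp_all add: J_closed J_diff)
  moreover have "{f \<in> C. f \<in> J} = J" using J_C by blast
  ultimately show ?thesis by simp
qed

definition cls :: "'m ser \<Rightarrow> 'm ser set" where
  "cls f = J +>\<^bsub>sring S\<^esub> f"

abbreviation "Q \<equiv> sring S Quot J"

lemma ring_Q: "ring Q"
  by (rule ideal.quotient_is_ring[OF ideal_J])

lemma cls_mem: "f \<in> C \<Longrightarrow> g \<in> cls f \<longleftrightarrow> g \<approx> f"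
proof -
  assume f: "f \<in> C"
  have "g \<in> cls f \<longleftrightarrow> (\<exists>h\<in>J. g = h + f)"
    by (auto simp: cls_def a_r_coset_def r_coset_def)
  also have "\<dots> \<longleftrightarrow> g - f \<in> J"
  proof
    show "\<exists>h\<in>J. g = h + f" if "g - f \<in> J" using that by (intro bexI[of _ "g - f"]) simp_all
  qed auto
  also have "\<dots> \<longleftrightarrow> g \<approx> f"
    using f J_C[of "g - f"] C_closed(3)[of "g - f" f] by (auto simp: eqJ_def)
  finally show ?thesis .
qed

lemma cls_eq_iff: "f \<in> C \<Longrightarrow> g \<in> C \<Longrightarrow> cls f = cls g \<longleftrightarrow> f \<approx> g"
proof
  assume *: "f \<in> C" "g \<in> C"
  show "f \<approx> g" if "cls f = cls g"
    using cls_mem[of g f] cls_mem[of f f] eqJ_refl[of f] * that by simp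
  show "cls f = cls g" if "f \<approx> g"
  proof (rule Set.set_eqI)
    fix h
    show "h \<in> cls f \<longleftrightarrow> h \<in> cls g"
      using that eqJ_trans[of h f g] eqJ_trans[of h g f] eqJ_sym[of f g] * by (auto simp: cls_mem)
  qed
qed

lemma Q_simps:
  "carrier Q = cls ` C" "\<one>\<^bsub>Q\<^esub> = cls 1" "\<zero>\<^bsub>Q\<^esub> = cls 0"
  "f \<in> C \<Longrightarrow> g \<in> C \<Longrightarrow> cls f \<otimes>\<^bsub>Q\<^esub> cls g = cls (f * g)"
  "f \<in> C \<Longrightarrow> g \<in> C \<Longrightarrow> cls f \<oplus>\<^bsub>Q\<^esub> cls g = cls (f + g)"
proof -
  interpret ideal J "sring S" by (rule ideal_J)
  show "carrier Q = cls ` C"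
    by (auto simp: FactRing_def A_RCOSETS_def' cls_def)
  show "\<one>\<^bsub>Q\<^esub> = cls 1" by (simp add: FactRing_def cls_def)
  show "\<zero>\<^bsub>Q\<^esub> = cls 0"
    using a_rcos_zero[OF ideal_J, of 0] J_closed by (simp add: FactRing_def cls_def)
  assume "f \<in> C" "g \<in> C"
  then show "cls f \<otimes>\<^bsub>Q\<^esub> cls g = cls (f * g)" "cls f \<oplus>\<^bsub>Q\<^esub> cls g = cls (f + g)"
    using rcoset_mult_add[of f g] a_rcos_sum[of f g]
    by (simp_all add: FactRing_def cls_def)
qed

text \<open>A map on cosets that is defined through representatives may be computed at any representative, once
congruent representatives are known to give the same coset.\<close>
lemma coset_map_cls:
  assumes "f \<in> C" "\<And>g. g \<approx> f \<Longrightarrow> B +>\<^bsub>A\<^esub> h g = B +>\<^bsub>A\<^esub> h f"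
  shows "coset_map A B h (cls f) = B +>\<^bsub>A\<^esub> h f"
proof -
  have "(\<lambda>g. B +>\<^bsub>A\<^esub> h g) ` cls f = {B +>\<^bsub>A\<^esub> h f}"
    using assms by (auto simp: cls_mem intro!: image_eqI[of _ _ f] eqJ_refl)
  then show ?thesis by (simp add: coset_map_def)
qed

lemma eqJ_commute_power:
  assumes "a \<in> C" "b \<in> C" "a * b \<approx> b * a"
  shows "a * b ^ k \<approx> b ^ k * a"
proof (induction k)
  case (Suc k)
  have "a * b ^ Suc k \<approx> b * (a * b ^ k)"
    using eqJ_mult[OF assms(3) eqJ_refl[of "b ^ k"]] assms by (simp add: mult.assoc)
  also have "\<dots> \<approx> b * (b ^ k * a)" by (intro eqJ_mult eqJ_refl Suc assms)
  finally show ?case by (simp add: mult.assoc)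
qed (use assms eqJ_refl in simp)

text \<open>Commutation with \<open>b\<close> passes to powers, and to the exponential because the ideal is closed: the
commutator is the sum of a series of elements of \<open>J\<close>.\<close>
lemma eqJ_commute_exps:
  assumes "a \<in> C" "b \<in> C" "a * b \<approx> b * a" "b mnil = 0"
  shows "a * exps b \<approx> exps b * a"
proof -
  let ?h = "\<lambda>f. a * f - f * a"
  have "ssum (\<lambda>k. ?h (sc (1 / fact k) (b ^ k))) \<in> J"
  proof (rule J_ssum)
    show "?h (sc (1 / fact k) (b ^ k)) \<in> J" for k
      using eqJ_sc[OF eqJ_commute_power[OF assms(1-3)], of "1 / fact k" k] by (simp add: eqJ_def)
    show "low k (?h (sc (1 / fact k) (b ^ k)))" for k
      by (intro cont_linD(3)[OF cont_lin_diff[OF cont_lin_mult]] low_sc low_power assms)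
  qed
  moreover have "ssum (\<lambda>k. ?h (sc (1 / fact k) (b ^ k))) = ?h (exps b)"
    unfolding exps_eq_ssum
    by (rule cont_lin_ssum[symmetric, OF cont_lin_diff[OF cont_lin_mult]])
       (intro low_sc low_power assms)
  ultimately show ?thesis using assms by (auto simp: eqJ_def exps_def)
qed

lemma eqJ_exps_exps_commute:
  assumes "a \<in> C" "b \<in> C" "a * b \<approx> b * a" "a mnil = 0" "b mnil = 0"
  shows "exps a * exps b \<approx> exps b * exps a"
  using assms eqJ_commute_exps[of "exps b" a] eqJ_commute_exps[of a b]
  by (auto simp: exps_def intro: eqJ_sym)

text \<open>The exponential law for elements that commute modulo the relations: expand the powers of \<open>a + b\<close> by
iterating left multiplication with \<open>a + b\<close>.\<close>
lemma eqJ_exps_add: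
  assumes "a \<in> C" "b \<in> C" "a * b \<approx> b * a" "a mnil = 0" "b mnil = 0"
  shows "exps (a + b) \<approx> exps a * exps b"
proof -
  have T: "(a + b) * (a ^ i * b ^ j) - (a ^ Suc i * b ^ j + a ^ i * b ^ Suc j) \<in> J" for i j
  proof -
    have "b * a ^ i - a ^ i * b \<in> J"
      using eqJ_commute_power[of b a i] eqJ_sym[OF assms(3)] assms by (simp add: eqJ_def)
    then have "(b * a ^ i - a ^ i * b) * b ^ j \<in> J" using assms by (intro J_closed) auto
    then show ?thesis by (simp add: algebra_simps)
  qed
  have pw: "((\<lambda>x. (a + b) * x) ^^ k) (a ^ 0 * b ^ 0) = (a + b) ^ k" for k
    by (induction k) (auto simp: algebra_simps)
  let ?p = "\<lambda>k. sc (1 / fact k) ((a + b) ^ k)"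
  let ?q = "\<lambda>k. \<Sum>i\<le>k. sc (1 / fact i * (1 / fact (k - i))) (a ^ i * b ^ (k - i))"
  have "ssum (\<lambda>k. ?p k - ?q k) \<in> J"
  proof (rule J_ssum)
    show "?p k - ?q k \<in> J" for k
      using binomial_iterate_mod[where T = "\<lambda>i j. a ^ i * b ^ j" and N = J and k = k,
          OF cont_lin_mult(1)[of "a + b"]] T J_closed J_sc assms
      unfolding pw by auto
    have "low k (a ^ i * b ^ (k - i))" if "i \<le> k" for i k
      using low_mult[OF low_power low_power, of a b i "k - i"] assms that by simp
    then show "low k (?p k - ?q k)" for k
      using assms by (intro low_diff low_sc low_sum low_power) auto
  qed
  moreover have "ssum (\<lambda>k. ?p k - ?q k) = ssum ?p - ssum ?q"
    by (auto simp: ssum_def fun_eq_iff sum_subtractf)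
  moreover have "ssum ?q = exps a * exps b"
    unfolding exps_eq_ssum by (subst ssum_mult) (auto intro!: low_sc low_power assms simp: mult.commute)
  ultimately have "exps (a + b) - exps a * exps b \<in> J" by (simp only: exps_eq_ssum[of "a + b"])
  then show ?thesis using assms by (auto simp: eqJ_def exps_def)
qed

end

text \<open>Without relators the closed ideal is zero, and congruences become equations.\<close>
interpretation trivial_quotient: series_quotient UNIV "{} :: 'm::graded_monoid ser set"
  by standard auto

lemma trivial_quotient_J: "f \<in> trivial_quotient.J \<longleftrightarrow> f = (0 :: 'm::graded_monoid ser)"
proof
  assume "f \<in> trivial_quotient.J"
  then show "f = 0"
  proof (rule trivial_quotient.J_induct)
    fix f :: "'m ser"
    assume "\<And>d. \<exists>g\<in>trivial_quotient.C. g = 0 \<and> (\<forall>w. mdeg w \<le> d \<longrightarrow> g w = f w)"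
    then have "f w = 0" for w by (metis order_refl series_apply(1))
    then show "f = 0" by (simp add: fun_eq_iff)
  qed auto
qed (simp add: trivial_quotient.J_closed)

lemma exps_add:
  fixes f g :: "'m::graded_monoid ser"
  assumes "f mnil = 0" "g mnil = 0" "f * g = g * f"
  shows "exps (f + g) = exps f * exps g"
  using trivial_quotient.eqJ_exps_add[of f g] assms
  by (simp add: trivial_quotient.eqJ_def trivial_quotient_J sring_carrier)

lemma exps_minus:
  assumes "f mnil = 0"
  shows "exps f * exps (- f) = 1" "exps (- f) * exps f = 1"
  using exps_add[of f "- f"] exps_add[of "- f" f] assms by simp_all

section \<open>The coproduct and group-like elements\<close>

lemma times_list: "(f * g) w = (\<Sum>k\<le>length w. f (take k w) * g (drop k w))" for f g :: "'a ncps"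
  using arg_cong[OF ncps_ring_eq_sring[of UNIV], of "\<lambda>R. mult R f g w"] by (simp add: ncps_ring_def)

lemma times_list2: "(f * g) (u, v) = (\<Sum>i\<le>length u. \<Sum>j\<le>length v.
    f (take i u, take j v) * g (drop i u, drop j v))" for f g :: "'a ncps2"
  using arg_cong[OF ncps2_ring_eq_sring[of UNIV], of "\<lambda>R. mult R f g (u, v)"]
  by (simp add: ncps2_ring_def)

lemma one_list2: "(1 :: 'a ncps2) = (\<lambda>(u, v). if u = [] \<and> v = [] then 1 else 0)"
  by (auto simp: one_series_def mnil_prod_def)

lemma one_Nil [simp]: "(1 :: 'a ncps) [] = 1"
  by (simp add: one_series_def)

lemma shuffle_list_Nil [simp]: "shuffle_list u [] = [u]"
  by (cases u) auto

lemma shuffle_list_set: "w \<in> set (shuffle_list u v) \<Longrightarrow> set w = set u \<union> set v \<and> length w = length u + length v"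
  by (induction u v arbitrary: w rule: shuffle_list.induct) auto

text \<open>The coefficient of a coproduct for an arbitrary coefficient function, which the recursion over
shuffles changes.\<close>
definition shuffle_sum :: "'a list \<Rightarrow> 'a list \<Rightarrow> ('a list \<Rightarrow> rat) \<Rightarrow> rat" where
  "shuffle_sum u v F = (\<Sum>w\<leftarrow>shuffle_list u v. F w)"

lemma shuffle_sum_simps [simp]:
  "shuffle_sum [] v F = F v" "shuffle_sum u [] F = F u"
  "shuffle_sum (x # u) (y # v) F =
     shuffle_sum u (y # v) (\<lambda>w. F (x # w)) + shuffle_sum (x # u) v (\<lambda>w. F (y # w))"
  by (simp_all add: shuffle_sum_def o_def)

lemma shuffle_sum_add: "shuffle_sum u v (\<lambda>w. F w + G w) = shuffle_sum u v F + shuffle_sum u v G"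
  by (simp add: shuffle_sum_def sum_list_addf)

lemma shuffle_sum_mult:
  "shuffle_sum u v (\<lambda>w. c * F w) = c * shuffle_sum u v F"
  "shuffle_sum u v (\<lambda>w. F w * c) = shuffle_sum u v F * c"
  by (simp_all add: shuffle_sum_def sum_list_const_mult sum_list_mult_const)

lemma shuffle_sum_eq_0:
  assumes "\<And>w. w \<in> set (shuffle_list u v) \<Longrightarrow> F w = 0"
  shows "shuffle_sum u v F = 0"
proof -
  have "(\<Sum>w\<leftarrow>ws. F w) = 0" if "\<And>w. w \<in> set ws \<Longrightarrow> F w = 0" for ws
    using that by (induction ws) auto
  then show ?thesis using assms by (simp add: shuffle_sum_def)
qed

text \<open>Cutting the shuffles of \<open>u\<close> and \<open>v\<close> in two is the same as shuffling the two halves of cuts of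
  \<open>u\<close> and \<open>v\<close>. This is the multiplicativity of the coproduct.\<close>
lemma shuffle_sum_cut:
  "shuffle_sum u v (\<lambda>w. \<Sum>k\<le>length w. F (take k w) (drop k w)) =
   (\<Sum>i\<le>length u. \<Sum>j\<le>length v. shuffle_sum (take i u) (take j v)
      (\<lambda>a. shuffle_sum (drop i u) (drop j v) (F a)))"
proof (induction u v arbitrary: F rule: shuffle_list.induct)
  case (3 x u y v)
  let ?A = "\<lambda>i j. shuffle_sum (take i u) (take j (y # v))
      (\<lambda>a. shuffle_sum (drop i u) (drop j (y # v)) (F (x # a)))"
  let ?B = "\<lambda>i j. shuffle_sum (take i (x # u)) (take j v)
      (\<lambda>a. shuffle_sum (drop i (x # u)) (drop j v) (F (y # a)))"
  let ?T = "\<lambda>i j. shuffle_sum (take i (x # u)) (take j (y # v))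
      (\<lambda>a. shuffle_sum (drop i (x # u)) (drop j (y # v)) (F a))"
  have T: "?T (Suc i) (Suc j) = ?A i (Suc j) + ?B (Suc i) j" "?T (Suc i) 0 = ?A i 0"
    "?T 0 (Suc j) = ?B 0 j" for i j
    by (simp_all add: shuffle_sum_add)
  have 1: "shuffle_sum (x # u) (y # v) (\<lambda>w. \<Sum>k\<le>length w. F (take k w) (drop k w)) =
      ?T 0 0 + (\<Sum>i\<le>length u. \<Sum>j\<le>Suc (length v). ?A i j) + (\<Sum>i\<le>Suc (length u). \<Sum>j\<le>length v. ?B i j)"
    using "3.IH"(1)[of "\<lambda>a. F (x # a)"] "3.IH"(2)[of "\<lambda>a. F (y # a)"]
    by (simp add: sum.atMost_Suc_shift[of _ "length _"] shuffle_sum_add del: sum.atMost_Suc)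
  have "(\<Sum>i\<le>length (x # u). \<Sum>j\<le>length (y # v). ?T i j) = ?T 0 0 + (\<Sum>j\<le>length v. ?T 0 (Suc j)) +
      (\<Sum>i\<le>length u. ?T (Suc i) 0) + (\<Sum>i\<le>length u. \<Sum>j\<le>length v. ?T (Suc i) (Suc j))"
    by (simp only: length_Cons sum.atMost_Suc_shift sum.distrib add.assoc)
  also have "\<dots> = ?T 0 0 + (\<Sum>i\<le>length u. \<Sum>j\<le>Suc (length v). ?A i j) +
      (\<Sum>i\<le>Suc (length u). \<Sum>j\<le>length v. ?B i j)"
    by (simp only: T sum.atMost_Suc_shift sum.distrib add_ac)
  finally show ?case using 1 by simp
qed simp_all

lemma coproduct_apply: "ncps_coproduct f (u, v) = shuffle_sum u v f"
  by (simp add: ncps_coproduct_def shuffle_sum_def)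

lemma coproduct_mult: "ncps_coproduct (f * g) = ncps_coproduct f * ncps_coproduct g"
proof (rule ext, clarify)
  fix u v :: "'a list"
  show "ncps_coproduct (f * g) (u, v) = (ncps_coproduct f * ncps_coproduct g) (u, v)"
    using shuffle_sum_cut[of u v "\<lambda>a b. f a * g b"]
    by (simp add: coproduct_apply times_list2 shuffle_sum_mult times_list[abs_def])
qed

lemma coproduct_1: "ncps_coproduct 1 = 1"
proof (rule ext, clarify)
  fix u v :: "'a list"
  have "shuffle_sum u v 1 = (if u = [] \<and> v = [] then 1 else 0)"
  proof (cases "u = [] \<and> v = []")
    case False
    then have "shuffle_sum u v 1 = 0"
      by (intro shuffle_sum_eq_0) (auto simp: one_series_def dest: shuffle_list_set)
    then show ?thesis using False by auto
  qed (simp add: one_series_def)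
  then show "ncps_coproduct 1 (u, v) = 1 (u, v)"
    by (simp add: coproduct_apply one_list2)
qed

lemma cont_lin_coproduct: "cont_lin ncps_coproduct"
  unfolding cont_lin_def
proof (intro conjI allI impI)
  fix f g :: "'a ncps" and c d
  show "ncps_coproduct (f + g) = ncps_coproduct f + ncps_coproduct g"
    by (auto simp: fun_eq_iff coproduct_apply shuffle_sum_add plus_series_def)
  show "ncps_coproduct (sc c f) = sc c (ncps_coproduct f)"
    by (auto simp: fun_eq_iff coproduct_apply shuffle_sum_mult sc_def)
  assume *: "low d f"
  show "low d (ncps_coproduct f)"
    unfolding low_def
  proof (clarify)
    fix u v :: "'a list" assume "mdeg (u, v) < d"
    then show "ncps_coproduct f (u, v) = 0"
      unfolding coproduct_apply using *
      by (intro shuffle_sum_eq_0) (auto simp: low_def mdeg_prod_def dest: shuffle_list_set)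
  qed
qed

lemma tensor_mult: "ncps_tensor f g * ncps_tensor f' g' = ncps_tensor (f * f') (g * g')"
  by (auto simp: fun_eq_iff ncps_tensor_def times_list2 times_list sum_product mult_ac)

lemma tensor_1: "ncps_tensor 1 1 = 1"
  by (auto simp: fun_eq_iff ncps_tensor_def one_series_def mnil_prod_def)

lemma tensor_diff:
  "ncps_tensor (f - f') g = ncps_tensor f g - ncps_tensor f' g"
  "ncps_tensor g (f - f') = ncps_tensor g f - ncps_tensor g f'"
  by (auto simp: fun_eq_iff ncps_tensor_def algebra_simps)

lemma cont_lin_tensor: "cont_lin (\<lambda>f. ncps_tensor f 1)" "cont_lin (ncps_tensor 1)"
  by (auto simp: cont_lin_def fun_eq_iff ncps_tensor_def sc_apply low_def mdeg_prod_def
      one_series_def algebra_simps)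

lemma tensor_exps:
  assumes "f [] = 0"
  shows "ncps_tensor (exps f) 1 = exps (ncps_tensor f 1)" "ncps_tensor 1 (exps f) = exps (ncps_tensor 1 f)"
  unfolding exps_def using assms
  by (auto intro!: cont_lin_psub cont_lin_tensor simp: tensor_mult tensor_1)

lemma tensor_mnil: "ncps_tensor f g mnil = f [] * g []"
  by (simp add: ncps_tensor_def mnil_prod_def)

text \<open>The two tensor factors commute; this is what allows to take logarithms of \<open>f \<otimes> f\<close>.\<close>
lemma tensor_commute: "ncps_tensor f 1 * ncps_tensor 1 g = ncps_tensor 1 g * ncps_tensor f 1"
  "ncps_tensor f 1 * ncps_tensor 1 g = ncps_tensor f g"
  by (simp_all add: tensor_mult)

definition primitive :: "'a ncps \<Rightarrow> bool" where
  "primitive f \<longleftrightarrow> ncps_coproduct f = ncps_tensor f 1 + ncps_tensor 1 f"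

text \<open>A shuffle of two nonempty words has length at least two, so only the two trivial splittings of a single
letter contribute.\<close>
lemma primitive_gen: "primitive (ncps_gen x)"
proof -
  have "shuffle_sum u v (ncps_gen x) = ncps_tensor (ncps_gen x) 1 (u, v) + ncps_tensor 1 (ncps_gen x) (u, v)"
    for u v
  proof (cases "u = [] \<or> v = []")
    case False
    have "shuffle_sum u v (ncps_gen x) = 0"
    proof (rule shuffle_sum_eq_0)
      fix w assume "w \<in> set (shuffle_list u v)"
      then have "length w = length u + length v" using shuffle_list_set by blast
      then have "length w \<noteq> length [x]" using False by (cases u; cases v) auto
      then show "ncps_gen x w = 0" by (auto simp: ncps_gen_def)
    qed
    then show ?thesis using False by (simp add: ncps_tensor_def one_series_def)
  qed (auto simp: ncps_tensor_def one_series_def ncps_gen_def)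
  then show ?thesis by (auto simp: primitive_def fun_eq_iff coproduct_apply)
qed

lemma primitive_add: "primitive f \<Longrightarrow> primitive g \<Longrightarrow> primitive (f + g)"
  by (simp add: primitive_def cont_linD[OF cont_lin_coproduct] cont_linD[OF cont_lin_tensor(1)]
      cont_linD[OF cont_lin_tensor(2)] algebra_simps)

lemma primitive_commutator: "primitive f \<Longrightarrow> primitive g \<Longrightarrow> primitive (f * g - g * f)"
  by (simp add: primitive_def cont_linD[OF cont_lin_coproduct] coproduct_mult tensor_diff
      algebra_simps tensor_mult)

section \<open>The oriented Artin algebra\<close>

lemma gen_carrier: "x \<in> X \<Longrightarrow> ncps_gen x \<in> carrier (sring (lists X))"
  by (auto simp: sring_carrier ncps_gen_def)

interpretation free_quotient: series_quotient "lists X" "{}"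
  by standard auto

lemma commutator_eq: "f \<in> carrier (sring (lists X)) \<Longrightarrow> g \<in> carrier (sring (lists X)) \<Longrightarrow>
    commutator (sring (lists X)) f g = f * g - g * f"
  by (simp add: commutator_def free_quotient.minus_A free_quotient.C_mult)

abbreviation gv :: "nat \<Rightarrow> nat \<Rightarrow> idx ncps" where "gv i j \<equiv> ncps_gen (i, j)"

lemma gv_carrier: "i \<in> {1..n} \<Longrightarrow> j \<in> {1..n} \<Longrightarrow> i \<noteq> j \<Longrightarrow> gv i j \<in> carrier (sring (lists (pairs n)))"
  by (rule gen_carrier) (simp add: pairs_def)

lemma oriented_relators_eq: "oriented_relators n =
     {gv i k * gv j k - gv j k * gv i k | i j k. {i, j, k} \<subseteq> {1..n} \<and> distinct [i, j, k]} \<union>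
     {gv i j * (gv i k + gv j k) - (gv i k + gv j k) * gv i j | i j k.
        {i, j, k} \<subseteq> {1..n} \<and> distinct [i, j, k]} \<union>
     {gv i j * gv k l - gv k l * gv i j | i j k l. {i, j, k, l} \<subseteq> {1..n} \<and> distinct [i, j, k, l]}"
proof -
  have c: "commutator (ncps_ring (pairs n)) f g = f * g - g * f"
    if "f \<in> carrier (sring (lists (pairs n)))" "g \<in> carrier (sring (lists (pairs n)))" for f g
    using that by (simp add: ncps_ring_eq_sring commutator_eq)
  have 1: "{i, j, k} \<subseteq> {1..n} \<and> distinct [i, j, k] \<Longrightarrow>
     commutator (FA n) (gv i k) (gv j k) = gv i k * gv j k - gv j k * gv i k" for i j k
    by (rule c) (auto intro!: gv_carrier simp del: atLeastAtMost_iff)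
  have 2: "{i, j, k} \<subseteq> {1..n} \<and> distinct [i, j, k] \<Longrightarrow>
     commutator (FA n) (gv i j) (gv i k \<oplus>\<^bsub>FA n\<^esub> gv j k) =
     gv i j * (gv i k + gv j k) - (gv i k + gv j k) * gv i j" for i j k
    unfolding ncps_ring_eq_sring sring_simps
    by (rule c[unfolded ncps_ring_eq_sring])
       (auto intro!: gv_carrier free_quotient.C_closed simp del: atLeastAtMost_iff)
  have 3: "{i, j, k, l} \<subseteq> {1..n} \<and> distinct [i, j, k, l] \<Longrightarrow>
     commutator (FA n) (gv i j) (gv k l) = gv i j * gv k l - gv k l * gv i j" for i j k l
    by (rule c) (auto intro!: gv_carrier simp del: atLeastAtMost_iff)
  show ?thesis
    unfolding oriented_relators_def
    by (intro arg_cong2[of _ _ _ _ "(\<union>)"] Collect_cong; metis 1 2 3)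
qed

lemma relators_carrier: "oriented_relators n \<subseteq> carrier (sring (lists (pairs n)))"
  unfolding oriented_relators_eq
  by (auto intro!: free_quotient.C_closed free_quotient.C_mult gv_carrier simp del: atLeastAtMost_iff)

interpretation FA: series_quotient "lists (pairs n)" "oriented_relators n" for n
  by standard (use relators_carrier in auto)

lemma deg2_eq: "(\<lambda>(u, v). length u + length v) = (mdeg :: 'a list \<times> 'b list \<Rightarrow> nat)"
  by (auto simp: mdeg_prod_def)

lemma rel_ideal_eq: "rel_ideal n = FA.J n"
  by (simp add: rel_ideal_def FA.J_def ncps_ring_eq_sring flip: mdeg_list_def)

lemma tensor_carrier: "f \<in> carrier (sring (lists X)) \<Longrightarrow> g \<in> carrier (sring (lists X)) \<Longrightarrow>
    ncps_tensor f g \<in> carrier (sring (lists X \<times> lists X))"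
  by (auto simp: sring_carrier ncps_tensor_def)

lemma coproduct_carrier:
  assumes "f \<in> carrier (sring (lists X))"
  shows "ncps_coproduct f \<in> carrier (sring (lists X \<times> lists X))"
  unfolding sring_carrier
proof (intro allI impI)
  fix p assume "ncps_coproduct f p \<noteq> 0"
  moreover obtain u v where p: "p = (u, v)" by fastforce
  ultimately have "ncps_coproduct f (u, v) \<noteq> 0" by simp
  then obtain w where "w \<in> set (shuffle_list u v)" "f w \<noteq> 0"
    unfolding coproduct_apply using shuffle_sum_eq_0 by blast
  then show "p \<in> lists X \<times> lists X"
    using assms by (auto simp: p sring_carrier in_lists_conv_set dest!: shuffle_list_set)
qed

definition tensor_relators :: "nat \<Rightarrow> idx ncps2 set" where
  "tensor_relators n = {ncps_tensor f g | f g. f \<in> FA.C n \<and> g \<in> FA.C n \<and> (f \<in> FA.J n \<or> g \<in> FA.J n)}"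

interpretation FA2: series_quotient "lists (pairs n) \<times> lists (pairs n)" "tensor_relators n" for n
  by standard (auto simp: tensor_relators_def mnil_prod_def mcat_prod_def intro!: tensor_carrier)

lemma rel_ideal2_eq: "rel_ideal2 n = FA2.J n"
proof -
  have "rel_ideal2 n = closed_ideal (sring (lists (pairs n) \<times> lists (pairs n))) mdeg (tensor_relators n)"
    by (simp add: rel_ideal2_def rel_ideal_eq ncps_ring_eq_sring ncps2_ring_eq_sring deg2_eq tensor_relators_def)
  then show ?thesis by (simp only: FA2.J_def)
qed

lemma OA_eq: "OA n = FA.Q n"
  by (simp add: OA_def rel_ideal_eq ncps_ring_eq_sring)

lemma OA2_eq: "OA2 n = FA2.Q n"
  by (simp add: OA2_def rel_ideal2_eq ncps2_ring_eq_sring)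

lemmas OA_simps = FA.Q_simps[folded OA_eq]

text \<open>The relators are homogeneous of degree two. Hence constant term and linear part are invariants of a
coset.\<close>
lemma J_low2: "f \<in> FA.J n \<Longrightarrow> low 2 f"
proof (rule FA.J_low)
  have "low 1 (gv i j)" for i j by (simp add: ncps_gen_def)
  then have "low 2 (gv i j * gv k l)" for i j k l 
    using low_mult[of 1 "gv i j" 1 "gv k l"] by (simp add: numeral_2_eq_2)
  then show "low 2 g" if "g \<in> oriented_relators n" for g
    using that by (auto simp: oriented_relators_eq distrib_left distrib_right intro!: low_add low_diff)
qed

lemma J_const: "f \<in> FA.J n \<Longrightarrow> f [] = 0" and J_linear: "f \<in> FA.J n \<Longrightarrow> f [p] = 0"
  using J_low2[of f n] by (auto simp: low_def)

lemma eqJ_const: "FA.eqJ n f g \<Longrightarrow> f [] = g []" and eqJ_linear: "FA.eqJ n f g \<Longrightarrow> f [p] = g [p]"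
  using J_const[of "f - g" n] J_linear[of "f - g" n p] by (auto simp: FA.eqJ_def)

lemma J2_const: "f \<in> FA2.J n \<Longrightarrow> f ([], []) = 0"
proof -
  assume "f \<in> FA2.J n"
  then have "low 1 f"
  proof (rule FA2.J_low[rotated])
    fix g assume "g \<in> tensor_relators n"
    then show "low 1 g"
      by (auto simp: tensor_relators_def ncps_tensor_def mnil_prod_def J_const)
  qed
  then show ?thesis by (simp add: low_def mnil_prod_def)
qed

lemma tensor_J: "f \<in> FA.J n \<Longrightarrow> g \<in> FA.C n \<Longrightarrow> ncps_tensor f g \<in> FA2.J n"
  "f \<in> FA.J n \<Longrightarrow> g \<in> FA.C n \<Longrightarrow> ncps_tensor g f \<in> FA2.J n"
proof -
  assume "f \<in> FA.J n" "g \<in> FA.C n"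
  then have "ncps_tensor f g \<in> tensor_relators n" "ncps_tensor g f \<in> tensor_relators n"
    unfolding tensor_relators_def by (auto dest: FA.J_C)
  then show "ncps_tensor f g \<in> FA2.J n" "ncps_tensor g f \<in> FA2.J n"
    by (auto intro: FA2.G_J)
qed

lemma tensor_eqJ:
  assumes "FA.eqJ n f f'" "FA.eqJ n g g'"
  shows "FA2.eqJ n (ncps_tensor f g) (ncps_tensor f' g')"
proof -
  have "ncps_tensor (f - f') g \<in> FA2.J n" "ncps_tensor f' (g - g') \<in> FA2.J n"
    using assms tensor_J by (auto simp: FA.eqJ_def)
  from FA2.J_closed(2)[OF this] show ?thesis
    using assms by (auto simp: FA.eqJ_def FA2.eqJ_def tensor_diff intro!: tensor_carrier)
qed

text \<open>The relators are commutators of primitive elements, hence primitive, and so the coproduct maps the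
ideal that they generate into the corresponding ideal of the tensor square.\<close>
lemma coproduct_J: "f \<in> FA.J n \<Longrightarrow> ncps_coproduct f \<in> FA2.J n"
proof (rule FA.J_induct)
  fix r assume r: "r \<in> oriented_relators n"
  then have "primitive r"
    by (auto simp: oriented_relators_eq intro!: primitive_commutator primitive_add primitive_gen)
  then show "ncps_coproduct r \<in> FA2.J n"
    unfolding primitive_def using tensor_J[OF FA.G_J[OF r], of 1] by (simp add: FA2.J_closed)
next
  fix f assume f: "f \<in> FA.C n"
    and lim: "\<And>d. \<exists>g\<in>FA.C n. ncps_coproduct g \<in> FA2.J n \<and> (\<forall>w. mdeg w \<le> d \<longrightarrow> g w = f w)"
  show "ncps_coproduct f \<in> FA2.J n"
  proof (rule FA2.J_limit)
    fix d
    from lim[of d] obtain g where "ncps_coproduct g \<in> FA2.J n" "\<forall>w. mdeg w \<le> d \<longrightarrow> g w = f w" by blast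
    then show "\<exists>g\<in>FA2.J n. \<forall>w. mdeg w \<le> d \<longrightarrow> g w = ncps_coproduct f w"
      using cont_lin_agree[OF cont_lin_coproduct, of d g f] by blast
  qed (rule coproduct_carrier[OF f])
next
  fix f g :: "idx ncps" assume "ncps_coproduct f \<in> FA2.J n" "ncps_coproduct g \<in> FA2.J n"
  then have "ncps_coproduct f - ncps_coproduct g \<in> FA2.J n" by (rule FA2.J_diff)
  then show "ncps_coproduct (f - g) \<in> FA2.J n" by (simp only: cont_linD[OF cont_lin_coproduct])
qed (simp_all add: cont_linD[OF cont_lin_coproduct] coproduct_mult FA2.J_closed coproduct_carrier)

lemma coproduct_eqJ: "FA.eqJ n f g \<Longrightarrow> FA2.eqJ n (ncps_coproduct f) (ncps_coproduct g)"
  using coproduct_J[of "f - g" n]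
  by (auto simp: FA.eqJ_def FA2.eqJ_def cont_linD[OF cont_lin_coproduct] intro!: coproduct_carrier)

section \<open>The group of exponentials\<close>

lemma o_tensor_cls:
  assumes "f \<in> FA.C n" "g \<in> FA.C n"
  shows "o_tensor n (FA.cls n f) (FA.cls n g) = FA2.cls n (ncps_tensor f g)"
proof -
  have "FA2.cls n (ncps_tensor f' g') = FA2.cls n (ncps_tensor f g)"
    if "FA.eqJ n f' f" "FA.eqJ n g' g" for f' g'
    using tensor_eqJ[OF that] FA2.cls_eq_iff[of "ncps_tensor f' g'" n "ncps_tensor f g"]
    by (simp add: FA2.eqJ_def)
  then have "(\<lambda>p. FA2.cls n (case p of (f, g) \<Rightarrow> ncps_tensor f g)) ` (FA.cls n f \<times> FA.cls n g) =
      {FA2.cls n (ncps_tensor f g)}"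
    using assms by (auto simp: FA.cls_mem intro!: image_eqI[of _ _ "(f, g)"] FA.eqJ_refl)
  then show ?thesis
    by (simp add: o_tensor_def coset_map_def rel_ideal2_eq ncps2_ring_eq_sring FA2.cls_def)
qed

lemma o_coproduct_cls:
  assumes "f \<in> FA.C n"
  shows "o_coproduct n (FA.cls n f) = FA2.cls n (ncps_coproduct f)"
  unfolding o_coproduct_def rel_ideal2_eq ncps2_ring_eq_sring FA2.cls_def
proof (rule FA.coset_map_cls[OF assms], fold FA2.cls_def)
  fix g assume "FA.eqJ n g f"
  from coproduct_eqJ[OF this] show "FA2.cls n (ncps_coproduct g) = FA2.cls n (ncps_coproduct f)"
    using FA2.cls_eq_iff[of "ncps_coproduct g" n "ncps_coproduct f"] by (simp add: FA2.eqJ_def)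
qed

lemma oriented_lie_eq: "oriented_lie n =
    FA.cls n ` {f \<in> FA.C n. FA2.eqJ n (ncps_coproduct f) (ncps_tensor f 1 + ncps_tensor 1 f)}"
proof -
  have "o_coproduct n (FA.cls n f) = o_tensor n (FA.cls n f) \<one>\<^bsub>OA n\<^esub> \<oplus>\<^bsub>OA2 n\<^esub> o_tensor n \<one>\<^bsub>OA n\<^esub> (FA.cls n f)
    \<longleftrightarrow> FA2.eqJ n (ncps_coproduct f) (ncps_tensor f 1 + ncps_tensor 1 f)" if f: "f \<in> FA.C n" for f
  proof -
    have "ncps_tensor f 1 \<in> FA2.C n" "ncps_tensor 1 f \<in> FA2.C n" "ncps_coproduct f \<in> FA2.C n"
      using f by (auto intro!: tensor_carrier coproduct_carrier)
    then show ?thesis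
      using f by (simp add: OA_simps OA2_eq FA2.Q_simps o_coproduct_cls o_tensor_cls FA2.cls_eq_iff)
  qed
  then show ?thesis unfolding oriented_lie_def OA_simps by auto
qed

lemma ncps_exp_eq: "ncps_exp X f = exps f"
  by (auto simp: ncps_exp_def exps_eq_ssum ssum_def ncps_ring_eq_sring sc_apply fun_eq_iff)

lemma o_exp_cls:
  assumes "f \<in> FA.C n" "f [] = 0"
  shows "o_exp n (FA.cls n f) = FA.cls n (exps f)"
proof -
  have "FA.cls n (exps g) = FA.cls n (exps f)" if g: "FA.eqJ n g f" for g
  proof -
    have "FA.eqJ n (exps g) (exps f)"
      unfolding exps_def using eqJ_const[OF g] assms g by (intro FA.eqJ_psub) auto
    then show ?thesis
      using FA.cls_eq_iff[of "exps g" n "exps f"] by (simp add: FA.eqJ_def)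
  qed
  then show ?thesis
    using FA.coset_map_cls[OF assms(1), where B = "FA.J n" and A = "sring (lists (pairs n))" and h = exps,
        folded FA.cls_def]
    by (simp add: o_exp_def ncps_exp_eq[abs_def] rel_ideal_eq ncps_ring_eq_sring)
qed

text \<open>Group-likeness of a representative, modulo the relations. The constant term is required to be one
so that a logarithm exists.\<close>
definition group_like :: "nat \<Rightarrow> idx ncps \<Rightarrow> bool" where
  "group_like n f \<longleftrightarrow> f \<in> FA.C n \<and> f [] = 1 \<and> FA2.eqJ n (ncps_coproduct f) (ncps_tensor f f)"

text \<open>The coproduct of \<open>exp f\<close> is \<open>exp (f \<otimes> 1 + 1 \<otimes> f)\<close>, the product of \<open>exp f \<otimes> 1\<close> and \<open>1 \<otimes> exp f\<close>.\<close>
lemma group_like_exps: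
  assumes "f \<in> FA.C n" "f [] = 0" "FA2.eqJ n (ncps_coproduct f) (ncps_tensor f 1 + ncps_tensor 1 f)"
  shows "group_like n (exps f)"
proof -
  have "ncps_coproduct (exps f) = exps (ncps_coproduct f)"
    unfolding exps_def using assms
    by (intro cont_lin_psub cont_lin_coproduct coproduct_mult coproduct_1) simp
  moreover have "FA2.eqJ n (exps (ncps_coproduct f)) (exps (ncps_tensor f 1 + ncps_tensor 1 f))"
    unfolding exps_def using assms
    by (intro FA2.eqJ_psub) (simp_all add: mnil_prod_def coproduct_apply ncps_tensor_def)
  moreover have "exps (ncps_tensor f 1 + ncps_tensor 1 f) = ncps_tensor (exps f) (exps f)"
    using assms(2) tensor_commute
    by (subst exps_add) (simp_all add: tensor_mnil flip: tensor_exps)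
  moreover have "exps f [] = 1" using exps_mnil[of f] by simp
  ultimately show ?thesis using assms(1) by (auto simp: group_like_def exps_def)
qed

text \<open>Conversely, the logarithm of a group-like element is primitive: \<open>f \<otimes> f\<close> is the product of the
  commuting elements \<open>f \<otimes> 1\<close> and \<open>1 \<otimes> f\<close>, so its logarithm is the sum of theirs.\<close>
lemma primitive_logs:
  assumes "group_like n f"
  defines "a \<equiv> logs f"
  shows "a \<in> FA.C n" "a [] = 0" "exps a = f"
    "FA2.eqJ n (ncps_coproduct a) (ncps_tensor a 1 + ncps_tensor 1 a)"
proof -
  have f: "f \<in> FA.C n" "f [] = 1" "FA2.eqJ n (ncps_coproduct f) (ncps_tensor f f)"
    using assms by (auto simp: group_like_def)
  show a: "a \<in> FA.C n" "a [] = 0" "exps a = f"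
    using f logs_mnil[of f] exps_logs[of f] by (auto simp: a_def logs_def)
  have "ncps_tensor f f = exps (ncps_tensor a 1 + ncps_tensor 1 a)"
    using a(2) tensor_commute(1) tensor_commute(2)[of f f]
    by (subst exps_add) (simp_all add: tensor_mnil a(3) flip: tensor_exps)
  then have *: "logs (ncps_tensor f f) = ncps_tensor a 1 + ncps_tensor 1 a"
    using a(2) by (simp add: logs_exps tensor_mnil)
  have "ncps_coproduct a = logs (ncps_coproduct f)"
    unfolding a_def logs_def using f
    by (subst cont_lin_psub[OF cont_lin_coproduct coproduct_mult coproduct_1])
       (simp_all add: cont_linD[OF cont_lin_coproduct] coproduct_1)
  moreover have "FA2.eqJ n (logs (ncps_coproduct f)) (logs (ncps_tensor f f))"
    unfolding logs_def
  proof (rule FA2.eqJ_psub)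
    show "FA2.eqJ n (ncps_coproduct f - 1) (ncps_tensor f f - 1)"
      using FA2.eqJ_add[OF f(3) FA2.eqJ_refl[of "- 1"]] by simp
  qed (use f in \<open>simp_all add: mnil_prod_def coproduct_apply ncps_tensor_def one_list2\<close>)
  ultimately show "FA2.eqJ n (ncps_coproduct a) (ncps_tensor a 1 + ncps_tensor 1 a)" by (simp add: *)
qed

text \<open>This description replaces the Baker-Campbell-Hausdorff formula: that products of exponentials are
exponentials is evident for group-like elements, because the coproduct is multiplicative.\<close>
lemma exp_lie_carrier: "carrier (exp_lie n) = FA.cls n ` {f. group_like n f}"
proof -
  have "o_exp n x \<in> FA.cls n ` {f. group_like n f}" if "x \<in> oriented_lie n" for x
  proof -
    from that obtain f where x: "x = FA.cls n f" and f: "f \<in> FA.C n"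
      and p: "FA2.eqJ n (ncps_coproduct f) (ncps_tensor f 1 + ncps_tensor 1 f)"
      by (auto simp: oriented_lie_eq)
    have "(ncps_coproduct f - (ncps_tensor f 1 + ncps_tensor 1 f)) ([], []) = 0"
      by (rule J2_const[of _ n]) (use p[unfolded FA2.eqJ_def] in blast)
    then have "f [] = 0" by (simp add: coproduct_apply ncps_tensor_def one_series_def)
    then show ?thesis using x f p group_like_exps by (simp add: o_exp_cls)
  qed
  moreover have "FA.cls n f \<in> o_exp n ` oriented_lie n" if "group_like n f" for f
    using primitive_logs[OF that]
    by (intro image_eqI[of _ _ "FA.cls n (logs f)"]) (auto simp: oriented_lie_eq o_exp_cls)
  ultimately show ?thesis by (auto simp: exp_lie_def)
qed

lemma group_like_mult:
  assumes "group_like n f" "group_like n g"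
  shows "group_like n (f * g)"
  using assms FA2.eqJ_mult[of n "ncps_coproduct f" "ncps_tensor f f" "ncps_coproduct g" "ncps_tensor g g"]
    times_mnil[of f g]
  by (auto simp: group_like_def coproduct_mult tensor_mult)

lemma group_like_inverse:
  assumes "group_like n f"
  obtains g where "group_like n g" "f * g = 1" "g * f = 1"
proof
  note a = primitive_logs[OF assms]
  show "group_like n (exps (- logs f))"
  proof (rule group_like_exps)
    show "FA2.eqJ n (ncps_coproduct (- logs f)) (ncps_tensor (- logs f) 1 + ncps_tensor 1 (- logs f))"
      using FA2.eqJ_minus[OF a(4)]
      by (simp add: cont_linD[OF cont_lin_coproduct] cont_linD[OF cont_lin_tensor(1)]
          cont_linD[OF cont_lin_tensor(2)] add.commute)
  qed (use a in auto)
  show "f * exps (- logs f) = 1" "exps (- logs f) * f = 1"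
    using exps_minus[of "logs f"] a by simp_all
qed

lemma group_like_1: "group_like n 1"
  by (simp add: group_like_def coproduct_1 tensor_1 FA2.eqJ_refl flip: mnil_list_def)

lemma exp_lie_simps [simp]:
  "mult (exp_lie n) = mult (OA n)" "one (exp_lie n) = one (OA n)"
  by (simp_all add: exp_lie_def)

lemma group_like_C: "group_like n f \<Longrightarrow> f \<in> FA.C n"
  by (simp add: group_like_def)

lemma group_exp_lie: "group (exp_lie n)"
proof (rule groupI)
  fix x assume "x \<in> carrier (exp_lie n)"
  then obtain f where f: "group_like n f" "x = FA.cls n f" by (auto simp: exp_lie_carrier)
  from group_like_inverse[OF f(1)] obtain g where "group_like n g" "g * f = 1" by blast
  then show "\<exists>y\<in>carrier (exp_lie n). y \<otimes>\<^bsub>exp_lie n\<^esub> x = \<one>\<^bsub>exp_lie n\<^esub>"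
    using f by (auto simp: exp_lie_carrier OA_simps group_like_C intro!: bexI[of _ g])
qed (auto simp: exp_lie_carrier OA_simps group_like_C group_like_1 group_like_mult FA.C_mult mult.assoc)

section \<open>Presented groups\<close>

abbreviation flip :: "'a \<times> bool \<Rightarrow> 'a \<times> bool" where "flip l \<equiv> (fst l, \<not> snd l)"

definition winv :: "'a gword \<Rightarrow> 'a gword" where "winv w = rev (map flip w)"

text \<open>The element of the presented group that a word represents.\<close>
definition wcl :: "'a set \<Rightarrow> ('a gword \<times> 'a gword) set \<Rightarrow> 'a gword \<Rightarrow> 'a gword set" where
  "wcl X E w = word_rel X E `` {w}"

lemma gwords_simps [simp]:
  "[] \<in> gwords X" "l # w \<in> gwords X \<longleftrightarrow> fst l \<in> X \<and> w \<in> gwords X"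
  "u @ v \<in> gwords X \<longleftrightarrow> u \<in> gwords X \<and> v \<in> gwords X"
  by (auto simp: gwords_def mem_Times_iff)

lemma winv_simps [simp]:
  "winv [] = []" "winv (l # w) = winv w @ [flip l]" "winv (u @ v) = winv v @ winv u"
  "winv (winv w) = w" "length (winv w) = length w" "winv w = [] \<longleftrightarrow> w = []"
  by (auto simp: winv_def rev_map o_def)

lemma winv_gwords [simp]: "winv w \<in> gwords X \<longleftrightarrow> w \<in> gwords X"
  by (induction w) auto

lemma word_eq_gwords: "word_eq X E u v \<Longrightarrow> u \<in> gwords X \<and> v \<in> gwords X"
  by (induction rule: word_eq.induct) auto

lemma wcl_self: "w \<in> gwords X \<Longrightarrow> w \<in> wcl X E w"
  by (auto simp: wcl_def word_rel_def intro: word_eq.refl)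

lemma mem_wcl: "u \<in> wcl X E w \<longleftrightarrow> word_eq X E w u"
  by (auto simp: wcl_def word_rel_def)

lemma wcl_eq_iff:
  assumes "u \<in> gwords X"
  shows "wcl X E u = wcl X E v \<longleftrightarrow> word_eq X E u v"
proof
  assume "wcl X E u = wcl X E v"
  then have "word_eq X E v u" using wcl_self[OF assms, of E] by (simp add: mem_wcl)
  then show "word_eq X E u v" by (rule word_eq.sym)
next
  assume uv: "word_eq X E u v"
  have "word_eq X E u w \<longleftrightarrow> word_eq X E v w" for w
    using uv word_eq.sym[OF uv] word_eq.trans by blast
  then show "wcl X E u = wcl X E v" by (auto simp: mem_wcl)
qed

lemma word_eq_winv: "w \<in> gwords X \<Longrightarrow> word_eq X E (winv w @ w) []"
proof (induction w)
  case (Cons l w)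
  have "word_eq X E [flip l, l] []" using Cons.prems word_eq.cancel[of "fst l" X E "\<not> snd l"] by simp
  then have "word_eq X E (winv w @ [flip l, l] @ w) (winv w @ [] @ w)"
    using Cons.prems by (intro word_eq.append word_eq.refl) auto
  then show ?case using Cons word_eq.trans[of X E "winv w @ [flip l, l] @ w" "winv w @ w" "[]"] by simp
qed (simp add: word_eq.refl)

context
  fixes X :: "'a set" and E :: "('a gword \<times> 'a gword) set"
begin

abbreviation "PG \<equiv> presented_group X E"

lemma PG_carrier: "carrier PG = wcl X E ` gwords X"
  by (auto simp: presented_group_def quotient_def wcl_def)

lemma wcl_carrier: "w \<in> gwords X \<Longrightarrow> wcl X E w \<in> carrier PG"
  by (auto simp: PG_carrier)

lemma PG_one: "\<one>\<^bsub>PG\<^esub> = wcl X E []"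
  by (simp add: presented_group_def wcl_def)

lemma PG_mult:
  assumes "u \<in> gwords X" "v \<in> gwords X"
  shows "wcl X E u \<otimes>\<^bsub>PG\<^esub> wcl X E v = wcl X E (u @ v)"
proof -
  have *: "wcl X E (u' @ v') = wcl X E (u @ v)" if "u' \<in> wcl X E u" "v' \<in> wcl X E v" for u' v'
  proof -
    have "word_eq X E (u @ v) (u' @ v')" using that unfolding mem_wcl by (rule word_eq.append)
    then show ?thesis using assms wcl_eq_iff[of "u @ v" X E "u' @ v'"] by simp
  qed
  have ne: "wcl X E u \<noteq> {}" "wcl X E v \<noteq> {}" using assms wcl_self by blast+
  have "(\<Union>v'\<in>wcl X E v. wcl X E (u' @ v')) = wcl X E (u @ v)" if "u' \<in> wcl X E u" for u'
    by (rule SUP_eq_const[OF ne(2)]) (rule *[OF that])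
  then have "(\<Union>u'\<in>wcl X E u. \<Union>v'\<in>wcl X E v. wcl X E (u' @ v')) = wcl X E (u @ v)"
    by (rule SUP_eq_const[OF ne(1)])
  then show ?thesis by (simp add: presented_group_def wcl_def)
qed

lemma PG_winv: "w \<in> gwords X \<Longrightarrow> wcl X E (winv w) \<otimes>\<^bsub>PG\<^esub> wcl X E w = \<one>\<^bsub>PG\<^esub>"
  using wcl_eq_iff[of "winv w @ w" X E "[]"] word_eq_winv[of w X E] by (simp add: PG_mult PG_one)

lemma PG_group: "group PG"
proof (rule groupI)
  fix x assume "x \<in> carrier PG"
  then obtain w where w: "x = wcl X E w" "w \<in> gwords X" by (auto simp: PG_carrier)
  then show "\<exists>y\<in>carrier PG. y \<otimes>\<^bsub>PG\<^esub> x = \<one>\<^bsub>PG\<^esub>"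
    using PG_winv[of w] wcl_carrier[of "winv w"] by auto
qed (auto simp: PG_carrier PG_one PG_mult)

lemma PG_inv: "w \<in> gwords X \<Longrightarrow> inv\<^bsub>PG\<^esub> (wcl X E w) = wcl X E (winv w)"
  by (rule group.inv_equality[OF PG_group])
     (simp_all add: PG_winv wcl_carrier)

context
  fixes G :: "('b, 'm) monoid_scheme" and f :: "'a \<Rightarrow> 'b"
  assumes G: "group G" and f: "\<And>x. x \<in> X \<Longrightarrow> f x \<in> carrier G"
begin

interpretation G: group G by (rule G)

lemma word_value_closed: "w \<in> gwords X \<Longrightarrow> word_value G f w \<in> carrier G"
  unfolding word_value_def by (induction w) (auto simp: f)

lemma word_value_Cons: "word_value G f (l # w) =
    (if snd l then f (fst l) else inv\<^bsub>G\<^esub> (f (fst l))) \<otimes>\<^bsub>G\<^esub> word_value G f w"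
  by (simp add: word_value_def case_prod_unfold)

lemma word_value_append: "u \<in> gwords X \<Longrightarrow> v \<in> gwords X \<Longrightarrow>
    word_value G f (u @ v) = word_value G f u \<otimes>\<^bsub>G\<^esub> word_value G f v"
proof (induction u)
  case Nil
  then show ?case using word_value_closed by (simp add: word_value_def)
next
  case (Cons l u)
  then have "word_value G f (u @ v) = word_value G f u \<otimes>\<^bsub>G\<^esub> word_value G f v" by simp
  then show ?case using Cons.prems word_value_closed by (simp add: word_value_Cons f G.m_assoc)
qed

lemma hom_word_value:
  assumes h: "h \<in> hom PG G" and hf: "\<And>x. x \<in> X \<Longrightarrow> h (wcl X E [(x, True)]) = f x" and w: "w \<in> gwords X"
  shows "h (wcl X E w) = word_value G f w"
  using w
proof (induction w)
  case Nil
  then show ?case using hom_one[OF h PG_group G] by (simp add: word_value_def PG_one)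
next
  case (Cons l w)
  obtain x b where l: "l = (x, b)" by fastforce
  interpret P: group PG by (rule PG_group)
  have x: "x \<in> X" "w \<in> gwords X" using Cons.prems l by auto
  have c: "wcl X E [(x, True)] \<in> carrier PG" using x by (auto simp: PG_carrier)
  have 1: "h (wcl X E [(x, b)]) = (if b then f x else inv\<^bsub>G\<^esub> (f x))"
  proof (cases b)
    case False
    have "wcl X E [(x, False)] = inv\<^bsub>PG\<^esub> (wcl X E [(x, True)])" using x by (simp add: PG_inv)
    then show ?thesis
      using False group_hom.hom_inv[of PG G h, OF _ c] h hf x G
      by (simp add: group_hom_def group_hom_axioms_def PG_group)
  qed (simp add: hf x)
  have "wcl X E (l # w) = wcl X E [(x, b)] \<otimes>\<^bsub>PG\<^esub> wcl X E w" using x by (simp add: PG_mult l)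
  then have "h (wcl X E (l # w)) = h (wcl X E [(x, b)]) \<otimes>\<^bsub>G\<^esub> h (wcl X E w)"
    using x hom_mult[OF h] by (simp add: PG_carrier)
  then show ?case using 1 Cons x by (simp add: word_value_Cons l)
qed

lemma pres_hom_word:
  assumes rel: "\<And>u v. (u, v) \<in> E \<Longrightarrow> u \<in> gwords X \<Longrightarrow> v \<in> gwords X \<Longrightarrow> word_value G f u = word_value G f v"
    and w: "w \<in> gwords X"
  shows "pres_hom G f (wcl X E w) = word_value G f w"
proof -
  have "word_value G f u = word_value G f v" if "word_eq X E u v" for u v
    using that
  proof (induction rule: word_eq.induct)
    case (append u u' v v')
    then show ?case
      using word_eq_gwords[OF append(1)] word_eq_gwords[OF append(2)] by (simp add: word_value_append)
  next
    case (cancel x b)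
    then show ?case by (simp add: word_value_def f)
  qed (use rel in auto)
  then have "word_value G f v = word_value G f w" if "v \<in> wcl X E w" for v
    using that unfolding mem_wcl by metis
  then have "word_value G f ` wcl X E w = {word_value G f w}"
    using wcl_self[OF w, of E] by blast
  then show ?thesis by (simp add: pres_hom_def)
qed

text \<open>The universal property of a presentation, through the value of a word, which the elementary
transformations of words leave unchanged.\<close>
lemma pres_hom_hom:
  assumes rel: "\<And>u v. (u, v) \<in> E \<Longrightarrow> u \<in> gwords X \<Longrightarrow> v \<in> gwords X \<Longrightarrow> word_value G f u = word_value G f v"
  shows "pres_hom G f \<in> hom PG G" "\<And>x. x \<in> X \<Longrightarrow> pres_hom G f (wcl X E [(x, True)]) = f x"
proof -
  note pw = pres_hom_word[OF rel]
  show "pres_hom G f \<in> hom PG G"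
    by (rule homI) (auto simp: PG_carrier PG_mult pw word_value_closed word_value_append)
  show "pres_hom G f (wcl X E [(x, True)]) = f x" if "x \<in> X" for x
    using that f by (simp add: pw word_value_def)
qed

end

lemma hom_eq_on_generators:
  assumes "group G" "h \<in> hom PG G" "k \<in> hom PG G"
    "\<And>x. x \<in> X \<Longrightarrow> h (wcl X E [(x, True)]) = k (wcl X E [(x, True)])" "A \<in> carrier PG"
  shows "h A = k A"
proof -
  have c: "h (wcl X E [(x, True)]) \<in> carrier G" if "x \<in> X" for x
    using hom_in_carrier[OF assms(2), of "wcl X E [(x, True)]"] that by (auto simp: PG_carrier)
  obtain w where w: "A = wcl X E w" "w \<in> gwords X" using assms(5) by (auto simp: PG_carrier)
  let ?f = "\<lambda>x. h (wcl X E [(x, True)])"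
  have "h (wcl X E w) = word_value G ?f w"
    by (rule hom_word_value[OF assms(1) _ assms(2) _ w(2)]) (simp_all add: c)
  moreover have "k (wcl X E w) = word_value G ?f w"
    by (rule hom_word_value[OF assms(1) _ assms(3) _ w(2)]) (use c assms(4) in simp_all)
  ultimately show ?thesis using w by simp
qed

end

section \<open>Reduced words\<close>

definition reduced :: "'a gword \<Rightarrow> bool" where
  "reduced w \<longleftrightarrow> successively (\<lambda>a b. b \<noteq> flip a) w"

text \<open>Left multiplication of a reduced word by a letter. These operations define an action of the free group
on reduced words, and the action on the empty word yields the normal form \<open>fred\<close>.\<close>
fun rcons :: "'a \<times> bool \<Rightarrow> 'a gword \<Rightarrow> 'a gword" where
  "rcons l [] = [l]"
| "rcons l (m # w) = (if m = flip l then w else l # m # w)"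

definition fred :: "'a gword \<Rightarrow> 'a gword" where "fred w = foldr rcons w []"

lemma reduced_simps [simp]:
  "reduced []" "reduced [l]" "reduced (l # m # w) \<longleftrightarrow> m \<noteq> flip l \<and> reduced (m # w)"
  by (auto simp: reduced_def)

lemma reduced_append: "reduced (u @ v) \<longleftrightarrow>
    reduced u \<and> reduced v \<and> (u = [] \<or> v = [] \<or> hd v \<noteq> flip (last u))"
  by (auto simp: reduced_def successively_append_iff)

lemma reduced_Cons: "reduced (l # w) \<longleftrightarrow> reduced w \<and> (w = [] \<or> hd w \<noteq> flip l)"
  using reduced_append[of "[l]" w] by auto

lemma reduced_winv [simp]: "reduced (winv w) \<longleftrightarrow> reduced w"
proof -
  have "reduced w \<Longrightarrow> reduced (winv w)" for w :: "'a gword"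
  proof (induction w)
    case (Cons l w)
    have "w = [] \<or> last (winv w) = flip (hd w)" by (cases w) auto
    then show ?case using Cons by (auto simp: reduced_append reduced_Cons prod_eq_iff)
  qed simp
  from this[of w] this[of "winv w"] show ?thesis by auto
qed

lemma reduced_rcons: "reduced w \<Longrightarrow> reduced (rcons l w)"
  by (cases w) (auto simp: reduced_Cons)

lemma rcons_flip: "reduced w \<Longrightarrow> rcons l (rcons (flip l) w) = w"
  by (cases w; cases "tl w") (auto simp: reduced_Cons)

lemma reduced_foldr: "reduced z \<Longrightarrow> reduced (foldr rcons w z)"
  by (induction w) (auto simp: reduced_rcons)

lemma reduced_fred [simp]: "reduced (fred w)"
  by (simp add: fred_def reduced_foldr)

lemma fred_reduced: "reduced w \<Longrightarrow> fred w = w"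
proof (induction w)
  case (Cons l w)
  then have "fred w = w" by (simp add: reduced_Cons)
  then show ?case using Cons.prems by (cases w) (auto simp: fred_def reduced_Cons)
qed (simp add: fred_def)

lemma length_fred: "length (fred w) \<le> length w"
proof (induction w)
  case (Cons l w)
  have "length (rcons l z) \<le> Suc (length z)" for z by (cases z) auto
  from this[of "fred w"] show ?case using Cons by (simp add: fred_def)
qed (simp add: fred_def)

text \<open>Van der Waerden's argument: equivalent words act in the same way on reduced words.\<close>
lemma fred_eqI: "word_eq X {} u v \<Longrightarrow> fred u = fred v"
proof -
  assume "word_eq X {} u v"
  then have "\<forall>z. reduced z \<longrightarrow> foldr rcons u z = foldr rcons v z"
  proof (induction rule: word_eq.induct)
    case (cancel x b)
    then show ?case using rcons_flip[of _ "(x, b)"] by auto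
  qed (auto simp: reduced_foldr)
  then show ?thesis by (simp add: fred_def)
qed

lemma word_eq_fred: "w \<in> gwords X \<Longrightarrow> word_eq X {} w (fred w)"
proof (induction w)
  case (Cons l w)
  then have w: "w \<in> gwords X" "fst l \<in> X" "word_eq X {} w (fred w)" by auto
  then have 1: "word_eq X {} ([l] @ w) ([l] @ fred w)"
    by (intro word_eq.append word_eq.refl) auto
  have f: "fred w \<in> gwords X" using word_eq_gwords[OF w(3)] by simp
  have "word_eq X {} ([l] @ fred w) (rcons l (fred w))"
  proof (cases "\<exists>z. fred w = flip l # z")
    case True
    then obtain z where z: "fred w = flip l # z" by blast
    then have "word_eq X {} ([l, flip l] @ z) ([] @ z)"
      using f w word_eq.cancel[of "fst l" X "{}" "snd l"] by (intro word_eq.append word_eq.refl) auto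
    then show ?thesis using z by simp
  next
    case False
    then have "rcons l (fred w) = l # fred w" by (cases "fred w") auto
    then show ?thesis using f w by (simp add: word_eq.refl)
  qed
  then show ?case using word_eq.trans[OF 1] by (simp add: fred_def)
qed (simp add: fred_def word_eq.refl)

lemma fred_gwords: "w \<in> gwords X \<Longrightarrow> fred w \<in> gwords X"
  using word_eq_fred word_eq_gwords by blast

lemma wcl_fred: "w \<in> gwords X \<Longrightarrow> wcl X {} (fred w) = wcl X {} w"
  using word_eq_fred[of w X] wcl_eq_iff[of w X "{}" "fred w"] by simp

lemma wcl_eq_fred: "u \<in> gwords X \<Longrightarrow> v \<in> gwords X \<Longrightarrow> wcl X {} u = wcl X {} v \<longleftrightarrow> fred u = fred v"
proof
  assume *: "u \<in> gwords X" "v \<in> gwords X"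
  show "fred u = fred v" if "wcl X {} u = wcl X {} v"
    using that * by (intro fred_eqI[of X]) (simp add: wcl_eq_iff)
  show "wcl X {} u = wcl X {} v" if "fred u = fred v"
    using wcl_fred[OF *(1)] wcl_fred[OF *(2)] that by simp
qed

lemma wcl_inj: "u \<in> gwords X \<Longrightarrow> v \<in> gwords X \<Longrightarrow> reduced u \<Longrightarrow> reduced v \<Longrightarrow>
    wcl X {} u = wcl X {} v \<Longrightarrow> u = v"
  by (simp add: wcl_eq_fred fred_reduced)

lemma free_carrier_reduced:
  assumes "A \<in> carrier (presented_group X {})"
  obtains w where "w \<in> gwords X" "reduced w" "A = wcl X {} w"
proof -
  obtain w where w: "w \<in> gwords X" "A = wcl X {} w" using assms by (auto simp: PG_carrier)
  show ?thesis by (rule that[of "fred w"]) (simp_all add: w fred_gwords wcl_fred)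
qed

text \<open>Index sets are written \<open>{1..n}\<close> and should keep this form under simplification.\<close>
declare One_nat_def [simp del]

section \<open>Free groups\<close>

abbreviation W :: "nat \<Rightarrow> nat gword set" where "W n \<equiv> gwords {1..n}"
abbreviation cw :: "nat \<Rightarrow> nat gword \<Rightarrow> fg_elem" where "cw n \<equiv> wcl {1..n} {}"

lemma FG_group: "group (FG n)" by (simp add: FG_def PG_group)
lemma FG_carrier: "carrier (FG n) = cw n ` W n" by (simp add: FG_def PG_carrier)
lemma FG_one: "\<one>\<^bsub>FG n\<^esub> = cw n []" by (simp add: FG_def PG_one)
lemma FG_mult: "u \<in> W n \<Longrightarrow> v \<in> W n \<Longrightarrow> cw n u \<otimes>\<^bsub>FG n\<^esub> cw n v = cw n (u @ v)"
  by (simp add: FG_def PG_mult)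
lemma FG_inv: "w \<in> W n \<Longrightarrow> inv\<^bsub>FG n\<^esub> (cw n w) = cw n (winv w)"
  by (simp add: FG_def PG_inv)
lemma cw_carrier [simp]: "w \<in> W n \<Longrightarrow> cw n w \<in> carrier (FG n)"
  by (auto simp: FG_carrier)
lemma gen_eq: "gen n i = cw n [(i, True)]" by (simp add: gen_def wcl_def)
lemma gen_carrier_FG [simp]: "i \<in> {1..n} \<Longrightarrow> gen n i \<in> carrier (FG n)" by (simp add: gen_eq)

lemma FG_hom_eqI:
  assumes "group G" "h \<in> hom (FG n) G" "k \<in> hom (FG n) G" "\<And>i. i \<in> {1..n} \<Longrightarrow> h (gen n i) = k (gen n i)"
    "x \<in> carrier (FG n)"
  shows "h x = k x"
  using hom_eq_on_generators[OF assms(1), of h "{1..n}" "{}" k x] assms(2-5) by (simp add: FG_def gen_eq)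

lemma free_endo:
  assumes f: "\<And>i. i \<in> {1..n} \<Longrightarrow> f i \<in> carrier (FG n)"
  shows "free_endo n f \<in> hom (FG n) (FG n)" "free_endo n f \<in> extensional (carrier (FG n))"
    "i \<in> {1..n} \<Longrightarrow> free_endo n f (gen n i) = f i"
proof -
  have *: "pres_hom (FG n) f \<in> hom (FG n) (FG n)" "i \<in> {1..n} \<Longrightarrow> pres_hom (FG n) f (gen n i) = f i" for i
    using pres_hom_hom[OF FG_group, of "{1..n}" f n "{}"] f by (simp_all add: FG_def gen_eq)
  show "free_endo n f \<in> hom (FG n) (FG n)"
    using *(1) group.is_monoid[OF FG_group] unfolding free_endo_def hom_def
    by (auto simp: Pi_iff monoid.m_closed)
  show "free_endo n f \<in> extensional (carrier (FG n))" by (simp add: free_endo_def)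
  show "i \<in> {1..n} \<Longrightarrow> free_endo n f (gen n i) = f i" using *(2) by (simp add: free_endo_def)
qed

text \<open>Conjugation in the convention of the automorphisms \<open>x\<^sub>i \<mapsto> y\<^sup>-\<^sup>1 x\<^sub>i y\<close>; it is a right action.\<close>
abbreviation cj :: "nat \<Rightarrow> fg_elem \<Rightarrow> fg_elem \<Rightarrow> fg_elem" where
  "cj n x y \<equiv> inv\<^bsub>FG n\<^esub> y \<otimes>\<^bsub>FG n\<^esub> x \<otimes>\<^bsub>FG n\<^esub> y"

lemma cj_closed: "x \<in> carrier (FG n) \<Longrightarrow> y \<in> carrier (FG n) \<Longrightarrow> cj n x y \<in> carrier (FG n)"
  by (simp add: FG_group group.is_monoid monoid.m_closed)

lemma cj_cj: "x \<in> carrier (FG n) \<Longrightarrow> y \<in> carrier (FG n) \<Longrightarrow> z \<in> carrier (FG n) \<Longrightarrow>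
    cj n (cj n x y) z = cj n x (y \<otimes>\<^bsub>FG n\<^esub> z)"
proof -
  interpret group "FG n" by (rule FG_group)
  show "x \<in> carrier (FG n) \<Longrightarrow> y \<in> carrier (FG n) \<Longrightarrow> z \<in> carrier (FG n) \<Longrightarrow> ?thesis"
    by (simp add: inv_mult_group m_assoc)
qed

lemma cj_one: "x \<in> carrier (FG n) \<Longrightarrow> cj n x \<one>\<^bsub>FG n\<^esub> = x"
proof -
  interpret group "FG n" by (rule FG_group)
  show "x \<in> carrier (FG n) \<Longrightarrow> ?thesis" by simp
qed

lemma cj_cancel: "x \<in> carrier (FG n) \<Longrightarrow> y \<in> carrier (FG n) \<Longrightarrow> cj n (cj n x y) (inv\<^bsub>FG n\<^esub> y) = x"
proof -
  interpret group "FG n" by (rule FG_group)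
  assume xy: "x \<in> carrier (FG n)" "y \<in> carrier (FG n)"
  show ?thesis unfolding cj_cj[OF xy inv_closed[OF xy(2)]] using xy by (simp add: cj_one)
qed

lemma FG_hom_simps:
  assumes "h \<in> hom (FG n) (FG m)"
  shows "x \<in> carrier (FG n) \<Longrightarrow> h x \<in> carrier (FG m)"
    "x \<in> carrier (FG n) \<Longrightarrow> y \<in> carrier (FG n) \<Longrightarrow> h (x \<otimes>\<^bsub>FG n\<^esub> y) = h x \<otimes>\<^bsub>FG m\<^esub> h y"
    "x \<in> carrier (FG n) \<Longrightarrow> h (inv\<^bsub>FG n\<^esub> x) = inv\<^bsub>FG m\<^esub> (h x)"
    "x \<in> carrier (FG n) \<Longrightarrow> y \<in> carrier (FG n) \<Longrightarrow> h (cj n x y) = cj m (h x) (h y)"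
proof -
  interpret group_hom "FG n" "FG m" h
    by (simp add: group_hom_def group_hom_axioms_def FG_group assms)
  show "x \<in> carrier (FG n) \<Longrightarrow> h x \<in> carrier (FG m)"
    "x \<in> carrier (FG n) \<Longrightarrow> y \<in> carrier (FG n) \<Longrightarrow> h (x \<otimes>\<^bsub>FG n\<^esub> y) = h x \<otimes>\<^bsub>FG m\<^esub> h y"
    "x \<in> carrier (FG n) \<Longrightarrow> h (inv\<^bsub>FG n\<^esub> x) = inv\<^bsub>FG m\<^esub> (h x)"
    "x \<in> carrier (FG n) \<Longrightarrow> y \<in> carrier (FG n) \<Longrightarrow> h (cj n x y) = cj m (h x) (h y)"
    by simp_all
qed

lemma cj_cw: "u \<in> W n \<Longrightarrow> w \<in> W n \<Longrightarrow> cj n (cw n u) (cw n w) = cw n (winv w @ u @ w)"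
  by (simp add: FG_inv FG_mult)

section \<open>Conjugates of generators\<close>

text \<open>The word \<open>y\<^sup>-\<^sup>1 x\<^sub>p y\<close>.\<close>
definition cjw :: "nat \<Rightarrow> nat gword \<Rightarrow> nat gword" where
  "cjw p y = winv y @ [(p, True)] @ y"

text \<open>The normal form of a conjugator: since powers of \<open>x\<^sub>p\<close> commute with \<open>x\<^sub>p\<close>, the conjugator of
  \<open>x\<^sub>p\<close> can be taken not to start with them, and then \<open>y\<^sup>-\<^sup>1 x\<^sub>p y\<close> is reduced as it stands.\<close>
definition conj_reduced :: "nat \<Rightarrow> nat gword \<Rightarrow> bool" where
  "conj_reduced p y \<longleftrightarrow> reduced y \<and> (y \<noteq> [] \<longrightarrow> fst (hd y) \<noteq> p)"

definition strip :: "nat \<Rightarrow> nat gword \<Rightarrow> nat gword" where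
  "strip p w = dropWhile (\<lambda>l. fst l = p) (fred w)"

lemma reduced_cjw:
  assumes "conj_reduced p y" shows "reduced (cjw p y)"
proof (cases y)
  case (Cons l z)
  then show ?thesis
    using assms reduced_winv[of y] by (auto simp: cjw_def conj_reduced_def reduced_append)
qed (simp add: cjw_def)

text \<open>Both words are reduced as they stand, hence equal, and their middle letters are in the same place.\<close>
lemma cjw_inj:
  assumes "conj_reduced p y" "conj_reduced q z" "y \<in> W n" "z \<in> W n" "p \<in> {1..n}" "q \<in> {1..n}"
    "cw n (cjw p y) = cw n (cjw q z)"
  shows "p = q" "y = z"
proof -
  have eq: "cjw p y = cjw q z"
    using assms by (intro wcl_inj[of _ "{1..n}"]) (auto simp: reduced_cjw, auto simp: cjw_def)
  have "length (cjw p y) = length (cjw q z)" by (simp only: eq)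
  then have "length y = length z" by (simp add: cjw_def)
  then show "p = q" "y = z" using eq by (auto simp: cjw_def)
qed

lemma conj_reduced_strip: "conj_reduced p (strip p w)"
proof -
  let ?d = "dropWhile (\<lambda>l. fst l = p) (fred w)"
  have "reduced (takeWhile (\<lambda>l. fst l = p) (fred w) @ ?d)" by simp
  then have "reduced ?d" unfolding reduced_append by blast
  moreover have "?d \<noteq> [] \<Longrightarrow> fst (hd ?d) \<noteq> p" by (rule hd_dropWhile)
  ultimately show ?thesis by (simp add: conj_reduced_def strip_def)
qed

lemma strip_length: "length (strip p w) \<le> length w"
  unfolding strip_def using length_fred[of w] length_dropWhile_le[of "\<lambda>l. fst l = p" "fred w"]
  by linarith

lemma strip_gwords: "w \<in> W n \<Longrightarrow> strip p w \<in> W n"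
  using fred_gwords[of w "{1..n}"] set_dropWhileD[of _ "\<lambda>l. fst l = p" "fred w"]
  by (auto simp: strip_def gwords_def in_lists_conv_set)

lemma cw_cjw: "w \<in> W n \<Longrightarrow> p \<in> {1..n} \<Longrightarrow> cw n (cjw p w) = cj n (gen n p) (cw n w)"
  by (simp add: cjw_def gen_eq cj_cw)

text \<open>The letters that are stripped form a power of \<open>x\<^sub>p\<close>, which commutes with \<open>x\<^sub>p\<close>.\<close>
lemma cw_cjw_strip:
  assumes w: "w \<in> W n" and p: "p \<in> {1..n}"
  shows "cw n (cjw p (strip p w)) = cw n (cjw p w)"
proof -
  interpret group "FG n" by (rule FG_group)
  let ?t = "takeWhile (\<lambda>l. fst l = p) (fred w)"
  have fw: "fred w \<in> W n" using w by (rule fred_gwords)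
  then have t: "?t \<in> W n"
    by (auto simp: gwords_def in_lists_conv_set dest: set_takeWhileD)
  have triv: "cj n (gen n p) (cw n z) = gen n p" if "z \<in> W n" "\<And>l. l \<in> set z \<Longrightarrow> fst l = p" for z
    using that
  proof (induction z)
    case Nil
    then show ?case using p by (simp add: FG_one[symmetric])
  next
    case (Cons l z)
    have l: "cw n [l] = gen n p \<or> cw n [l] = inv\<^bsub>FG n\<^esub> (gen n p)"
    proof -
      have "l = (p, snd l)" using Cons.prems(2)[of l] by (simp add: prod_eq_iff)
      then show ?thesis using p by (cases "snd l") (auto simp: gen_eq FG_inv)
    qed
    have c: "cw n [l] \<in> carrier (FG n)" "cw n z \<in> carrier (FG n)" using Cons.prems by auto
    have "cw n (l # z) = cw n [l] \<otimes>\<^bsub>FG n\<^esub> cw n z" using Cons.prems by (simp add: FG_mult)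
    then have "cj n (gen n p) (cw n (l # z)) = cj n (cj n (gen n p) (cw n [l])) (cw n z)"
      using p c by (subst cj_cj) auto
    also have "cj n (gen n p) (cw n [l]) = gen n p"
      using l
    proof
      assume "cw n [l] = inv\<^bsub>FG n\<^esub> (gen n p)"
      then show ?thesis using p by (simp add: m_assoc)
    qed (use p in simp)
    finally show ?case using Cons by simp
  qed
  have s: "strip p w \<in> W n" using w by (rule strip_gwords)
  have "cw n w = cw n (?t @ strip p w)"
    using wcl_fred[OF w] by (simp add: strip_def)
  then have "cw n w = cw n ?t \<otimes>\<^bsub>FG n\<^esub> cw n (strip p w)"
    using t s by (simp add: FG_mult)
  then have "cw n (cjw p w) = cj n (cj n (gen n p) (cw n ?t)) (cw n (strip p w))"
    using w p t s by (simp add: cw_cjw cj_cj)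
  also have "cj n (gen n p) (cw n ?t) = gen n p"
    using t by (rule triv) (auto dest: set_takeWhileD)
  finally show ?thesis using s p by (simp add: cw_cjw)
qed

section \<open>The braid-permutation group\<close>

lemma auto_FG_D:
  assumes "a \<in> auto (FG n)"
  shows "a \<in> hom (FG n) (FG n)" "a \<in> extensional (carrier (FG n))" "bij_betw a (carrier (FG n)) (carrier (FG n))"
  using assms by (auto simp: auto_def Bij_def)

lemma auto_FG_I: "a \<in> hom (FG n) (FG n) \<Longrightarrow> a \<in> extensional (carrier (FG n)) \<Longrightarrow>
    bij_betw a (carrier (FG n)) (carrier (FG n)) \<Longrightarrow> a \<in> auto (FG n)"
  by (auto simp: auto_def Bij_def)

lemma auto_eqI:
  assumes "a \<in> auto (FG n)" "b \<in> auto (FG n)" "\<And>i. i \<in> {1..n} \<Longrightarrow> a (gen n i) = b (gen n i)"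
  shows "a = b"
  using FG_hom_eqI[OF FG_group auto_FG_D(1)[OF assms(1)] auto_FG_D(1)[OF assms(2)] assms(3)]
    auto_FG_D(2)[OF assms(1)] auto_FG_D(2)[OF assms(2)]
  by (intro extensionalityI[of a "carrier (FG n)" b])

lemma AutoGroup_mult: "a \<in> auto (FG n) \<Longrightarrow> b \<in> auto (FG n) \<Longrightarrow>
    a \<otimes>\<^bsub>AutoGroup (FG n)\<^esub> b = compose (carrier (FG n)) a b"
  by (simp add: AutoGroup_def BijGroup_def auto_def)

lemma BP_simps: "carrier (BP n) = {a \<in> auto (FG n). \<exists>s. is_bp_perm n a s}"
  "mult (BP n) = mult (AutoGroup (FG n))" "one (BP n) = one (AutoGroup (FG n))"
  by (simp_all add: BP_def)

lemma is_bp_perm_mult: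
  assumes a: "a \<in> auto (FG n)" "is_bp_perm n a s" and b: "b \<in> auto (FG n)" "is_bp_perm n b t"
  shows "is_bp_perm n (a \<otimes>\<^bsub>AutoGroup (FG n)\<^esub> b) (s \<circ> t)"
  unfolding is_bp_perm_def
proof (intro conjI ballI)
  show "s \<circ> t permutes {1..n}"
    using a b by (auto simp: is_bp_perm_def intro: permutes_compose)
  fix i assume i: "i \<in> {1..n}"
  interpret group "FG n" by (rule FG_group)
  note ha = FG_hom_simps[OF auto_FG_D(1)[OF a(1)]]
  obtain y where y: "y \<in> carrier (FG n)" "b (gen n i) = cj n (gen n (t i)) y"
    using b(2) i unfolding is_bp_perm_def by blast
  have ti: "t i \<in> {1..n}" using b i permutes_in_image[of t "{1..n}" i] by (auto simp: is_bp_perm_def)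
  obtain z where z: "z \<in> carrier (FG n)" "a (gen n (t i)) = cj n (gen n (s (t i))) z"
    using a(2) ti unfolding is_bp_perm_def by blast
  have sti: "s (t i) \<in> {1..n}" using a ti permutes_in_image[of s "{1..n}" "t i"] by (auto simp: is_bp_perm_def)
  have "(a \<otimes>\<^bsub>AutoGroup (FG n)\<^esub> b) (gen n i) = a (cj n (gen n (t i)) y)"
    using a b i y by (simp add: AutoGroup_mult compose_def)
  also have "\<dots> = cj n (cj n (gen n (s (t i))) z) (a y)"
    using ha(4)[of "gen n (t i)" y] y ti z by simp
  also have "\<dots> = cj n (gen n (s (t i))) (z \<otimes>\<^bsub>FG n\<^esub> a y)"
    using y z sti ha by (intro cj_cj) auto
  finally show "\<exists>y\<in>carrier (FG n). (a \<otimes>\<^bsub>AutoGroup (FG n)\<^esub> b) (gen n i) = cj n (gen n ((s \<circ> t) i)) y"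
    using y z ha by auto
qed

lemma is_bp_perm_one: "is_bp_perm n (\<one>\<^bsub>AutoGroup (FG n)\<^esub>) id"
  unfolding is_bp_perm_def
proof (intro conjI ballI)
  fix i assume i: "i \<in> {1..n}"
  show "\<exists>y\<in>carrier (FG n). \<one>\<^bsub>AutoGroup (FG n)\<^esub> (gen n i) = cj n (gen n (id i)) y"
    using i FG_group by (intro bexI[of _ "\<one>\<^bsub>FG n\<^esub>"])
      (auto simp: cj_one AutoGroup_def BijGroup_def group.is_monoid monoid.one_closed)
qed (rule permutes_id)

lemma is_bp_perm_inv:
  assumes a: "a \<in> auto (FG n)" "is_bp_perm n a s"
  shows "is_bp_perm n (inv\<^bsub>AutoGroup (FG n)\<^esub> a) (inv_into UNIV s)"
  unfolding is_bp_perm_def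
proof (intro conjI ballI)
  interpret F: group "FG n" by (rule FG_group)
  interpret A: group "AutoGroup (FG n)" by (rule F.AutoGroup)
  have s: "s permutes {1..n}" using a by (simp add: is_bp_perm_def)
  then show "inv_into UNIV s permutes {1..n}" by (rule permutes_inv)
  fix j assume j: "j \<in> {1..n}"
  define i where "i = inv_into UNIV s j"
  have i: "i \<in> {1..n}" "s i = j"
    using j permutes_in_image[OF permutes_inv[OF s], of j] permutes_inverses(1)[OF s] by (auto simp: i_def)
  define b where "b = inv\<^bsub>AutoGroup (FG n)\<^esub> a"
  have ac: "a \<in> carrier (AutoGroup (FG n))" using a by (simp add: AutoGroup_def)
  then have b: "b \<in> auto (FG n)" "b \<otimes>\<^bsub>AutoGroup (FG n)\<^esub> a = \<one>\<^bsub>AutoGroup (FG n)\<^esub>"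
    using A.inv_closed[OF ac] A.l_inv[OF ac] unfolding b_def by (simp_all only:) (simp add: AutoGroup_def)
  have ba: "b (a x) = x" if "x \<in> carrier (FG n)" for x
    using fun_cong[OF b(2), of x] that a b(1)
    by (simp add: AutoGroup_mult compose_def) (simp add: AutoGroup_def BijGroup_def)
  note hb = FG_hom_simps[OF auto_FG_D(1)[OF b(1)]]
  obtain y where y: "y \<in> carrier (FG n)" "a (gen n i) = cj n (gen n j) y"
    using a(2) i unfolding is_bp_perm_def by blast
  have c: "b (gen n j) \<in> carrier (FG n)" "b y \<in> carrier (FG n)"
    using hb(1)[of "gen n j"] hb(1)[of y] y j by auto
  have "gen n i = cj n (b (gen n j)) (b y)"
    using ba[of "gen n i"] hb(4)[of "gen n j" y] i j y by simp
  then have "cj n (gen n i) (inv\<^bsub>FG n\<^esub> (b y)) = b (gen n j)"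
    using cj_cancel[OF c] by simp
  then show "\<exists>y\<in>carrier (FG n). (inv\<^bsub>AutoGroup (FG n)\<^esub> a) (gen n j) = cj n (gen n (inv_into UNIV s j)) y"
    using c by (intro bexI[of _ "inv\<^bsub>FG n\<^esub> (b y)"]) (simp_all flip: i_def b_def)
qed

lemma BP_subgroup: "subgroup (carrier (BP n)) (AutoGroup (FG n))"
proof -
  interpret A: group "AutoGroup (FG n)" by (rule group.AutoGroup[OF FG_group])
  have c: "carrier (AutoGroup (FG n)) = auto (FG n)" by (simp add: AutoGroup_def)
  show ?thesis
  proof (rule A.subgroupI)
    show "carrier (BP n) \<noteq> {}" using is_bp_perm_one A.one_closed by (auto simp: BP_simps c)
  qed (use is_bp_perm_inv is_bp_perm_mult A.inv_closed A.m_closed in \<open>auto simp: BP_simps c\<close>, blast)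
qed

lemma BP_group: "group (BP n)"
  using group.subgroup_imp_group[OF group.AutoGroup[OF FG_group] BP_subgroup, of n]
  by (simp add: BP_def)

lemma BP_auto: "a \<in> carrier (BP n) \<Longrightarrow> a \<in> auto (FG n)" by (simp add: BP_simps)

lemma BP_apply:
  assumes "a \<in> carrier (BP n)" "b \<in> carrier (BP n)" "x \<in> carrier (FG n)"
  shows "(a \<otimes>\<^bsub>BP n\<^esub> b) x = a (b x)"
  using assms by (simp add: BP_simps AutoGroup_mult compose_def)

lemma BP_one_apply: "x \<in> carrier (FG n) \<Longrightarrow> \<one>\<^bsub>BP n\<^esub> x = x"
  by (simp add: BP_simps AutoGroup_def BijGroup_def)

lemma BP_eqI:
  assumes "a \<in> carrier (BP n)" "b \<in> carrier (BP n)" "\<And>i. i \<in> {1..n} \<Longrightarrow> a (gen n i) = b (gen n i)"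
  shows "a = b"
  using assms by (intro auto_eqI) (auto simp: BP_simps)

lemmas BP_hom_simps = FG_hom_simps[OF auto_FG_D(1)[OF BP_auto]]

text \<open>The conjugator can be put into the normal form in which it is unique.\<close>
lemma is_bp_perm_word:
  assumes "is_bp_perm n a s" "i \<in> {1..n}"
  obtains y where "y \<in> W n" "conj_reduced (s i) y" "a (gen n i) = cw n (cjw (s i) y)" "s i \<in> {1..n}"
proof -
  have si: "s i \<in> {1..n}" using assms permutes_in_image[of s "{1..n}" i] by (auto simp: is_bp_perm_def)
  obtain w where "w \<in> W n" "a (gen n i) = cj n (gen n (s i)) (cw n w)"
    using assms unfolding is_bp_perm_def FG_carrier by blast
  then show ?thesis
    using si cw_cjw_strip[of w n "s i"] cw_cjw[of w n "s i"]
    by (intro that[of "strip (s i) w"]) (simp_all add: conj_reduced_strip strip_gwords)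
qed

lemma is_bp_perm_unique:
  assumes "is_bp_perm n a s" "is_bp_perm n a t"
  shows "s = t"
proof
  fix i
  show "s i = t i"
  proof (cases "i \<in> {1..n}")
    case True
    from is_bp_perm_word[OF assms(1) True] is_bp_perm_word[OF assms(2) True] show ?thesis
      by (metis cjw_inj(1))
  next
    case False
    then show ?thesis using assms permutes_not_in by (metis is_bp_perm_def)
  qed
qed

lemma bp_perm_eqI: "is_bp_perm n a s \<Longrightarrow> bp_perm n a = s"
  unfolding bp_perm_def using is_bp_perm_unique by blast

lemma is_bp_perm_bp_perm: "a \<in> carrier (BP n) \<Longrightarrow> is_bp_perm n a (bp_perm n a)"
  by (auto simp: BP_simps dest: bp_perm_eqI)

lemma bp_perm_permutes: "a \<in> carrier (BP n) \<Longrightarrow> bp_perm n a permutes {1..n}"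
  using is_bp_perm_bp_perm by (auto simp: is_bp_perm_def)

lemma bp_perm_hom: "bp_perm n \<in> hom (BP n) (sym_group n)"
proof (rule homI)
  fix a b assume "a \<in> carrier (BP n)" "b \<in> carrier (BP n)"
  then show "bp_perm n (a \<otimes>\<^bsub>BP n\<^esub> b) = bp_perm n a \<otimes>\<^bsub>sym_group n\<^esub> bp_perm n b"
    using is_bp_perm_bp_perm by (intro bp_perm_eqI) (simp add: sym_group_mult BP_simps(2) is_bp_perm_mult BP_auto)
qed (simp add: sym_group_carrier bp_perm_permutes)

lemma BC_carrier: "carrier (BC n) = {a \<in> carrier (BP n). bp_perm n a = id}"
  by (simp add: BC_def kernel_def sym_group_one)

lemma BC_simps [simp]: "mult (BC n) = mult (BP n)" "one (BC n) = one (BP n)"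
  by (simp_all add: BC_def)

lemma BC_BP: "a \<in> carrier (BC n) \<Longrightarrow> a \<in> carrier (BP n)" by (simp add: BC_carrier)

lemma BC_subgroup: "subgroup (carrier (BC n)) (BP n)"
  using group_hom.subgroup_kernel[of "BP n" "sym_group n" "bp_perm n"] bp_perm_hom
  by (simp add: BC_def group_hom_def group_hom_axioms_def BP_group sym_group_is_group)

lemma BC_group: "group (BC n)"
  using group.subgroup_imp_group[OF BP_group BC_subgroup, of n] by (simp add: BC_def)

lemma BC_inv: "a \<in> carrier (BC n) \<Longrightarrow> inv\<^bsub>BC n\<^esub> a = inv\<^bsub>BP n\<^esub> a"
  using group.m_inv_consistent[OF BP_group BC_subgroup, of a n] by (simp add: BC_def)

lemma BP_mem_I: "a \<in> auto (FG n) \<Longrightarrow> is_bp_perm n a s \<Longrightarrow> a \<in> carrier (BP n)"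
  by (auto simp: BP_simps)

lemma BC_mem_I: "a \<in> auto (FG n) \<Longrightarrow> is_bp_perm n a id \<Longrightarrow> a \<in> carrier (BC n)"
  by (auto simp: BC_carrier BP_simps dest: bp_perm_eqI)

lemma bij_of_inverses:
  assumes "a \<in> hom (FG n) (FG n)" "b \<in> hom (FG n) (FG n)"
    "\<And>i. i \<in> {1..n} \<Longrightarrow> a (b (gen n i)) = gen n i" "\<And>i. i \<in> {1..n} \<Longrightarrow> b (a (gen n i)) = gen n i"
  shows "bij_betw a (carrier (FG n)) (carrier (FG n))"
proof -
  have id: "(\<lambda>x. x) \<in> hom (FG n) (FG n)" by (simp add: hom_def)
  have c: "(\<lambda>x. f (g x)) \<in> hom (FG n) (FG n)" if "f \<in> hom (FG n) (FG n)" "g \<in> hom (FG n) (FG n)" for f g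
    using that by (auto simp: hom_def Pi_iff)
  have "a (b x) = x" "b (a x) = x" if "x \<in> carrier (FG n)" for x
    using FG_hom_eqI[OF FG_group c[OF assms(1,2)] id assms(3) that]
      FG_hom_eqI[OF FG_group c[OF assms(2,1)] id assms(4) that] by simp_all
  then show ?thesis
    using assms by (intro bij_betw_byWitness[of _ b]) (auto simp: hom_def)
qed

section \<open>The generators of the McCool group and the permutations\<close>

definition signed :: "nat \<Rightarrow> bool \<Rightarrow> fg_elem \<Rightarrow> fg_elem" where
  "signed n e x = (if e then x else inv\<^bsub>FG n\<^esub> x)"

text \<open>The generator \<open>a\<^sub>i\<^sub>k\<close> and its inverse in one family, so that signs need not be treated separately.\<close>
definition move :: "nat \<Rightarrow> nat \<Rightarrow> nat \<Rightarrow> bool \<Rightarrow> fg_aut" where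
  "move n i k e = free_endo n (\<lambda>m. if m = i then cj n (gen n i) (signed n e (gen n k)) else gen n m)"

lemma aut_gen_eq_move: "aut_gen n i k = move n i k True"
  unfolding aut_gen_def move_def signed_def by (rule arg_cong[of _ _ "free_endo n"]) auto

lemma signed_carrier [simp]: "x \<in> carrier (FG n) \<Longrightarrow> signed n e x \<in> carrier (FG n)"
  by (simp add: signed_def FG_group group.inv_closed)

lemma signed_cancel: "x \<in> carrier (FG n) \<Longrightarrow> signed n e x \<otimes>\<^bsub>FG n\<^esub> signed n (\<not> e) x = \<one>\<^bsub>FG n\<^esub>"
  by (simp add: signed_def FG_group group.r_inv group.l_inv)

lemma signed_hom: "h \<in> hom (FG n) (FG m) \<Longrightarrow> x \<in> carrier (FG n) \<Longrightarrow> h (signed n e x) = signed m e (h x)"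
  using FG_hom_simps(3)[of h n m x] by (simp add: signed_def)

lemma move_apply:
  assumes "i \<in> {1..n}" "k \<in> {1..n}" "i \<noteq> k" "m \<in> {1..n}"
  shows "move n i k e (gen n m) = (if m = i then cj n (gen n i) (signed n e (gen n k)) else gen n m)"
  unfolding move_def using assms by (subst free_endo(3)) (auto intro: cj_closed)

lemma move_hom:
  assumes "i \<in> {1..n}" "k \<in> {1..n}" "i \<noteq> k"
  shows "move n i k e \<in> hom (FG n) (FG n)" "move n i k e \<in> extensional (carrier (FG n))"
  unfolding move_def using assms by (auto intro!: free_endo(1,2) cj_closed)

lemma move_cancel_gen:
  assumes "i \<in> {1..n}" "k \<in> {1..n}" "i \<noteq> k" "m \<in> {1..n}"
  shows "move n i k e (move n i k (\<not> e) (gen n m)) = gen n m"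
  using assms FG_hom_simps(4)[OF move_hom(1)[OF assms(1-3)], of "gen n i" "signed n (\<not> e) (gen n k)"]
  by (simp add: move_apply cj_cj signed_hom[OF move_hom(1)] signed_cancel cj_one)

lemma move_BC:
  assumes "i \<in> {1..n}" "k \<in> {1..n}" "i \<noteq> k"
  shows "move n i k e \<in> carrier (BC n)"
proof (rule BC_mem_I)
  show "move n i k e \<in> auto (FG n)"
    using bij_of_inverses[OF move_hom(1)[OF assms] move_hom(1)[OF assms], of e "\<not> e"]
      move_cancel_gen[OF assms] move_cancel_gen[OF assms, of _ "\<not> e"]
    by (intro auto_FG_I move_hom assms) auto
  show "is_bp_perm n (move n i k e) id"
    unfolding is_bp_perm_def
  proof (intro conjI ballI permutes_id)
    fix m assume m: "m \<in> {1..n}"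
    show "\<exists>y\<in>carrier (FG n). move n i k e (gen n m) = cj n (gen n (id m)) y"
    proof (cases "m = i")
      case True
      then show ?thesis using assms m by (auto simp: move_apply)
    next
      case False
      then show ?thesis using assms m FG_group
        by (intro bexI[of _ "\<one>\<^bsub>FG n\<^esub>"]) (auto simp: move_apply cj_one group.is_monoid monoid.one_closed)
    qed
  qed
qed

lemmas move_BP = BC_BP[OF move_BC]

lemma move_cancel:
  assumes "i \<in> {1..n}" "k \<in> {1..n}" "i \<noteq> k"
  shows "move n i k e \<otimes>\<^bsub>BP n\<^esub> move n i k (\<not> e) = \<one>\<^bsub>BP n\<^esub>"
proof (rule BP_eqI)
  interpret group "BP n" by (rule BP_group)
  show "move n i k e \<otimes>\<^bsub>BP n\<^esub> move n i k (\<not> e) \<in> carrier (BP n)" "\<one>\<^bsub>BP n\<^esub> \<in> carrier (BP n)"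
    using move_BP[OF assms] by auto
qed (use assms in \<open>simp add: BP_apply move_BP move_cancel_gen BP_one_apply\<close>)

lemma perm_aut_apply: "s permutes {1..n} \<Longrightarrow> i \<in> {1..n} \<Longrightarrow> perm_aut n s (gen n i) = gen n (s i)"
  unfolding perm_aut_def using permutes_in_image[of s "{1..n}"] by (subst free_endo(3)) auto

lemma perm_aut_hom: "s permutes {1..n} \<Longrightarrow> perm_aut n s \<in> hom (FG n) (FG n)"
  "s permutes {1..n} \<Longrightarrow> perm_aut n s \<in> extensional (carrier (FG n))"
  unfolding perm_aut_def using permutes_in_image[of s "{1..n}"] by (auto intro!: free_endo(1,2))

lemma is_bp_perm_perm_aut: "s permutes {1..n} \<Longrightarrow> is_bp_perm n (perm_aut n s) s"
  unfolding is_bp_perm_def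
proof (intro conjI ballI)
  fix m assume "s permutes {1..n}" and m: "m \<in> {1..n}"
  then show "\<exists>y\<in>carrier (FG n). perm_aut n s (gen n m) = cj n (gen n (s m)) y"
    using FG_group permutes_in_image[of s "{1..n}" m]
    by (intro bexI[of _ "\<one>\<^bsub>FG n\<^esub>"]) (auto simp: perm_aut_apply cj_one group.is_monoid monoid.one_closed)
qed

lemma perm_aut_BP:
  assumes s: "s permutes {1..n}" shows "perm_aut n s \<in> carrier (BP n)"
proof (rule BP_mem_I)
  note s' = permutes_inv[OF s]
  have "s i \<in> {1..n}" "inv_into UNIV s i \<in> {1..n}" if "i \<in> {1..n}" for i
    using that permutes_in_image[OF s] permutes_in_image[OF s'] by auto
  then show "perm_aut n s \<in> auto (FG n)"
    using s s' permutes_inverses[OF s]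
    by (intro auto_FG_I bij_of_inverses[of _ _ "perm_aut n (inv_into UNIV s)"] perm_aut_hom)
       (auto simp: perm_aut_apply)
qed (rule is_bp_perm_perm_aut[OF s])

lemma bp_perm_perm_aut: "s permutes {1..n} \<Longrightarrow> bp_perm n (perm_aut n s) = s"
  by (intro bp_perm_eqI is_bp_perm_perm_aut)

lemma perm_aut_mult:
  assumes "s permutes {1..n}" "t permutes {1..n}"
  shows "perm_aut n s \<otimes>\<^bsub>BP n\<^esub> perm_aut n t = perm_aut n (s \<circ> t)"
proof (rule BP_eqI)
  interpret group "BP n" by (rule BP_group)
  show "perm_aut n s \<otimes>\<^bsub>BP n\<^esub> perm_aut n t \<in> carrier (BP n)" "perm_aut n (s \<circ> t) \<in> carrier (BP n)"
    using assms by (auto intro!: perm_aut_BP permutes_compose)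
  fix i assume "i \<in> {1..n}"
  then show "(perm_aut n s \<otimes>\<^bsub>BP n\<^esub> perm_aut n t) (gen n i) = perm_aut n (s \<circ> t) (gen n i)"
    using assms permutes_in_image[OF assms(2), of i]
    by (simp add: BP_apply perm_aut_BP perm_aut_apply permutes_compose)
qed

lemma perm_aut_id: "perm_aut n id = \<one>\<^bsub>BP n\<^esub>"
proof (rule BP_eqI)
  show "\<one>\<^bsub>BP n\<^esub> \<in> carrier (BP n)" using BP_group by (simp add: group.is_monoid monoid.one_closed)
qed (auto intro!: perm_aut_BP permutes_id simp: perm_aut_apply permutes_id BP_one_apply)

section \<open>Reduction of automorphisms to the identity\<close>

text \<open>The word \<open>y\<^sub>i\<close>, in normal form, with \<open>a(x\<^sub>i) = y\<^sub>i\<^sup>-\<^sup>1 x\<^sub>i y\<^sub>i\<close>.\<close>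
definition conjugator :: "nat \<Rightarrow> fg_aut \<Rightarrow> nat \<Rightarrow> nat gword" where
  "conjugator n a i = (THE y. y \<in> W n \<and> conj_reduced i y \<and> a (gen n i) = cw n (cjw i y))"

lemma conjugator_eqI:
  assumes "y \<in> W n" "conj_reduced i y" "a (gen n i) = cw n (cjw i y)" "i \<in> {1..n}"
  shows "conjugator n a i = y"
  unfolding conjugator_def
proof (rule the_equality)
  fix z assume "z \<in> W n \<and> conj_reduced i z \<and> a (gen n i) = cw n (cjw i z)"
  then show "z = y" using assms cjw_inj(2)[of i z i y n] by simp
qed (use assms in blast)

lemma conjugator_props:
  assumes "a \<in> carrier (BC n)" "i \<in> {1..n}"
  shows "conjugator n a i \<in> W n" "conj_reduced i (conjugator n a i)" "a (gen n i) = cw n (cjw i (conjugator n a i))"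
proof -
  have "is_bp_perm n a id" using assms is_bp_perm_bp_perm[of a n] by (auto simp: BC_carrier)
  from is_bp_perm_word[OF this assms(2)] obtain y where
    "y \<in> W n" "conj_reduced i y" "a (gen n i) = cw n (cjw i y)" by auto
  then show "conjugator n a i \<in> W n" "conj_reduced i (conjugator n a i)" "a (gen n i) = cw n (cjw i (conjugator n a i))"
    using conjugator_eqI[of y n i a] assms by auto
qed

lemma conjugator_strip:
  assumes "w \<in> W n" "a (gen n i) = cw n (cjw i w)" "i \<in> {1..n}"
  shows "conjugator n a i = strip i w"
  using assms by (intro conjugator_eqI) (simp_all add: strip_gwords conj_reduced_strip cw_cjw_strip)

lemma cw_cancel: "u \<in> W n \<Longrightarrow> v \<in> W n \<Longrightarrow> t \<in> W n \<Longrightarrow> cw n (u @ v @ winv v @ t) = cw n (u @ t)"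
proof -
  interpret group "FG n" by (rule FG_group)
  assume *: "u \<in> W n" "v \<in> W n" "t \<in> W n"
  have "cw n (u @ v @ winv v @ t) = cw n u \<otimes>\<^bsub>FG n\<^esub> (cw n v \<otimes>\<^bsub>FG n\<^esub> inv\<^bsub>FG n\<^esub> (cw n v)) \<otimes>\<^bsub>FG n\<^esub> cw n t"
    using * by (simp add: FG_mult FG_inv del: r_inv)
  then show ?thesis using * by (simp add: FG_mult)
qed

lemma cw_append_cong: "u \<in> W n \<Longrightarrow> u' \<in> W n \<Longrightarrow> v \<in> W n \<Longrightarrow> v' \<in> W n \<Longrightarrow>
    cw n u = cw n u' \<Longrightarrow> cw n v = cw n v' \<Longrightarrow> cw n (u @ v) = cw n (u' @ v')"
  by (simp add: FG_mult[symmetric])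

lemma cw_cjw_cong: "w \<in> W n \<Longrightarrow> w' \<in> W n \<Longrightarrow> i \<in> {1..n} \<Longrightarrow> cw n w = cw n w' \<Longrightarrow>
    cw n (cjw i w) = cw n (cjw i w')"
  by (simp add: cw_cjw)

lemma signed_cw_cjw: "y \<in> W n \<Longrightarrow> k \<in> {1..n} \<Longrightarrow>
    signed n e (cw n (cjw k y)) = cw n (winv y @ [(k, e)] @ y)"
  by (auto simp: signed_def cjw_def FG_inv)

lemma cj_cw_cjw: "w \<in> W n \<Longrightarrow> y \<in> W n \<Longrightarrow> i \<in> {1..n} \<Longrightarrow> k \<in> {1..n} \<Longrightarrow>
   cj n (cw n (cjw i w)) (signed n e (cw n (cjw k y))) = cw n (cjw i (w @ winv y @ [(k, e)] @ y))"
  by (simp only: signed_cw_cjw) (simp add: cw_cjw cj_cj FG_mult)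

text \<open>Right multiplication by \<open>a\<^sub>i\<^sub>k\<^sup>e\<close> multiplies \<open>y\<^sub>i\<close> by \<open>y\<^sub>k\<^sup>-\<^sup>1 x\<^sub>k\<^sup>e y\<^sub>k\<close>. This shortens \<open>y\<^sub>i\<close> when \<open>y\<^sub>i\<close> ends in
\<open>x\<^sub>k\<^sup>-\<^sup>e y\<^sub>k\<close>. The condition on the words is easier to compare for two moves than the lengths are.\<close>
definition reduces :: "nat \<Rightarrow> fg_aut \<Rightarrow> nat \<Rightarrow> nat \<Rightarrow> bool \<Rightarrow> bool" where
  "reduces n a i k e \<longleftrightarrow> (\<exists>z. conjugator n a i = z @ [(k, \<not> e)] @ conjugator n a k)"

definition aut_length :: "nat \<Rightarrow> fg_aut \<Rightarrow> nat" where
  "aut_length n a = (\<Sum>i\<in>{1..n}. length (conjugator n a i))"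

definition admissible :: "nat \<Rightarrow> nat \<Rightarrow> nat \<Rightarrow> bool" where
  "admissible n i k \<longleftrightarrow> i \<in> {1..n} \<and> k \<in> {1..n} \<and> i \<noteq> k"

abbreviation mv :: "nat \<Rightarrow> fg_aut \<Rightarrow> nat \<Rightarrow> nat \<Rightarrow> bool \<Rightarrow> fg_aut" where
  "mv n a i k e \<equiv> a \<otimes>\<^bsub>BP n\<^esub> move n i k e"

lemma BC_mult: "a \<in> carrier (BC n) \<Longrightarrow> b \<in> carrier (BC n) \<Longrightarrow> a \<otimes>\<^bsub>BP n\<^esub> b \<in> carrier (BC n)"
  using BC_group[of n] by (metis BC_simps(1) group.is_monoid monoid.m_closed)

lemma mv_BC: "a \<in> carrier (BC n) \<Longrightarrow> admissible n i k \<Longrightarrow> mv n a i k e \<in> carrier (BC n)"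
  by (simp add: BC_mult move_BC admissible_def)

lemma mv_gen:
  assumes a: "a \<in> carrier (BP n)" and ik: "admissible n i k" and m: "m \<in> {1..n}"
  shows "mv n a i k e (gen n m) = (if m = i then cj n (a (gen n i)) (signed n e (a (gen n k))) else a (gen n m))"
proof -
  have ik': "i \<in> {1..n}" "k \<in> {1..n}" "i \<noteq> k" using ik by (auto simp: admissible_def)
  have h: "a \<in> hom (FG n) (FG n)" using a by (simp add: BP_auto auto_FG_D)
  show ?thesis
    using ik' m BP_hom_simps(4)[OF a, of "gen n i" "signed n e (gen n k)"] signed_hom[OF h, of "gen n k" e]
    by (simp add: BP_apply[OF a move_BP] move_apply)
qed

lemma mv_cancel:
  assumes "a \<in> carrier (BC n)" "admissible n i k"
  shows "mv n (mv n a i k e) i k (\<not> e) = a"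
proof -
  interpret group "BP n" by (rule BP_group)
  show ?thesis
    using assms by (simp add: m_assoc BC_BP move_BP move_cancel admissible_def)
qed

text \<open>A move changes the image of a single generator. Moves on different generators can therefore be studied
independently.\<close>
lemma conjugator_mv_other:
  assumes "a \<in> carrier (BC n)" "admissible n i k" "m \<in> {1..n}" "m \<noteq> i"
  shows "conjugator n (mv n a i k e) m = conjugator n a m"
  using assms conjugator_props[OF assms(1,3)] by (intro conjugator_eqI) (simp_all add: mv_gen BC_BP)

lemma conjugator_mv_same:
  assumes a: "a \<in> carrier (BC n)" and ik: "admissible n i k"
  shows "conjugator n (mv n a i k e) i = strip i (conjugator n a i @ winv (conjugator n a k) @ [(k, e)] @ conjugator n a k)"
proof (rule conjugator_strip)
  have ik': "i \<in> {1..n}" "k \<in> {1..n}" "i \<noteq> k" using ik by (auto simp: admissible_def)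
  note yi = conjugator_props[OF a ik'(1)] and yk = conjugator_props[OF a ik'(2)]
  show "conjugator n a i @ winv (conjugator n a k) @ [(k, e)] @ conjugator n a k \<in> W n" "i \<in> {1..n}"
    using yi(1) yk(1) ik' by auto
  show "mv n a i k e (gen n i) = cw n (cjw i (conjugator n a i @ winv (conjugator n a k) @ [(k, e)] @ conjugator n a k))"
    using cj_cw_cjw[OF yi(1) yk(1) ik'(1,2)] yi(3) yk(3) ik ik' a by (simp add: mv_gen BC_BP)
qed

lemma length_conjugator_le:
  assumes "a (gen n i) = cw n (cjw i w)" "cw n w = cw n w'" "w \<in> W n" "w' \<in> W n" "i \<in> {1..n}"
  shows "length (conjugator n a i) \<le> length w'"
  using conjugator_strip[of w' n a i] assms strip_length[of i w'] cw_cjw_cong[of w n w' i] by simp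

text \<open>If \<open>y\<^sub>i = z x\<^sub>k\<^sup>-\<^sup>e y\<^sub>k\<close> then the new conjugator is represented by \<open>z y\<^sub>k\<close>.\<close>
lemma reduces_length:
  assumes a: "a \<in> carrier (BC n)" and ik: "admissible n i k" and r: "reduces n a i k e"
  shows "length (conjugator n (mv n a i k e) i) < length (conjugator n a i)" "aut_length n (mv n a i k e) < aut_length n a"
proof -
  have ik': "i \<in> {1..n}" "k \<in> {1..n}" "i \<noteq> k" using ik by (auto simp: admissible_def)
  note yi = conjugator_props[OF a ik'(1)] and yk = conjugator_props[OF a ik'(2)]
  obtain z where z: "conjugator n a i = z @ [(k, \<not> e)] @ conjugator n a k" using r by (auto simp: reduces_def)
  have zW: "z \<in> W n" using yi(1) z by simp
  have "mv n a i k e (gen n i) = cw n (cjw i (conjugator n a i @ winv (conjugator n a k) @ [(k, e)] @ conjugator n a k))"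
    using cj_cw_cjw[OF yi(1) yk(1) ik'(1,2)] yi(3) yk(3) ik ik' a by (simp add: mv_gen BC_BP)
  moreover have "cw n (conjugator n a i @ winv (conjugator n a k) @ [(k, e)] @ conjugator n a k) = cw n (z @ conjugator n a k)"
    using cw_cancel[OF zW, of "(k, \<not> e) # conjugator n a k" "conjugator n a k"] ik' yk(1) z by simp
  ultimately have "length (conjugator n (mv n a i k e) i) \<le> length (z @ conjugator n a k)"
    using length_conjugator_le[of "mv n a i k e" n i "conjugator n a i @ winv (conjugator n a k) @ [(k, e)] @ conjugator n a k" "z @ conjugator n a k"]
      yi(1) yk(1) ik' zW by simp
  then show *: "length (conjugator n (mv n a i k e) i) < length (conjugator n a i)" by (simp add: z)
  show "aut_length n (mv n a i k e) < aut_length n a"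
    unfolding aut_length_def using ik' *
    by (intro sum_strict_mono_ex1) (auto, metis conjugator_mv_other[OF a ik] atLeastAtMost_iff less_imp_le order_refl)
qed

lemma cw_fred: "w \<in> W n \<Longrightarrow> cw n (fred w) = cw n w" by (rule wcl_fred)

lemma fred_winv: "w \<in> W n \<Longrightarrow> fred (winv w) = winv (fred w)"
  by (intro wcl_inj[of _ "{1..n}"]) (simp_all add: fred_gwords cw_fred FG_inv[symmetric] wcl_fred)

text \<open>The only way in which \<open>x\<^sub>k\<close> can disappear when \<open>y\<^sub>i\<close> is multiplied by the conjugate
  \<open>y\<^sub>k\<^sup>-\<^sup>1 x\<^sub>k y\<^sub>k\<close> is that \<open>y\<^sub>i\<close> ends in \<open>x\<^sub>k\<^sup>-\<^sup>1 y\<^sub>k\<close>.\<close>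
lemma last_imp_reduces:
  assumes a: "a \<in> carrier (BC n)" and ik: "i \<in> {1..n}" "k \<in> {1..n}"
    and r: "fred (conjugator n a i @ winv (conjugator n a k)) = z @ [(k, \<not> e)]"
  shows "reduces n a i k e"
proof -
  note yi = conjugator_props[OF a ik(1)] and yk = conjugator_props[OF a ik(2)]
  let ?w = "conjugator n a i @ winv (conjugator n a k)"
  have w: "?w \<in> W n" using yi yk by simp
  have zk: "z @ [(k, \<not> e)] \<in> W n" "reduced (z @ [(k, \<not> e)])"
    using fred_gwords[OF w] reduced_fred[of ?w] r by simp_all
  then have red: "reduced (z @ [(k, \<not> e)] @ conjugator n a k)"
    using yk(2) by (auto simp: conj_reduced_def reduced_append reduced_Cons)
  have "cw n (z @ [(k, \<not> e)] @ conjugator n a k) = cw n (?w @ conjugator n a k)"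
    using cw_append_cong[OF _ _ _ _ cw_fred[OF w, unfolded r], of "conjugator n a k" "conjugator n a k"] zk w yk by simp
  also have "\<dots> = cw n (conjugator n a i)"
    using cw_cancel[of "conjugator n a i" n "winv (conjugator n a k)" "[]"] yi yk by simp
  finally have "conjugator n a i = z @ [(k, \<not> e)] @ conjugator n a k"
    using yi yk zk red by (intro wcl_inj[of _ "{1..n}"]) (auto simp: conj_reduced_def)
  then show ?thesis by (auto simp: reduces_def)
qed

text \<open>No move leaves the length unchanged: if a move does not shorten, its inverse does so
  afterwards.\<close>
lemma reduces_or_reduces_back:
  assumes a: "a \<in> carrier (BC n)" and ik: "admissible n i k"
  shows "reduces n a i k e \<or> reduces n (mv n a i k e) i k (\<not> e)"
proof (rule disjCI)
  have ik': "i \<in> {1..n}" "k \<in> {1..n}" "i \<noteq> k" using ik by (auto simp: admissible_def)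
  note yi = conjugator_props[OF a ik'(1)] and yk = conjugator_props[OF a ik'(2)]
  assume "\<not> reduces n (mv n a i k e) i k (\<not> e)"
  show "reduces n a i k e"
  proof (rule ccontr)
    assume nr: "\<not> reduces n a i k e"
    let ?w = "conjugator n a i @ winv (conjugator n a k)" and ?t = "[(k, e)] @ conjugator n a k"
    have w: "?w \<in> W n" "?t \<in> W n" using yi yk ik' by simp_all
    have "fred ?w = [] \<or> last (fred ?w) \<noteq> (k, \<not> e)"
      using last_imp_reduces[OF a ik'(1,2), of "butlast (fred ?w)" e] nr append_butlast_last_id by metis
    then have red: "reduced (fred ?w @ ?t)"
      using yk(2) by (auto simp: conj_reduced_def reduced_append reduced_Cons prod_eq_iff)
    have "cw n (fred ?w @ ?t) = cw n (?w @ ?t)"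
      using w by (intro cw_append_cong cw_fred fred_gwords) auto
    then have "fred (?w @ ?t) = fred ?w @ ?t"
      using w red fred_gwords[OF w(1)] wcl_eq_fred[of "fred ?w @ ?t" "{1..n}" "?w @ ?t"] by (simp add: fred_reduced)
    then have "conjugator n (mv n a i k e) i = dropWhile (\<lambda>l. fst l = i) (fred ?w) @ [(k, e)] @ conjugator n a k"
      using conjugator_mv_same[OF a ik, of e] ik' by (simp add: strip_def dropWhile_append3)
    then have "reduces n (mv n a i k e) i k (\<not> e)"
      using conjugator_mv_other[OF a ik, of k e] ik' by (auto simp: reduces_def)
    then show False using \<open>\<not> reduces n (mv n a i k e) i k (\<not> e)\<close> by blast
  qed
qed

text \<open>Nielsen's argument: if nothing reduces, the middle letters of the images of the generators
  survive in every product, so a generator can only be the image of itself.\<close>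
lemma middle_letters_survive:
  assumes a: "a \<in> carrier (BC n)"
    and nr: "\<And>i k e. admissible n i k \<Longrightarrow> \<not> reduces n a i k e"
    and m: "m \<in> W n" "reduced m" "m \<noteq> []"
  shows "\<exists>p. a (cw n m) = cw n (p @ [last m] @ conjugator n a (fst (last m))) \<and> p \<in> W n \<and>
    reduced (p @ [last m] @ conjugator n a (fst (last m))) \<and> length m \<le> Suc (length p)"
  using m
proof (induction m rule: rev_induct)
  case (snoc l' m)
  obtain k d where l': "l' = (k, d)" by fastforce
  have k: "k \<in> {1..n}" and mW: "m \<in> W n" and mred: "reduced m"
    using snoc.prems l' by (auto simp: reduced_append)
  note yk = conjugator_props[OF a k]
  have yk': "reduced ([l'] @ conjugator n a k)" using yk(2) by (auto simp: conj_reduced_def reduced_Cons l')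
  have "cw n [l'] = signed n d (gen n k)" using k by (auto simp: l' signed_def gen_eq FG_inv)
  moreover have "a \<in> hom (FG n) (FG n)" using a by (simp add: BC_BP BP_auto auto_FG_D)
  ultimately have al: "a (cw n [l']) = cw n (winv (conjugator n a k) @ [l'] @ conjugator n a k)"
    using signed_hom[of a n n "gen n k" d] signed_cw_cjw[OF yk(1) k, of d] yk(3) k by (simp add: l')
  show ?case
  proof (cases "m = []")
    case True
    show ?thesis
    proof (intro exI[of _ "winv (conjugator n a k)"] conjI)
      have "reduced (winv (conjugator n a k) @ [l'] @ conjugator n a k)"
        using yk(2) yk' reduced_cjw[OF yk(2)] reduced_winv[of "conjugator n a k"]
        by (cases "conjugator n a k") (auto simp: l' cjw_def reduced_append conj_reduced_def)
      then show "reduced (winv (conjugator n a k) @ [last (m @ [l'])] @ conjugator n a (fst (last (m @ [l']))))"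
        by (simp add: l')
    qed (use True al yk in \<open>auto simp: l'\<close>)
  next
    case False
    obtain i c where l: "last m = (i, c)" by fastforce
    have i: "i \<in> {1..n}" using mW False l last_in_set[OF False] by (auto simp: gwords_def)
    note yi = conjugator_props[OF a i]
    from snoc.IH[OF mW mred False] l obtain p where p: "a (cw n m) = cw n (p @ [(i, c)] @ conjugator n a i)"
      "p \<in> W n" "reduced (p @ [(i, c)] @ conjugator n a i)" "length m \<le> Suc (length p)" by auto
    let ?w = "conjugator n a i @ winv (conjugator n a k)"
    have w: "?w \<in> W n" using yi yk by simp
    have ne: "l' \<noteq> flip (i, c)" using snoc.prems(2) False l by (auto simp: reduced_append)
    have ends: "last (fred ?w) \<noteq> (k, \<not> d) \<and> hd (fred ?w) \<noteq> (i, \<not> c)" if nonempty: "fred ?w \<noteq> []"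
    proof (cases "i = k")
      case True
      have "fred ?w = fred []"
        using True wcl_eq_fred[of ?w "{1..n}" "[]"] w cw_cancel[of "[]" n "conjugator n a i" "[]"] yi by simp
      then show ?thesis using nonempty by (simp add: fred_reduced)
    next
      case ik: False
      have 1: "last (fred ?w) \<noteq> (k, \<not> d)"
      proof
        assume "last (fred ?w) = (k, \<not> d)"
        then have "fred ?w = butlast (fred ?w) @ [(k, \<not> d)]"
          using append_butlast_last_id[OF nonempty] by metis
        then have "reduces n a i k d" by (rule last_imp_reduces[OF a i k])
        then show False using nr[of i k d] i k ik by (simp add: admissible_def)
      qed
      have eq: "fred (conjugator n a k @ winv (conjugator n a i)) = winv (fred ?w)" using fred_winv[OF w] by simp
      have "hd (fred ?w) \<noteq> (i, \<not> c)"
      proof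
        assume "hd (fred ?w) = (i, \<not> c)"
        then obtain t where "fred ?w = (i, \<not> c) # t" using nonempty by (cases "fred ?w") auto
        then have "fred (conjugator n a k @ winv (conjugator n a i)) = winv t @ [(i, \<not> (\<not> c))]" unfolding eq by simp
        then have "reduces n a k i (\<not> c)" by (rule last_imp_reduces[OF a k i])
        then show False using nr[of k i] i k ik by (auto simp: admissible_def)
      qed
      then show ?thesis using 1 by simp
    qed
    have pi: "reduced (p @ [(i, c)])" using p(3) by (auto simp: reduced_append)
    have "reduced (fred ?w @ [l'] @ conjugator n a k)"
      using ends yk' by (subst reduced_append) (auto simp: l' prod_eq_iff)
    then have red: "reduced ((p @ [(i, c)]) @ fred ?w @ [l'] @ conjugator n a k)"
      using ends pi ne by (subst reduced_append) (auto simp: l' prod_eq_iff hd_append)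
    have "a (cw n (m @ [l'])) = cw n (p @ [(i, c)] @ conjugator n a i) \<otimes>\<^bsub>FG n\<^esub> cw n (winv (conjugator n a k) @ [l'] @ conjugator n a k)"
      using BP_hom_simps(2)[OF BC_BP[OF a], of "cw n m" "cw n [l']"] mW k al p(1) l' by (simp add: FG_mult)
    also have "\<dots> = cw n ((p @ [(i, c)]) @ ?w @ [l'] @ conjugator n a k)"
      using p(2) yi yk i k l' by (simp add: FG_mult)
    also have "\<dots> = cw n ((p @ [(i, c)]) @ fred ?w @ [l'] @ conjugator n a k)"
      using p(2) w yk i k l' by (intro cw_append_cong cw_fred[symmetric] fred_gwords) (auto simp: fred_gwords)
    finally have "a (cw n (m @ [l'])) = cw n ((p @ [(i, c)]) @ fred ?w @ [l'] @ conjugator n a k)" .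
    then show ?thesis
      using red p(2,4) i fred_gwords[OF w] by (intro exI[of _ "p @ [(i, c)] @ fred ?w"]) (auto simp: l')
  qed
qed simp

text \<open>Some word \<open>m\<close> is mapped to \<open>x\<^sub>j\<close>. As the middle letter belonging to the last letter of \<open>m\<close> survives
together with everything after it, the image can have length one only if the conjugator is empty.\<close>
lemma irreducible_eq_one:
  assumes a: "a \<in> carrier (BC n)"
    and nr: "\<And>i k e. admissible n i k \<Longrightarrow> \<not> reduces n a i k e"
  shows "a = \<one>\<^bsub>BP n\<^esub>"
proof (rule BP_eqI)
  show "a \<in> carrier (BP n)" using a by (rule BC_BP)
  show "\<one>\<^bsub>BP n\<^esub> \<in> carrier (BP n)" using BP_group by (simp add: group.is_monoid monoid.one_closed)
  fix j assume j: "j \<in> {1..n}"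
  have "gen n j \<in> a ` carrier (FG n)"
    using auto_FG_D(3)[OF BP_auto[OF BC_BP[OF a]]] j by (simp add: bij_betw_def)
  then obtain x where "x \<in> carrier (FG n)" "a x = gen n j" by auto
  moreover from this(1) obtain m where m: "m \<in> W n" "reduced m" "x = cw n m"
    unfolding FG_def by (rule free_carrier_reduced)
  ultimately have m: "m \<in> W n" "reduced m" "a (cw n m) = cw n [(j, True)]"
    by (simp_all add: gen_eq)
  have "m \<noteq> []"
  proof
    assume "m = []"
    then have "a (cw n m) = cw n []"
      using hom_one[OF auto_FG_D(1)[OF BP_auto[OF BC_BP[OF a]]] FG_group FG_group] by (simp add: FG_one)
    then have "[(j, True)] = []" using m(3) j by (intro wcl_inj[of _ "{1..n}"]) auto
    then show False by simp
  qed
  from middle_letters_survive[OF a nr m(1,2) this] obtain p where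
    p: "cw n [(j, True)] = cw n (p @ [last m] @ conjugator n a (fst (last m)))" "p \<in> W n"
      "reduced (p @ [last m] @ conjugator n a (fst (last m)))" using m(3) by auto
  have l: "fst (last m) \<in> {1..n}" using m(1) last_in_set[OF \<open>m \<noteq> []\<close>] by (auto simp: gwords_def)
  have "[(j, True)] = p @ [last m] @ conjugator n a (fst (last m))"
    using p j l conjugator_props(1)[OF a l] by (intro wcl_inj[of _ "{1..n}"]) auto
  then have "conjugator n a j = []" by (cases p) (auto, metis fst_conv)
  then show "a (gen n j) = \<one>\<^bsub>BP n\<^esub> (gen n j)"
    using conjugator_props(3)[OF a j] j by (simp add: cjw_def gen_eq BP_one_apply)
qed

text \<open>The group is generated by the moves, because every automorphism is connected with the identity by a
sequence of shortening moves.\<close>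
lemma BC_induct [consumes 1, case_names one mv]:
  assumes "a \<in> carrier (BC n)"
    and one: "P \<one>\<^bsub>BP n\<^esub>"
    and mv: "\<And>a i k e. a \<in> carrier (BC n) \<Longrightarrow> admissible n i k \<Longrightarrow> P a \<Longrightarrow> P (mv n a i k e)"
  shows "P a"
  using assms(1)
proof (induction "aut_length n a" arbitrary: a rule: less_induct)
  case less
  show ?case
  proof (cases "\<exists>i k e. admissible n i k \<and> reduces n a i k e")
    case True
    then obtain i k e where *: "admissible n i k" "reduces n a i k e" by blast
    then have "P (mv n a i k e)" using less reduces_length(2) mv_BC by blast
    then have "P (mv n (mv n a i k e) i k (\<not> e))" using mv mv_BC less.prems * by blast
    then show ?thesis using mv_cancel[OF less.prems *(1)] by simp
  next
    case False
    then show ?thesis using irreducible_eq_one[OF less.prems] one by auto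
  qed
qed

section \<open>The presentation of the McCool group\<close>

definition mccool_relations :: "nat \<Rightarrow> ('g, 'm) monoid_scheme \<Rightarrow> (nat \<Rightarrow> nat \<Rightarrow> 'g) \<Rightarrow> bool" where
  "mccool_relations n G g \<longleftrightarrow> group G \<and>
     (\<forall>i k. admissible n i k \<longrightarrow> g i k \<in> carrier G) \<and>
     (\<forall>i j k. {i, j, k} \<subseteq> {1..n} \<longrightarrow> distinct [i, j, k] \<longrightarrow>
        g i k \<otimes>\<^bsub>G\<^esub> g j k = g j k \<otimes>\<^bsub>G\<^esub> g i k \<and>
        g i j \<otimes>\<^bsub>G\<^esub> (g i k \<otimes>\<^bsub>G\<^esub> g j k) = (g i k \<otimes>\<^bsub>G\<^esub> g j k) \<otimes>\<^bsub>G\<^esub> g i j) \<and>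
     (\<forall>i j k l. {i, j, k, l} \<subseteq> {1..n} \<longrightarrow> distinct [i, j, k, l] \<longrightarrow>
        g i j \<otimes>\<^bsub>G\<^esub> g k l = g k l \<otimes>\<^bsub>G\<^esub> g i j)"

context group
begin

definition sg :: "bool \<Rightarrow> 'a \<Rightarrow> 'a" where "sg e x = (if e then x else inv x)"

lemma sg_closed [simp]: "x \<in> carrier G \<Longrightarrow> sg e x \<in> carrier G"
  by (simp add: sg_def)

lemma sg_cancel: "x \<in> carrier G \<Longrightarrow> sg e x \<otimes> sg (\<not> e) x = \<one>"
  by (simp add: sg_def)

lemma commute_inv:
  assumes "x \<in> carrier G" "y \<in> carrier G" "x \<otimes> y = y \<otimes> x"
  shows "inv x \<otimes> y = y \<otimes> inv x"
proof -
  have "inv x \<otimes> y = inv x \<otimes> (y \<otimes> x) \<otimes> inv x" using assms(1,2) by (simp add: m_assoc)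
  also have "\<dots> = inv x \<otimes> (x \<otimes> y) \<otimes> inv x" using assms by simp
  also have "\<dots> = y \<otimes> inv x" using assms(1,2) by (simp add: m_assoc[symmetric])
  finally show ?thesis .
qed

lemma commute_sg:
  assumes "x \<in> carrier G" "y \<in> carrier G" "x \<otimes> y = y \<otimes> x"
  shows "sg e x \<otimes> sg d y = sg d y \<otimes> sg e x"
proof -
  have 1: "sg e x \<otimes> y = y \<otimes> sg e x" using assms commute_inv by (simp add: sg_def)
  then show ?thesis using commute_inv[of y "sg e x"] assms by (simp add: sg_def[of d])
qed

lemma sg_mult_commuting:
  assumes "x \<in> carrier G" "y \<in> carrier G" "x \<otimes> y = y \<otimes> x"
  shows "sg e (x \<otimes> y) = sg e x \<otimes> sg e y"
  using assms commute_sg[of x y False False] by (simp add: sg_def inv_mult_group)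

end

lemma move_eq_sg:
  assumes "admissible n i k"
  shows "move n i k e = group.sg (BP n) e (aut_gen n i k)"
proof -
  interpret group "BP n" by (rule BP_group)
  have "inv\<^bsub>BP n\<^esub> (move n i k True) = move n i k False"
    using assms move_cancel[of i n k False] by (intro inv_equality) (auto simp: admissible_def move_BP)
  then show ?thesis by (simp add: sg_def aut_gen_eq_move)
qed

lemma mccool_relations_BP: "mccool_relations n (BP n) (aut_gen n)"
  unfolding mccool_relations_def
proof (intro conjI allI impI)
  interpret group "BP n" by (rule BP_group)
  interpret F: group "FG n" by (rule FG_group)
  show "group (BP n)" by (rule BP_group)
  have c [simp]: "aut_gen n i k \<in> carrier (BP n)" if "admissible n i k" for i k
    using that by (simp add: aut_gen_eq_move move_BP admissible_def)
  then show "aut_gen n i k \<in> carrier (BP n)" if "admissible n i k" for i k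
    using that by simp
  have ap: "aut_gen n i k (gen n m) = (if m = i then cj n (gen n i) (gen n k) else gen n m)"
    if "admissible n i k" "m \<in> {1..n}" for i k m
    using that move_apply[of i n k m True] by (simp add: aut_gen_eq_move admissible_def signed_def)
  have hc: "aut_gen n i k (cj n x y) = cj n (aut_gen n i k x) (aut_gen n i k y)"
    if "admissible n i k" "x \<in> carrier (FG n)" "y \<in> carrier (FG n)" for i k x y
    using that BP_hom_simps(4)[OF c] by blast
  note rules = BP_apply ap hc cj_closed admissible_def
  fix i j k
  {
    assume *: "{i, j, k} \<subseteq> {1..n}" "distinct [i, j, k]"
    have adm: "admissible n i k" "admissible n j k" "admissible n i j" "i \<noteq> j" "i \<noteq> k" "j \<noteq> k"
      "i \<in> {1..n}" "j \<in> {1..n}" "k \<in> {1..n}"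
      using * by (auto simp: admissible_def)
    show "aut_gen n i k \<otimes>\<^bsub>BP n\<^esub> aut_gen n j k = aut_gen n j k \<otimes>\<^bsub>BP n\<^esub> aut_gen n i k"
    proof (rule BP_eqI)
      fix m assume "m \<in> {1..n}"
      then show "(aut_gen n i k \<otimes>\<^bsub>BP n\<^esub> aut_gen n j k) (gen n m) = (aut_gen n j k \<otimes>\<^bsub>BP n\<^esub> aut_gen n i k) (gen n m)"
        using adm by (simp add: BP_apply ap hc)
    qed (use adm in simp_all)
    show "aut_gen n i j \<otimes>\<^bsub>BP n\<^esub> (aut_gen n i k \<otimes>\<^bsub>BP n\<^esub> aut_gen n j k) =
        aut_gen n i k \<otimes>\<^bsub>BP n\<^esub> aut_gen n j k \<otimes>\<^bsub>BP n\<^esub> aut_gen n i j"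
    proof (rule BP_eqI)
      have xk: "cj n (gen n i) (gen n j \<otimes>\<^bsub>FG n\<^esub> gen n k) = cj n (cj n (gen n i) (gen n k)) (cj n (gen n j) (gen n k))"
      proof -
        have "gen n k \<otimes>\<^bsub>FG n\<^esub> cj n (gen n j) (gen n k) = gen n j \<otimes>\<^bsub>FG n\<^esub> gen n k"
          using adm by (simp add: F.m_assoc[symmetric])
        then show ?thesis
          using cj_cj[of "gen n i" n "gen n k" "cj n (gen n j) (gen n k)"] adm cj_closed by simp
      qed
      fix m assume "m \<in> {1..n}"
      then show "(aut_gen n i j \<otimes>\<^bsub>BP n\<^esub> (aut_gen n i k \<otimes>\<^bsub>BP n\<^esub> aut_gen n j k)) (gen n m) =
          (aut_gen n i k \<otimes>\<^bsub>BP n\<^esub> aut_gen n j k \<otimes>\<^bsub>BP n\<^esub> aut_gen n i j) (gen n m)"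
        using adm xk by (simp add: BP_apply ap hc cj_closed) (simp add: cj_cj)
    qed (use adm in simp_all)
  }
  fix l assume *: "{i, j, k, l} \<subseteq> {1..n}" "distinct [i, j, k, l]"
  have adm: "admissible n i j" "admissible n k l" "i \<noteq> k" "i \<noteq> l" "j \<noteq> k" "j \<noteq> l"
      "i \<in> {1..n}" "j \<in> {1..n}" "k \<in> {1..n}" "l \<in> {1..n}"
    using * by (auto simp: admissible_def)
  show "aut_gen n i j \<otimes>\<^bsub>BP n\<^esub> aut_gen n k l = aut_gen n k l \<otimes>\<^bsub>BP n\<^esub> aut_gen n i j"
  proof (rule BP_eqI)
    fix m assume "m \<in> {1..n}"
    then show "(aut_gen n i j \<otimes>\<^bsub>BP n\<^esub> aut_gen n k l) (gen n m) = (aut_gen n k l \<otimes>\<^bsub>BP n\<^esub> aut_gen n i j) (gen n m)"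
      using adm by (simp add: BP_apply ap hc)
  qed (use adm in simp_all)
qed

context
  fixes n :: nat and G :: "('g, 'm) monoid_scheme" (structure) and g :: "nat \<Rightarrow> nat \<Rightarrow> 'g"
  assumes rel: "mccool_relations n G g"
begin

interpretation group G using rel by (simp add: mccool_relations_def)

abbreviation gs :: "nat \<Rightarrow> nat \<Rightarrow> bool \<Rightarrow> 'g" where "gs i k e \<equiv> sg e (g i k)"

lemma g_closed: "admissible n i k \<Longrightarrow> g i k \<in> carrier G"
  using rel by (simp add: mccool_relations_def)

lemma gs_closed: "admissible n i k \<Longrightarrow> gs i k e \<in> carrier G"
  by (simp add: g_closed)

text \<open>The indices allow that \<open>k = l\<close>, so that two of McCool's relations are covered.\<close>
lemma gs_commute:
  assumes "admissible n i k" "admissible n j l" "i \<noteq> j" "l \<noteq> i" "k \<noteq> j"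
  shows "gs i k e \<otimes> gs j l d = gs j l d \<otimes> gs i k e"
proof (rule commute_sg)
  show "g i k \<otimes> g j l = g j l \<otimes> g i k"
    using rel assms by (cases "k = l") (simp_all add: mccool_relations_def admissible_def)
qed (use assms g_closed in auto)

lemma gs_triangle:
  assumes "admissible n p q" "admissible n p k" "admissible n q k"
  shows "gs p q d \<otimes> (gs p k e \<otimes> gs q k e) = (gs p k e \<otimes> gs q k e) \<otimes> gs p q d"
proof -
  have 1: "g p k \<otimes> g q k = g q k \<otimes> g p k"
    and 2: "g p q \<otimes> (g p k \<otimes> g q k) = (g p k \<otimes> g q k) \<otimes> g p q"
    using rel assms unfolding mccool_relations_def admissible_def by (auto simp: distinct_length_2_or_more)
  have "gs p q d \<otimes> sg e (g p k \<otimes> g q k) = sg e (g p k \<otimes> g q k) \<otimes> gs p q d"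
    using assms g_closed by (intro commute_sg 2) auto
  then show ?thesis
    using sg_mult_commuting[OF g_closed g_closed 1, OF assms(2,3)] by simp
qed

end

text \<open>Of two suffixes of the same word the shorter one is a suffix of the longer one; with the letter in front
of it as soon as there is room.\<close>
lemma suffix_extend:
  assumes "(z @ [m]) @ u = w @ v" "length u < length v"
  shows "\<exists>t. v = t @ [m] @ u"
proof -
  from assms(1) obtain us where "z @ [m] = w @ us \<and> us @ u = v \<or> (z @ [m]) @ us = w \<and> u = us @ v"
    unfolding append_eq_append_conv2 by blast
  then have us: "z @ [m] = w @ us" "us @ u = v" using assms(2) by auto
  then have ne: "us \<noteq> []" using assms(2) by auto
  have "last us = m" using arg_cong[OF us(1), of last] ne by simp
  then have "us = butlast us @ [m]" using append_butlast_last_id[OF ne] by simp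
  then show ?thesis using us(2) by (intro exI[of _ "butlast us"]) (metis append_assoc)
qed

text \<open>\<open>descends n G g a x\<close>: some sequence of shortening moves leads from \<open>a\<close> to the identity, and the
  corresponding product of the elements \<open>g\<close> is \<open>x\<close>.\<close>
inductive descends :: "nat \<Rightarrow> ('g, 'm) monoid_scheme \<Rightarrow> (nat \<Rightarrow> nat \<Rightarrow> 'g) \<Rightarrow> fg_aut \<Rightarrow> 'g \<Rightarrow> bool"
  for n G g where
  one: "descends n G g \<one>\<^bsub>BP n\<^esub> \<one>\<^bsub>G\<^esub>"
| step: "a \<in> carrier (BC n) \<Longrightarrow> admissible n i k \<Longrightarrow> reduces n a i k e \<Longrightarrow>
    descends n G g (mv n a i k e) x \<Longrightarrow> descends n G g a (x \<otimes>\<^bsub>G\<^esub> group.sg G (\<not> e) (g i k))"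

lemma conjugator_one: "i \<in> {1..n} \<Longrightarrow> conjugator n \<one>\<^bsub>BP n\<^esub> i = []"
  by (intro conjugator_eqI) (auto simp: conj_reduced_def cjw_def BP_one_apply gen_eq)

lemma not_reduces_one: "admissible n i k \<Longrightarrow> \<not> reduces n \<one>\<^bsub>BP n\<^esub> i k e"
  by (simp add: reduces_def conjugator_one admissible_def)

text \<open>The critical configuration: \<open>X\<^sub>p\<close> is shortened by \<open>X\<^sub>q\<close>, which is itself shortened by \<open>X\<^sub>k\<close>.
  Then \<open>X\<^sub>p\<close> is also shortened by \<open>X\<^sub>k\<close>, and the relation between \<open>a\<^sub>p\<^sub>q\<close> and \<open>a\<^sub>p\<^sub>k a\<^sub>q\<^sub>k\<close> closes the
  diagram, at an automorphism that is shorter as well.\<close>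
locale triangle =
  fixes n :: nat and a :: fg_aut and p q k :: nat and d e :: bool and z' z'' :: "nat gword"
  assumes a: "a \<in> carrier (BC n)"
    and pq: "admissible n p q" and qk: "admissible n q k" and pk: "p \<noteq> k"
    and Yp: "conjugator n a p = z' @ [(q, \<not> d)] @ conjugator n a q"
    and Yq: "conjugator n a q = z'' @ [(k, \<not> e)] @ conjugator n a k"
begin

lemma adm: "admissible n p k" "p \<in> {1..n}" "q \<in> {1..n}" "k \<in> {1..n}" "p \<noteq> q" "q \<noteq> k" "p \<noteq> k"
  using pq qk pk by (auto simp: admissible_def)

lemmas Ya = conjugator_props[OF a]

lemma words: "z' \<in> W n" "z'' \<in> W n"
  using Ya(1)[of p] Ya(1)[of q] Yp Yq adm by auto

lemma red: "reduces n a p q d" "reduces n a q k e" "reduces n a p k e"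
  using Yp Yq by (auto simp: reduces_def)

definition "apq = mv n a p q d"
definition "apk = mv n a p k e"
definition "aqk = mv n a q k e"
definition "end_pt = mv n apk q k e \<otimes>\<^bsub>BP n\<^esub> move n p q d"

lemma BCs: "apq \<in> carrier (BC n)" "apk \<in> carrier (BC n)" "aqk \<in> carrier (BC n)"
  "mv n apk q k e \<in> carrier (BC n)" "mv n apq q k e \<in> carrier (BC n)" "end_pt \<in> carrier (BC n)"
  by (simp_all add: apq_def apk_def aqk_def end_pt_def mv_BC a pq qk adm)

lemma shorter: "aut_length n apq < aut_length n a" "aut_length n apk < aut_length n a"
  "aut_length n aqk < aut_length n a"
  using reduces_length(2)[OF a] red pq qk adm by (auto simp: apq_def apk_def aqk_def)

lemma BP_move_relations:
  "move n p k e \<otimes>\<^bsub>BP n\<^esub> move n q k e = move n q k e \<otimes>\<^bsub>BP n\<^esub> move n p k e"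
  "move n p q d \<otimes>\<^bsub>BP n\<^esub> (move n p k e \<otimes>\<^bsub>BP n\<^esub> move n q k e) =
   (move n p k e \<otimes>\<^bsub>BP n\<^esub> move n q k e) \<otimes>\<^bsub>BP n\<^esub> move n p q d"
  using gs_commute[OF mccool_relations_BP adm(1) qk, of e e] gs_triangle[OF mccool_relations_BP pq adm(1) qk, of d e]
    adm by (simp_all add: move_eq_sg pq qk)

lemma end_pt_eq:
  "end_pt = mv n (mv n apq q k e) p k e" "mv n aqk p k e = mv n apk q k e"
proof -
  interpret group "BP n" by (rule BP_group)
  have m: "move n p k e \<in> carrier (BP n)" "move n q k e \<in> carrier (BP n)" "move n p q d \<in> carrier (BP n)"
    "a \<in> carrier (BP n)"
    using adm a by (simp_all add: move_BP BC_BP)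
  show 2: "mv n aqk p k e = mv n apk q k e"
    using m BP_move_relations(1) by (simp add: aqk_def apk_def m_assoc)
  show "end_pt = mv n (mv n apq q k e) p k e"
    using m BP_move_relations by (simp add: end_pt_def apk_def apq_def m_assoc)
qed

lemma mid_reduces: "reduces n apk q k e" "reduces n aqk p k e" "reduces n apq q k e"
  using conjugator_mv_other[OF a pq] conjugator_mv_other[OF a qk] conjugator_mv_other[OF a adm(1)] adm red
  by (auto simp: reduces_def apk_def aqk_def apq_def)

lemma mid_shorter:
  "aut_length n (mv n apk q k e) < aut_length n a" "aut_length n (mv n apq q k e) < aut_length n a"
  using reduces_length(2)[OF BCs(2) qk mid_reduces(1)] reduces_length(2)[OF BCs(1) qk mid_reduces(3)] shorter
  by auto

text \<open>With \<open>y\<^sub>p = z' x\<^sub>q\<^sup>-\<^sup>d y\<^sub>q\<close> and \<open>y\<^sub>q = z'' x\<^sub>k\<^sup>-\<^sup>e y\<^sub>k\<close> the three moves turn \<open>y\<^sub>p\<close> into \<open>z' z'' y\<^sub>k\<close> and \<open>y\<^sub>q\<close> into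
\<open>z'' y\<^sub>k\<close>.\<close>
lemma end_pt_shorter: "aut_length n end_pt < aut_length n a"
proof -
  let ?b = "mv n apq q k e"
  have other: "conjugator n end_pt m = conjugator n a m" if "m \<in> {1..n}" "m \<noteq> p" "m \<noteq> q" for m
    using that conjugator_mv_other[OF BCs(5) adm(1)] conjugator_mv_other[OF BCs(1) qk] conjugator_mv_other[OF a pq]
    by (simp add: end_pt_eq apq_def)
  have "length (conjugator n end_pt q) < length (conjugator n a q)"
    using reduces_length(1)[OF BCs(1) qk mid_reduces(3)] conjugator_mv_other[OF BCs(5) adm(1)] conjugator_mv_other[OF a pq] adm
    by (simp add: end_pt_eq apq_def)
  moreover have "length (conjugator n end_pt p) < length (conjugator n a p)"
  proof -
    have eq: "end_pt (gen n p) = cj n (cj n (a (gen n p)) (signed n d (a (gen n q)))) (signed n e (a (gen n k)))"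
      using a pq qk adm BCs by (simp add: end_pt_eq mv_gen BC_BP apq_def)
    let ?v = "[(q, \<not> d)] @ conjugator n a q" and ?u = "[(k, \<not> e)] @ conjugator n a k"
    let ?w1 = "conjugator n a p @ winv (conjugator n a q) @ [(q, d)] @ conjugator n a q"
    let ?w = "?w1 @ winv (conjugator n a k) @ [(k, e)] @ conjugator n a k"
    have W: "?w1 \<in> W n" "?w \<in> W n" using Ya(1) adm by auto
    have "end_pt (gen n p) = cw n (cjw p ?w)"
      unfolding eq using cj_cw_cjw[of "conjugator n a p" n "conjugator n a q" p q d] cj_cw_cjw[OF W(1), of "conjugator n a k" p k e] Ya adm
      by simp
    moreover have "cw n ?w = cw n (z' @ z'' @ conjugator n a k)"
    proof -
      have "cw n ?w = cw n (z' @ ?v @ winv ?v @ (conjugator n a q @ winv (conjugator n a k) @ [(k, e)] @ conjugator n a k))"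
        by (simp add: Yp)
      also have "\<dots> = cw n (z' @ (conjugator n a q @ winv (conjugator n a k) @ [(k, e)] @ conjugator n a k))"
        using words Ya(1) adm by (intro cw_cancel) auto
      also have "\<dots> = cw n ((z' @ z'') @ ?u @ winv ?u @ conjugator n a k)"
        by (simp add: Yq)
      also have "\<dots> = cw n ((z' @ z'') @ conjugator n a k)"
        using words Ya(1) adm by (intro cw_cancel) auto
      finally show ?thesis by simp
    qed
    ultimately have "length (conjugator n end_pt p) \<le> length (z' @ z'' @ conjugator n a k)"
      using W words Ya(1) adm length_conjugator_le[of end_pt n p ?w "z' @ z'' @ conjugator n a k"] by simp
    then show ?thesis by (simp add: Yp Yq)
  qed
  ultimately show ?thesis
    unfolding aut_length_def using adm other
    by (intro sum_strict_mono_ex1) (auto, metis atLeastAtMost_iff less_imp_le order_refl)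
qed

end

context
  fixes n :: nat and G :: "('g, 'm) monoid_scheme" (structure) and g :: "nat \<Rightarrow> nat \<Rightarrow> 'g"
  assumes rel: "mccool_relations n G g"
begin

interpretation group G using rel by (simp add: mccool_relations_def)

abbreviation (input) "D \<equiv> descends n G g"
abbreviation (input) "gt i k e \<equiv> sg e (g i k)"

lemma gt_closed: "admissible n i k \<Longrightarrow> gt i k e \<in> carrier G"
  by (rule gs_closed[OF rel])

lemma descends_closed: "D a x \<Longrightarrow> a \<in> carrier (BC n) \<and> x \<in> carrier G"
proof (induction rule: descends.induct)
  case one
  show ?case using BC_group[of n] by (metis BC_simps(2) group.is_monoid monoid.one_closed one_closed)
qed (auto simp: gt_closed)

lemma descends_exists: "a \<in> carrier (BC n) \<Longrightarrow> \<exists>x. D a x"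
proof (induction "aut_length n a" arbitrary: a rule: less_induct)
  case less
  show ?case
  proof (cases "\<exists>i k e. admissible n i k \<and> reduces n a i k e")
    case True
    then obtain i k e where *: "admissible n i k" "reduces n a i k e" by blast
    then obtain x where "D (mv n a i k e) x" using less reduces_length(2) mv_BC by blast
    then show ?thesis using descends.step[OF less.prems *, of G g x] by blast
  next
    case False
    then show ?thesis using irreducible_eq_one[OF less.prems] descends.one by metis
  qed
qed

text \<open>Once the value at \<open>a\<close> is unique it is compatible with all moves, not only with the shortening ones:
the inverse of a move that does not shorten is a shortening one.\<close>
lemma descends_mv:
  assumes unique: "\<And>x y. D a x \<Longrightarrow> D a y \<Longrightarrow> x = y"
    and a: "D a x" and ik: "admissible n i k"
  shows "D (mv n a i k e) (x \<otimes> gt i k e)"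
proof -
  have aBC: "a \<in> carrier (BC n)" and x: "x \<in> carrier G" using descends_closed[OF a] by auto
  from reduces_or_reduces_back[OF aBC ik, of e] show ?thesis
  proof
    assume r: "reduces n a i k e"
    obtain x' where x': "D (mv n a i k e) x'" using descends_exists[OF mv_BC[OF aBC ik]] by blast
    have "x = x' \<otimes> gt i k (\<not> e)" by (rule unique[OF a descends.step[OF aBC ik r x']])
    moreover have "x' \<in> carrier G" using descends_closed[OF x'] by simp
    ultimately have "x \<otimes> gt i k e = x'"
      using g_closed[OF rel ik] sg_cancel[of "g i k" "\<not> e"] by (simp add: m_assoc)
    then show ?thesis using x' by simp
  next
    assume r: "reduces n (mv n a i k e) i k (\<not> e)"
    then show ?thesis
      using descends.step[OF mv_BC[OF aBC ik] ik r, of G g x] a mv_cancel[OF aBC ik] by simp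
  qed
qed

text \<open>Newman's argument: two first moves from \<open>a\<close> are completed to a diagram whose other corners are
shorter than \<open>a\<close>, where the values are unique by induction, and the diagram closes by one of the
relations.\<close>
lemma descends_unique: "D a x \<Longrightarrow> D a y \<Longrightarrow> x = y"
proof (induction "aut_length n a" arbitrary: a x y rule: less_induct)
  case less
  note IH = less.hyps
  have step: "D (mv n b i k e) (z \<otimes> gt i k e)"
    if "aut_length n b < aut_length n a" "D b z" "admissible n i k" for b i k e z
    by (rule descends_mv[OF IH[OF that(1)] that(2,3)])
  have aBC: "a \<in> carrier (BC n)" using descends_closed[OF less.prems(1)] by simp
  \<comment> \<open>two shortening moves that can be completed to a diagram of shorter automorphisms agree\<close>
  have tri: "xP \<otimes> gt p q (\<not> d) = xA \<otimes> gt p k (\<not> e) \<and> xP \<otimes> gt p q (\<not> d) = xB \<otimes> gt q k (\<not> e)"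
    if t: "triangle n a p q k d e z' z''"
      and x: "D (mv n a p q d) xP" "D (mv n a p k e) xA" "D (mv n a q k e) xB"
    for p q k d e z' z'' xP xA xB
  proof -
    interpret t: triangle n a p q k d e z' z'' by (rule t)
    have c: "xP \<in> carrier G" "xA \<in> carrier G" "xB \<in> carrier G" using x descends_closed by blast+
    let ?P = "gt p q d" and ?A = "gt p k e" and ?B = "gt q k e"
    have gc: "?P \<in> carrier G" "?A \<in> carrier G" "?B \<in> carrier G"
      using gt_closed t.pq t.qk t.adm by auto
    have AB: "?A \<otimes> ?B = ?B \<otimes> ?A" using gs_commute[OF rel t.adm(1) t.qk, of e e] t.adm by simp
    have PAB: "?P \<otimes> (?A \<otimes> ?B) = (?A \<otimes> ?B) \<otimes> ?P" using gs_triangle[OF rel t.pq t.adm(1) t.qk] .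
    have inv: "gt p q (\<not> d) = inv ?P" "gt p k (\<not> e) = inv ?A" "gt q k (\<not> e) = inv ?B"
      using g_closed[OF rel] t.pq t.qk t.adm by (auto simp: sg_def)
    have "D t.end_pt (xP \<otimes> ?B \<otimes> ?A)"
      unfolding t.end_pt_eq(1) using x t.shorter t.mid_shorter t.qk t.adm
      by (intro step) (auto simp: t.apq_def)
    moreover have "D t.end_pt (xA \<otimes> ?B \<otimes> ?P)"
      unfolding t.end_pt_def using x t.shorter t.mid_shorter t.qk t.pq
      by (intro step) (auto simp: t.apk_def)
    moreover have "D t.end_pt (xB \<otimes> ?A \<otimes> ?P)"
      unfolding t.end_pt_def t.end_pt_eq(2)[symmetric] using x t.shorter t.mid_shorter t.adm t.pq
      by (intro step) (auto simp: t.aqk_def t.end_pt_eq(2)[unfolded t.aqk_def])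
    ultimately have 1: "xP \<otimes> ?B \<otimes> ?A = xA \<otimes> ?B \<otimes> ?P" and 2: "xP \<otimes> ?B \<otimes> ?A = xB \<otimes> ?A \<otimes> ?P"
      using IH[OF t.end_pt_shorter] by blast+
    have P': "xP \<otimes> inv ?P = xP \<otimes> ?B \<otimes> ?A \<otimes> inv (?A \<otimes> ?B \<otimes> ?P)"
    proof -
      have "xP \<otimes> ?B \<otimes> ?A = xP \<otimes> (?A \<otimes> ?B)" using c gc AB by (simp add: m_assoc)
      moreover have "inv (?A \<otimes> ?B \<otimes> ?P) = inv (?A \<otimes> ?B) \<otimes> inv ?P"
        using gc PAB by (metis inv_mult_group m_closed)
      ultimately show ?thesis using c gc by (simp add: m_assoc) (simp add: m_assoc[symmetric])
    qed
    have "xP \<otimes> inv ?P = xA \<otimes> inv ?A"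
      unfolding P' 1 using c gc by (simp add: inv_mult_group m_assoc) (simp add: m_assoc[symmetric])
    moreover have "xP \<otimes> inv ?P = xB \<otimes> inv ?B"
      unfolding P' 2 using c gc by (simp add: AB inv_mult_group m_assoc) (simp add: m_assoc[symmetric])
    ultimately show ?thesis by (simp add: inv)
  qed
  have Dmv: "\<exists>u. D (mv n a i k e) u" if "admissible n i k" for i k e
    using descends_exists[OF mv_BC[OF aBC that]] .
  show ?case
  proof (cases "a = \<one>\<^bsub>BP n\<^esub>")
    case True
    have "u = \<one>" if "D a u" for u
      using that by cases (use not_reduces_one True in auto)
    then show ?thesis using less.prems by blast
  next
    case False
    from less.prems(1) False obtain i k e x1 where 1: "admissible n i k" "reduces n a i k e"
      "D (mv n a i k e) x1" "x = x1 \<otimes> gt i k (\<not> e)" by cases auto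
    from less.prems(2) False obtain j l d y1 where 2: "admissible n j l" "reduces n a j l d"
      "D (mv n a j l d) y1" "y = y1 \<otimes> gt j l (\<not> d)" by cases auto
    obtain z where z: "conjugator n a i = z @ [(k, \<not> e)] @ conjugator n a k" using 1 by (auto simp: reduces_def)
    obtain z' where z': "conjugator n a j = z' @ [(l, \<not> d)] @ conjugator n a l" using 2 by (auto simp: reduces_def)
    have c: "x1 \<in> carrier G" "y1 \<in> carrier G" using 1 2 descends_closed by blast+
    \<comment> \<open>both moves act on \<open>x\<^sub>i\<close>: then the multiplier with the shorter conjugator also shortens the other one\<close>
    have wlog: "x1 \<otimes> gt i k (\<not> e) = y1 \<otimes> gt i l (\<not> d)"
      if i: "admissible n i k" "admissible n i l" "k \<noteq> l"
        and z: "conjugator n a i = z @ [(k, \<not> e)] @ conjugator n a k" and z': "conjugator n a i = z' @ [(l, \<not> d)] @ conjugator n a l"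
        and len: "length (conjugator n a k) < length (conjugator n a l)"
        and D: "D (mv n a i k e) x1" "D (mv n a i l d) y1" for i k l e d z z' x1 y1
    proof -
      have "(z @ [(k, \<not> e)]) @ conjugator n a k = (z' @ [(l, \<not> d)]) @ conjugator n a l" using z z' by simp
      then have "\<exists>z''. conjugator n a l = z'' @ [(k, \<not> e)] @ conjugator n a k" using len by (rule suffix_extend)
      then obtain z'' where z'': "conjugator n a l = z'' @ [(k, \<not> e)] @ conjugator n a k" by blast
      have lk: "admissible n l k" using i by (auto simp: admissible_def)
      have "triangle n a i l k d e z' z''"
        by unfold_locales (use aBC i lk z' z'' in \<open>auto simp: admissible_def\<close>)
      moreover obtain u where "D (mv n a l k e) u" using Dmv[OF lk] by blast
      ultimately show ?thesis using tri D by metis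
    qed
    \<comment> \<open>one move acts on the generator whose image the other one multiplies with\<close>
    have chain: "x1 \<otimes> gt i k (\<not> e) = y1 \<otimes> gt j i (\<not> d)"
      if i: "admissible n i k" "admissible n j i" "k \<noteq> j"
        and z: "conjugator n a i = z @ [(k, \<not> e)] @ conjugator n a k" and z': "conjugator n a j = z' @ [(i, \<not> d)] @ conjugator n a i"
        and D: "D (mv n a i k e) x1" "D (mv n a j i d) y1" for i j k e d z z' x1 y1
    proof -
      have jk: "admissible n j k" using i by (auto simp: admissible_def)
      have "triangle n a j i k d e z' z"
        by unfold_locales (use aBC i z z' in auto)
      moreover obtain u where "D (mv n a j k e) u" using Dmv[OF jk] by blast
      ultimately show ?thesis using tri D by metis
    qed
    \<comment> \<open>the last case, in which neither move affects the other one, is closed by a commutation\<close>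
    consider "i = j" "k = l" | "i = j" "k \<noteq> l" | "i \<noteq> j" "l = i" | "i \<noteq> j" "k = j" "l \<noteq> i"
      | "i \<noteq> j" "l \<noteq> i" "k \<noteq> j" by blast
    then show ?thesis
    proof cases
      case a1: 1
      then have "e = d" using z z' by simp
      then show ?thesis using a1 1 2 IH reduces_length(2)[OF aBC 1(1,2)] by blast
    next
      case a2: 2
      consider "length (conjugator n a k) < length (conjugator n a l)" | "length (conjugator n a l) < length (conjugator n a k)"
        | "length (conjugator n a k) = length (conjugator n a l)" by linarith
      then show ?thesis
      proof cases
        case 3
        have "length z = length z'" using z z' a2 3 arg_cong[OF z, of length] arg_cong[OF z', of length] by simp
        then show ?thesis using z z' a2 by simp
      qed (use wlog[of i k l] wlog[of i l k] a2 1 2 z z' in metis)+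
    next
      case a3: 3
      have "k \<noteq> j"
      proof
        assume "k = j"
        then show False using a3 z z' arg_cong[OF z, of length] arg_cong[OF z', of length] by simp
      qed
      then show ?thesis using chain[of i k j] a3 1 2 z z' by metis
    next
      case a4: 4
      then show ?thesis using chain[of j l i] 1 2 z z' by metis
    next
      case a5: 5
      have ra: "reduces n (mv n a i k e) j l d"
        using 2(1,2) conjugator_mv_other[OF aBC 1(1)] a5 by (auto simp: reduces_def admissible_def)
      have BPs: "mv n (mv n a i k e) j l d = mv n (mv n a j l d) i k e"
      proof -
        interpret B: group "BP n" by (rule BP_group)
        have "move n i k e \<otimes>\<^bsub>BP n\<^esub> move n j l d = move n j l d \<otimes>\<^bsub>BP n\<^esub> move n i k e"
          using gs_commute[OF mccool_relations_BP 1(1) 2(1), of e d] a5 1 2 by (simp add: move_eq_sg)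
        then show ?thesis
          using aBC 1(1) 2(1) by (simp add: B.m_assoc BC_BP move_BP admissible_def)
      qed
      have s1: "aut_length n (mv n a i k e) < aut_length n a" "aut_length n (mv n a j l d) < aut_length n a"
        using reduces_length(2)[OF aBC] 1 2 by auto
      have s2: "aut_length n (mv n (mv n a i k e) j l d) < aut_length n a"
        using reduces_length(2)[OF mv_BC[OF aBC 1(1)] 2(1) ra] s1 by simp
      have "x1 \<otimes> gt j l d = y1 \<otimes> gt i k e"
        using IH[OF s2 step[OF s1(1) 1(3) 2(1)]] step[OF s1(2) 2(3) 1(1), of e] by (simp add: BPs)
      moreover have comm: "gt i k e' \<otimes> gt j l d' = gt j l d' \<otimes> gt i k e'" for e' d'
        using gs_commute[OF rel 1(1) 2(1)] a5 by simp
      ultimately have "x1 \<otimes> gt j l d \<otimes> (gt j l (\<not> d) \<otimes> gt i k (\<not> e)) =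
          y1 \<otimes> gt i k e \<otimes> (gt i k (\<not> e) \<otimes> gt j l (\<not> d))" by simp
      moreover have "u \<otimes> sg b h \<otimes> (sg (\<not> b) h \<otimes> v) = u \<otimes> v"
        if "u \<in> carrier G" "v \<in> carrier G" "h \<in> carrier G" for u v h b
      proof -
        have "u \<otimes> sg b h \<otimes> (sg (\<not> b) h \<otimes> v) = u \<otimes> (sg b h \<otimes> sg (\<not> b) h) \<otimes> v"
          using that by (simp add: m_assoc)
        then show ?thesis using that by (simp only: sg_cancel r_one)
      qed
      ultimately show ?thesis
        using c gt_closed 1 2 g_closed[OF rel] by simp
    qed
  qed
qed

text \<open>McCool's theorem in the form of a universal property.\<close>
theorem mccool_universal: "\<exists>h\<in>hom (BC n) G. \<forall>i k. admissible n i k \<longrightarrow> h (aut_gen n i k) = g i k"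
proof -
  define h where "h a = (THE x. D a x)" for a
  have h: "h a = x" if "D a x" for a x
    unfolding h_def using that descends_unique by blast
  have Dh: "D a (h a)" if "a \<in> carrier (BC n)" for a
    using descends_exists[OF that] h by auto
  have hm: "h (mv n a i k e) = h a \<otimes> gt i k e" if "a \<in> carrier (BC n)" "admissible n i k" for a i k e
    using descends_mv[OF descends_unique Dh[OF that(1)] that(2)] by (rule h)
  have hc: "h a \<in> carrier G" if "a \<in> carrier (BC n)" for a using descends_closed[OF Dh[OF that]] by simp
  have one: "h \<one>\<^bsub>BP n\<^esub> = \<one>" by (rule h[OF descends.one])
  interpret B: group "BC n" by (rule BC_group)
  have mult: "h (b \<otimes>\<^bsub>BP n\<^esub> a) = h b \<otimes> h a" if "a \<in> carrier (BC n)" "b \<in> carrier (BC n)" for a b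
    using that(1)
  proof (induction rule: BC_induct)
    case one
    then show ?case using hc that(2) B.r_one[of b] \<open>h \<one>\<^bsub>BP n\<^esub> = \<one>\<close> by simp
  next
    case (mv a i k e)
    have "b \<otimes>\<^bsub>BP n\<^esub> mv n a i k e = mv n (b \<otimes>\<^bsub>BP n\<^esub> a) i k e"
      using B.m_assoc[of b a "move n i k e"] that mv by (simp add: move_BC admissible_def)
    then show ?case using mv that hc by (simp add: hm BC_mult m_assoc gt_closed g_closed[OF rel])
  qed
  have "h (aut_gen n i k) = g i k" if "admissible n i k" for i k
    using hm[OF B.one_closed that, of True] one that B.l_one[of "aut_gen n i k"] g_closed[OF rel that]
    by (simp add: aut_gen_eq_move move_BC admissible_def sg_def)
  then show ?thesis
    by (intro bexI[of _ h] homI) (auto simp: hc mult)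
qed

end

lemma BC_hom_eqI:
  assumes G: "group G" and h: "h \<in> hom (BC n) G" "h' \<in> hom (BC n) G"
    and eq: "\<And>i k. admissible n i k \<Longrightarrow> h (aut_gen n i k) = h' (aut_gen n i k)"
    and a: "a \<in> carrier (BC n)"
  shows "h a = h' a"
proof -
  have move: "h (move n i k e) = h' (move n i k e)" if ik: "admissible n i k" for i k e
  proof (cases e)
    case False
    have c: "aut_gen n i k \<in> carrier (BC n)" using ik by (simp add: aut_gen_eq_move move_BC admissible_def)
    have "move n i k e = inv\<^bsub>BC n\<^esub> (aut_gen n i k)"
      using False move_eq_sg[OF ik, of False] c by (simp add: group.sg_def[OF BP_group] BC_inv)
    then show ?thesis
      using eq[OF ik] group_hom.hom_inv[of "BC n" G h, OF _ c] group_hom.hom_inv[of "BC n" G h', OF _ c] h G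
      by (simp add: group_hom_def group_hom_axioms_def BC_group)
  qed (use eq[OF ik] in \<open>simp add: aut_gen_eq_move\<close>)
  show ?thesis
    using a
  proof (induction rule: BC_induct)
    case one
    show ?case using hom_one[OF h(1) BC_group G] hom_one[OF h(2) BC_group G] by simp
  next
    case (mv a i k e)
    then have "move n i k e \<in> carrier (BC n)" by (simp add: move_BC admissible_def)
    then show ?case using mv move hom_mult[OF h(1), of a "move n i k e"] hom_mult[OF h(2), of a "move n i k e"]
      by simp
  qed
qed

section \<open>Derivations of the algebra of power series\<close>

text \<open>The left derivatives of a series, determined by \<open>P = P(1) + \<Sum>\<^sub>b X\<^sub>b P\<^sub>b\<close>.\<close>
definition ld :: "nat \<Rightarrow> nat ncps \<Rightarrow> nat ncps" where "ld b P = (\<lambda>w. P (b # w))"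

text \<open>The coefficient of \<open>X\<^sub>b X\<^sub>c\<close> in \<open>X\<^sub>i X\<^sub>j - X\<^sub>j X\<^sub>i\<close>.\<close>
definition br :: "nat \<Rightarrow> nat \<Rightarrow> nat \<Rightarrow> nat \<Rightarrow> rat" where
  "br i j b c = (if b = i \<and> c = j then 1 else 0) - (if b = j \<and> c = i then 1 else 0)"

text \<open>The continuous derivation with \<open>X\<^sub>i \<mapsto> X\<^sub>i X\<^sub>j - X\<^sub>j X\<^sub>i\<close> that kills the other generators,
  computed on coefficients by splitting off the first letter: if \<open>P = P(1) + \<Sum>\<^sub>b X\<^sub>b P\<^sub>b\<close>, then its
  value is \<open>\<Sum>\<^sub>b X\<^sub>b D(P\<^sub>b) + D(X\<^sub>i) P\<^sub>i\<close>.\<close>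
fun der :: "nat \<Rightarrow> nat \<Rightarrow> nat ncps \<Rightarrow> nat ncps" where
  "der i j P [] = 0"
| "der i j P (b # u) = der i j (ld b P) u + (case u of [] \<Rightarrow> 0 | c # u' \<Rightarrow> br i j b c * P (i # u'))"

lemma ld_simps [simp]: "ld b (f + g) = ld b f + ld b g" "ld b (sc c f) = sc c (ld b f)" "ld b 0 = 0"
  by (auto simp: ld_def fun_eq_iff sc_apply)

lemma times_Nil [simp]: "(f * g) [] = f [] * (g [])" for f g :: "'a ncps"
  using times_mnil[of f g] by simp

lemma times_Cons: "(P * Q) (b # w) = P [] * Q (b # w) + (ld b P * Q) w"
proof -
  have "(P * Q) (b # w) = (\<Sum>k\<le>Suc (length w). P (take k (b # w)) * Q (drop k (b # w)))"
    by (simp add: times_list)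
  also have "\<dots> = P [] * Q (b # w) + (\<Sum>k\<le>length w. P (b # take k w) * Q (drop k w))"
    by (subst sum.atMost_Suc_shift) simp
  finally show ?thesis by (simp add: times_list ld_def)
qed

lemma ld_mult: "ld b (P * Q) = sc (P []) (ld b Q) + ld b P * Q"
  by (auto simp: fun_eq_iff ld_def[of b "P * Q"] times_Cons sc_apply ld_def[of b Q])

lemma der_add: "der i j (P + Q) u = der i j P u + der i j Q u"
  by (induction u arbitrary: P Q) (auto split: list.split simp: algebra_simps)

lemma der_sc: "der i j (sc c P) u = c * der i j P u"
  by (induction u arbitrary: P) (auto split: list.split simp: algebra_simps sc_apply)

lemma der_low: "low d P \<Longrightarrow> length u < Suc d \<Longrightarrow> der i j P u = 0"
proof (induction u arbitrary: P d)
  case (Cons b u)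
  then obtain d' where d: "d = Suc d'" by (cases d) auto
  have "low d' (ld b P)" using Cons.prems(1) by (auto simp: low_def ld_def d)
  then have "der i j (ld b P) u = 0" using Cons.IH[of d' "ld b P"] Cons.prems(2) d by simp
  then show ?case using Cons.prems by (auto split: list.split simp: low_def)
qed simp

lemma cont_lin_der: "cont_lin (der i j)"
  unfolding cont_lin_def
proof (intro conjI allI impI)
  show "der i j (f + g) = der i j f + der i j g" for f g by (auto simp: fun_eq_iff der_add)
  show "der i j (sc c f) = sc c (der i j f)" for c f by (auto simp: fun_eq_iff der_sc sc_apply)
  show "low d (der i j f)" if "low d f" for d f using der_low[OF that] by (auto simp: low_def)
qed

lemma low_der: "low d P \<Longrightarrow> low (Suc d) (der i j P)"
  using der_low[of d P] by (auto simp: low_def)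

lemmas der_simps = cont_linD[OF cont_lin_der]

text \<open>The contribution to the derivation that starts with \<open>X\<^sub>b\<close> and comes from replacing a leading \<open>X\<^sub>i\<close> by
its image.\<close>
definition sh :: "nat \<Rightarrow> nat \<Rightarrow> nat \<Rightarrow> nat ncps \<Rightarrow> nat ncps" where
  "sh i j b P = (\<lambda>w. case w of [] \<Rightarrow> 0 | c # w' \<Rightarrow> br i j b c * P (i # w'))"

lemma ld_der: "ld b (der i j P) = der i j (ld b P) + sh i j b P"
  by (auto simp: fun_eq_iff ld_def[of b "der i j P"] sh_def)

lemma sh_mult: "sh i j b (P * Q) w = P [] * sh i j b Q w + (sh i j b P * Q) w"
proof (cases w)
  case (Cons c w')
  have "ld c (sh i j b P) = sc (br i j b c) (ld i P)" by (auto simp: fun_eq_iff ld_def sh_def sc_apply)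
  moreover have "sh i j b P [] = 0" by (simp add: sh_def)
  ultimately have "(sh i j b P * Q) w = br i j b c * (ld i P * Q) w'"
    by (simp add: Cons times_Cons sc_apply)
  then show ?thesis by (simp add: sh_def Cons times_Cons algebra_simps)
qed (simp add: sh_def)

text \<open>Leibniz' rule is proved letter by letter: both sides have the same left derivatives, by induction on
the length of the word.\<close>
lemma der_mult: "der i j (P * Q) = der i j P * Q + P * der i j Q"
proof
  fix u
  show "der i j (P * Q) u = (der i j P * Q + P * der i j Q) u"
  proof (induction u arbitrary: P Q)
    case (Cons b u)
    have "der i j (P * Q) (b # u) = ld b (der i j (P * Q)) u" by (simp only: ld_def)
    also have "\<dots> = der i j (ld b (P * Q)) u + sh i j b (P * Q) u" by (simp only: ld_der series_apply)
    also have "der i j (ld b (P * Q)) u = P [] * der i j (ld b Q) u + der i j (ld b P * Q) u"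
      by (simp only: ld_mult der_add der_sc)
    also have "der i j (ld b P * Q) u = (der i j (ld b P) * Q) u + (ld b P * der i j Q) u"
      using Cons by simp
    finally have 1: "der i j (P * Q) (b # u) = P [] * der i j (ld b Q) u + ((der i j (ld b P) * Q) u +
        (ld b P * der i j Q) u) + (P [] * sh i j b Q u + (sh i j b P * Q) u)"
      by (simp only: sh_mult)
    have 2: "(der i j P * Q) (b # u) = (der i j (ld b P) * Q) u + (sh i j b P * Q) u"
      by (simp only: times_Cons ld_der distrib_right series_apply der.simps(1) mult_zero_left add_0)
    have "der i j Q (b # u) = ld b (der i j Q) u" by (simp only: ld_def)
    then have 3: "(P * der i j Q) (b # u) = P [] * (der i j (ld b Q) u + sh i j b Q u) + (ld b P * der i j Q) u"
      by (simp only: times_Cons ld_der series_apply)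
    show ?case by (simp only: series_apply 1 2 3 distrib_left add_ac)
  qed simp
qed

abbreviation X :: "nat \<Rightarrow> nat ncps" where "X a \<equiv> ncps_gen a"

lemma X_Nil [simp]: "ncps_gen a [] = 0" by (simp add: ncps_gen_def)

lemma ld_X: "ld b (X a) = (if a = b then 1 else 0)"
  by (auto simp: fun_eq_iff ld_def ncps_gen_def one_series_def)

lemma der_1: "der i j 1 = 0"
  using der_mult[of i j 1 1] by simp

lemma X_Cons: "ncps_gen a (c # t) = (if a = c \<and> t = [] then 1 else 0)"
  by (auto simp: ncps_gen_def)

lemma X_mult: "(X a * P) u = (case u of [] \<Rightarrow> 0 | b # w \<Rightarrow> if a = b then P w else 0)"
  by (cases u) (auto simp: times_Cons ld_X)

lemma der_X: "i \<noteq> j \<Longrightarrow> der i j (X a) = (if a = i then X i * X j - X j * X i else 0)"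
proof
  fix u assume ij: "i \<noteq> j"
  have z: "der i j 0 w = 0" "der i j 1 w = 0" for w by (simp_all add: der_simps der_1)
  show "der i j (X a) u = (if a = i then X i * X j - X j * X i else 0) u"
  proof (cases u)
    case (Cons b w)
    have "der i j (ld b (X a)) w = 0" by (simp add: ld_X z)
    then show ?thesis
      using ij by (cases w; cases "tl w") (auto simp: Cons X_mult X_Cons br_def)
  qed simp
qed

definition is_der :: "(nat ncps \<Rightarrow> nat ncps) \<Rightarrow> bool" where
  "is_der h \<longleftrightarrow> cont_lin h \<and> (\<forall>P Q. h (P * Q) = h P * Q + P * h Q)"

lemma is_der_der: "is_der (der i j)" by (simp add: is_der_def cont_lin_der der_mult)

lemma is_der_commutator:
  assumes "is_der h" "is_der k"
  shows "is_der (\<lambda>P. h (k P) - k (h P))"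
proof -
  have hk: "cont_lin h" "cont_lin k" and leib: "h (P * Q) = h P * Q + P * h Q" "k (P * Q) = k P * Q + P * k Q"
    for P Q using assms by (auto simp: is_der_def)
  have "cont_lin (\<lambda>P. h (k P) - k (h P))"
    by (rule cont_lin_diff[OF cont_lin_compose[OF hk] cont_lin_compose[OF hk(2,1)]])
  then show ?thesis
    by (simp add: is_der_def leib cont_linD(1)[OF hk(1)] cont_linD(1)[OF hk(2)] algebra_simps)
qed

lemma is_der_add:
  assumes "is_der h" "is_der k"
  shows "is_der (\<lambda>P. h P + k P)"
proof -
  have "cont_lin (\<lambda>P. h P + k P)"
    using assms unfolding is_der_def cont_lin_def by (auto simp: sc_add algebra_simps intro: low_add)
  then show ?thesis using assms by (auto simp: is_der_def algebra_simps)
qed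

abbreviation V :: "nat \<Rightarrow> nat ncps set" where "V n \<equiv> carrier (sring (lists {1..n}))"

lemma V_ld: "P \<in> V n \<Longrightarrow> ld b P \<in> V n"
  by (auto simp: sring_carrier ld_def)

lemma V_decompose:
  assumes "P \<in> V n"
  shows "P = sc (P []) 1 + (\<Sum>a\<in>{1..n}. X a * ld a P)"
proof
  fix u
  show "P u = (sc (P []) 1 + (\<Sum>a\<in>{1..n}. X a * ld a P)) u"
  proof (cases u)
    case (Cons b w)
    have "(\<Sum>a\<in>{1..n}. (X a * ld a P) u) = (\<Sum>a\<in>{1..n}. if a = b then P u else 0)"
      by (rule sum.cong) (auto simp: X_mult Cons ld_def)
    also have "\<dots> = P u" using assms by (auto simp: sring_carrier Cons)
    finally show ?thesis by (simp add: Cons ser_simps one_series_def)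
  qed (simp add: ser_simps X_mult)
qed

text \<open>Splitting off first letters gives \<open>h P = \<Sum>\<^sub>a X\<^sub>a h(P\<^sub>a)\<close>, so that \<open>h P\<close> vanishes in every degree. Relations
between derivations therefore need to be checked on the variables only.\<close>
lemma derivation_eq_0:
  assumes h: "is_der h" and z: "\<And>a. a \<in> {1..n} \<Longrightarrow> h (X a) = 0" and P: "P \<in> V n"
  shows "h P = 0"
proof
  have lin: "cont_lin h" and leib: "\<And>P Q. h (P * Q) = h P * Q + P * h Q" using h by (auto simp: is_der_def)
  have h1: "h 1 = 0" using leib[of 1 1] by simp
  have rec: "h P = (\<Sum>a\<in>{1..n}. X a * h (ld a P))" if "P \<in> V n" for P
  proof -
    have "h P = h (sc (P []) 1 + (\<Sum>a\<in>{1..n}. X a * ld a P))" using V_decompose[OF that] by simp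
    also have "\<dots> = (\<Sum>a\<in>{1..n}. h (X a * ld a P))"
      by (simp only: cont_linD[OF lin] cont_lin_sum[OF lin] h1 sc_simps add_0)
    also have "\<dots> = (\<Sum>a\<in>{1..n}. X a * h (ld a P))" by (rule sum.cong) (simp_all add: leib z)
    finally show ?thesis .
  qed
  fix u
  show "h P u = 0 u"
    using P
  proof (induction u arbitrary: P)
    case Nil
    then show ?case by (simp add: rec[OF Nil] ser_simps X_mult)
  next
    case (Cons b u)
    then show ?case using V_ld[OF Cons.prems]
      by (simp add: rec[OF Cons.prems] ser_simps X_mult)
  qed
qed

lemma der_V:
  assumes ij: "i \<in> {1..n}" "j \<in> {1..n}" and P: "P \<in> V n"
  shows "der i j P \<in> V n"
proof -
  have "der i j P u = 0" if "u \<notin> lists {1..n}" for u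
    using that P
  proof (induction u arbitrary: P)
    case (Cons b u)
    have 1: "der i j (ld b P) u = 0"
    proof (cases "b \<in> {1..n}")
      case False
      then have "b # w \<notin> lists {1..n}" for w by auto
      then have "ld b P = 0" using free_quotient.C_D[OF Cons.prems(2)] by (simp add: fun_eq_iff ld_def)
      then show ?thesis by (simp add: der_simps)
    next
      case True
      then have "u \<notin> lists {1..n}" using Cons.prems(1) by simp
      then show ?thesis using Cons.IH V_ld[OF Cons.prems(2)] by simp
    qed
    have "br i j b c * P (i # u') = 0" if "u = c # u'" for c u'
    proof (cases "br i j b c = 0")
      case False
      then have "b \<in> {1..n}" "c \<in> {1..n}" using ij by (auto simp: br_def split: if_splits)
      then have "i # u' \<notin> lists {1..n}" using Cons.prems(1) that by simp
      then show ?thesis using free_quotient.C_D[OF Cons.prems(2)] by simp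
    qed simp
    then show ?case using 1 by (simp split: list.split)
  qed simp
  then show ?thesis by (auto simp: sring_carrier)
qed

section \<open>The action of the oriented Artin algebra on power series\<close>

text \<open>The composition of the derivations that correspond to the letters of a word.\<close>
definition dw :: "idx list \<Rightarrow> nat ncps \<Rightarrow> nat ncps" where
  "dw w = foldr (\<lambda>(i, j). der i j) w"

definition words :: "nat \<Rightarrow> nat \<Rightarrow> idx list set" where
  "words n N = {w \<in> lists (pairs n). length w \<le> N}"

text \<open>A power series in the \<open>v\<^sub>i\<^sub>j\<close> acts by substituting the derivations for the generators; as each
  of them raises the degree, only finitely many words contribute to a coefficient.\<close>
definition act :: "nat \<Rightarrow> idx ncps \<Rightarrow> nat ncps \<Rightarrow> nat ncps" where
  "act n f P = (\<lambda>u. \<Sum>w\<in>words n (length u). f w * dw w P u)"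

lemma finite_pairs: "finite (pairs n)"
  by (rule finite_subset[of _ "{1..n} \<times> {1..n}"]) (auto simp: pairs_def)

lemma finite_words [simp]: "finite (words n N)"
proof -
  have "words n N = {xs. set xs \<subseteq> pairs n \<and> length xs \<le> N}"
    by (auto simp: words_def in_lists_conv_set)
  then show ?thesis using finite_lists_length_le[OF finite_pairs] by simp
qed

lemma dw_simps [simp]: "dw [] P = P" "dw (p # w) P = der (fst p) (snd p) (dw w P)"
  "dw (u @ v) P = dw u (dw v P)"
  by (simp_all add: dw_def case_prod_unfold)

lemma low_dw: "low d P \<Longrightarrow> low (length w + d) (dw w P)"
  by (induction w) (auto intro: low_der)

lemma cont_lin_dw: "cont_lin (dw w)"
proof (induction w)
  case (Cons p w)
  then show ?case using cont_lin_compose[OF cont_lin_der Cons] by simp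
qed (simp add: cont_lin_def)

lemma dw_V: "w \<in> lists (pairs n) \<Longrightarrow> P \<in> V n \<Longrightarrow> dw w P \<in> V n"
proof (induction w)
  case (Cons p w)
  then have "dw w P \<in> V n" "fst p \<in> {1..n}" "snd p \<in> {1..n}" by (auto simp: pairs_def)
  then show ?case by (simp add: der_V)
qed simp

lemma act_ge:
  assumes "length u \<le> N"
  shows "act n f P u = (\<Sum>w\<in>words n N. f w * dw w P u)"
  unfolding act_def
proof (rule sum.mono_neutral_left)
  show "\<forall>w\<in>words n N - words n (length u). f w * dw w P u = 0"
  proof
    fix w assume "w \<in> words n N - words n (length u)"
    then have "length u < length w" by (auto simp: words_def)
    then have "dw w P u = 0" using low_dw[of 0 P w] by (simp add: low_def)
    then show "f w * dw w P u = 0" by simp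
  qed
  show "words n (length u) \<subseteq> words n N" using assms by (auto simp: words_def)
qed simp

lemma cont_lin_act_arg: "cont_lin (act n f)"
  unfolding cont_lin_def
proof (intro conjI allI impI)
  show "act n f (P + Q) = act n f P + act n f Q" for P Q
    by (auto simp: fun_eq_iff act_def cont_linD[OF cont_lin_dw] algebra_simps sum.distrib)
  show "act n f (sc c P) = sc c (act n f P)" for c P
    by (auto simp: fun_eq_iff act_def cont_linD[OF cont_lin_dw] sc_apply sum_distrib_left mult_ac)
  show "low d (act n f P)" if "low d P" for d P
    using cont_linD(3)[OF cont_lin_dw that] by (auto simp: low_def act_def)
qed

lemma cont_lin_act: "cont_lin (\<lambda>f. act n f P)"
  unfolding cont_lin_def
proof (intro conjI allI impI)
  show "act n (f + g) P = act n f P + act n g P" for f g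
    by (auto simp: fun_eq_iff act_def algebra_simps sum.distrib)
  show "act n (sc c f) P = sc c (act n f P)" for c f
    by (auto simp: fun_eq_iff act_def sc_apply sum_distrib_left mult_ac)
  show "low d (act n f P)" if "low d f" for d f
    using that by (auto simp: low_def act_def words_def intro!: sum.neutral)
qed

lemmas act_simps = cont_linD[OF cont_lin_act]

text \<open>A product of series acts as the composition, since a word of the product is split in finitely many
ways and words act by composition.\<close>
lemma act_mult: "act n (f * g) P = act n f (act n g P)"
proof
  fix u :: "nat list"
  let ?N = "length u"
  have "act n f (act n g P) u = (\<Sum>w\<in>words n ?N. f w * dw w (\<Sum>w'\<in>words n ?N. sc (g w') (dw w' P)) u)"
    unfolding act_def[of n f]
  proof (intro sum.cong refl arg_cong2[of _ _ _ _ times])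
    fix w
    show "dw w (act n g P) u = dw w (\<Sum>w'\<in>words n ?N. sc (g w') (dw w' P)) u"
      by (rule cont_lin_agree[OF cont_lin_dw, of ?N]) (simp_all add: act_ge ser_simps)
  qed simp_all
  also have "\<dots> = (\<Sum>(w, w')\<in>words n ?N \<times> words n ?N. f w * g w' * dw (w @ w') P u)"
    by (simp add: cont_lin_sum[OF cont_lin_dw] cont_linD[OF cont_lin_dw] ser_simps sum_distrib_left
        sum.cartesian_product mult.assoc)
  also have "\<dots> = (\<Sum>(w, w')\<in>{(w, w'). w @ w' \<in> words n ?N}. f w * g w' * dw (w @ w') P u)"
  proof (rule sum.mono_neutral_right)
    show "\<forall>p\<in>words n ?N \<times> words n ?N - {(w, w'). w @ w' \<in> words n ?N}.
        (case p of (w, w') \<Rightarrow> f w * g w' * dw (w @ w') P u) = 0"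
    proof
      fix p assume p: "p \<in> words n ?N \<times> words n ?N - {(w, w'). w @ w' \<in> words n ?N}"
      then have "\<not> length (fst p @ snd p) \<le> ?N" by (auto simp: words_def)
      then have "dw (fst p @ snd p) P u = 0" using low_dw[of 0 P "fst p @ snd p"] by (simp only: low_def) simp
      then show "(case p of (w, w') \<Rightarrow> f w * g w' * dw (w @ w') P u) = 0" by (simp add: case_prod_unfold)
    qed
  qed (simp, auto simp: words_def)
  also have "\<dots> = (\<Sum>(v, p)\<in>Sigma (words n ?N) splits. f (fst p) * g (snd p) * dw v P u)"
    by (rule sum.reindex_bij_witness[of _ "\<lambda>(v, p). p" "\<lambda>(w, w'). (w @ w', (w, w'))"])
       (auto simp: splits_def)
  also have "\<dots> = act n (f * g) P u"
    by (simp add: act_def times_series_def sum_distrib_right sum.Sigma)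
  finally show "act n (f * g) P u = act n f (act n g P) u" by simp
qed

lemma act_1: "act n 1 P = P"
proof
  fix u
  have "act n 1 P u = (\<Sum>w\<in>words n (length u). if w = [] then P u else 0)"
    unfolding act_def by (rule sum.cong) (auto simp: one_series_def)
  moreover have "[] \<in> words n (length u)" by (simp add: words_def)
  ultimately show "act n 1 P u = P u" by simp
qed

lemma act_gen:
  assumes "p \<in> pairs n"
  shows "act n (ncps_gen p) P = der (fst p) (snd p) P"
proof
  fix u
  have "act n (ncps_gen p) P u = (\<Sum>w\<in>words n (length u). if w = [p] then der (fst p) (snd p) P u else 0)"
    unfolding act_def by (rule sum.cong) (auto simp: ncps_gen_def)
  moreover have "[p] \<in> words n (length u) \<longleftrightarrow> u \<noteq> []"
    using assms by (cases u) (auto simp: words_def)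
  ultimately show "act n (ncps_gen p) P u = der (fst p) (snd p) P u"
    by (cases u) auto
qed

lemma act_V: "P \<in> V n \<Longrightarrow> act n f P \<in> V n"
proof -
  assume P: "P \<in> V n"
  have "act n f P u = 0" if "u \<notin> lists {1..n}" for u
    unfolding act_def using dw_V[OF _ P] that by (intro sum.neutral) (auto simp: words_def sring_carrier)
  then show ?thesis by (auto simp: sring_carrier)
qed

lemma relator_cases:
  assumes "r \<in> oriented_relators n"
  obtains (a) i j k where "{i, j, k} \<subseteq> {1..n}" "distinct [i, j, k]" "r = gv i k * gv j k - gv j k * gv i k"
    | (b) i j k where "{i, j, k} \<subseteq> {1..n}" "distinct [i, j, k]"
        "r = gv i j * (gv i k + gv j k) - (gv i k + gv j k) * gv i j"
    | (c) i j k l where "{i, j, k, l} \<subseteq> {1..n}" "distinct [i, j, k, l]" "r = gv i j * gv k l - gv k l * gv i j"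
proof -
  from assms have "(\<exists>i j k. r = gv i k * gv j k - gv j k * gv i k \<and> {i, j, k} \<subseteq> {1..n} \<and> distinct [i, j, k]) \<or>
     (\<exists>i j k. r = gv i j * (gv i k + gv j k) - (gv i k + gv j k) * gv i j \<and>
        {i, j, k} \<subseteq> {1..n} \<and> distinct [i, j, k]) \<or>
     (\<exists>i j k l. r = gv i j * gv k l - gv k l * gv i j \<and> {i, j, k, l} \<subseteq> {1..n} \<and> distinct [i, j, k, l])"
    unfolding oriented_relators_eq by (simp only: Un_iff mem_Collect_eq disj_assoc)
  then show thesis
  proof (elim disjE exE conjE)
    fix i j k assume "{i, j, k} \<subseteq> {1..n}" "distinct [i, j, k]" "r = gv i k * gv j k - gv j k * gv i k"
    then show thesis by (rule a)
  next
    fix i j k assume "{i, j, k} \<subseteq> {1..n}" "distinct [i, j, k]"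
      "r = gv i j * (gv i k + gv j k) - (gv i k + gv j k) * gv i j"
    then show thesis by (rule b)
  next
    fix i j k l assume "{i, j, k, l} \<subseteq> {1..n}" "distinct [i, j, k, l]" "r = gv i j * gv k l - gv k l * gv i j"
    then show thesis by (rule c)
  qed
qed

text \<open>The derivations satisfy the defining relations, so the action factors through the quotient.\<close>
lemma act_J:
  assumes "f \<in> FA.J n" "P \<in> V n"
  shows "act n f P = 0"
  using assms(2)
proof (rule FA.J_induct[OF assms(1), of "\<lambda>f. \<forall>P\<in>V n. act n f P = 0", rule_format, rotated -1])
  fix r P assume r: "r \<in> oriented_relators n" and P: "P \<in> V n"
  have ag: "act n (gv i j) Q = der i j Q" if "i \<in> {1..n}" "j \<in> {1..n}" "i \<noteq> j" for i j Q
    using act_gen[of "(i, j)" n Q] that by (simp add: pairs_def)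
  from r show "act n r P = 0"
  proof (cases rule: relator_cases)
    case (a i j k)
    then have "act n r P = der i k (der j k P) - der j k (der i k P)"
      by (simp add: act_simps act_mult ag)
    moreover have "der i k (der j k P) - der j k (der i k P) = 0"
      by (rule derivation_eq_0[OF is_der_commutator[OF is_der_der is_der_der] _ P])
         (use a in \<open>auto simp: der_X der_simps der_mult\<close>)
    ultimately show ?thesis by simp
  next
    case (b i j k)
    then have "act n r P = der i j (der i k P + der j k P) - (der i k (der i j P) + der j k (der i j P))"
      by (simp add: act_simps act_mult ag)
    moreover have "der i j (der i k P + der j k P) - (der i k (der i j P) + der j k (der i j P)) = 0"
      by (rule derivation_eq_0[OF is_der_commutator[OF is_der_der is_der_add[OF is_der_der is_der_der]] _ P])
         (use b in \<open>auto simp: der_X der_simps der_mult algebra_simps\<close>)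
    ultimately show ?thesis by simp
  next
    case (c i j k l)
    then have "act n r P = der i j (der k l P) - der k l (der i j P)"
      by (simp add: act_simps act_mult ag)
    moreover have "der i j (der k l P) - der k l (der i j P) = 0"
      by (rule derivation_eq_0[OF is_der_commutator[OF is_der_der is_der_der] _ P])
         (use c in \<open>auto simp: der_X der_simps der_mult\<close>)
    ultimately show ?thesis by simp
  qed
next
  fix f P assume lim: "\<And>d. \<exists>g\<in>FA.C n. (\<forall>P\<in>V n. act n g P = 0) \<and> (\<forall>w. mdeg w \<le> d \<longrightarrow> g w = f w)"
    and P: "P \<in> V n"
  have "act n f P u = 0" for u
  proof -
    obtain g where "act n g P = 0" "\<forall>w. mdeg w \<le> length u \<longrightarrow> g w = f w" using lim[of "length u"] P by blast
    then show ?thesis using cont_lin_agree[OF cont_lin_act, of "length u" g f u n P] by simp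
  qed
  then show "act n f P = 0" by (simp add: fun_eq_iff)
qed (auto simp: act_simps act_mult act_V cont_linD(4)[OF cont_lin_act_arg])

lemma act_eqJ: "FA.eqJ n f g \<Longrightarrow> P \<in> V n \<Longrightarrow> act n f P = act n g P"
  using act_J[of "f - g" n P] by (simp add: FA.eqJ_def act_simps)

section \<open>Exponentials of derivations\<close>

text \<open>The exponential of a derivation; it is defined because the derivation raises degrees.\<close>
definition exp_der :: "nat \<Rightarrow> nat \<Rightarrow> nat ncps \<Rightarrow> nat ncps" where
  "exp_der i j P = ssum (\<lambda>k. sc (1 / fact k) ((der i j ^^ k) P))"

lemma low_funpow_der: "low k ((der i j ^^ k) P)"
  by (induction k) (auto intro: low_der)

text \<open>Leibniz' rule for iterated derivations and the binomial theorem: the exponential of a derivation is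
multiplicative.\<close>
lemma exp_der_mult: "exp_der i j (P * Q) = exp_der i j P * exp_der i j Q"
proof -
  let ?T = "\<lambda>a b. (der i j ^^ a) P * (der i j ^^ b) Q"
  have "exp_der i j P * exp_der i j Q =
      ssum (\<lambda>k. \<Sum>a\<le>k. sc (1 / fact a * (1 / fact (k - a))) (?T a (k - a)))"
    unfolding exp_der_def by (subst ssum_mult) (auto intro!: low_sc low_funpow_der simp: mult.commute)
  moreover have "sc (1 / fact k) ((der i j ^^ k) (P * Q)) =
      (\<Sum>a\<le>k. sc (1 / fact a * (1 / fact (k - a))) (?T a (k - a)))" for k
    using binomial_iterate[OF cont_lin_der, where T = ?T and k = k, of i j] by (simp add: der_mult)
  ultimately show ?thesis by (simp add: exp_der_def)
qed

lemma funpow_der_0: "der i j P = 0 \<Longrightarrow> (der i j ^^ k) P = (if k = 0 then P else 0)"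
  by (induction k) (auto simp: der_simps)

lemma exp_der_fixed:
  assumes "der i j P = 0" shows "exp_der i j P = P"
proof
  fix u
  have "exp_der i j P u = (\<Sum>k\<le>mdeg u. if k = 0 then P u else 0)"
    unfolding exp_der_def ssum_def by (rule sum.cong) (auto simp: funpow_der_0[OF assms] sc_apply)
  then show "exp_der i j P u = P u" by simp
qed

lemma act_exps_gen:
  assumes "(i, j) \<in> pairs n"
  shows "act n (exps (gv i j)) P = exp_der i j P"
proof -
  have "act n (gv i j ^ k) P = (der i j ^^ k) P" for k
    by (induction k) (simp_all add: act_1 act_mult act_gen[OF assms])
  moreover have "act n (exps (gv i j)) P = ssum (\<lambda>k. act n (sc (1 / fact k) (gv i j ^ k)) P)"
    unfolding exps_eq_ssum
    by (rule cont_lin_ssum[OF cont_lin_act]) (auto intro!: low_sc low_power)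
  ultimately show ?thesis by (simp add: exp_der_def act_simps)
qed

lemma commutator_step: "(x * c - c * x) * y + x * (y * c - c * y) = x * y * c - c * (x * y)"
  for x y c :: "'r::ring_1"
  by (simp add: algebra_simps)

text \<open>The derivation acts on \<open>X\<^sub>a\<close> as an inner derivation, and then it does so on all powers.\<close>
lemma der_exps_X:
  assumes "der i j (X a) = X a * c - c * X a"
  shows "der i j (exps (X a)) = exps (X a) * c - c * exps (X a)"
proof -
  have pw: "der i j (X a ^ k) = X a ^ k * c - c * X a ^ k" for k
  proof (induction k)
    case (Suc k)
    show ?case by (simp only: power_Suc der_mult assms Suc commutator_step)
  qed (simp add: der_1)
  let ?p = "\<lambda>k. sc (1 / fact k) (X a ^ k)"
  have low: "low k (?p k)" for k by (auto intro!: low_sc low_power)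
  have "der i j (exps (X a)) = ssum (\<lambda>k. der i j (?p k))"
    unfolding exps_eq_ssum by (rule cont_lin_ssum[OF cont_lin_der low])
  moreover have "exps (X a) * c - c * exps (X a) = ssum (\<lambda>k. ?p k * c - c * ?p k)"
    unfolding exps_eq_ssum by (rule cont_lin_ssum[OF cont_lin_diff[OF cont_lin_mult(2) cont_lin_mult(1)] low])
  moreover have "der i j (?p k) = ?p k * c - c * ?p k" for k
    by (simp add: der_simps pw sc_diff)
  ultimately show ?thesis by simp
qed

text \<open>On \<open>exp X\<^sub>i\<close> the derivation is the commutator with \<open>X\<^sub>j\<close>, which it kills; the exponential of a commutator is
a conjugation.\<close>
lemma exp_der_exps_X:
  assumes "i \<noteq> j"
  shows "exp_der i j (exps (X a)) = (if a = i then exps (- X j) * exps (X i) * exps (X j) else exps (X a))"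
proof (cases "a = i")
  case False
  then have "der i j (exps (X a)) = 0" using der_exps_X[of i j a 0] assms by (simp add: der_X)
  then show ?thesis using False by (simp add: exp_der_fixed)
next
  case True
  let ?E = "exps (X i)"
  let ?T = "\<lambda>a b. (- X j) ^ a * ?E * X j ^ b"
  have dE: "der i j ?E = ?E * X j - X j * ?E" using der_exps_X[of i j i "X j"] assms by (simp add: der_X)
  have d0: "der i j (X j ^ b) = 0" "der i j ((- X j) ^ b) = 0" for b
    using assms by (induction b) (simp_all add: der_1 der_mult der_X der_simps)
  have T: "der i j (?T a b) = ?T (Suc a) b + ?T a (Suc b)" for a b
    by (simp add: der_mult d0 dE power_commutes[symmetric] algebra_simps)
  have "exp_der i j ?E = ssum (\<lambda>k. \<Sum>a\<le>k. sc (1 / fact a * (1 / fact (k - a))) (?T a (k - a)))"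
    unfolding exp_der_def using binomial_iterate[OF cont_lin_der, where T = ?T, OF T] by simp
  also have "\<dots> = ssum (\<lambda>a. sc (1 / fact a) ((- X j) ^ a * ?E)) * ssum (\<lambda>b. sc (1 / fact b) (X j ^ b))"
  proof (subst ssum_mult)
    show "low k (sc (1 / fact k) ((- X j) ^ k * ?E))" for k
      using low_mult[OF low_power[of "- X j" k] low_0[of ?E]] by (intro low_sc) simp
  qed (auto intro!: low_sc low_power simp: mult.commute)
  also have "ssum (\<lambda>a. sc (1 / fact a) ((- X j) ^ a * ?E)) = exps (- X j) * ?E"
  proof -
    have "exps (- X j) * ?E = ssum (\<lambda>a. sc (1 / fact a) ((- X j) ^ a) * ?E)"
      unfolding exps_eq_ssum[of "- X j"]
      by (rule cont_lin_ssum[OF cont_lin_mult(2)]) (auto intro!: low_sc low_power)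
    then show ?thesis by simp
  qed
  finally show ?thesis using True by (simp add: exps_eq_ssum)
qed

section \<open>The Magnus embedding\<close>

definition Mletter :: "nat \<times> bool \<Rightarrow> nat ncps" where
  "Mletter l = exps (if snd l then X (fst l) else - X (fst l))"

definition Mword :: "nat gword \<Rightarrow> nat ncps" where
  "Mword w = foldr (\<lambda>l P. Mletter l * P) w 1"

lemma Mword_simps [simp]: "Mword [] = 1" "Mword (l # w) = Mletter l * Mword w"
  "Mword (u @ v) = Mword u * Mword v"
proof -
  show "Mword [] = 1" "Mword (l # w) = Mletter l * Mword w" by (simp_all add: Mword_def)
  then show "Mword (u @ v) = Mword u * Mword v" by (induction u) (simp_all add: Mword_def mult.assoc)
qed

lemma Mletter_cancel: "Mletter (x, b) * Mletter (x, \<not> b) = 1"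
  using exps_minus[of "X x"] by (cases b) (simp_all add: Mletter_def)

lemma Mword_eq: "word_eq A {} u v \<Longrightarrow> Mword u = Mword v"
  by (induction rule: word_eq.induct) (simp_all add: Mletter_cancel)

text \<open>The embedding \<open>x\<^sub>i \<mapsto> exp X\<^sub>i\<close> of the free group into the power series.\<close>
definition magnus :: "fg_elem \<Rightarrow> nat ncps" where
  "magnus A = the_elem (Mword ` A)"

lemma magnus_cw: "w \<in> W n \<Longrightarrow> magnus (cw n w) = Mword w"
proof -
  assume w: "w \<in> W n"
  have "Mword v = Mword w" if "v \<in> cw n w" for v
    using that unfolding mem_wcl by (simp add: Mword_eq)
  then have "Mword ` cw n w = {Mword w}" using wcl_self[OF w, of "{}"] by blast
  then show ?thesis by (simp add: magnus_def)
qed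

lemma magnus_mult: "x \<in> carrier (FG n) \<Longrightarrow> y \<in> carrier (FG n) \<Longrightarrow> magnus (x \<otimes>\<^bsub>FG n\<^esub> y) = magnus x * magnus y"
  by (auto simp: FG_carrier FG_mult magnus_cw)

lemma magnus_one: "magnus (\<one>\<^bsub>FG n\<^esub>) = 1"
  by (simp add: FG_one magnus_cw)

lemma magnus_gen: "i \<in> {1..n} \<Longrightarrow> magnus (gen n i) = exps (X i)"
  by (simp add: gen_eq magnus_cw Mletter_def)

lemma magnus_inv_gen: "i \<in> {1..n} \<Longrightarrow> magnus (inv\<^bsub>FG n\<^esub> (gen n i)) = exps (- X i)"
  by (simp add: gen_eq FG_inv magnus_cw Mletter_def)

lemma Mword_V: "w \<in> W n \<Longrightarrow> Mword w \<in> V n"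
proof (induction w)
  case (Cons l w)
  then have "X (fst l) \<in> V n" by (intro gen_carrier) simp
  then have "Mletter l \<in> V n" by (auto simp: Mletter_def exps_def intro!: free_quotient.C_psub)
  then show ?case using Cons by (simp add: free_quotient.C_mult)
qed simp

lemma magnus_V: "x \<in> carrier (FG n) \<Longrightarrow> magnus x \<in> V n"
  by (auto simp: FG_carrier magnus_cw Mword_V)

text \<open>Multiplicative maps from a free group to a ring are determined on the generators.\<close>
lemma multiplicative_eqI:
  fixes h k :: "fg_elem \<Rightarrow> 'r::ring_1"
  assumes h: "\<And>x y. x \<in> carrier (FG n) \<Longrightarrow> y \<in> carrier (FG n) \<Longrightarrow> h (x \<otimes>\<^bsub>FG n\<^esub> y) = h x * h y" "h \<one>\<^bsub>FG n\<^esub> = 1"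
    and k: "\<And>x y. x \<in> carrier (FG n) \<Longrightarrow> y \<in> carrier (FG n) \<Longrightarrow> k (x \<otimes>\<^bsub>FG n\<^esub> y) = k x * k y" "k \<one>\<^bsub>FG n\<^esub> = 1"
    and eq: "\<And>i. i \<in> {1..n} \<Longrightarrow> h (gen n i) = k (gen n i)" and x: "x \<in> carrier (FG n)"
  shows "h x = k x"
proof -
  interpret group "FG n" by (rule FG_group)
  have letter: "h (cw n [l]) = k (cw n [l])" if "fst l \<in> {1..n}" for l
  proof (cases "snd l")
    case True
    then have "cw n [l] = gen n (fst l)" by (simp add: gen_eq prod_eq_iff[symmetric]) (metis prod.collapse)
    then show ?thesis using eq that by simp
  next
    case False
    let ?g = "gen n (fst l)"
    have l: "cw n [l] = inv\<^bsub>FG n\<^esub> ?g"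
      using that False by (simp add: gen_eq FG_inv) (metis prod.collapse)
    have g: "?g \<in> carrier (FG n)" using that by simp
    have "h (inv\<^bsub>FG n\<^esub> ?g) * h ?g = 1" "k ?g * k (inv\<^bsub>FG n\<^esub> ?g) = 1"
      using g h(1)[of "inv\<^bsub>FG n\<^esub> ?g" ?g] k(1)[of ?g "inv\<^bsub>FG n\<^esub> ?g"] h(2) k(2) by simp_all
    then have "h (inv\<^bsub>FG n\<^esub> ?g) = h (inv\<^bsub>FG n\<^esub> ?g) * (k ?g * k (inv\<^bsub>FG n\<^esub> ?g))" by simp
    also have "\<dots> = (h (inv\<^bsub>FG n\<^esub> ?g) * h ?g) * k (inv\<^bsub>FG n\<^esub> ?g)" using eq that by (simp add: mult.assoc)
    finally show ?thesis using \<open>h (inv\<^bsub>FG n\<^esub> ?g) * h ?g = 1\<close> by (simp add: l)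
  qed
  have "h (cw n w) = k (cw n w)" if "w \<in> W n" for w
    using that
  proof (induction w)
    case Nil
    then show ?case using h(2) k(2) by (simp add: FG_one)
  next
    case (Cons l w)
    then have "cw n (l # w) = cw n [l] \<otimes>\<^bsub>FG n\<^esub> cw n w" by (simp add: FG_mult)
    then show ?case using Cons letter[of l] h(1)[of "cw n [l]" "cw n w"] k(1)[of "cw n [l]" "cw n w"] by simp
  qed
  then show ?thesis using x by (auto simp: FG_carrier)
qed

text \<open>Both sides are multiplicative in \<open>x\<close>, and they agree on generators: \<open>exp v\<^sub>i\<^sub>j\<close> acts on the image of the
free group as \<open>a\<^sub>i\<^sub>j\<close>.\<close>
lemma exp_der_magnus:
  assumes ij: "admissible n i j" and x: "x \<in> carrier (FG n)"
  shows "exp_der i j (magnus x) = magnus (aut_gen n i j x)"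
proof (rule multiplicative_eqI[OF _ _ _ _ _ x])
  have ij': "i \<in> {1..n}" "j \<in> {1..n}" "i \<noteq> j" using ij by (auto simp: admissible_def)
  have hom: "aut_gen n i j \<in> hom (FG n) (FG n)" using ij' by (simp add: aut_gen_eq_move move_hom)
  note a = FG_hom_simps[OF hom]
  show "exp_der i j (magnus (\<one>\<^bsub>FG n\<^esub>)) = 1" by (simp add: magnus_one exp_der_fixed der_1)
  show "magnus (aut_gen n i j (\<one>\<^bsub>FG n\<^esub>)) = 1" using hom_one[OF hom FG_group FG_group] by (simp add: magnus_one)
  fix a assume "a \<in> {1..n}"
  then show "exp_der i j (magnus (gen n a)) = magnus (aut_gen n i j (gen n a))"
    using ij' FG_group[of n] magnus_mult[of "inv\<^bsub>FG n\<^esub> (gen n j) \<otimes>\<^bsub>FG n\<^esub> gen n i" n "gen n j"]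
      magnus_mult[of "inv\<^bsub>FG n\<^esub> (gen n j)" n "gen n i"]
    by (simp add: aut_gen_eq_move move_apply signed_def magnus_gen exp_der_exps_X magnus_inv_gen
        group.is_monoid monoid.m_closed)
next
  fix x y assume xy: "x \<in> carrier (FG n)" "y \<in> carrier (FG n)"
  then show "exp_der i j (magnus (x \<otimes>\<^bsub>FG n\<^esub> y)) = exp_der i j (magnus x) * exp_der i j (magnus y)"
    by (simp add: magnus_mult exp_der_mult)
  have "aut_gen n i j \<in> hom (FG n) (FG n)" using ij by (simp add: aut_gen_eq_move move_hom admissible_def)
  from FG_hom_simps(1,2)[OF this] show "magnus (aut_gen n i j (x \<otimes>\<^bsub>FG n\<^esub> y)) = magnus (aut_gen n i j x) * magnus (aut_gen n i j y)"
    using xy by (simp add: magnus_mult)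
qed

lemma exps_X_apply: "exps (sc c (X i)) u = (if u = replicate (length u) i then c ^ length u / fact (length u) else 0)"
proof -
  have pw: "(sc c (X i) ^ k) u = (if u = replicate k i then c ^ k else 0)" for k u
  proof (induction k arbitrary: u)
    case (Suc k)
    have 1: "(sc c (X i) ^ Suc k) u = c * (X i * sc c (X i) ^ k) u"
      by (simp only: power_Suc sc_simps(5)) (simp only: sc_apply)
    show ?case unfolding 1 X_mult by (cases u) (auto simp: Suc)
  qed (simp add: one_series_def)
  have "exps (sc c (X i)) u = (\<Sum>k\<le>length u. if k = length u then
      (if u = replicate (length u) i then c ^ length u / fact (length u) else 0) else 0)"
    unfolding exps_eq_ssum ssum_def mdeg_list_def
    by (intro sum.cong refl) (auto simp: sc_apply pw dest: arg_cong[where f = length])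
  then show ?thesis by simp
qed

lemma sum_atMost_split2: "(\<Sum>k\<le>Suc m. F k) = F 0 + (F (Suc 0) + (\<Sum>k<m. F (Suc (Suc k))))"
  for F :: "nat \<Rightarrow> rat"
  by (induction m) (auto simp: algebra_simps)

text \<open>A word without equal neighbours starts with at most one letter \<open>X\<^sub>i\<close>, so only the terms of degree at most
one of the exponential contribute.\<close>
lemma exps_X_mult_apply:
  assumes "distinct_adj t"
  shows "(exps (sc c (X i)) * Q) t = Q t + (if t \<noteq> [] \<and> hd t = i then c * Q (tl t) else 0)"
proof (cases t)
  case (Cons a t')
  have "(exps (sc c (X i)) * Q) t = (\<Sum>k\<le>Suc (length t'). exps (sc c (X i)) (take k t) * Q (drop k t))"
    by (simp add: times_list Cons)
  also have "\<dots> = Q t + (exps (sc c (X i)) [a] * Q t' +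
      (\<Sum>k<length t'. exps (sc c (X i)) (take (Suc (Suc k)) t) * Q (drop (Suc (Suc k)) t)))"
    by (subst sum_atMost_split2) (simp add: exps_X_apply[of _ _ "[]"] Cons)
  also have "(\<Sum>k<length t'. exps (sc c (X i)) (take (Suc (Suc k)) t) * Q (drop (Suc (Suc k)) t)) = 0"
  proof (intro sum.neutral ballI)
    fix k assume "k \<in> {..<length t'}"
    then obtain b t'' where t': "t' = b # t''" by (cases t') auto
    have "a \<noteq> b" using assms by (simp add: Cons t')
    then show "exps (sc c (X i)) (take (Suc (Suc k)) t) * Q (drop (Suc (Suc k)) t) = 0"
      by (auto simp: exps_X_apply Cons t')
  qed
  finally show ?thesis by (simp add: Cons exps_X_apply[of c i "[a]"])
qed (simp add: exps_X_apply[of c i "[]"])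

lemma Mletter_replicate: "Mword (replicate e l) = exps (sc (of_nat e * (if snd l then 1 else - 1)) (X (fst l)))"
proof (induction e)
  case (Suc e)
  let ?s = "if snd l then 1 else - 1 :: rat"
  have "Mletter l = exps (sc ?s (X (fst l)))" by (simp add: Mletter_def)
  moreover have "sc ?s (X (fst l)) + sc (of_nat e * ?s) (X (fst l)) = sc (of_nat (Suc e) * ?s) (X (fst l))"
    by (simp only: sc_add(2)[symmetric]) (simp add: algebra_simps)
  moreover have "exps (sc ?s (X (fst l)) + sc (of_nat e * ?s) (X (fst l))) =
      exps (sc ?s (X (fst l))) * exps (sc (of_nat e * ?s) (X (fst l)))"
    by (rule exps_add) (simp_all add: sc_apply mult.commute)
  ultimately show ?case using Suc by simp
qed simp

lemma reduced_decompose: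
  assumes "reduced w" "w \<noteq> []"
  obtains e l w' where "w = replicate (Suc e) l @ w'" "reduced w'" "w' = [] \<or> fst (hd w') \<noteq> fst l"
proof -
  obtain l v where w: "w = l # v" using assms by (cases w) auto
  define t where "t = takeWhile (\<lambda>m. m = l) v"
  define w' where "w' = dropWhile (\<lambda>m. m = l) v"
  have t: "t = replicate (length t) l" unfolding t_def
    by (rule replicate_length_same[symmetric]) (auto dest: set_takeWhileD)
  have eq: "w = replicate (Suc (length t)) l @ w'"
    using t w by (simp add: t_def w'_def)
  have "reduced w'" using assms(1) unfolding eq by (simp only: reduced_append)
  moreover have "fst (hd w') \<noteq> fst l" if "w' \<noteq> []"
  proof -
    have "hd w' \<noteq> l" using hd_dropWhile[of "\<lambda>m. m = l" v] that by (simp add: w'_def)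
    moreover have "hd w' \<noteq> flip l" using assms(1) that unfolding eq by (auto simp: reduced_append last_replicate simp del: replicate_Suc)
    ultimately show ?thesis by (auto simp: prod_eq_iff)
  qed
  ultimately show ?thesis using eq that by blast
qed

text \<open>The coefficient of the image of \<open>x\<^sub>p\<^sup>c x\<^sub>q\<^sup>d \<dots>\<close>, with different neighbouring generators and nonzero exponents,
at the word \<open>X\<^sub>p X\<^sub>q \<dots>\<close> is the product of the exponents. The vanishing at longer words without equal
neighbours is what the induction needs.\<close>
lemma Mword_leading:
  assumes "reduced w"
  shows "\<exists>s. distinct_adj s \<and> (s = [] \<longleftrightarrow> w = []) \<and> (w \<noteq> [] \<longrightarrow> hd s = fst (hd w)) \<and> Mword w s \<noteq> 0 \<and>
    (\<forall>t. distinct_adj t \<longrightarrow> length t > length s \<longrightarrow> Mword w t = 0)"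
  using assms
proof (induction "length w" arbitrary: w rule: less_induct)
  case less
  show ?case
  proof (cases "w = []")
    case True
    then show ?thesis by (auto simp: one_series_def)
  next
    case False
    from reduced_decompose[OF less.prems False] obtain e l w' where w: "w = replicate (Suc e) l @ w'"
      "reduced w'" "w' = [] \<or> fst (hd w') \<noteq> fst l" .
    define c :: rat where "c = of_nat (Suc e) * (if snd l then 1 else - 1)"
    have c: "c \<noteq> 0" using of_nat_neq_0[of e, where ?'a = rat] by (simp add: c_def del: of_nat_Suc)
    have M: "Mword w = exps (sc c (X (fst l))) * Mword w'"
      by (simp only: w(1) Mword_simps(3) Mletter_replicate c_def)
    obtain s where s: "distinct_adj s" "s = [] \<longleftrightarrow> w' = []" "w' \<noteq> [] \<longrightarrow> hd s = fst (hd w')" "Mword w' s \<noteq> 0"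
      "\<And>t. distinct_adj t \<Longrightarrow> length t > length s \<Longrightarrow> Mword w' t = 0"
      using less.hyps[of w'] w by auto
    have d: "distinct_adj (fst l # s)" using s w(3) by (cases s) auto
    show ?thesis
    proof (intro exI[of _ "fst l # s"] conjI allI impI)
      show "Mword w (fst l # s) \<noteq> 0"
        using s(4) s(5)[OF d] c by (simp add: M exps_X_mult_apply[OF d])
      show "hd (fst l # s) = fst (hd w)" by (simp add: w(1))
      fix t :: "nat list" assume t: "distinct_adj t" "length t > length (fst l # s)"
      have "distinct_adj (tl t)" using t(1) by (cases t) (auto dest: distinct_adj_ConsD)
      then show "Mword w t = 0"
        using s(5)[OF t(1)] s(5)[of "tl t"] t by (simp add: M exps_X_mult_apply)
    qed (use d False in auto)
  qed
qed

text \<open>A nonempty reduced word has a nonzero coefficient in positive degree.\<close>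
lemma magnus_inj:
  assumes "x \<in> carrier (FG n)" "y \<in> carrier (FG n)" "magnus x = magnus y"
  shows "x = y"
proof -
  interpret group "FG n" by (rule FG_group)
  let ?z = "x \<otimes>\<^bsub>FG n\<^esub> inv\<^bsub>FG n\<^esub> y"
  have "magnus ?z = magnus (y \<otimes>\<^bsub>FG n\<^esub> inv\<^bsub>FG n\<^esub> y)" using assms by (simp only: magnus_mult inv_closed)
  then have 1: "magnus ?z = 1" using assms by (simp add: magnus_one)
  have z: "?z \<in> carrier (FG n)" using assms by simp
  then obtain w where w: "w \<in> W n" "reduced w" "?z = cw n w"
    unfolding FG_def by (rule free_carrier_reduced)
  have "w = []"
  proof (rule ccontr)
    assume "w \<noteq> []"
    then obtain s where "s \<noteq> []" "Mword w s \<noteq> 0" using Mword_leading[OF w(2)] by blast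
    then show False using 1 w magnus_cw[OF w(1)] by (simp add: one_series_def)
  qed
  then have "?z = \<one>\<^bsub>FG n\<^esub>" using w by (simp add: FG_one)
  then show ?thesis using assms by (metis inv_closed inv_inv inv_equality)
qed

section \<open>Faithfulness\<close>

lemma o_exp_vgen: "(i, j) \<in> pairs n \<Longrightarrow> o_exp n (vgen n i j) = FA.cls n (exps (gv i j))"
proof -
  assume "(i, j) \<in> pairs n"
  then have "gv i j \<in> FA.C n" by (rule gen_carrier)
  moreover have "vgen n i j = FA.cls n (gv i j)"
    by (simp add: vgen_def FA.cls_def rel_ideal_eq ncps_ring_eq_sring)
  ultimately show ?thesis using o_exp_cls[of "gv i j" n] by simp
qed

lemma admissible_pairs: "admissible n i j \<longleftrightarrow> (i, j) \<in> pairs n"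
  by (auto simp: admissible_def pairs_def)

lemma group_like_exps_gen:
  assumes "(i, j) \<in> pairs n" shows "group_like n (exps (gv i j))"
proof -
  have g: "gv i j \<in> FA.C n" using assms by (rule gen_carrier)
  then have "ncps_tensor (gv i j) 1 + ncps_tensor 1 (gv i j) \<in> FA2.C n"
    by (intro FA2.C_closed tensor_carrier) auto
  then show ?thesis
    using g primitive_gen[of "(i, j)"] by (intro group_like_exps) (simp_all add: primitive_def FA2.eqJ_refl)
qed

text \<open>Through the action, \<open>R c\<close> acts on the image of \<open>F\<^sub>n\<close> in the power series as \<open>c\<close> acts on \<open>F\<^sub>n\<close>.\<close>
lemma R_acts:
  assumes R: "is_R n R" and a: "a \<in> carrier (BC n)"
    and f: "group_like n f" "R a = FA.cls n f" and x: "x \<in> carrier (FG n)"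
  shows "act n f (magnus x) = magnus (a x)"
proof -
  have hom: "R \<in> hom (BC n) (exp_lie n)"
    and gen: "\<And>i j. admissible n i j \<Longrightarrow> R (aut_gen n i j) = FA.cls n (exps (gv i j))"
    using R by (auto simp: is_R_def admissible_pairs o_exp_vgen)
  have act_cong: "act n f (magnus x) = act n g (magnus x)"
    if "group_like n f" "group_like n g" "FA.cls n f = FA.cls n g" "x \<in> carrier (FG n)" for f g x
    using that act_eqJ[of n f g "magnus x"] by (simp add: FA.cls_eq_iff group_like_C magnus_V)
  have rep: "\<exists>f. group_like n f \<and> R a = FA.cls n f" if "a \<in> carrier (BC n)" for a
    using hom_in_carrier[OF hom that] by (auto simp: exp_lie_carrier)
  have Rmult: "R (a \<otimes>\<^bsub>BP n\<^esub> b) = FA.cls n (f * g)"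
    if "a \<in> carrier (BC n)" "b \<in> carrier (BC n)" "group_like n f" "R a = FA.cls n f"
      "group_like n g" "R b = FA.cls n g" for a b f g
    using hom_mult[OF hom that(1,2)] that by (simp add: OA_simps group_like_C)
  have R1: "R \<one>\<^bsub>BP n\<^esub> = FA.cls n 1"
    using hom_one[OF hom BC_group group_exp_lie] by (simp add: OA_simps)
  have move: "act n h (magnus x) = magnus (move n i k e x)"
    if ik: "admissible n i k" and h: "group_like n h" "R (move n i k e) = FA.cls n h" and x: "x \<in> carrier (FG n)"
    for i k e h x
  proof (cases e)
    case True
    have "act n h (magnus x) = act n (exps (gv i k)) (magnus x)"
      using h x True gen[OF ik] group_like_exps_gen[of i k n] ik
      by (intro act_cong) (auto simp: aut_gen_eq_move admissible_pairs)
    then show ?thesis using ik x True by (simp add: act_exps_gen admissible_pairs[symmetric] exp_der_magnus aut_gen_eq_move)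
  next
    case False
    have ik': "i \<in> {1..n}" "k \<in> {1..n}" "i \<noteq> k" using ik by (auto simp: admissible_def)
    have mBC: "move n i k b \<in> carrier (BC n)" for b using ik' by (rule move_BC)
    let ?g = "exps (gv i k)"
    have g: "group_like n ?g" "R (move n i k True) = FA.cls n ?g"
      using group_like_exps_gen[of i k n] gen[OF ik] ik by (auto simp: admissible_pairs aut_gen_eq_move)
    define y where "y = move n i k False x"
    have y: "y \<in> carrier (FG n)" unfolding y_def using FG_hom_simps(1)[OF move_hom(1)[OF ik']] x by simp
    have xy: "x = move n i k True y"
      unfolding y_def using BP_apply[OF move_BP[OF ik'] move_BP[OF ik'] x, of True False] move_cancel[OF ik', of True]
        BP_one_apply[OF x] by simp
    have "FA.cls n (h * ?g) = FA.cls n 1"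
      using Rmult[OF mBC mBC h(1) _ g, of False] h(2) False move_cancel[OF ik', of False] R1 by simp
    moreover have "act n ?g (magnus y) = magnus x"
      using ik y by (simp add: act_exps_gen admissible_pairs[symmetric] exp_der_magnus xy aut_gen_eq_move)
    ultimately have "act n h (magnus x) = act n 1 (magnus y)"
      using act_cong[OF group_like_mult[OF h(1) g(1)] group_like_1 _ y] by (simp add: act_mult)
    then show ?thesis using False by (simp add: act_1 y_def)
  qed
  show ?thesis
    using a f x
  proof (induction arbitrary: f x rule: BC_induct)
    case one
    then show ?case using act_cong[OF one(1) group_like_1] R1 by (simp add: act_1 BP_one_apply)
  next
    case (mv a i k e)
    have mBC: "move n i k e \<in> carrier (BC n)" using mv(2) by (simp add: admissible_def move_BC)
    obtain f0 h where f0: "group_like n f0" "R a = FA.cls n f0" and h: "group_like n h" "R (move n i k e) = FA.cls n h"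
      using rep mv(1) mBC by meson
    have "act n f (magnus x) = act n (f0 * h) (magnus x)"
      using mv.prems Rmult[OF mv(1) mBC f0 h] by (intro act_cong group_like_mult f0 h) auto
    also have "\<dots> = act n f0 (magnus (move n i k e x))"
      using move[OF mv(2) h mv.prems(3)] by (simp add: act_mult)
    also have "\<dots> = magnus (a (move n i k e x))"
      using mv.IH[OF f0] BP_hom_simps(1)[OF BC_BP[OF mBC] mv.prems(3)] by simp
    finally show ?case using BP_apply[OF BC_BP[OF mv(1)] BC_BP[OF mBC] mv.prems(3)] by simp
  qed
qed

text \<open>The automorphism is recovered from its value through the action and the Magnus embedding.\<close>
lemma R_inj:
  assumes R: "is_R n R"
  shows "inj_on R (carrier (BC n))"
proof (rule inj_onI)
  fix a b assume ab: "a \<in> carrier (BC n)" "b \<in> carrier (BC n)" "R a = R b"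
  have "R \<in> hom (BC n) (exp_lie n)" using R by (simp add: is_R_def)
  then have "R a \<in> carrier (exp_lie n)" using ab(1) by (rule hom_in_carrier)
  then obtain f where f: "group_like n f" "R a = FA.cls n f" by (auto simp: exp_lie_carrier)
  show "a = b"
  proof (rule BP_eqI)
    fix i assume "i \<in> {1..n}"
    then have i: "gen n i \<in> carrier (FG n)" by simp
    have "magnus (a (gen n i)) = magnus (b (gen n i))"
      using R_acts[OF R ab(1) f i] R_acts[OF R ab(2) f(1) _ i] ab(3) f(2) by simp
    then show "a (gen n i) = b (gen n i)"
      using i ab BP_hom_simps(1)[OF BC_BP] by (intro magnus_inj[of _ n]) auto
  qed (use ab BC_BP in auto)
qed

section \<open>Existence and uniqueness of the universal representation\<close>

lemma cls_mult_eq: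
  assumes "f \<in> FA.C n" "g \<in> FA.C n" "f' \<in> FA.C n" "g' \<in> FA.C n" "FA.eqJ n (f * g) (f' * g')"
  shows "FA.cls n f \<otimes>\<^bsub>OA n\<^esub> FA.cls n g = FA.cls n f' \<otimes>\<^bsub>OA n\<^esub> FA.cls n g'"
  using assms by (simp add: OA_simps FA.cls_eq_iff)

lemma relator_eqJ:
  assumes "f * g - g * f \<in> oriented_relators n" "f \<in> FA.C n" "g \<in> FA.C n"
  shows "FA.eqJ n (f * g) (g * f)"
  using assms FA.G_J by (auto simp: FA.eqJ_def)

text \<open>The relation of \<open>v\<^sub>i\<^sub>j\<close> with \<open>v\<^sub>i\<^sub>k + v\<^sub>j\<^sub>k\<close> becomes one with \<open>exp v\<^sub>i\<^sub>k exp v\<^sub>j\<^sub>k\<close> because \<open>v\<^sub>i\<^sub>k\<close> and \<open>v\<^sub>j\<^sub>k\<close> commute.\<close>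
lemma mccool_relations_exp_lie: "mccool_relations n (exp_lie n) (\<lambda>i k. o_exp n (vgen n i k))"
proof -
  let ?g = "\<lambda>i k. o_exp n (vgen n i k)"
  have gC: "gv i k \<in> FA.C n" if "admissible n i k" for i k
    using that by (auto simp: admissible_pairs intro: gen_carrier)
  have g: "?g i k = FA.cls n (exps (gv i k))" "exps (gv i k) \<in> FA.C n" if "admissible n i k" for i k
    using that gC[OF that] by (auto simp: admissible_pairs o_exp_vgen exps_def)
  have closed: "?g i k \<in> carrier (exp_lie n)" if "admissible n i k" for i k
    using that g group_like_exps_gen by (auto simp: exp_lie_carrier admissible_pairs)
  show ?thesis
    unfolding mccool_relations_def
  proof (intro conjI allI impI)
    show "group (exp_lie n)" by (rule group_exp_lie)
    show "?g i k \<in> carrier (exp_lie n)" if "admissible n i k" for i k using closed[OF that] .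
    fix i j k
    {
      assume *: "{i, j, k} \<subseteq> {1..n}" "distinct [i, j, k]"
      then have adm: "admissible n i k" "admissible n j k" "admissible n i j" by (auto simp: admissible_def)
      have r1: "gv i k * gv j k - gv j k * gv i k \<in> oriented_relators n"
        unfolding oriented_relators_eq using * by blast
      have r2: "gv i j * (gv i k + gv j k) - (gv i k + gv j k) * gv i j \<in> oriented_relators n"
        unfolding oriented_relators_eq using * by blast
      note c1 = relator_eqJ[OF r1 gC gC, OF adm(1,2)]
      have sum: "gv i k + gv j k \<in> FA.C n" using gC adm by auto
      note c2 = relator_eqJ[OF r2 gC sum, OF adm(3)]
      show "?g i k \<otimes>\<^bsub>exp_lie n\<^esub> ?g j k = ?g j k \<otimes>\<^bsub>exp_lie n\<^esub> ?g i k"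
        using adm g FA.eqJ_exps_exps_commute[OF gC gC c1, OF adm(1,2)] by (simp add: cls_mult_eq)
      have add: "FA.eqJ n (exps (gv i k) * exps (gv j k)) (exps (gv i k + gv j k))"
        using FA.eqJ_exps_add[OF gC gC c1, OF adm(1,2)] by (simp add: FA.eqJ_sym)
      have comm: "FA.eqJ n (exps (gv i j) * exps (gv i k + gv j k)) (exps (gv i k + gv j k) * exps (gv i j))"
        by (rule FA.eqJ_exps_exps_commute[OF gC[OF adm(3)] sum c2]) simp_all
      have "FA.eqJ n (exps (gv i j) * (exps (gv i k) * exps (gv j k))) ((exps (gv i k) * exps (gv j k)) * exps (gv i j))"
        using FA.eqJ_trans[OF FA.eqJ_trans[OF FA.eqJ_mult[OF FA.eqJ_refl[OF g(2)[OF adm(3)]] add] comm]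
          FA.eqJ_mult[OF FA.eqJ_sym[OF add] FA.eqJ_refl[OF g(2)[OF adm(3)]]]] .
      then show "?g i j \<otimes>\<^bsub>exp_lie n\<^esub> (?g i k \<otimes>\<^bsub>exp_lie n\<^esub> ?g j k) =
          ?g i k \<otimes>\<^bsub>exp_lie n\<^esub> ?g j k \<otimes>\<^bsub>exp_lie n\<^esub> ?g i j"
        using adm g by (simp add: OA_simps FA.C_mult FA.cls_eq_iff)
    }
    fix l assume *: "{i, j, k, l} \<subseteq> {1..n}" "distinct [i, j, k, l]"
    then have adm: "admissible n i j" "admissible n k l" by (auto simp: admissible_def)
    have r3: "gv i j * gv k l - gv k l * gv i j \<in> oriented_relators n"
      unfolding oriented_relators_eq using * by blast
    show "?g i j \<otimes>\<^bsub>exp_lie n\<^esub> ?g k l = ?g k l \<otimes>\<^bsub>exp_lie n\<^esub> ?g i j"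
      using adm g FA.eqJ_exps_exps_commute[OF gC gC relator_eqJ[OF r3 gC gC], OF adm adm] by (simp add: cls_mult_eq)
  qed
qed

lemma is_R_alt: "is_R n R \<longleftrightarrow> R \<in> hom (BC n) (exp_lie n) \<and>
    (\<forall>i j. admissible n i j \<longrightarrow> R (aut_gen n i j) = o_exp n (vgen n i j))"
  by (auto simp: is_R_def admissible_pairs)

lemma R_exists_unique: "\<exists>!R. R \<in> extensional (carrier (BC n)) \<and> is_R n R"
proof (rule ex_ex1I)
  obtain h where h: "h \<in> hom (BC n) (exp_lie n)"
    "\<And>i k. admissible n i k \<Longrightarrow> h (aut_gen n i k) = o_exp n (vgen n i k)"
    using mccool_universal[OF mccool_relations_exp_lie, of n] by blast
  have "aut_gen n i k \<in> carrier (BC n)" if "admissible n i k" for i k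
    using that by (simp add: aut_gen_eq_move move_BC admissible_def)
  moreover have "restrict h (carrier (BC n)) \<in> hom (BC n) (exp_lie n)"
    using h(1) BC_mult by (auto simp: hom_def Pi_iff)
  ultimately have "is_R n (restrict h (carrier (BC n)))"
    using h by (simp add: is_R_alt)
  then show "\<exists>R. R \<in> extensional (carrier (BC n)) \<and> is_R n R" by blast
next
  fix R R' assume R: "R \<in> extensional (carrier (BC n)) \<and> is_R n R" "R' \<in> extensional (carrier (BC n)) \<and> is_R n R'"
  have "R c = R' c" if c: "c \<in> carrier (BC n)" for c
    by (rule BC_hom_eqI[OF group_exp_lie[of n] _ _ _ c]) (use R in \<open>simp_all add: is_R_alt\<close>)
  then show "R = R'"
    using R by (intro extensionalityI[of R "carrier (BC n)" R']) simp_all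
qed

section \<open>The action of permutations\<close>

text \<open>The renaming of indices, for series and (as \<open>subst2\<close>) for their tensor square.\<close>
definition subst :: "(nat \<Rightarrow> nat) \<Rightarrow> idx ncps \<Rightarrow> idx ncps" where
  "subst s f = (\<lambda>w. f (map (map_prod (inv_into UNIV s) (inv_into UNIV s)) w))"

definition subst2 :: "(nat \<Rightarrow> nat) \<Rightarrow> idx ncps2 \<Rightarrow> idx ncps2" where
  "subst2 s F = (\<lambda>(u, v). F (map (map_prod (inv_into UNIV s) (inv_into UNIV s)) u,
     map (map_prod (inv_into UNIV s) (inv_into UNIV s)) v))"

lemma subst_mult: "subst s (f * g) = subst s f * subst s g"
  by (auto simp: subst_def fun_eq_iff times_list take_map drop_map)

lemma subst2_mult: "subst2 s (f * g) = subst2 s f * subst2 s g"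
  by (auto simp: subst2_def fun_eq_iff times_list2 take_map drop_map)

lemma subst_1: "subst s 1 = 1"
  by (auto simp: subst_def fun_eq_iff one_series_def)

lemma cont_lin_subst: "cont_lin (subst s)" "cont_lin (subst2 s)"
  by (auto simp: cont_lin_def subst_def subst2_def fun_eq_iff sc_apply low_def mdeg_prod_def)

lemma shuffle_list_map: "shuffle_list (map f u) (map f v) = map (map f) (shuffle_list u v)"
  by (induction u v rule: shuffle_list.induct) simp_all

lemma coproduct_subst: "ncps_coproduct (subst s f) = subst2 s (ncps_coproduct f)"
  by (auto simp: ncps_coproduct_def subst_def subst2_def fun_eq_iff shuffle_list_map o_def)

lemma tensor_subst: "ncps_tensor (subst s f) (subst s g) = subst2 s (ncps_tensor f g)"
  by (auto simp: ncps_tensor_def subst_def subst2_def fun_eq_iff)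

context
  fixes n :: nat and s :: "nat \<Rightarrow> nat"
  assumes s: "s permutes {1..n}"
begin

lemma map_pairs_iff: "map (map_prod (inv_into UNIV s) (inv_into UNIV s)) w \<in> lists (pairs n) \<longleftrightarrow> w \<in> lists (pairs n)"
proof -
  have m: "inv_into UNIV s i \<in> {1..n} \<longleftrightarrow> i \<in> {1..n}" for i
    using permutes_in_image[OF permutes_inv[OF s]] .
  have "map_prod (inv_into UNIV s) (inv_into UNIV s) p \<in> pairs n \<longleftrightarrow> p \<in> pairs n" for p
    using m[of "fst p"] m[of "snd p"] inj_eq[OF permutes_inj[OF permutes_inv[OF s]], of "fst p" "snd p"]
    by (cases p) (simp add: pairs_def del: atLeastAtMost_iff)
  then show ?thesis by (auto simp: in_lists_conv_set)
qed

lemma subst_C: "f \<in> FA.C n \<Longrightarrow> subst s f \<in> FA.C n"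
  using map_pairs_iff by (auto simp: sring_carrier subst_def simp del: in_lists_conv_set)

lemma subst2_C: "F \<in> FA2.C n \<Longrightarrow> subst2 s F \<in> FA2.C n"
proof -
  assume F: "F \<in> FA2.C n"
  show ?thesis
    unfolding sring_carrier
  proof (intro allI impI)
    fix p assume "subst2 s F p \<noteq> 0"
    then have "(map (map_prod (inv_into UNIV s) (inv_into UNIV s)) (fst p),
      map (map_prod (inv_into UNIV s) (inv_into UNIV s)) (snd p)) \<in> lists (pairs n) \<times> lists (pairs n)"
      using F unfolding sring_carrier subst2_def case_prod_unfold by blast
    then show "p \<in> lists (pairs n) \<times> lists (pairs n)" unfolding mem_Times_iff fst_conv snd_conv map_pairs_iff .
  qed
qed

lemma subst_gen: "subst s (gv i j) = gv (s i) (s j)"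
proof
  fix w
  show "subst s (gv i j) w = gv (s i) (s j) w"
    by (cases w; cases "tl w") (auto simp: subst_def ncps_gen_def permutes_inverses[OF s])
qed

lemmas subst_lin = cont_linD[OF cont_lin_subst(1)[of s]]
lemmas subst2_lin = cont_linD[OF cont_lin_subst(2)[of s]]

lemma subst_J: "f \<in> FA.J n \<Longrightarrow> subst s f \<in> FA.J n"
proof (rule FA.J_induct[where P = "\<lambda>f. subst s f \<in> FA.J n" and n = n])
  fix r assume "r \<in> oriented_relators n"
  then have "subst s r \<in> oriented_relators n"
  proof (cases rule: relator_cases)
    case (a i j k)
    then have "{s i, s j, s k} \<subseteq> {1..n}" "distinct [s i, s j, s k]"
      using permutes_in_image[OF s] inj_eq[OF permutes_inj[OF s]] by auto
    moreover have "subst s r = gv (s i) (s k) * gv (s j) (s k) - gv (s j) (s k) * gv (s i) (s k)"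
      by (simp add: a subst_lin subst_mult subst_gen)
    ultimately show ?thesis unfolding oriented_relators_eq by blast
  next
    case (b i j k)
    then have "{s i, s j, s k} \<subseteq> {1..n}" "distinct [s i, s j, s k]"
      using permutes_in_image[OF s] inj_eq[OF permutes_inj[OF s]] by auto
    moreover have "subst s r = gv (s i) (s j) * (gv (s i) (s k) + gv (s j) (s k)) -
        (gv (s i) (s k) + gv (s j) (s k)) * gv (s i) (s j)"
      by (simp only: b subst_lin subst_mult subst_gen)
    ultimately show ?thesis unfolding oriented_relators_eq by blast
  next
    case (c i j k l)
    then have "{s i, s j, s k, s l} \<subseteq> {1..n}" "distinct [s i, s j, s k, s l]"
      using permutes_in_image[OF s] inj_eq[OF permutes_inj[OF s]] by auto
    moreover have "subst s r = gv (s i) (s j) * gv (s k) (s l) - gv (s k) (s l) * gv (s i) (s j)"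
      by (simp add: c subst_lin subst_mult subst_gen)
    ultimately show ?thesis unfolding oriented_relators_eq by blast
  qed
  then show "subst s r \<in> FA.J n" by (rule FA.G_J)
next
  fix f g assume "subst s f \<in> FA.J n" "subst s g \<in> FA.J n"
  from FA.J_diff[OF this] show "subst s (f - g) \<in> FA.J n" by (simp only: subst_lin)
next
  fix f assume f: "f \<in> FA.C n" and lim: "\<And>d. \<exists>g\<in>FA.C n. subst s g \<in> FA.J n \<and> (\<forall>w. mdeg w \<le> d \<longrightarrow> g w = f w)"
  show "subst s f \<in> FA.J n"
  proof (rule FA.J_limit[OF subst_C[OF f]])
    fix d
    from lim[of d] obtain g where "subst s g \<in> FA.J n" "\<forall>w. mdeg w \<le> d \<longrightarrow> g w = f w" by blast
    then show "\<exists>g\<in>FA.J n. \<forall>w. mdeg w \<le> d \<longrightarrow> g w = subst s f w"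
      using cont_lin_agree[OF cont_lin_subst(1), of d g f] by blast
  qed
qed (simp_all add: subst_lin subst_mult FA.J_closed subst_C)

lemma subst2_J: "F \<in> FA2.J n \<Longrightarrow> subst2 s F \<in> FA2.J n"
proof (rule FA2.J_induct[where P = "\<lambda>f. subst2 s f \<in> FA2.J n" and n = n])
  fix r assume "r \<in> tensor_relators n"
  then obtain f g where fg: "r = ncps_tensor f g" "f \<in> FA.C n" "g \<in> FA.C n" "f \<in> FA.J n \<or> g \<in> FA.J n"
    unfolding tensor_relators_def by blast
  then have "subst2 s r = ncps_tensor (subst s f) (subst s g)" by (simp add: tensor_subst)
  then show "subst2 s r \<in> FA2.J n"
    using fg tensor_J[OF subst_J subst_C] tensor_J(2)[OF subst_J subst_C] by auto
next
  fix f g assume "subst2 s f \<in> FA2.J n" "subst2 s g \<in> FA2.J n"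
  from FA2.J_diff[OF this] show "subst2 s (f - g) \<in> FA2.J n" by (simp only: subst2_lin)
next
  fix f assume f: "f \<in> FA2.C n" and lim: "\<And>d. \<exists>g\<in>FA2.C n. subst2 s g \<in> FA2.J n \<and> (\<forall>w. mdeg w \<le> d \<longrightarrow> g w = f w)"
  show "subst2 s f \<in> FA2.J n"
  proof (rule FA2.J_limit[OF subst2_C[OF f]])
    fix d
    from lim[of d] obtain g where "subst2 s g \<in> FA2.J n" "\<forall>w. mdeg w \<le> d \<longrightarrow> g w = f w" by blast
    then show "\<exists>g\<in>FA2.J n. \<forall>w. mdeg w \<le> d \<longrightarrow> g w = subst2 s f w"
      using cont_lin_agree[OF cont_lin_subst(2), of d g f] by blast
  qed
qed (simp_all add: subst2_lin subst2_mult FA2.J_closed subst2_C)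

lemma subst_eqJ: "FA.eqJ n f g \<Longrightarrow> FA.eqJ n (subst s f) (subst s g)"
  using subst_J[of "f - g"] by (simp add: FA.eqJ_def subst_lin subst_C)

lemma o_act_cls: "f \<in> FA.C n \<Longrightarrow> o_act n s (FA.cls n f) = FA.cls n (subst s f)"
proof -
  assume f: "f \<in> FA.C n"
  have "FA.cls n (subst s g) = FA.cls n (subst s f)" if "FA.eqJ n g f" for g
    using subst_eqJ[OF that] FA.cls_eq_iff[of "subst s g" n "subst s f"] by (simp add: FA.eqJ_def)
  then show ?thesis
    using FA.coset_map_cls[OF f, where B = "FA.J n" and A = "sring (lists (pairs n))" and h = "subst s",
        folded FA.cls_def]
    by (simp add: o_act_def subst_def[abs_def] rel_ideal_eq ncps_ring_eq_sring)
qed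

text \<open>Renaming indices permutes the relators and commutes with the coproduct.\<close>
lemma group_like_subst:
  assumes "group_like n f" shows "group_like n (subst s f)"
proof -
  have "subst2 s (ncps_coproduct f - ncps_tensor f f) \<in> FA2.J n"
    using assms by (intro subst2_J) (simp add: group_like_def FA2.eqJ_def)
  then have "ncps_coproduct (subst s f) - ncps_tensor (subst s f) (subst s f) \<in> FA2.J n"
    by (simp only: subst2_lin coproduct_subst tensor_subst)
  moreover have "subst s f \<in> FA.C n" using assms by (simp add: group_like_C subst_C)
  moreover have "subst s f [] = 1" using assms by (simp add: subst_def group_like_def)
  ultimately show ?thesis
    by (simp add: group_like_def FA2.eqJ_def tensor_carrier coproduct_carrier)
qed

lemma perm_conj_aut_gen:
  assumes ij: "admissible n i j"
  shows "perm_aut n s \<otimes>\<^bsub>BP n\<^esub> aut_gen n i j \<otimes>\<^bsub>BP n\<^esub> inv\<^bsub>BP n\<^esub> (perm_aut n s) = aut_gen n (s i) (s j)"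
proof -
  interpret B: group "BP n" by (rule BP_group)
  have ij': "i \<in> {1..n}" "j \<in> {1..n}" "i \<noteq> j" using ij by (auto simp: admissible_def)
  have sij: "s i \<in> {1..n}" "s j \<in> {1..n}" "s i \<noteq> s j"
    using ij' permutes_in_image[OF s] inj_eq[OF permutes_inj[OF s]] by auto
  have c: "perm_aut n s \<in> carrier (BP n)" "aut_gen n i j \<in> carrier (BP n)" "aut_gen n (s i) (s j) \<in> carrier (BP n)"
    using ij' sij s by (auto simp: perm_aut_BP aut_gen_eq_move intro!: move_BP)
  have "perm_aut n s \<otimes>\<^bsub>BP n\<^esub> aut_gen n i j = aut_gen n (s i) (s j) \<otimes>\<^bsub>BP n\<^esub> perm_aut n s"
  proof (rule BP_eqI)
    fix m assume m: "m \<in> {1..n}"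
    have sm: "s m \<in> {1..n}" "s m = s i \<longleftrightarrow> m = i" using m permutes_in_image[OF s] inj_eq[OF permutes_inj[OF s]] by auto
    have g: "gen n i \<in> carrier (FG n)" "gen n j \<in> carrier (FG n)" using ij' by auto
    have "perm_aut n s (cj n (gen n i) (gen n j)) = cj n (gen n (s i)) (gen n (s j))"
      using FG_hom_simps(4)[OF perm_aut_hom(1)[OF s] g] ij' s by (simp add: perm_aut_apply)
    then show "(perm_aut n s \<otimes>\<^bsub>BP n\<^esub> aut_gen n i j) (gen n m) = (aut_gen n (s i) (s j) \<otimes>\<^bsub>BP n\<^esub> perm_aut n s) (gen n m)"
      using m sm ij' sij c s by (simp add: BP_apply perm_aut_apply aut_gen_eq_move move_apply signed_def)
  qed (use c in auto)
  then show ?thesis using c by (simp add: B.m_assoc)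
qed

end

lemma perm_conj_BC:
  assumes s: "s permutes {1..n}" and c: "c \<in> carrier (BC n)"
  shows "perm_aut n s \<otimes>\<^bsub>BP n\<^esub> c \<otimes>\<^bsub>BP n\<^esub> inv\<^bsub>BP n\<^esub> (perm_aut n s) \<in> carrier (BC n)"
proof -
  have "BC n = BP n \<lparr>carrier := kernel (BP n) (sym_group n) (bp_perm n)\<rparr>" by (simp add: BC_def)
  moreover have "kernel (BP n) (sym_group n) (bp_perm n) \<lhd> BP n"
    using group_hom.normal_kernel[of "BP n" "sym_group n" "bp_perm n"] bp_perm_hom
    by (simp add: group_hom_def group_hom_axioms_def BP_group sym_group_is_group)
  ultimately show ?thesis
    using normal.inv_op_closed2[of "carrier (BC n)" "BP n" "perm_aut n s" c] perm_aut_BP[OF s] c by simp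
qed

text \<open>Both sides are homomorphisms in \<open>c\<close>, and on generators both rename the indices.\<close>
lemma R_equivariant:
  assumes R: "is_R n R" and s: "s permutes {1..n}" and c: "c \<in> carrier (BC n)"
  shows "R (perm_aut n s \<otimes>\<^bsub>BP n\<^esub> c \<otimes>\<^bsub>BP n\<^esub> inv\<^bsub>BP n\<^esub> (perm_aut n s)) = o_act n s (R c)"
proof (rule BC_hom_eqI[OF group_exp_lie _ _ _ c])
  interpret B: group "BP n" by (rule BP_group)
  have hom: "R \<in> hom (BC n) (exp_lie n)" using R by (simp add: is_R_def)
  let ?p = "perm_aut n s"
  let ?k = "\<lambda>c. ?p \<otimes>\<^bsub>BP n\<^esub> c \<otimes>\<^bsub>BP n\<^esub> inv\<^bsub>BP n\<^esub> ?p"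
  have p: "?p \<in> carrier (BP n)" using s by (rule perm_aut_BP)
  show "(\<lambda>c. R (?k c)) \<in> hom (BC n) (exp_lie n)"
  proof (rule homI)
    fix a b assume ab: "a \<in> carrier (BC n)" "b \<in> carrier (BC n)"
    have c: "a \<in> carrier (BP n)" "b \<in> carrier (BP n)" using ab by (auto intro: BC_BP)
    have "inv\<^bsub>BP n\<^esub> ?p \<otimes>\<^bsub>BP n\<^esub> (?p \<otimes>\<^bsub>BP n\<^esub> (b \<otimes>\<^bsub>BP n\<^esub> inv\<^bsub>BP n\<^esub> ?p)) = b \<otimes>\<^bsub>BP n\<^esub> inv\<^bsub>BP n\<^esub> ?p"
      using c p by (simp add: B.m_assoc[symmetric])
    then have "?k (a \<otimes>\<^bsub>BP n\<^esub> b) = ?k a \<otimes>\<^bsub>BP n\<^esub> ?k b"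
      using c p by (simp add: B.m_assoc)
    then show "R (?k (a \<otimes>\<^bsub>BC n\<^esub> b)) = R (?k a) \<otimes>\<^bsub>exp_lie n\<^esub> R (?k b)"
      using hom_mult[OF hom perm_conj_BC[OF s ab(1)] perm_conj_BC[OF s ab(2)]] by simp
  qed (use hom_in_carrier[OF hom] perm_conj_BC[OF s] in auto)
  show "(\<lambda>c. o_act n s (R c)) \<in> hom (BC n) (exp_lie n)"
  proof (rule homI)
    fix a b assume ab: "a \<in> carrier (BC n)" "b \<in> carrier (BC n)"
    obtain f g where f: "group_like n f" "R a = FA.cls n f" and g: "group_like n g" "R b = FA.cls n g"
      using hom_in_carrier[OF hom ab(1)] hom_in_carrier[OF hom ab(2)] by (auto simp: exp_lie_carrier)
    show "o_act n s (R a) \<in> carrier (exp_lie n)"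
      using f group_like_subst[OF s f(1)] by (auto simp: o_act_cls[OF s] group_like_C exp_lie_carrier)
    show "o_act n s (R (a \<otimes>\<^bsub>BC n\<^esub> b)) = o_act n s (R a) \<otimes>\<^bsub>exp_lie n\<^esub> o_act n s (R b)"
      using hom_mult[OF hom ab] f g
      by (simp add: OA_simps o_act_cls[OF s] group_like_C FA.C_mult subst_mult subst_C[OF s])
  qed
  fix i j assume ij: "admissible n i j"
  then have sij: "admissible n (s i) (s j)"
    using permutes_in_image[OF s] inj_eq[OF permutes_inj[OF s]] by (auto simp: admissible_def)
  have "subst s (exps (gv i j)) = exps (gv (s i) (s j))"
    unfolding exps_def by (subst cont_lin_psub[OF cont_lin_subst(1) subst_mult subst_1]) (simp_all add: subst_gen[OF s])
  then show "R (?k (aut_gen n i j)) = o_act n s (R (aut_gen n i j))"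
    using R ij sij group_like_exps_gen[of i j n]
    by (simp add: perm_conj_aut_gen[OF s ij] is_R_alt o_exp_vgen admissible_pairs o_act_cls[OF s] group_like_C)
qed

section \<open>Adding a strand\<close>

abbreviation incl :: "nat \<Rightarrow> fg_elem \<Rightarrow> fg_elem" where "incl n \<equiv> pres_hom (FG (Suc n)) (gen (Suc n))"

lemma incl_hom: "incl n \<in> hom (FG n) (FG (Suc n))"
  and incl_gen: "i \<in> {1..n} \<Longrightarrow> incl n (gen n i) = gen (Suc n) i"
  using pres_hom_hom[OF FG_group[of "Suc n"], of "{1..n}" "gen (Suc n)" "{}"]
  by (simp_all add: FG_def[of n] gen_eq[of n])

lemma bp_embed_facts:
  assumes a: "a \<in> carrier (BP n)"
  shows "bp_embed n a \<in> hom (FG (Suc n)) (FG (Suc n))" "bp_embed n a \<in> extensional (carrier (FG (Suc n)))"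
    "i \<in> {1..n} \<Longrightarrow> bp_embed n a (gen (Suc n) i) = incl n (a (gen n i))"
    "bp_embed n a (gen (Suc n) (Suc n)) = gen (Suc n) (Suc n)"
    "x \<in> carrier (FG n) \<Longrightarrow> bp_embed n a (incl n x) = incl n (a x)"
proof -
  have ha: "a \<in> hom (FG n) (FG n)" using a by (simp add: BP_auto auto_FG_D)
  have c: "(if i \<le> n then incl n (a (gen n i)) else gen (Suc n) i) \<in> carrier (FG (Suc n))" if "i \<in> {1..Suc n}" for i
    using that FG_hom_simps(1)[OF incl_hom] FG_hom_simps(1)[OF ha] by auto
  show 1: "bp_embed n a \<in> hom (FG (Suc n)) (FG (Suc n))" "bp_embed n a \<in> extensional (carrier (FG (Suc n)))"
    unfolding bp_embed_def using c by (auto intro!: free_endo(1,2))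
  show 2: "bp_embed n a (gen (Suc n) i) = incl n (a (gen n i))" if "i \<in> {1..n}" for i
    using that c unfolding bp_embed_def by (subst free_endo(3)) auto
  show "bp_embed n a (gen (Suc n) (Suc n)) = gen (Suc n) (Suc n)"
    using c unfolding bp_embed_def by (subst free_endo(3)) auto
  assume x: "x \<in> carrier (FG n)"
  have comp: "(\<lambda>x. g (f x)) \<in> hom A C" if "f \<in> hom A B" "g \<in> hom B C" for f g and A :: "fg_elem monoid" and B C :: "fg_elem monoid"
    using that by (auto simp: hom_def Pi_iff)
  show "bp_embed n a (incl n x) = incl n (a x)"
    by (rule FG_hom_eqI[OF FG_group comp[OF incl_hom 1(1)] comp[OF ha incl_hom] _ x])
       (simp add: incl_gen 2)
qed

lemma bp_embed_BP:
  assumes a: "a \<in> carrier (BP n)"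
  shows "bp_embed n a \<in> carrier (BP (Suc n))" "bp_perm (Suc n) (bp_embed n a) = bp_perm n a"
proof -
  interpret B: group "BP n" by (rule BP_group)
  note e = bp_embed_facts[OF a]
  have inv: "inv\<^bsub>BP n\<^esub> a \<in> carrier (BP n)" using a by simp
  note e' = bp_embed_facts[OF inv]
  have ainv: "a ((inv\<^bsub>BP n\<^esub> a) x) = x" "(inv\<^bsub>BP n\<^esub> a) (a x) = x" if "x \<in> carrier (FG n)" for x
    using BP_apply[OF a inv that] BP_apply[OF inv a that] a BP_one_apply[OF that] by simp_all
  have cases: "i \<in> {1..Suc n} \<Longrightarrow> i \<in> {1..n} \<or> i = Suc n" for i by auto
  have "bp_embed n a (bp_embed n (inv\<^bsub>BP n\<^esub> a) (gen (Suc n) i)) = gen (Suc n) i"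
    "bp_embed n (inv\<^bsub>BP n\<^esub> a) (bp_embed n a (gen (Suc n) i)) = gen (Suc n) i" if "i \<in> {1..Suc n}" for i
    using cases[OF that] BP_hom_simps(1)[OF a, of "gen n i"] BP_hom_simps(1)[OF inv, of "gen n i"] ainv[of "gen n i"]
    by (auto simp: e(3,4,5) e'(3,4,5) incl_gen)
  then have auto: "bp_embed n a \<in> auto (FG (Suc n))"
    using e(1,2) e'(1) by (intro auto_FG_I bij_of_inverses[of _ _ "bp_embed n (inv\<^bsub>BP n\<^esub> a)"]) auto
  have "is_bp_perm (Suc n) (bp_embed n a) (bp_perm n a)"
    unfolding is_bp_perm_def
  proof (intro conjI ballI)
    have p: "bp_perm n a permutes {1..n}" using a by (rule bp_perm_permutes)
    then show "bp_perm n a permutes {1..Suc n}" by (rule permutes_subset) auto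
    fix i assume "i \<in> {1..Suc n}"
    from cases[OF this] show "\<exists>y\<in>carrier (FG (Suc n)). bp_embed n a (gen (Suc n) i) = cj (Suc n) (gen (Suc n) (bp_perm n a i)) y"
    proof
      assume i: "i \<in> {1..n}"
      obtain y where y: "y \<in> carrier (FG n)" "a (gen n i) = cj n (gen n (bp_perm n a i)) y"
        using is_bp_perm_bp_perm[OF a] i unfolding is_bp_perm_def by blast
      have pi: "bp_perm n a i \<in> {1..n}" using permutes_in_image[OF p] i by blast
      have "bp_embed n a (gen (Suc n) i) = cj (Suc n) (gen (Suc n) (bp_perm n a i)) (incl n y)"
        using FG_hom_simps(4)[OF incl_hom _ y(1), of "gen n (bp_perm n a i)"] pi
        by (simp add: e(3)[OF i] y(2) incl_gen)
      then show ?thesis using FG_hom_simps(1)[OF incl_hom y(1)] by blast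
    next
      assume i: "i = Suc n"
      then have "bp_perm n a i = i" using permutes_not_in[OF p] by auto
      then show ?thesis using FG_group[of "Suc n"] i
        by (intro bexI[of _ "\<one>\<^bsub>FG (Suc n)\<^esub>"]) (auto simp: e(4) cj_one group.is_monoid monoid.one_closed)
    qed
  qed
  then show "bp_embed n a \<in> carrier (BP (Suc n))" "bp_perm (Suc n) (bp_embed n a) = bp_perm n a"
    using auto by (auto intro: BP_mem_I bp_perm_eqI)
qed

lemma bp_embed_eqI:
  assumes "a \<in> carrier (BP n)" "b \<in> carrier (BP (Suc n))" "\<And>i. i \<in> {1..n} \<Longrightarrow> b (gen (Suc n) i) = incl n (a (gen n i))"
    "b (gen (Suc n) (Suc n)) = gen (Suc n) (Suc n)"
  shows "bp_embed n a = b"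
proof (rule BP_eqI)
  fix i assume "i \<in> {1..Suc n}"
  then have "i \<in> {1..n} \<or> i = Suc n" by auto
  then show "bp_embed n a (gen (Suc n) i) = b (gen (Suc n) i)"
    using assms bp_embed_facts(3,4)[OF assms(1)] by auto
qed (use assms bp_embed_BP in auto)

lemma bp_embed_mult:
  assumes a: "a \<in> carrier (BP n)" and b: "b \<in> carrier (BP n)"
  shows "bp_embed n (a \<otimes>\<^bsub>BP n\<^esub> b) = bp_embed n a \<otimes>\<^bsub>BP (Suc n)\<^esub> bp_embed n b"
proof -
  interpret B: group "BP n" by (rule BP_group)
  interpret B': group "BP (Suc n)" by (rule BP_group)
  show ?thesis
  proof (rule bp_embed_eqI)
    fix i assume i: "i \<in> {1..n}"
    then show "(bp_embed n a \<otimes>\<^bsub>BP (Suc n)\<^esub> bp_embed n b) (gen (Suc n) i) = incl n ((a \<otimes>\<^bsub>BP n\<^esub> b) (gen n i))"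
      using BP_apply[OF bp_embed_BP(1)[OF a] bp_embed_BP(1)[OF b], of "gen (Suc n) i"] BP_apply[OF a b, of "gen n i"]
        BP_hom_simps(1)[OF b, of "gen n i"] bp_embed_facts(3)[OF b i] bp_embed_facts(5)[OF a, of "b (gen n i)"]
      by simp
  qed (use a b bp_embed_BP bp_embed_facts(4) in \<open>auto simp: BP_apply\<close>)
qed

lemma bp_embed_hom: "bp_embed n \<in> hom (BP n) (BP (Suc n))"
  by (rule homI) (simp_all add: bp_embed_BP bp_embed_mult)

lemma bp_embed_aut_gen:
  assumes ij: "admissible n i j"
  shows "bp_embed n (aut_gen n i j) = aut_gen (Suc n) i j"
proof -
  have ij': "i \<in> {1..n}" "j \<in> {1..n}" "i \<noteq> j" "i \<in> {1..Suc n}" "j \<in> {1..Suc n}" using ij by (auto simp: admissible_def)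
  show ?thesis
    unfolding aut_gen_eq_move
  proof (rule bp_embed_eqI)
    fix m assume m: "m \<in> {1..n}"
    then have m': "m \<in> {1..Suc n}" by auto
    have "incl n (cj n (gen n i) (gen n j)) = cj (Suc n) (gen (Suc n) i) (gen (Suc n) j)"
      using FG_hom_simps(4)[OF incl_hom, of "gen n i" n "gen n j"] ij' by (simp add: incl_gen)
    then show "move (Suc n) i j True (gen (Suc n) m) = incl n (move n i j True (gen n m))"
      using m m' ij' by (simp add: move_apply signed_def incl_gen)
  next
    have "Suc n \<noteq> i" using ij' by auto
    then show "move (Suc n) i j True (gen (Suc n) (Suc n)) = gen (Suc n) (Suc n)"
      using move_apply[OF ij'(4,5,3), of "Suc n" True] by simp
  qed (use ij' in \<open>auto intro!: move_BP\<close>)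
qed

lemma bp_embed_perm_aut:
  assumes s: "s permutes {1..n}"
  shows "bp_embed n (perm_aut n s) = perm_aut (Suc n) s"
proof (rule bp_embed_eqI)
  have s': "s permutes {1..Suc n}" using s by (rule permutes_subset) auto
  then show "perm_aut (Suc n) s \<in> carrier (BP (Suc n))" by (rule perm_aut_BP)
  show "perm_aut n s \<in> carrier (BP n)" using s by (rule perm_aut_BP)
  fix i assume i: "i \<in> {1..n}"
  then have "i \<in> {1..Suc n}" "s i \<in> {1..n}" using permutes_in_image[OF s] by auto
  then show "perm_aut (Suc n) s (gen (Suc n) i) = incl n (perm_aut n s (gen n i))"
    using i s s' by (simp add: perm_aut_apply incl_gen)
next
  have s': "s permutes {1..Suc n}" using s by (rule permutes_subset) auto
  then show "perm_aut (Suc n) s (gen (Suc n) (Suc n)) = gen (Suc n) (Suc n)"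
    using permutes_not_in[OF s, of "Suc n"] by (simp add: perm_aut_apply)
qed

lemma bp_embed_BC: "c \<in> carrier (BC n) \<Longrightarrow> bp_embed n c \<in> carrier (BC (Suc n))"
  by (simp add: BC_carrier bp_embed_BP)

lemma pairs_Suc: "pairs n \<subseteq> pairs (Suc n)"
  by (auto simp: pairs_def)

lemma C_Suc: "f \<in> FA.C n \<Longrightarrow> f \<in> FA.C (Suc n)"
  using pairs_Suc lists_mono[of "pairs n" "pairs (Suc n)"] by (auto simp: sring_carrier simp del: in_lists_conv_set)

text \<open>The relators for \<open>n\<close> strands are also relators for \<open>n + 1\<close>, and the limits are the same.\<close>
lemma J_Suc: "f \<in> FA.J n \<Longrightarrow> f \<in> FA.J (Suc n)"
proof (rule FA.J_induct[where P = "\<lambda>f. f \<in> FA.J (Suc n)" and n = n])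
  fix r assume "r \<in> oriented_relators n"
  then have "r \<in> oriented_relators (Suc n)"
  proof (cases rule: relator_cases)
    case (a i j k)
    then have "{i, j, k} \<subseteq> {1..Suc n}" by auto
    then show ?thesis unfolding oriented_relators_eq using a by blast
  next
    case (b i j k)
    then have "{i, j, k} \<subseteq> {1..Suc n}" by auto
    then show ?thesis unfolding oriented_relators_eq using b by blast
  next
    case (c i j k l)
    then have "{i, j, k, l} \<subseteq> {1..Suc n}" by auto
    then show ?thesis unfolding oriented_relators_eq using c by blast
  qed
  then show "r \<in> FA.J (Suc n)" by (rule FA.G_J)
next
  fix f assume f: "f \<in> FA.C n" and lim: "\<And>d. \<exists>g\<in>FA.C n. g \<in> FA.J (Suc n) \<and> (\<forall>w. mdeg w \<le> d \<longrightarrow> g w = f w)"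
  show "f \<in> FA.J (Suc n)" by (rule FA.J_limit) (use C_Suc[OF f] lim in auto)
qed (simp_all add: FA.J_closed FA.J_diff C_Suc)

lemma eqJ_Suc: "FA.eqJ n f g \<Longrightarrow> FA.eqJ (Suc n) f g"
  by (simp add: FA.eqJ_def C_Suc J_Suc)

lemma o_embed_cls: "f \<in> FA.C n \<Longrightarrow> o_embed n (FA.cls n f) = FA.cls (Suc n) f"
proof -
  assume f: "f \<in> FA.C n"
  have "FA.cls (Suc n) g = FA.cls (Suc n) f" if "FA.eqJ n g f" for g
    using eqJ_Suc[OF that] FA.cls_eq_iff[of g "Suc n" f] by (simp add: FA.eqJ_def)
  then show ?thesis
    using FA.coset_map_cls[OF f, where B = "FA.J (Suc n)" and A = "sring (lists (pairs (Suc n)))" and h = "\<lambda>f. f",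
        folded FA.cls_def]
    by (simp add: o_embed_def rel_ideal_eq ncps_ring_eq_sring)
qed

lemma OA_monoid: "monoid (OA n)"
  using FA.ring_Q[of n] by (simp add: OA_eq ring_def)

lemma group_like_Units:
  assumes "group_like m f" "f \<in> FA.C n" "m \<le> n"
  shows "FA.cls n f \<in> Units (OA n)"
proof -
  obtain g where g: "group_like m g" "f * g = 1" "g * f = 1" by (rule group_like_inverse[OF assms(1)])
  have "g \<in> FA.C k" if "m \<le> k" for k
    using that by (induction k rule: dec_induct) (auto simp: group_like_C[OF g(1)] C_Suc)
  then have "g \<in> FA.C n" using assms(3) by blast
  then show ?thesis using assms(2) g(2,3) by (auto simp: Units_def OA_simps intro!: bexI[of _ g])
qed

text \<open>Again a comparison of homomorphisms on generators. The units of the algebra serve as a common target,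
which avoids a discussion of the image of the group-like elements.\<close>
lemma R_stable:
  assumes R: "is_R n R" and R': "is_R (Suc n) R'" and c: "c \<in> carrier (BC n)"
  shows "R' (bp_embed n c) = o_embed n (R c)"
proof (rule BC_hom_eqI[OF monoid.units_group[OF OA_monoid] _ _ _ c])
  have hom: "R \<in> hom (BC n) (exp_lie n)" "R' \<in> hom (BC (Suc n)) (exp_lie (Suc n))"
    using R R' by (auto simp: is_R_def)
  show "(\<lambda>c. R' (bp_embed n c)) \<in> hom (BC n) (units_of (OA (Suc n)))"
  proof (rule homI)
    fix a b assume ab: "a \<in> carrier (BC n)" "b \<in> carrier (BC n)"
    obtain f where f: "group_like (Suc n) f" "R' (bp_embed n a) = FA.cls (Suc n) f"
      using hom_in_carrier[OF hom(2) bp_embed_BC[OF ab(1)]] by (auto simp: exp_lie_carrier)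
    show "R' (bp_embed n a) \<in> carrier (units_of (OA (Suc n)))"
      using f group_like_Units[OF f(1) group_like_C[OF f(1)] order_refl] by (simp add: units_of_def)
    show "R' (bp_embed n (a \<otimes>\<^bsub>BC n\<^esub> b)) = R' (bp_embed n a) \<otimes>\<^bsub>units_of (OA (Suc n))\<^esub> R' (bp_embed n b)"
      using hom_mult[OF hom(2) bp_embed_BC[OF ab(1)] bp_embed_BC[OF ab(2)]] ab
      by (simp add: bp_embed_mult BC_BP units_of_def)
  qed
  show "(\<lambda>c. o_embed n (R c)) \<in> hom (BC n) (units_of (OA (Suc n)))"
  proof (rule homI)
    fix a b assume ab: "a \<in> carrier (BC n)" "b \<in> carrier (BC n)"
    obtain f g where f: "group_like n f" "R a = FA.cls n f" and g: "group_like n g" "R b = FA.cls n g"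
      using hom_in_carrier[OF hom(1) ab(1)] hom_in_carrier[OF hom(1) ab(2)] by (auto simp: exp_lie_carrier)
    show "o_embed n (R a) \<in> carrier (units_of (OA (Suc n)))"
      using f group_like_Units[OF f(1) C_Suc] by (simp add: o_embed_cls group_like_C units_of_def)
    show "o_embed n (R (a \<otimes>\<^bsub>BC n\<^esub> b)) = o_embed n (R a) \<otimes>\<^bsub>units_of (OA (Suc n))\<^esub> o_embed n (R b)"
      using hom_mult[OF hom(1) ab] f g
      by (simp add: o_embed_cls group_like_C FA.C_mult OA_simps units_of_def C_Suc)
  qed
  fix i j assume ij: "admissible n i j"
  then have ij': "admissible (Suc n) i j" by (auto simp: admissible_def)
  have "R' (aut_gen (Suc n) i j) = FA.cls (Suc n) (exps (gv i j))" "R (aut_gen n i j) = FA.cls n (exps (gv i j))"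
    using R R' ij ij' by (simp_all add: is_R_alt admissible_pairs o_exp_vgen)
  then show "R' (bp_embed n (aut_gen n i j)) = o_embed n (R (aut_gen n i j))"
    using ij group_like_exps_gen[of i j n]
    by (simp add: bp_embed_aut_gen o_embed_cls group_like_C admissible_pairs)
qed

section \<open>Combing of braids\<close>

lemma (in group) generate_conj_closed:
  assumes S: "S \<subseteq> carrier G" and g: "g \<in> carrier G"
    and c: "\<And>s. s \<in> S \<Longrightarrow> g \<otimes> s \<otimes> inv g \<in> generate G S" and h: "h \<in> generate G S"
  shows "g \<otimes> h \<otimes> inv g \<in> generate G S"
proof -
  have conj_mult: "g \<otimes> (a \<otimes> b) \<otimes> inv g = (g \<otimes> a \<otimes> inv g) \<otimes> (g \<otimes> b \<otimes> inv g)"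
    if "a \<in> carrier G" "b \<in> carrier G" for a b
  proof -
    have "inv g \<otimes> (g \<otimes> (b \<otimes> inv g)) = b \<otimes> inv g" using that g by (simp add: m_assoc[symmetric])
    then show ?thesis using that g by (simp add: m_assoc)
  qed
  show ?thesis
    using h
  proof (induction rule: generate.induct)
    case one
    then show ?case using g generate.one by simp
  next
    case (inv s)
    have "g \<otimes> inv s \<otimes> inv g = inv (g \<otimes> s \<otimes> inv g)"
      using inv S g by (auto simp: inv_mult_group m_assoc)
    then show ?case using generate_m_inv_closed[OF S c[OF inv]] by simp
  next
    case (eng a b)
    then have "a \<in> carrier G" "b \<in> carrier G" using generate_in_carrier[OF S] by auto
    then show ?case using eng generate.eng by (simp add: conj_mult)
  qed (rule c)
qed

text \<open>A group with a solution of the braid relations on \<open>n + 1\<close> strands. The product \<open>desc k = x n \<dots> x k\<close>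
moves the strand \<open>k\<close> to the last position, and \<open>pure k\<close> is the pure braid that winds the last strand
once around the \<open>k\<close>-th. The subgroup \<open>P\<close> of the braids on the first \<open>n\<close> strands normalizes the
subgroup \<open>U\<close> of the pure braids that only move the last one.\<close>
locale braid_solution = group G for G (structure) +
  fixes n :: nat and x :: "nat \<Rightarrow> 'a"
  assumes x_closed: "i \<in> {1..n} \<Longrightarrow> x i \<in> carrier G"
    and far: "i \<in> {1..n} \<Longrightarrow> j \<in> {1..n} \<Longrightarrow> i + 2 \<le> j \<Longrightarrow> x i \<otimes> x j = x j \<otimes> x i"
    and near: "i \<in> {1..n} \<Longrightarrow> Suc i \<in> {1..n} \<Longrightarrow>
      x (Suc i) \<otimes> (x i \<otimes> x (Suc i)) = x i \<otimes> (x (Suc i) \<otimes> x i)"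
begin

definition desc :: "nat \<Rightarrow> 'a" where
  "desc k = foldl (\<lambda>g i. g \<otimes> x i) \<one> (rev [k..<Suc n])"

lemma desc_Suc: "k \<le> n \<Longrightarrow> desc k = desc (Suc k) \<otimes> x k"
  by (simp add: desc_def upt_conv_Cons del: upt_Suc)

lemma desc_last: "desc (Suc n) = \<one>" by (simp add: desc_def)

lemma desc_closed: "1 \<le> k \<Longrightarrow> k \<le> Suc n \<Longrightarrow> desc k \<in> carrier G"
proof (induction "Suc n - k" arbitrary: k)
  case 0
  then have "k = Suc n" by simp
  then show ?case by (simp add: desc_last)
next
  case (Suc d)
  then have "desc (Suc k) \<in> carrier G" by (intro Suc.hyps(1)) auto
  then show ?case using Suc x_closed[of k] by (simp add: desc_Suc)
qed

lemma desc_far: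
  assumes "1 \<le> i" "i + 1 < k" "k \<le> Suc n"
  shows "desc k \<otimes> x i = x i \<otimes> desc k"
  using assms
proof (induction "Suc n - k" arbitrary: k)
  case 0
  then have "k = Suc n" by simp
  then show ?case using x_closed[of i] 0 by (simp add: desc_last)
next
  case (Suc d)
  have c: "x i \<in> carrier G" "x k \<in> carrier G" "desc (Suc k) \<in> carrier G"
    using Suc x_closed desc_closed by auto
  have IH: "desc (Suc k) \<otimes> x i = x i \<otimes> desc (Suc k)" using Suc by (intro Suc.hyps(1)) auto
  have ki: "x k \<otimes> x i = x i \<otimes> x k" using far[of i k] Suc by auto
  have "desc k \<otimes> x i = desc (Suc k) \<otimes> (x k \<otimes> x i)" using Suc c by (simp add: desc_Suc m_assoc)
  also have "\<dots> = (desc (Suc k) \<otimes> x i) \<otimes> x k" using c by (simp add: ki m_assoc)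
  also have "\<dots> = x i \<otimes> desc k" using Suc c by (simp add: IH desc_Suc m_assoc)
  finally show ?case .
qed

text \<open>Sliding a crossing through the strand that moves to the end shifts its position by one.\<close>
lemma desc_shift:
  assumes "1 \<le> k" "k \<le> i" "Suc i \<le> n"
  shows "desc k \<otimes> x (Suc i) = x i \<otimes> desc k"
  using assms
proof (induction "i - k" arbitrary: k)
  case 0
  then have k: "k = i" by simp
  have c: "x i \<in> carrier G" "x (Suc i) \<in> carrier G" "desc (Suc (Suc i)) \<in> carrier G"
    using 0 x_closed desc_closed by auto
  have d: "desc i = desc (Suc (Suc i)) \<otimes> (x (Suc i) \<otimes> x i)"
    using 0 c k by (simp add: desc_Suc[of i] desc_Suc[of "Suc i"] m_assoc)
  have "desc i \<otimes> x (Suc i) = desc (Suc (Suc i)) \<otimes> (x i \<otimes> (x (Suc i) \<otimes> x i))"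
    using near[of i] 0 c k by (simp add: d m_assoc)
  also have "\<dots> = (desc (Suc (Suc i)) \<otimes> x i) \<otimes> (x (Suc i) \<otimes> x i)" using c by (simp add: m_assoc)
  also have "\<dots> = x i \<otimes> desc i"
    using desc_far[of i "Suc (Suc i)"] 0 c k by (simp add: d m_assoc)
  finally show ?case by (simp add: k)
next
  case (Suc e)
  have c: "x i \<in> carrier G" "x (Suc i) \<in> carrier G" "x k \<in> carrier G" "desc (Suc k) \<in> carrier G"
    using Suc x_closed desc_closed by auto
  have IH: "desc (Suc k) \<otimes> x (Suc i) = x i \<otimes> desc (Suc k)" using Suc by (intro Suc.hyps(1)) auto
  have ki: "x k \<otimes> x (Suc i) = x (Suc i) \<otimes> x k" using Suc by (intro far) auto
  have "desc k \<otimes> x (Suc i) = desc (Suc k) \<otimes> (x k \<otimes> x (Suc i))" using Suc c by (simp add: desc_Suc m_assoc)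
  also have "\<dots> = (desc (Suc k) \<otimes> x (Suc i)) \<otimes> x k" using c by (simp add: ki m_assoc)
  also have "\<dots> = x i \<otimes> desc k" using Suc c by (simp add: IH desc_Suc m_assoc)
  finally show ?case .
qed

definition pure :: "nat \<Rightarrow> 'a" where
  "pure k = desc (Suc k) \<otimes> (x k \<otimes> x k) \<otimes> inv (desc (Suc k))"

definition "U = generate G (pure ` {1..n})"
definition "P = generate G (x ` {1..<n})"

lemma pure_closed: "k \<in> {1..n} \<Longrightarrow> pure k \<in> carrier G"
  using x_closed desc_closed[of "Suc k"] by (simp add: pure_def)

lemma pure_U: "k \<in> {1..n} \<Longrightarrow> pure k \<in> U"
  by (simp add: U_def generate.incl)

lemma x_P: "i \<in> {1..<n} \<Longrightarrow> x i \<in> P"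
  by (simp add: P_def generate.incl)

lemma U_subgroup: "subgroup U G" and P_subgroup: "subgroup P G"
  unfolding U_def P_def using pure_closed x_closed by (auto intro!: generate_is_subgroup)

lemma conj_eq_of_commute: "g \<in> carrier G \<Longrightarrow> h \<in> carrier G \<Longrightarrow> g \<otimes> h = h' \<otimes> g \<Longrightarrow> h' \<in> carrier G \<Longrightarrow>
    g \<otimes> h \<otimes> inv g = h'"
  by (simp add: m_assoc)

text \<open>The action of a crossing on the two windings around its strands; the relevant identities live in
the braid group on three strands, generated by \<open>x i\<close> and \<open>x (Suc i)\<close>, up to conjugation by a product
that commutes with \<open>x i\<close>.\<close>
lemma pure_conj_same:
  assumes i: "i \<in> {1..<n}"
  shows "x i \<otimes> pure i = pure (Suc i) \<otimes> x i" "x i \<otimes> pure (Suc i) = (inv (pure (Suc i)) \<otimes> pure i \<otimes> pure (Suc i)) \<otimes> x i"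
proof -
  let ?t = "desc (Suc (Suc i))" and ?a = "x i" and ?b = "x (Suc i)"
  have c: "?a \<in> carrier G" "?b \<in> carrier G" "?t \<in> carrier G"
    using i x_closed desc_closed by auto
  have ta: "?a \<otimes> ?t = ?t \<otimes> ?a" using desc_far[of i "Suc (Suc i)"] i by simp
  have ti: "?a \<otimes> inv ?t = inv ?t \<otimes> ?a" using commute_inv[of ?t ?a] c ta by simp
  have aba: "?b \<otimes> (?a \<otimes> ?b) = ?a \<otimes> (?b \<otimes> ?a)" using near[of i] i by simp
  have p1: "pure i = ?t \<otimes> (?b \<otimes> (?a \<otimes> ?a) \<otimes> inv ?b) \<otimes> inv ?t"
    using c i by (simp add: pure_def desc_Suc[of "Suc i"] inv_mult_group m_assoc)
  have p2: "pure (Suc i) = ?t \<otimes> (?b \<otimes> ?b) \<otimes> inv ?t" by (simp add: pure_def)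
  have cl: "pure i \<in> carrier G" "pure (Suc i) \<in> carrier G" using i by (auto intro!: pure_closed)
  \<comment> \<open>two identities in the braid group on three strands\<close>
  have e1: "?a \<otimes> (?b \<otimes> (?a \<otimes> ?a) \<otimes> inv ?b) = (?b \<otimes> ?b) \<otimes> ?a"
  proof -
    have "?a \<otimes> (?b \<otimes> (?a \<otimes> ?a)) = (?a \<otimes> (?b \<otimes> ?a)) \<otimes> ?a" using c by (simp add: m_assoc)
    also have "\<dots> = ?b \<otimes> (?a \<otimes> (?b \<otimes> ?a))" using c by (subst aba[symmetric]) (simp add: m_assoc)
    also have "\<dots> = (?b \<otimes> ?b) \<otimes> ?a \<otimes> ?b" using c by (subst aba[symmetric]) (simp add: m_assoc)
    finally have "?a \<otimes> (?b \<otimes> (?a \<otimes> ?a)) \<otimes> inv ?b = (?b \<otimes> ?b) \<otimes> ?a \<otimes> ?b \<otimes> inv ?b" by simp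
    then show ?thesis using c by (simp add: m_assoc)
  qed
  have e2: "(?b \<otimes> ?b) \<otimes> ?a \<otimes> (?b \<otimes> ?b) = ?b \<otimes> (?a \<otimes> ?a) \<otimes> ?b \<otimes> ?a"
  proof -
    have "(?b \<otimes> ?b) \<otimes> ?a \<otimes> (?b \<otimes> ?b) = ?b \<otimes> (?b \<otimes> (?a \<otimes> ?b)) \<otimes> ?b" using c by (simp add: m_assoc)
    also have "\<dots> = ?b \<otimes> ?a \<otimes> (?b \<otimes> (?a \<otimes> ?b))" unfolding aba using c by (simp add: m_assoc aba)
    also have "\<dots> = ?b \<otimes> (?a \<otimes> ?a) \<otimes> ?b \<otimes> ?a" unfolding aba using c by (simp add: m_assoc aba)
    finally show ?thesis .
  qed
  have out: "?a \<otimes> (?t \<otimes> z \<otimes> inv ?t) = ?t \<otimes> (?a \<otimes> z) \<otimes> inv ?t"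
    "(?t \<otimes> z \<otimes> inv ?t) \<otimes> ?a = ?t \<otimes> (z \<otimes> ?a) \<otimes> inv ?t" if "z \<in> carrier G" for z
    using that c by (simp_all add: m_assoc ti[symmetric]) (simp add: m_assoc[symmetric] ta)
  show "x i \<otimes> pure i = pure (Suc i) \<otimes> x i" unfolding p1 p2 using c e1 by (simp add: out)
  have comp: "(?t \<otimes> y \<otimes> inv ?t) \<otimes> (?t \<otimes> z \<otimes> inv ?t) = ?t \<otimes> (y \<otimes> z) \<otimes> inv ?t"
    if "y \<in> carrier G" "z \<in> carrier G" for y z
  proof -
    have "inv ?t \<otimes> (?t \<otimes> (z \<otimes> inv ?t)) = z \<otimes> inv ?t" using that c by (simp add: m_assoc[symmetric])
    then show ?thesis using that c by (simp add: m_assoc)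
  qed
  have "pure (Suc i) \<otimes> (x i \<otimes> pure (Suc i)) = pure i \<otimes> pure (Suc i) \<otimes> x i"
  proof -
    have "pure (Suc i) \<otimes> (x i \<otimes> pure (Suc i)) = ?t \<otimes> ((?b \<otimes> ?b) \<otimes> (?a \<otimes> (?b \<otimes> ?b))) \<otimes> inv ?t"
      unfolding p2 using c by (simp add: out comp)
    also have "(?b \<otimes> ?b) \<otimes> (?a \<otimes> (?b \<otimes> ?b)) = (?b \<otimes> (?a \<otimes> ?a) \<otimes> inv ?b) \<otimes> (?b \<otimes> ?b) \<otimes> ?a"
    proof -
      have "inv ?b \<otimes> (?b \<otimes> (?b \<otimes> ?a)) = ?b \<otimes> ?a" using c by (simp add: m_assoc[symmetric])
      then show ?thesis using e2 c by (simp add: m_assoc)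
    qed
    also have "?t \<otimes> \<dots> \<otimes> inv ?t = pure i \<otimes> pure (Suc i) \<otimes> x i"
      unfolding p1 p2 using c by (simp add: out comp)
    finally show ?thesis .
  qed
  then have "x i \<otimes> pure (Suc i) = inv (pure (Suc i)) \<otimes> (pure i \<otimes> pure (Suc i) \<otimes> x i)"
    using c cl by (subst inv_solve_left) auto
  then show "x i \<otimes> pure (Suc i) = (inv (pure (Suc i)) \<otimes> pure i \<otimes> pure (Suc i)) \<otimes> x i"
    using c cl by (simp add: m_assoc)
qed

text \<open>A crossing that does not involve the strand \<open>k\<close> is moved through the conjugating product, where it
becomes a crossing far from \<open>x k\<close>.\<close>
lemma pure_conj_other:
  assumes i: "i \<in> {1..<n}" and k: "k \<in> {1..n}" "k \<noteq> i" "k \<noteq> Suc i"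
  shows "x i \<otimes> pure k = pure k \<otimes> x i"
proof -
  let ?t = "desc (Suc k)"
  have c: "x i \<in> carrier G" "x (Suc i) \<in> carrier G" "x k \<in> carrier G" "?t \<in> carrier G"
    using i k x_closed desc_closed by auto
  define j where "j = (if i < k then i else Suc i)"
  have j: "x j \<in> carrier G" using c by (simp add: j_def)
  have t: "x i \<otimes> ?t = ?t \<otimes> x j"
    using desc_far[of i "Suc k"] desc_shift[of "Suc k" i] i k by (auto simp: j_def)
  have kj: "x j \<otimes> x k = x k \<otimes> x j"
    using far[of i k] far[of k "Suc i"] i k by (auto simp: j_def)
  have tj: "x j \<otimes> inv ?t = inv ?t \<otimes> x i"
  proof -
    have "inv ?t \<otimes> (x i \<otimes> ?t) \<otimes> inv ?t = inv ?t \<otimes> (?t \<otimes> x j) \<otimes> inv ?t" by (simp only: t)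
    then show ?thesis using c j by (simp add: m_assoc) (simp add: m_assoc[symmetric])
  qed
  have "x i \<otimes> pure k = (x i \<otimes> ?t) \<otimes> (x k \<otimes> x k) \<otimes> inv ?t" using c by (simp add: pure_def m_assoc)
  also have "\<dots> = ?t \<otimes> ((x j \<otimes> x k) \<otimes> x k) \<otimes> inv ?t" using c j by (simp add: t m_assoc)
  also have "\<dots> = ?t \<otimes> (x k \<otimes> (x j \<otimes> x k)) \<otimes> inv ?t" using c j by (simp add: kj m_assoc)
  also have "\<dots> = ?t \<otimes> (x k \<otimes> x k) \<otimes> (x j \<otimes> inv ?t)" using c j by (simp add: kj m_assoc)
  also have "\<dots> = pure k \<otimes> x i" using c j by (simp add: tj pure_def m_assoc)
  finally show ?thesis .
qed

lemma x_normalizes: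
  assumes i: "i \<in> {1..<n}" and u: "u \<in> U"
  shows "x i \<otimes> u \<otimes> inv (x i) \<in> U" "inv (x i) \<otimes> u \<otimes> x i \<in> U"
proof -
  have xi: "x i \<in> carrier G" using i x_closed by simp
  have S: "pure ` {1..n} \<subseteq> carrier G" using pure_closed by auto
  have i': "i \<in> {1..n}" "Suc i \<in> {1..n}" using i by auto
  note pc = pure_closed[OF i'(1)] pure_closed[OF i'(2)]
  interpret Us: subgroup U G by (rule U_subgroup)
  let ?p = "pure i" and ?q = "pure (Suc i)"
  have 1: "x i \<otimes> ?p \<otimes> inv (x i) = ?q"
    using pure_conj_same(1)[OF i] pc xi by (intro conj_eq_of_commute) auto
  have 2: "x i \<otimes> ?q \<otimes> inv (x i) = inv ?q \<otimes> ?p \<otimes> ?q"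
    using pure_conj_same(2)[OF i] pc xi by (intro conj_eq_of_commute) auto
  have 3: "inv (x i) \<otimes> ?q \<otimes> x i = ?p"
    using 1[symmetric] pc xi by (simp add: m_assoc) (simp add: m_assoc[symmetric])
  have 4: "inv (x i) \<otimes> ?p \<otimes> x i = ?p \<otimes> ?q \<otimes> inv ?p"
  proof -
    have "?p = ?q \<otimes> (x i \<otimes> ?q \<otimes> inv (x i)) \<otimes> inv ?q" unfolding 2 using pc xi by (simp add: m_assoc) (simp add: m_assoc[symmetric])
    then have "inv (x i) \<otimes> ?p \<otimes> x i = inv (x i) \<otimes> (?q \<otimes> (x i \<otimes> ?q \<otimes> inv (x i)) \<otimes> inv ?q) \<otimes> x i" by simp
    also have "\<dots> = (inv (x i) \<otimes> ?q \<otimes> x i) \<otimes> ?q \<otimes> inv (inv (x i) \<otimes> ?q \<otimes> x i)"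
      using pc xi by (simp add: m_assoc inv_mult_group)
    finally show ?thesis unfolding 3 .
  qed
  have a: "x i \<otimes> s \<otimes> inv (x i) \<in> U" "inv (x i) \<otimes> s \<otimes> inv (inv (x i)) \<in> U" if "s \<in> pure ` {1..n}" for s
  proof -
    from that obtain k where k: "k \<in> {1..n}" "s = pure k" by auto
    consider "k = i" | "k = Suc i" | "k \<noteq> i" "k \<noteq> Suc i" by blast
    then have "x i \<otimes> s \<otimes> inv (x i) \<in> U \<and> inv (x i) \<otimes> s \<otimes> x i \<in> U"
    proof cases
      case 3
      have com: "x i \<otimes> s = s \<otimes> x i" using pure_conj_other[OF i k(1) 3] k(2) by simp
      have s: "s \<in> carrier G" using k pure_closed by simp
      have "x i \<otimes> s \<otimes> inv (x i) = s" using com s xi by (intro conj_eq_of_commute) auto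
      moreover have "inv (x i) \<otimes> s \<otimes> x i = s"
        using commute_inv[OF xi s com] s xi by (simp add: m_assoc)
      ultimately show ?thesis using k pure_U by simp
    qed (use k 1 2 3 4 pure_U i' in auto)
    then show "x i \<otimes> s \<otimes> inv (x i) \<in> U" "inv (x i) \<otimes> s \<otimes> inv (inv (x i)) \<in> U" using xi by simp_all
  qed
  show "x i \<otimes> u \<otimes> inv (x i) \<in> U"
    using generate_conj_closed[OF S xi, of u] a(1) u by (simp add: U_def)
  show "inv (x i) \<otimes> u \<otimes> x i \<in> U"
    using generate_conj_closed[OF S inv_closed[OF xi], of u] a(2) u xi by (simp add: U_def)
qed

lemma P_normalizes: "p \<in> P \<Longrightarrow> \<forall>u\<in>U. p \<otimes> u \<otimes> inv p \<in> U"
  unfolding P_def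
proof (induction rule: generate.induct)
  case one
  then show ?case using subgroup.mem_carrier[OF U_subgroup] by simp
next
  case (incl h)
  then show ?case using x_normalizes(1) by auto
next
  case (inv h)
  then show ?case using x_normalizes(2) x_closed by auto
next
  case (eng p q)
  have S: "x ` {1..<n} \<subseteq> carrier G" using x_closed by auto
  have pq: "p \<in> carrier G" "q \<in> carrier G" using eng generate_in_carrier[OF S] by auto
  show ?case
  proof
    fix u assume u: "u \<in> U"
    then have "u \<in> carrier G" using subgroup.mem_carrier[OF U_subgroup] by simp
    then have "p \<otimes> q \<otimes> u \<otimes> inv (p \<otimes> q) = p \<otimes> (q \<otimes> u \<otimes> inv q) \<otimes> inv p"
      using pq by (simp add: m_assoc inv_mult_group)
    then show "p \<otimes> q \<otimes> u \<otimes> inv (p \<otimes> q) \<in> U" using eng u by simp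
  qed
qed

text \<open>This set is closed under multiplication by the generators from the right, hence contains the
subgroup that they generate. First comes the
winding of the last strand, then a braid on the others, and at the end the choice of the strand that
becomes the last one.\<close>
definition combed :: "'a set" where
  "combed = {u \<otimes> p \<otimes> desc k | u p k. u \<in> U \<and> p \<in> P \<and> k \<in> {1..Suc n}}"

lemma combed_mult:
  assumes u: "u \<in> U" "p \<in> P" and u': "u' \<in> U" "p' \<in> P" and k: "k \<in> {1..Suc n}"
  shows "u \<otimes> p \<otimes> (u' \<otimes> p' \<otimes> desc k) \<in> combed"
proof -
  interpret Us: subgroup U G by (rule U_subgroup)
  interpret Ps: subgroup P G by (rule P_subgroup)
  have c: "u \<in> carrier G" "p \<in> carrier G" "u' \<in> carrier G" "p' \<in> carrier G" "desc k \<in> carrier G"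
    using assms desc_closed by auto
  have "u \<otimes> p \<otimes> (u' \<otimes> p' \<otimes> desc k) = (u \<otimes> (p \<otimes> u' \<otimes> inv p)) \<otimes> (p \<otimes> p') \<otimes> desc k"
  proof -
    have "inv p \<otimes> (p \<otimes> (p' \<otimes> desc k)) = p' \<otimes> desc k" using c by (simp add: m_assoc[symmetric])
    then show ?thesis using c by (simp add: m_assoc)
  qed
  moreover have "u \<otimes> (p \<otimes> u' \<otimes> inv p) \<in> U" using P_normalizes[OF u(2)] u u' by blast
  moreover have "p \<otimes> p' \<in> P" using u u' by blast
  ultimately show ?thesis using k unfolding combed_def by blast
qed

text \<open>If the crossing meets the strand that moves to the end, then that strand is exchanged with its
neighbour, in one direction at the price of a winding; otherwise the crossing is moved to the left.\<close>
lemma desc_times_x: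
  assumes k: "k \<in> {1..Suc n}" and i: "i \<in> {1..n}"
  shows "\<exists>u p k'. u \<in> U \<and> p \<in> P \<and> k' \<in> {1..Suc n} \<and> desc k \<otimes> x i = u \<otimes> p \<otimes> desc k'"
    "\<exists>u p k'. u \<in> U \<and> p \<in> P \<and> k' \<in> {1..Suc n} \<and> desc k \<otimes> inv (x i) = u \<otimes> p \<otimes> desc k'"
proof -
  interpret Us: subgroup U G by (rule U_subgroup)
  interpret Ps: subgroup P G by (rule P_subgroup)
  have xi: "x i \<in> carrier G" and dk: "desc k \<in> carrier G" using k i x_closed desc_closed by auto
  consider "i + 1 < k" | "i + 1 = k" | "i = k" | "k < i" by linarith
  then have "(\<exists>u p k'. u \<in> U \<and> p \<in> P \<and> k' \<in> {1..Suc n} \<and> desc k \<otimes> x i = u \<otimes> p \<otimes> desc k') \<and>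
    (\<exists>u p k'. u \<in> U \<and> p \<in> P \<and> k' \<in> {1..Suc n} \<and> desc k \<otimes> inv (x i) = u \<otimes> p \<otimes> desc k')"
  proof cases
    case 1
    then have "x i \<in> P" using i k by (intro x_P) auto
    moreover have e: "desc k \<otimes> x i = x i \<otimes> desc k" using desc_far[of i k] 1 i k by simp
    moreover have "desc k \<otimes> inv (x i) = inv (x i) \<otimes> desc k" using commute_inv[of "x i" "desc k"] e xi dk by simp
    ultimately show ?thesis using k xi
      by (intro conjI exI[of _ \<one>] exI[of _ "x i"] exI[of _ "inv (x i)"] exI[of _ k]) auto
  next
    case 2
    then have k': "k = Suc i" by simp
    then have e: "desc i = desc k \<otimes> x i" using desc_Suc[of i] i by simp
    have "pure i \<otimes> (desc k \<otimes> inv (x i)) = desc i"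
    proof -
      have "inv (desc k) \<otimes> (desc k \<otimes> inv (x i)) = inv (x i)" using xi dk by (simp add: m_assoc[symmetric])
      then show ?thesis using xi dk by (simp add: e pure_def k'[symmetric] m_assoc)
    qed
    moreover have di: "desc i \<in> carrier G" using e xi dk by simp
    ultimately have "desc k \<otimes> inv (x i) = inv (pure i) \<otimes> desc i"
      using xi dk pure_closed[OF i] by (subst inv_solve_left) auto
    moreover have "inv (pure i) \<in> U" using pure_U[OF i] by blast
    ultimately show ?thesis using i e pure_closed[OF i] di
      by (intro conjI exI[of _ \<one>] exI[of _ "inv (pure i)"] exI[of _ i]) auto
  next
    case 3
    then have e: "desc k = desc (Suc i) \<otimes> x i" using desc_Suc[of i] i by simp
    have d: "desc (Suc i) \<in> carrier G" using i desc_closed by simp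
    have "desc k \<otimes> inv (x i) = desc (Suc i)" using e d xi by (simp add: m_assoc)
    moreover have "desc k \<otimes> x i = pure i \<otimes> desc (Suc i)"
      using d xi by (simp add: e pure_def m_assoc)
    ultimately show ?thesis using i d pure_U[OF i] pure_closed[OF i]
      by (intro conjI exI[of _ \<one>] exI[of _ "pure i"] exI[of _ "Suc i"]) auto
  next
    case 4
    then obtain j where j: "i = Suc j" "k \<le> j" by (cases i) auto
    have jP: "x j \<in> P" using i j k by (intro x_P) auto
    have e: "desc k \<otimes> x i = x j \<otimes> desc k" using desc_shift[of k j] j i k by simp
    have xj: "x j \<in> carrier G" using jP by simp
    have "x j \<otimes> (desc k \<otimes> inv (x i)) = desc k"
      using arg_cong[OF e, of "\<lambda>g. g \<otimes> inv (x i)"] xi xj dk by (simp add: m_assoc)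
    then have "desc k \<otimes> inv (x i) = inv (x j) \<otimes> desc k"
      using xi xj dk by (subst inv_solve_left) auto
    then show ?thesis using e jP xj k dk
      by (intro conjI exI[of _ \<one>] exI[of _ "x j"] exI[of _ "inv (x j)"] exI[of _ k]) auto
  qed
  then show "\<exists>u p k'. u \<in> U \<and> p \<in> P \<and> k' \<in> {1..Suc n} \<and> desc k \<otimes> x i = u \<otimes> p \<otimes> desc k'"
    "\<exists>u p k'. u \<in> U \<and> p \<in> P \<and> k' \<in> {1..Suc n} \<and> desc k \<otimes> inv (x i) = u \<otimes> p \<otimes> desc k'" by auto
qed

lemma combed_step:
  assumes g: "g \<in> combed" and i: "i \<in> {1..n}"
  shows "g \<otimes> x i \<in> combed" "g \<otimes> inv (x i) \<in> combed"
proof -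
  obtain u p k where g: "g = u \<otimes> p \<otimes> desc k" "u \<in> U" "p \<in> P" "k \<in> {1..Suc n}"
    using g by (auto simp: combed_def)
  have c: "u \<in> carrier G" "p \<in> carrier G" "desc k \<in> carrier G" "x i \<in> carrier G"
    using g i desc_closed x_closed subgroup.mem_carrier[OF U_subgroup] subgroup.mem_carrier[OF P_subgroup] by auto
  have "g \<otimes> x i = u \<otimes> p \<otimes> (desc k \<otimes> x i)" "g \<otimes> inv (x i) = u \<otimes> p \<otimes> (desc k \<otimes> inv (x i))"
    using c by (simp_all add: g m_assoc)
  then show "g \<otimes> x i \<in> combed" "g \<otimes> inv (x i) \<in> combed"
    using desc_times_x[OF g(4) i] combed_mult[OF g(2,3)] by metis+
qed

lemma one_combed: "\<one> \<in> combed"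
  unfolding combed_def
  using subgroup.one_closed[OF U_subgroup] subgroup.one_closed[OF P_subgroup] desc_last
  by (intro CollectI exI[of _ \<one>] exI[of _ "Suc n"]) auto

end

section \<open>Artin's representation is faithful\<close>

lemma hom_braid_solution:
  assumes "braid_solution G n x" "h \<in> hom G H" "group H" "\<And>i. i \<in> {1..n} \<Longrightarrow> y i = h (x i)"
  shows "braid_solution H n y"
proof -
  interpret braid_solution G n x by fact
  note hm = hom_mult[OF assms(2)] 
  show ?thesis
  proof (intro braid_solution.intro braid_solution_axioms.intro)
    fix i
    show "y i \<in> carrier H" if "i \<in> {1..n}"
      using that assms(2,4) x_closed by (auto intro: hom_in_carrier)
    show "y i \<otimes>\<^bsub>H\<^esub> y j = y j \<otimes>\<^bsub>H\<^esub> y i" if "i \<in> {1..n}" "j \<in> {1..n}" "i + 2 \<le> j" for j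
      using that hm[of "x i" "x j"] hm[of "x j" "x i"] far[of i j] x_closed by (simp add: assms(4))
    show "y (Suc i) \<otimes>\<^bsub>H\<^esub> (y i \<otimes>\<^bsub>H\<^esub> y (Suc i)) = y i \<otimes>\<^bsub>H\<^esub> (y (Suc i) \<otimes>\<^bsub>H\<^esub> y i)"
      if "i \<in> {1..n}" "Suc i \<in> {1..n}"
    proof -
      have "h (x (Suc i) \<otimes>\<^bsub>G\<^esub> (x i \<otimes>\<^bsub>G\<^esub> x (Suc i))) = h (x i \<otimes>\<^bsub>G\<^esub> (x (Suc i) \<otimes>\<^bsub>G\<^esub> x i))" by (simp only: near[OF that])
      then show ?thesis using that x_closed by (simp add: assms(4) hm)
    qed
  qed fact
qed

lemma braid_solution_mono: "braid_solution G n x \<Longrightarrow> m \<le> n \<Longrightarrow> braid_solution G m x"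
  unfolding braid_solution_def braid_solution_axioms_def by auto

lemma Braid_group: "group (Braid n)"
  by (simp add: Braid_def PG_group)

lemma sigma_eq: "sigma n i = wcl {1..<n} (braid_relations n) [(i, True)]"
  by (simp add: sigma_def wcl_def)

lemma sigma_carrier: "i \<in> {1..<n} \<Longrightarrow> sigma n i \<in> carrier (Braid n)"
  by (simp add: sigma_eq Braid_def wcl_carrier)

lemma sigma_braid_solution: "braid_solution (Braid (Suc n)) n (sigma (Suc n))"
proof (intro braid_solution.intro braid_solution_axioms.intro Braid_group)
  have eqI: "wcl {1..<Suc n} (braid_relations (Suc n)) u = wcl {1..<Suc n} (braid_relations (Suc n)) v"
    if "(u, v) \<in> braid_relations (Suc n)" "u \<in> gwords {1..<Suc n}" "v \<in> gwords {1..<Suc n}" for u v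
    using that by (simp add: wcl_eq_iff word_eq.relation)
  fix i assume i: "i \<in> {1..n}"
  then show "sigma (Suc n) i \<in> carrier (Braid (Suc n))" by (simp add: sigma_carrier)
  show "sigma (Suc n) i \<otimes>\<^bsub>Braid (Suc n)\<^esub> sigma (Suc n) j = sigma (Suc n) j \<otimes>\<^bsub>Braid (Suc n)\<^esub> sigma (Suc n) i"
    if "j \<in> {1..n}" "i + 2 \<le> j" for j
    using that i eqI[of "[(i, True), (j, True)]" "[(j, True), (i, True)]"]
    by (simp add: sigma_eq Braid_def PG_mult braid_relations_def)
  show "sigma (Suc n) (Suc i) \<otimes>\<^bsub>Braid (Suc n)\<^esub> (sigma (Suc n) i \<otimes>\<^bsub>Braid (Suc n)\<^esub> sigma (Suc n) (Suc i)) =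
      sigma (Suc n) i \<otimes>\<^bsub>Braid (Suc n)\<^esub> (sigma (Suc n) (Suc i) \<otimes>\<^bsub>Braid (Suc n)\<^esub> sigma (Suc n) i)"
    if "Suc i \<in> {1..n}"
    using that i eqI[of "[(Suc i, True), (i, True), (Suc i, True)]" "[(i, True), (Suc i, True), (i, True)]"]
    by (simp add: sigma_eq Braid_def PG_mult braid_relations_def)
qed

lemma braid_hom:
  assumes "braid_solution G n x"
  shows "pres_hom G x \<in> hom (Braid (Suc n)) G" "i \<in> {1..n} \<Longrightarrow> pres_hom G x (sigma (Suc n) i) = x i"
proof -
  interpret braid_solution G n x by fact
  have xc: "x i \<in> carrier G" if "i \<in> {1..<Suc n}" for i using that x_closed by simp
  have far': "x i \<otimes>\<^bsub>G\<^esub> x j = x j \<otimes>\<^bsub>G\<^esub> x i" if "i \<in> {1..<Suc n}" "j \<in> {1..<Suc n}" "Suc (Suc i) \<le> j \<or> Suc (Suc j) \<le> i" for i j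
    using that far[of i j] far[of j i] by auto
  have near': "x (Suc i) \<otimes>\<^bsub>G\<^esub> (x i \<otimes>\<^bsub>G\<^esub> x (Suc i)) = x i \<otimes>\<^bsub>G\<^esub> (x (Suc i) \<otimes>\<^bsub>G\<^esub> x i)"
    if "i \<in> {1..<Suc n}" "Suc i \<in> {1..<Suc n}" for i
    using that by (intro near) auto
  have rel: "word_value G x u = word_value G x v"
    if uv: "(u, v) \<in> braid_relations (Suc n)" "u \<in> gwords {1..<Suc n}" "v \<in> gwords {1..<Suc n}" for u v
  proof -
    consider (a) i j where "u = [(i, True), (j, True)]" "v = [(j, True), (i, True)]"
        "i \<in> {1..<Suc n}" "j \<in> {1..<Suc n}" "Suc (Suc i) \<le> j \<or> Suc (Suc j) \<le> i"
      | (b) i where "u = [(Suc i, True), (i, True), (Suc i, True)]" "v = [(i, True), (Suc i, True), (i, True)]"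
        "i \<in> {1..<Suc n}" "Suc i \<in> {1..<Suc n}"
      using uv(1) unfolding braid_relations_def add_2_eq_Suc' Un_iff mem_Collect_eq prod.inject by blast
    then show ?thesis
    proof cases
      case (a i j)
      then show ?thesis using far'[OF a(3-5)] xc by (simp add: word_value_def)
    next
      case (b i)
      then show ?thesis using near'[OF b(3,4)] xc by (simp add: word_value_def)
    qed
  qed
  show "pres_hom G x \<in> hom (Braid (Suc n)) G" "i \<in> {1..n} \<Longrightarrow> pres_hom G x (sigma (Suc n) i) = x i"
    using pres_hom_hom[OF is_group xc rel, of "{1..<Suc n}" "braid_relations (Suc n)"] by (simp_all add: Braid_def sigma_eq)
qed

lemma braid_hom_eqI:
  assumes "group G" "h \<in> hom (Braid n) G" "k \<in> hom (Braid n) G"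
    "\<And>i. i \<in> {1..<n} \<Longrightarrow> h (sigma n i) = k (sigma n i)" "\<beta> \<in> carrier (Braid n)"
  shows "h \<beta> = k \<beta>"
  using hom_eq_on_generators[OF assms(1), of h "{1..<n}" "braid_relations n" k \<beta>] assms(2-5)
  by (simp add: Braid_def sigma_eq)

lemma Braid_combed: "carrier (Braid (Suc n)) \<subseteq> braid_solution.combed (Braid (Suc n)) n (sigma (Suc n))"
proof
  interpret braid_solution "Braid (Suc n)" n "sigma (Suc n)" by (rule sigma_braid_solution)
  let ?c = "wcl {1..<Suc n} (braid_relations (Suc n))"
  fix \<beta> assume "\<beta> \<in> carrier (Braid (Suc n))"
  then obtain w where w: "w \<in> gwords {1..<Suc n}" "\<beta> = ?c w" by (auto simp: Braid_def PG_carrier)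
  from w(1) have "?c w \<in> combed"
  proof (induction w rule: rev_induct)
    case Nil
    then show ?case using one_combed by (simp add: Braid_def PG_one)
  next
    case (snoc l w)
    then have i: "fst l \<in> {1..n}" and IH: "?c w \<in> combed" and w: "w \<in> gwords {1..<Suc n}" by auto
    have "?c (w @ [l]) = ?c w \<otimes>\<^bsub>Braid (Suc n)\<^esub> ?c [l]"
      using snoc w by (simp add: Braid_def PG_mult)
    moreover have "?c [l] = (if snd l then sigma (Suc n) (fst l) else inv\<^bsub>Braid (Suc n)\<^esub> (sigma (Suc n) (fst l)))"
      using i by (cases l) (auto simp: sigma_eq Braid_def PG_inv)
    ultimately show ?case using combed_step[OF IH i] by simp
  qed
  then show "\<beta> \<in> combed" using w by simp
qed

text \<open>The image of \<open>\<sigma>\<^sub>i\<close>; it maps \<open>x\<^sub>i\<close> to \<open>x\<^sub>i\<^sub>+\<^sub>1\<close> and \<open>x\<^sub>i\<^sub>+\<^sub>1\<close> to \<open>x\<^sub>i\<^sub>+\<^sub>1\<^sup>-\<^sup>1 x\<^sub>i x\<^sub>i\<^sub>+\<^sub>1\<close>.\<close>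
abbreviation artin :: "nat \<Rightarrow> nat \<Rightarrow> fg_aut" where
  "artin n i \<equiv> aut_gen n i (Suc i) \<otimes>\<^bsub>BP n\<^esub> perm_aut n (transpose i (Suc i))"

context
  fixes n i :: nat
  assumes i: "i \<in> {1..n}" "Suc i \<in> {1..n}"
begin

lemma transpose_permutes: "transpose i (Suc i) permutes {1..n}"
  using i by (intro permutes_swap_id) auto

lemma artin_BP: "artin n i \<in> carrier (BP n)"
  using group.is_monoid[OF BP_group, THEN monoid.m_closed] move_BP[of i n "Suc i"] perm_aut_BP[OF transpose_permutes] i
  by (simp add: aut_gen_eq_move)

lemma artin_apply:
  "artin n i (gen n i) = gen n (Suc i)"
  "artin n i (gen n (Suc i)) = cj n (gen n i) (gen n (Suc i))"
  "m \<in> {1..n} \<Longrightarrow> m \<noteq> i \<Longrightarrow> m \<noteq> Suc i \<Longrightarrow> artin n i (gen n m) = gen n m"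
proof -
  have *: "artin n i (gen n m) = move n i (Suc i) True (gen n (transpose i (Suc i) m))" if "m \<in> {1..n}" for m
    using that i move_BP[of i n "Suc i"] perm_aut_BP[OF transpose_permutes]
    by (simp add: aut_gen_eq_move BP_apply perm_aut_apply transpose_permutes)
  show "artin n i (gen n i) = gen n (Suc i)" "artin n i (gen n (Suc i)) = cj n (gen n i) (gen n (Suc i))"
    "m \<in> {1..n} \<Longrightarrow> m \<noteq> i \<Longrightarrow> m \<noteq> Suc i \<Longrightarrow> artin n i (gen n m) = gen n m"
    using i by (simp_all add: * move_apply signed_def)
qed

lemma bp_perm_artin: "bp_perm n (artin n i) = transpose i (Suc i)"
proof -
  have "move n i (Suc i) True \<in> carrier (BC n)" using i by (intro move_BC) auto
  then show ?thesis
    using hom_mult[OF bp_perm_hom, of "aut_gen n i (Suc i)" n "perm_aut n (transpose i (Suc i))"]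
      perm_aut_BP[OF transpose_permutes] bp_perm_perm_aut[OF transpose_permutes]
    by (simp add: aut_gen_eq_move BC_carrier sym_group_def)
qed

end

lemma artin_braid_solution: "braid_solution (BP (Suc n)) n (artin (Suc n))"
proof (intro braid_solution.intro braid_solution_axioms.intro BP_group)
  interpret B: group "BP (Suc n)" by (rule BP_group)
  let ?N = "Suc n"
  fix i assume i: "i \<in> {1..n}"
  then have i': "i \<in> {1..?N}" "Suc i \<in> {1..?N}" by auto
  note bi = artin_BP[OF i'] note ai = artin_apply[OF i']
  note hi = BP_hom_simps[OF bi]
  show "artin ?N i \<in> carrier (BP ?N)" by (rule bi)
  show "artin ?N i \<otimes>\<^bsub>BP ?N\<^esub> artin ?N j = artin ?N j \<otimes>\<^bsub>BP ?N\<^esub> artin ?N i"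
    if "j \<in> {1..n}" "i + 2 \<le> j" for j
  proof (rule BP_eqI)
    from that have j: "j \<in> {1..?N}" "Suc j \<in> {1..?N}" by auto
    note bj = artin_BP[OF j]
    show "artin ?N i \<otimes>\<^bsub>BP ?N\<^esub> artin ?N j \<in> carrier (BP ?N)" "artin ?N j \<otimes>\<^bsub>BP ?N\<^esub> artin ?N i \<in> carrier (BP ?N)"
      using bi bj by simp_all
    fix m assume m: "m \<in> {1..?N}"
    consider "m = i" | "m = Suc i" | "m = j" | "m = Suc j" | "m \<noteq> i" "m \<noteq> Suc i" "m \<noteq> j" "m \<noteq> Suc j" by blast
    then show "(artin ?N i \<otimes>\<^bsub>BP ?N\<^esub> artin ?N j) (gen ?N m) = (artin ?N j \<otimes>\<^bsub>BP ?N\<^esub> artin ?N i) (gen ?N m)"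
      by cases (use that i' j m in \<open>simp_all add: BP_apply bi bj ai artin_apply[OF j] hi BP_hom_simps[OF bj]\<close>)
  qed
  show "artin ?N (Suc i) \<otimes>\<^bsub>BP ?N\<^esub> (artin ?N i \<otimes>\<^bsub>BP ?N\<^esub> artin ?N (Suc i)) =
      artin ?N i \<otimes>\<^bsub>BP ?N\<^esub> (artin ?N (Suc i) \<otimes>\<^bsub>BP ?N\<^esub> artin ?N i)"
    if "Suc i \<in> {1..n}"
  proof (rule BP_eqI)
    interpret F: group "FG ?N" by (rule FG_group)
    from that have j: "Suc i \<in> {1..?N}" "Suc (Suc i) \<in> {1..?N}" by auto
    note bj = artin_BP[OF j]
    show "artin ?N (Suc i) \<otimes>\<^bsub>BP ?N\<^esub> (artin ?N i \<otimes>\<^bsub>BP ?N\<^esub> artin ?N (Suc i)) \<in> carrier (BP ?N)"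
      "artin ?N i \<otimes>\<^bsub>BP ?N\<^esub> (artin ?N (Suc i) \<otimes>\<^bsub>BP ?N\<^esub> artin ?N i) \<in> carrier (BP ?N)"
      using bi bj by simp_all
    fix m assume m: "m \<in> {1..?N}"
    let ?x = "gen ?N i" and ?y = "gen ?N (Suc i)" and ?z = "gen ?N (Suc (Suc i))"
    have c: "?x \<in> carrier (FG ?N)" "?y \<in> carrier (FG ?N)" "?z \<in> carrier (FG ?N)" using i' j by auto
    have "?z \<otimes>\<^bsub>FG ?N\<^esub> cj ?N ?y ?z = ?y \<otimes>\<^bsub>FG ?N\<^esub> ?z"
      using c by (simp add: F.m_assoc[symmetric])
    then have key: "cj ?N (cj ?N ?x ?z) (cj ?N ?y ?z) = cj ?N (cj ?N ?x ?y) ?z"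
      using c by (simp add: cj_cj cj_closed)
    consider "m = i" | "m = Suc i" | "m = Suc (Suc i)" | "m \<noteq> i" "m \<noteq> Suc i" "m \<noteq> Suc (Suc i)" by blast
    then show "(artin ?N (Suc i) \<otimes>\<^bsub>BP ?N\<^esub> (artin ?N i \<otimes>\<^bsub>BP ?N\<^esub> artin ?N (Suc i))) (gen ?N m) =
        (artin ?N i \<otimes>\<^bsub>BP ?N\<^esub> (artin ?N (Suc i) \<otimes>\<^bsub>BP ?N\<^esub> artin ?N i)) (gen ?N m)"
      by cases (use i' j m key in \<open>simp_all add: BP_apply bi bj ai artin_apply[OF j] hi(4) BP_hom_simps(4)[OF bj] cj_closed\<close>)
  qed
qed

lemma braid_to_bp_hom:
  "braid_to_bp (Suc n) \<in> hom (Braid (Suc n)) (BP (Suc n))"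
  "i \<in> {1..n} \<Longrightarrow> braid_to_bp (Suc n) (sigma (Suc n) i) = artin (Suc n) i"
  unfolding braid_to_bp_def using braid_hom[OF artin_braid_solution] by auto

lemma braid_perm_eq:
  assumes "\<beta> \<in> carrier (Braid (Suc n))"
  shows "bp_perm (Suc n) (braid_to_bp (Suc n) \<beta>) = braid_perm (Suc n) \<beta>"
proof -
  have S: "group (sym_group (Suc n))" by (rule sym_group_is_group)
  have sol: "braid_solution (sym_group (Suc n)) n (\<lambda>i. transpose i (Suc i))"
    by (rule hom_braid_solution[OF artin_braid_solution bp_perm_hom S]) (simp add: bp_perm_artin)
  have "(bp_perm (Suc n) \<circ> braid_to_bp (Suc n)) \<beta> = braid_perm (Suc n) \<beta>"
  proof (rule braid_hom_eqI[OF S])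
    show "bp_perm (Suc n) \<circ> braid_to_bp (Suc n) \<in> hom (Braid (Suc n)) (sym_group (Suc n))"
      by (rule hom_compose[OF braid_to_bp_hom(1) bp_perm_hom])
    show "braid_perm (Suc n) \<in> hom (Braid (Suc n)) (sym_group (Suc n))"
      unfolding braid_perm_def by (rule braid_hom(1)[OF sol])
  qed (use assms braid_hom(2)[OF sol] in \<open>auto simp: braid_perm_def braid_to_bp_hom bp_perm_artin\<close>)
  then show ?thesis by simp
qed

lemma braid_embed_hom:
  "braid_embed (Suc n) \<in> hom (Braid (Suc n)) (Braid (Suc (Suc n)))"
  "i \<in> {1..n} \<Longrightarrow> braid_embed (Suc n) (sigma (Suc n) i) = sigma (Suc (Suc n)) i"
  unfolding braid_embed_def
  using braid_hom[OF braid_solution_mono[OF sigma_braid_solution[of "Suc n"], of n]] by auto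

lemma braid_to_bp_embed:
  assumes "\<beta> \<in> carrier (Braid (Suc n))"
  shows "braid_to_bp (Suc (Suc n)) (braid_embed (Suc n) \<beta>) = bp_embed (Suc n) (braid_to_bp (Suc n) \<beta>)"
proof -
  have "(braid_to_bp (Suc (Suc n)) \<circ> braid_embed (Suc n)) \<beta> = (bp_embed (Suc n) \<circ> braid_to_bp (Suc n)) \<beta>"
  proof (rule braid_hom_eqI[OF BP_group[of "Suc (Suc n)"]])
    show "braid_to_bp (Suc (Suc n)) \<circ> braid_embed (Suc n) \<in> hom (Braid (Suc n)) (BP (Suc (Suc n)))"
      by (rule hom_compose[OF braid_embed_hom(1) braid_to_bp_hom(1)])
    show "bp_embed (Suc n) \<circ> braid_to_bp (Suc n) \<in> hom (Braid (Suc n)) (BP (Suc (Suc n)))"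
      by (rule hom_compose[OF braid_to_bp_hom(1) bp_embed_hom])
    fix i assume "i \<in> {1..<Suc n}"
    then have i: "i \<in> {1..n}" "i \<in> {1..Suc n}" "Suc i \<in> {1..Suc n}" by auto
    have c: "aut_gen (Suc n) i (Suc i) \<in> carrier (BP (Suc n))" using i by (simp add: aut_gen_eq_move move_BP)
    show "(braid_to_bp (Suc (Suc n)) \<circ> braid_embed (Suc n)) (sigma (Suc n) i) =
        (bp_embed (Suc n) \<circ> braid_to_bp (Suc n)) (sigma (Suc n) i)"
      using i c
      by (simp add: braid_embed_hom braid_to_bp_hom bp_embed_mult perm_aut_BP transpose_permutes
          bp_embed_perm_aut bp_embed_aut_gen admissible_def)
  qed fact
  then show ?thesis by simp
qed

interpretation S: braid_solution "Braid (Suc n)" n "sigma (Suc n)" for n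
  by (rule sigma_braid_solution)

text \<open>Killing the last generator makes conjugation by it invisible, and so separates the action of the last
strand from that of the others.\<close>
abbreviation del_last :: "nat \<Rightarrow> fg_elem \<Rightarrow> fg_elem" where
  "del_last n \<equiv> pres_hom (FG n) (\<lambda>i. if i \<le> n then gen n i else \<one>\<^bsub>FG n\<^esub>)"

lemma del_last_hom: "del_last n \<in> hom (FG (Suc n)) (FG n)"
  and del_last_gen: "i \<in> {1..n} \<Longrightarrow> del_last n (gen (Suc n) i) = gen n i"
  and del_last_last: "del_last n (gen (Suc n) (Suc n)) = \<one>\<^bsub>FG n\<^esub>"
proof -
  have c: "(if i \<le> n then gen n i else \<one>\<^bsub>FG n\<^esub>) \<in> carrier (FG n)" if "i \<in> {1..Suc n}" for i
    using that by (auto simp: FG_one)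
  note p = pres_hom_hom[OF FG_group[of n], of "{1..Suc n}" "\<lambda>i. if i \<le> n then gen n i else \<one>\<^bsub>FG n\<^esub>" "{}", OF c]
  show "del_last n \<in> hom (FG (Suc n)) (FG n)"
    "i \<in> {1..n} \<Longrightarrow> del_last n (gen (Suc n) i) = gen n i"
    "del_last n (gen (Suc n) (Suc n)) = \<one>\<^bsub>FG n\<^esub>"
    using p by (simp_all add: FG_def[of "Suc n"] gen_eq[of "Suc n"])
qed

lemma del_last_incl: "x \<in> carrier (FG n) \<Longrightarrow> del_last n (incl n x) = x"
  using FG_hom_eqI[OF FG_group, of "del_last n \<circ> incl n" n n id x] hom_compose[OF incl_hom del_last_hom]
  by (auto simp: incl_gen del_last_gen hom_def)

text \<open>The automorphisms that become trivial when \<open>x\<^sub>n\<^sub>+\<^sub>1\<close> is killed, together with the element \<open>y\<close> of \<open>F\<^sub>n\<close>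
along which they conjugate \<open>x\<^sub>n\<^sub>+\<^sub>1\<close>. For the automorphism of a braid in which only the last strand moves,
\<open>y\<close> is the path of that strand.\<close>
definition last_winding :: "nat \<Rightarrow> fg_aut \<Rightarrow> fg_elem \<Rightarrow> bool" where
  "last_winding n f y \<longleftrightarrow> f \<in> carrier (BP (Suc n)) \<and>
     (\<forall>i\<in>{1..n}. del_last n (f (gen (Suc n) i)) = gen n i) \<and>
     (\<exists>Y\<in>carrier (FG (Suc n)).
        f (gen (Suc n) (Suc n)) = cj (Suc n) (gen (Suc n) (Suc n)) Y \<and> del_last n Y = y)"

lemma del_last_cj_last:
  assumes "y \<in> carrier (FG (Suc n))"
  shows "del_last n (cj (Suc n) (gen (Suc n) (Suc n)) y) = \<one>\<^bsub>FG n\<^esub>"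
proof -
  interpret F: group "FG n" by (rule FG_group)
  show ?thesis
    using assms FG_hom_simps[OF del_last_hom, of _ n] by (simp add: del_last_last)
qed

lemma last_winding_del_last:
  assumes f: "last_winding n f y" and x: "x \<in> carrier (FG (Suc n))"
  shows "del_last n (f x) = del_last n x"
proof -
  have fBP: "f \<in> carrier (BP (Suc n))" using f by (simp add: last_winding_def)
  have "(del_last n \<circ> f) x = del_last n x"
  proof (rule FG_hom_eqI[OF FG_group _ del_last_hom _ x])
    show "del_last n \<circ> f \<in> hom (FG (Suc n)) (FG n)"
      by (rule hom_compose[OF auto_FG_D(1)[OF BP_auto[OF fBP]] del_last_hom])
    fix i assume "i \<in> {1..Suc n}"
    then consider "i \<in> {1..n}" | "i = Suc n" by fastforce
    then show "(del_last n \<circ> f) (gen (Suc n) i) = del_last n (gen (Suc n) i)"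
      by cases (use f in \<open>auto simp: last_winding_def del_last_gen del_last_last del_last_cj_last\<close>)
  qed
  then show ?thesis by simp
qed

text \<open>The conjugator of \<open>f g\<close> is \<open>Y f(Z)\<close>, and \<open>f\<close> disappears from it when the last generator is killed.\<close>
lemma last_winding_mult:
  assumes f: "last_winding n f y" and g: "last_winding n g z"
  shows "last_winding n (f \<otimes>\<^bsub>BP (Suc n)\<^esub> g) (y \<otimes>\<^bsub>FG n\<^esub> z)"
proof -
  interpret B: group "BP (Suc n)" by (rule BP_group)
  interpret F: group "FG (Suc n)" by (rule FG_group)
  let ?x = "gen (Suc n) (Suc n)"
  have c: "f \<in> carrier (BP (Suc n))" "g \<in> carrier (BP (Suc n))" using f g by (auto simp: last_winding_def)
  note hf = BP_hom_simps[OF c(1)] note hg = BP_hom_simps[OF c(2)]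
  obtain Y Z where Y: "Y \<in> carrier (FG (Suc n))" "f ?x = cj (Suc n) ?x Y" "del_last n Y = y"
    and Z: "Z \<in> carrier (FG (Suc n))" "g ?x = cj (Suc n) ?x Z" "del_last n Z = z"
    using f g unfolding last_winding_def by blast
  have "(f \<otimes>\<^bsub>BP (Suc n)\<^esub> g) ?x = cj (Suc n) ?x (Y \<otimes>\<^bsub>FG (Suc n)\<^esub> f Z)"
    using c Y(1,2) Z(1,2) hf by (simp add: BP_apply cj_cj)
  moreover have "del_last n (Y \<otimes>\<^bsub>FG (Suc n)\<^esub> f Z) = y \<otimes>\<^bsub>FG n\<^esub> z"
    using Y Z hf(1) by (simp add: FG_hom_simps[OF del_last_hom] last_winding_del_last[OF f])
  moreover have "del_last n ((f \<otimes>\<^bsub>BP (Suc n)\<^esub> g) (gen (Suc n) i)) = gen n i" if "i \<in> {1..n}" for i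
  proof -
    have "gen (Suc n) i \<in> carrier (FG (Suc n))" using that by simp
    then show ?thesis using that c hg
      by (simp add: BP_apply last_winding_del_last[OF f] last_winding_del_last[OF g] del_last_gen)
  qed
  moreover have "Y \<otimes>\<^bsub>FG (Suc n)\<^esub> f Z \<in> carrier (FG (Suc n))" using Y(1) Z(1) hf(1) by simp
  ultimately show ?thesis unfolding last_winding_def using c by blast
qed

lemma last_winding_inv:
  assumes f: "last_winding n f y"
  shows "last_winding n (inv\<^bsub>BP (Suc n)\<^esub> f) (inv\<^bsub>FG n\<^esub> y)"
proof -
  interpret B: group "BP (Suc n)" by (rule BP_group)
  interpret F: group "FG (Suc n)" by (rule FG_group)
  let ?x = "gen (Suc n) (Suc n)" and ?g = "inv\<^bsub>BP (Suc n)\<^esub> f"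
  have c: "f \<in> carrier (BP (Suc n))" "?g \<in> carrier (BP (Suc n))" using f by (auto simp: last_winding_def)
  note hg = BP_hom_simps[OF c(2)]
  have fg: "f (?g x) = x" "?g (f x) = x" if "x \<in> carrier (FG (Suc n))" for x
    using that c BP_apply[OF c that] BP_apply[OF c(2,1) that] by (simp_all add: BP_one_apply)
  obtain Y where Y: "Y \<in> carrier (FG (Suc n))" "f ?x = cj (Suc n) ?x Y" "del_last n Y = y"
    using f unfolding last_winding_def by blast
  have d: "del_last n (?g x) = del_last n x" if "x \<in> carrier (FG (Suc n))" for x
    using last_winding_del_last[OF f, of "?g x"] that fg hg(1) by simp
  have "?x = cj (Suc n) (?g ?x) (?g Y)"
    using fg(2)[of ?x] Y hg by simp
  then have "cj (Suc n) ?x (inv\<^bsub>FG (Suc n)\<^esub> (?g Y)) = cj (Suc n) (cj (Suc n) (?g ?x) (?g Y)) (inv\<^bsub>FG (Suc n)\<^esub> (?g Y))"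
    by simp
  also have "\<dots> = ?g ?x" using Y hg(1) by (intro cj_cancel) auto
  finally have "?g ?x = cj (Suc n) ?x (inv\<^bsub>FG (Suc n)\<^esub> (?g Y))" by simp
  moreover have "del_last n (inv\<^bsub>FG (Suc n)\<^esub> (?g Y)) = inv\<^bsub>FG n\<^esub> y"
    using Y hg(1) d by (simp add: FG_hom_simps[OF del_last_hom])
  moreover have "del_last n (?g (gen (Suc n) i)) = gen n i" if "i \<in> {1..n}" for i
    using that d[of "gen (Suc n) i"] by (simp add: del_last_gen)
  moreover have "inv\<^bsub>FG (Suc n)\<^esub> (?g Y) \<in> carrier (FG (Suc n))" using Y(1) hg(1) by simp
  ultimately show ?thesis unfolding last_winding_def using c by blast
qed

text \<open>If the conjugator commutes with \<open>x\<^sub>n\<^sub>+\<^sub>1\<close> then it is a power of \<open>x\<^sub>n\<^sub>+\<^sub>1\<close>, which is killed.\<close>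
lemma last_winding_one_iff:
  assumes "last_winding n \<one>\<^bsub>BP (Suc n)\<^esub> y"
  shows "y = \<one>\<^bsub>FG n\<^esub>"
proof -
  let ?M = "Suc n"
  interpret F: group "FG n" by (rule FG_group)
  interpret F': group "FG ?M" by (rule FG_group)
  obtain Y where Y: "Y \<in> carrier (FG ?M)" "gen ?M ?M = cj ?M (gen ?M ?M) Y" "del_last n Y = y"
    using assms by (auto simp: last_winding_def BP_one_apply)
  obtain w where w: "w \<in> W ?M" "Y = cw ?M w" using Y(1) by (auto simp: FG_carrier)
  have "cw ?M (cjw ?M (strip ?M w)) = cw ?M (cjw ?M [])"
  proof -
    have "cw ?M (cjw ?M []) = gen ?M ?M" by (simp add: cjw_def gen_eq)
    moreover have "cj ?M (gen ?M ?M) (cw ?M w) = gen ?M ?M" using w(2) Y(2) by simp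
    ultimately show ?thesis using w(1) by (simp add: cw_cjw_strip cw_cjw[OF w(1)])
  qed
  then have "strip ?M w = []"
    using cjw_inj(2)[of ?M "strip ?M w" ?M "[]" ?M] conj_reduced_strip strip_gwords[OF w(1)] by (auto simp: conj_reduced_def)
  then have last: "\<forall>l\<in>set (fred w). fst l = ?M" by (simp add: strip_def dropWhile_eq_Nil_conv)
  have fw: "fred w \<in> W ?M" using w(1) by (rule fred_gwords)
  have "del_last n (cw ?M v) = \<one>\<^bsub>FG n\<^esub>" if "v \<in> W ?M" "\<forall>l\<in>set v. fst l = ?M" for v
    using that
  proof (induction v)
    case Nil
    have "del_last n \<one>\<^bsub>FG ?M\<^esub> = \<one>\<^bsub>FG n\<^esub>" by (rule hom_one[OF del_last_hom FG_group FG_group])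
    then show ?case by (simp add: FG_one)
  next
    case (Cons l v)
    obtain b where l: "l = (?M, b)" using Cons by (cases l) auto
    have "cw ?M [l] = (if b then gen ?M ?M else inv\<^bsub>FG ?M\<^esub> (gen ?M ?M))"
      using l by (cases b) (simp_all add: gen_eq FG_inv)
    then have "del_last n (cw ?M [l]) = \<one>\<^bsub>FG n\<^esub>" "cw ?M [l] \<in> carrier (FG ?M)"
      using FG_hom_simps(3)[OF del_last_hom, of "gen ?M ?M"] l by (auto simp: del_last_last)
    moreover have "cw ?M (l # v) = cw ?M [l] \<otimes>\<^bsub>FG ?M\<^esub> cw ?M v" using Cons l by (simp add: FG_mult)
    ultimately show ?case using Cons FG_hom_simps(2)[OF del_last_hom, of "cw ?M [l]" n "cw ?M v"] by simp
  qed
  from this[OF fw last] show ?thesis using Y(3) w wcl_fred[of w "{1..?M}"] by simp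
qed

lemma desc_apply:
  assumes "k \<in> {1..Suc n}"
  shows "braid_to_bp (Suc n) (S.desc n k) (gen (Suc n) k) = gen (Suc n) (Suc n)"
    "j \<in> {1..Suc n} \<Longrightarrow> k < j \<Longrightarrow> braid_to_bp (Suc n) (S.desc n k) (gen (Suc n) j) =
        cj (Suc n) (gen (Suc n) (j - 1)) (gen (Suc n) (Suc n))"
    "j \<in> {1..Suc n} \<Longrightarrow> j < k \<Longrightarrow> braid_to_bp (Suc n) (S.desc n k) (gen (Suc n) j) = gen (Suc n) j"
proof -
  let ?M = "Suc n" and ?h = "\<lambda>k. braid_to_bp (Suc n) (S.desc n k)"
  have "?h k (gen ?M k) = gen ?M ?M \<and>
    (\<forall>j\<in>{1..?M}. (k < j \<longrightarrow> ?h k (gen ?M j) = cj ?M (gen ?M (j - 1)) (gen ?M ?M)) \<and>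
       (j < k \<longrightarrow> ?h k (gen ?M j) = gen ?M j))"
    using assms
  proof (induction "Suc n - k" arbitrary: k)
    case 0
    then have k: "k = Suc n" by simp
    have "?h k = \<one>\<^bsub>BP ?M\<^esub>"
      using hom_one[OF braid_to_bp_hom(1) Braid_group BP_group] by (simp add: k S.desc_last)
    then show ?case by (auto simp: k BP_one_apply)
  next
    case (Suc d)
    then have k: "k \<in> {1..n}" "k \<in> {1..?M}" "Suc k \<in> {1..?M}" by auto
    have IH: "?h (Suc k) (gen ?M (Suc k)) = gen ?M ?M"
      "\<And>j. j \<in> {1..?M} \<Longrightarrow> Suc k < j \<Longrightarrow> ?h (Suc k) (gen ?M j) = cj ?M (gen ?M (j - 1)) (gen ?M ?M)"
      "\<And>j. j \<in> {1..?M} \<Longrightarrow> j < Suc k \<Longrightarrow> ?h (Suc k) (gen ?M j) = gen ?M j"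
      using Suc.hyps(1)[of "Suc k"] Suc.hyps(2) k by auto
    have d: "S.desc n (Suc k) \<in> carrier (Braid ?M)" using k by (intro S.desc_closed) auto
    have hB: "?h (Suc k) \<in> carrier (BP ?M)" using hom_in_carrier[OF braid_to_bp_hom(1) d] .
    have "?h k = ?h (Suc k) \<otimes>\<^bsub>BP ?M\<^esub> artin ?M k"
      using k hom_mult[OF braid_to_bp_hom(1) d S.x_closed[of k n]] by (simp add: S.desc_Suc braid_to_bp_hom(2))
    then have e: "?h k (gen ?M j) = ?h (Suc k) (artin ?M k (gen ?M j))" if "j \<in> {1..?M}" for j
      using that BP_apply[OF hB artin_BP[OF k(2,3)]] by simp
    note a = artin_apply[OF k(2,3)]
    show ?case
    proof (intro conjI ballI impI)
      show "?h k (gen ?M k) = gen ?M ?M" using k by (simp add: e a IH)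
      fix j assume j: "j \<in> {1..?M}"
      show "?h k (gen ?M j) = cj ?M (gen ?M (j - 1)) (gen ?M ?M)" if "k < j"
      proof (cases "j = Suc k")
        case True
        then show ?thesis using k BP_hom_simps(4)[OF hB, of "gen ?M k" "gen ?M (Suc k)"] by (simp add: e a IH)
      next
        case False
        then show ?thesis using k j that by (simp add: e a IH)
      qed
      show "?h k (gen ?M j) = gen ?M j" if "j < k" using k j that by (simp add: e a IH)
    qed
  qed
  then show "?h k (gen ?M k) = gen ?M ?M"
    "j \<in> {1..?M} \<Longrightarrow> k < j \<Longrightarrow> ?h k (gen ?M j) = cj ?M (gen ?M (j - 1)) (gen ?M ?M)"
    "j \<in> {1..?M} \<Longrightarrow> j < k \<Longrightarrow> ?h k (gen ?M j) = gen ?M j" by blast+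
qed

text \<open>The image of \<open>pure k\<close> is evaluated at the elements \<open>h(x\<^sub>i)\<close>, where \<open>h\<close> is the image of the product that
conjugates the square of the \<open>k\<close>-th generator; there it is determined by that square alone.\<close>
lemma pure_last_winding:
  assumes k: "k \<in> {1..n}"
  shows "last_winding n (braid_to_bp (Suc n) (S.pure n k)) (gen n k)"
proof -
  let ?M = "Suc n" and ?b = "braid_to_bp (Suc n)"
  interpret B: group "BP ?M" by (rule BP_group)
  interpret F: group "FG ?M" by (rule FG_group)
  interpret Fn: group "FG n" by (rule FG_group)
  let ?t = "S.desc n (Suc k)" and ?h = "?b (S.desc n (Suc k))" and ?a = "artin ?M k"
  have k': "k \<in> {1..?M}" "Suc k \<in> {1..?M}" using k by auto
  have t: "?t \<in> carrier (Braid ?M)" using k by (intro S.desc_closed) auto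
  have x: "sigma ?M k \<in> carrier (Braid ?M)" using k S.x_closed by simp
  have p: "S.pure n k \<in> carrier (Braid ?M)" using S.pure_closed[OF k] .
  note hm = hom_mult[OF braid_to_bp_hom(1)]
  have hB: "?h \<in> carrier (BP ?M)" "?b (S.pure n k) \<in> carrier (BP ?M)"
    using hom_in_carrier[OF braid_to_bp_hom(1)] t p by auto
  note aB = artin_BP[OF k'] and a = artin_apply[OF k'] and da = desc_apply[OF k'(2)]
  note hh = BP_hom_simps[OF hB(1)] and hp = BP_hom_simps[OF hB(2)] and ha = BP_hom_simps[OF aB]
  have "S.pure n k \<otimes>\<^bsub>Braid ?M\<^esub> ?t = ?t \<otimes>\<^bsub>Braid ?M\<^esub> (sigma ?M k \<otimes>\<^bsub>Braid ?M\<^esub> sigma ?M k)"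
    using t x by (simp add: S.pure_def S.m_assoc)
  then have "?b (S.pure n k) \<otimes>\<^bsub>BP ?M\<^esub> ?h = ?h \<otimes>\<^bsub>BP ?M\<^esub> (?a \<otimes>\<^bsub>BP ?M\<^esub> ?a)"
    using arg_cong[where f="?b"] p t x k hm[OF p t] hm[OF t, of "sigma ?M k \<otimes>\<^bsub>Braid ?M\<^esub> sigma ?M k"] hm[OF x x]
    by (simp add: braid_to_bp_hom(2))
  then have e: "?b (S.pure n k) (?h y) = ?h (?a (?a y))" if "y \<in> carrier (FG ?M)" for y
    using that BP_apply[OF hB(2,1) that] BP_apply[OF hB(1) B.m_closed[OF aB aB] that] BP_apply[OF aB aB that] by simp
  let ?Y = "cj ?M (gen ?M k) (gen ?M ?M)"
  have gc: "gen ?M i \<in> carrier (FG ?M)" if "i \<in> {1..n}" for i using that by auto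
  have Y: "?Y \<in> carrier (FG ?M)" using k gc by (intro cj_closed) auto
  have delc: "del_last n (cj ?M (gen ?M i) (gen ?M ?M)) = gen n i" if "i \<in> {1..n}" for i
    using that gc[OF that] by (simp add: FG_hom_simps[OF del_last_hom] del_last_gen del_last_last)
  have last: "?b (S.pure n k) (gen ?M ?M) = cj ?M (gen ?M ?M) ?Y"
    using e[of "gen ?M (Suc k)"] k k' gc by (simp add: a da ha hh cj_closed)
  have "del_last n (?b (S.pure n k) (gen ?M i)) = gen n i" if i: "i \<in> {1..n}" for i
  proof -
    consider "i < k" | "i = k" | "k < i" by linarith
    then show ?thesis
    proof cases
      case 1
      then show ?thesis using e[of "gen ?M i"] i k by (simp add: a da del_last_gen)
    next
      case 2
      then show ?thesis using e[of "gen ?M k"] k k' delc[OF k] by (simp add: a da hh)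
    next
      case 3
      then have "?b (S.pure n k) (cj ?M (gen ?M i) (gen ?M ?M)) = cj ?M (gen ?M i) (gen ?M ?M)"
        using e[of "gen ?M (Suc i)"] i k by (simp add: a da)
      then have "del_last n (cj ?M (?b (S.pure n k) (gen ?M i)) (cj ?M (gen ?M ?M) ?Y)) = gen n i"
        using i hp(4)[of "gen ?M i" "gen ?M ?M"] delc[OF i] by (simp add: last)
      then show ?thesis
        using i gc[OF i] hp(1) Y
        by (simp add: FG_hom_simps[OF del_last_hom] del_last_last cj_closed)
    qed
  qed
  moreover have "del_last n ?Y = gen n k" using delc[OF k] .
  ultimately show ?thesis unfolding last_winding_def using hB(2) last Y by blast
qed

text \<open>The homomorphism from the free group that sends \<open>x\<^sub>k\<close> to \<open>pure k\<close>, a right inverse of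
the map that takes a braid to the path of its last strand.\<close>
abbreviation wind :: "nat \<Rightarrow> fg_elem \<Rightarrow> nat gword set" where
  "wind n \<equiv> pres_hom (Braid (Suc n)) (S.pure n)"

lemma wind_hom: "wind n \<in> hom (FG n) (Braid (Suc n))"
  and wind_gen: "k \<in> {1..n} \<Longrightarrow> wind n (gen n k) = S.pure n k"
  using pres_hom_hom[OF Braid_group[of "Suc n"], of "{1..n}" "S.pure n" "{}"] S.pure_closed[of _ n]
  by (simp_all add: FG_def gen_eq)

text \<open>Hence \<open>wind n\<close> is injective, even after the passage to automorphisms.\<close>
lemma wind_last_winding:
  assumes "z \<in> carrier (FG n)"
  shows "last_winding n (braid_to_bp (Suc n) (wind n z)) z"
proof -
  let ?M = "Suc n" and ?f = "\<lambda>z. braid_to_bp (Suc n) (wind n z)"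
  interpret F: group "FG n" by (rule FG_group)
  have hom: "?f \<in> hom (FG n) (BP ?M)"
    using hom_compose[OF wind_hom braid_to_bp_hom(1)] by (simp add: o_def)
  interpret f: group_hom "FG n" "BP ?M" ?f
    by (intro group_hom.intro group_hom_axioms.intro FG_group BP_group hom)
  have "last_winding n (?f (cw n w)) (cw n w)" if "w \<in> W n" for w
    using that
  proof (induction w)
    case Nil
    have "last_winding n \<one>\<^bsub>BP ?M\<^esub> \<one>\<^bsub>FG n\<^esub>"
      unfolding last_winding_def
      using cj_one[of "gen ?M ?M" ?M] hom_one[OF del_last_hom FG_group FG_group, of n] group.is_monoid[OF FG_group, THEN monoid.one_closed, of ?M]
        group.is_monoid[OF BP_group, THEN monoid.one_closed, of ?M]
      by (auto simp: BP_one_apply del_last_gen intro!: bexI[of _ "\<one>\<^bsub>FG ?M\<^esub>"])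
    then show ?case using f.hom_one by (simp add: FG_one)
  next
    case (Cons l w)
    then have l: "fst l \<in> {1..n}" and w: "w \<in> W n" and IH: "last_winding n (?f (cw n w)) (cw n w)" by auto
    have g: "gen n (fst l) \<in> carrier (FG n)" using l by simp
    have lw: "last_winding n (?f (gen n (fst l))) (gen n (fst l))"
      using pure_last_winding[OF l] by (simp add: wind_gen[OF l])
    have "cw n [l] = (if snd l then gen n (fst l) else inv\<^bsub>FG n\<^esub> (gen n (fst l)))"
      using l by (cases l) (auto simp: gen_eq FG_inv)
    then have "last_winding n (?f (cw n [l])) (cw n [l])"
      using lw last_winding_inv[OF lw] f.hom_inv[OF g] by simp
    moreover have "cw n (l # w) = cw n [l] \<otimes>\<^bsub>FG n\<^esub> cw n w" using l w by (simp add: FG_mult)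
    ultimately show ?case using last_winding_mult[OF _ IH] f.hom_mult[of "cw n [l]" "cw n w"] l w by simp
  qed
  then show ?thesis using assms by (auto simp: FG_carrier)
qed

lemma U_subset: "S.U n \<subseteq> wind n ` carrier (FG n)"
proof -
  interpret w: group_hom "FG n" "Braid (Suc n)" "wind n"
    by (intro group_hom.intro group_hom_axioms.intro FG_group Braid_group wind_hom)
  have "S.pure n k \<in> wind n ` carrier (FG n)" if "k \<in> {1..n}" for k
    using wind_gen[OF that] gen_carrier_FG[OF that] by (metis image_eqI)
  then show ?thesis unfolding S.U_def by (intro S.generate_subgroup_incl w.img_is_subgroup) auto
qed

lemma P_subset: "S.P (Suc n) \<subseteq> braid_embed (Suc n) ` carrier (Braid (Suc n))"
proof -
  interpret e: group_hom "Braid (Suc n)" "Braid (Suc (Suc n))" "braid_embed (Suc n)"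
    by (intro group_hom.intro group_hom_axioms.intro Braid_group braid_embed_hom)
  have "sigma (Suc (Suc n)) i \<in> braid_embed (Suc n) ` carrier (Braid (Suc n))" if "i \<in> {1..n}" for i
    using braid_embed_hom(2)[OF that] S.x_closed[OF that] by (metis image_eqI)
  then show ?thesis unfolding S.P_def by (intro S.generate_subgroup_incl e.img_is_subgroup) auto
qed

text \<open>Comb the braid as \<open>u p d\<close>. The image of \<open>x\<^sub>k\<close>, where \<open>k\<close> is the strand that \<open>d\<close> moves to the end, is a conjugate of
the last generator, so that \<open>d\<close> is trivial. Killing the last generator makes \<open>u\<close> disappear, so the braid
\<open>p\<close> on fewer strands acts trivially, and is trivial by induction. What remains is \<open>u\<close>, which is determined
by the path of the last strand.\<close>
lemma braid_to_bp_trivial: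
  "\<beta> \<in> carrier (Braid (Suc n)) \<Longrightarrow> braid_to_bp (Suc n) \<beta> = \<one>\<^bsub>BP (Suc n)\<^esub> \<Longrightarrow> \<beta> = \<one>\<^bsub>Braid (Suc n)\<^esub>"
proof (induction n arbitrary: \<beta>)
  case 0
  then have "\<beta> \<in> wcl {} (braid_relations (Suc 0)) ` gwords {}"
    by (simp add: Braid_def PG_carrier One_nat_def)
  then show ?case by (auto simp: Braid_def PG_one One_nat_def gwords_def)
next
  case (Suc n)
  let ?N = "Suc n" and ?M = "Suc (Suc n)" and ?b = "braid_to_bp (Suc (Suc n))"
  interpret B: group "BP ?M" by (rule BP_group)
  obtain u p k where \<beta>: "\<beta> = u \<otimes>\<^bsub>Braid ?M\<^esub> p \<otimes>\<^bsub>Braid ?M\<^esub> S.desc ?N k"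
    and up: "u \<in> S.U ?N" "p \<in> S.P ?N" and k: "k \<in> {1..?M}"
    using Braid_combed[of ?N] Suc.prems(1) by (auto simp: S.combed_def)
  obtain z b where z: "z \<in> carrier (FG ?N)" "u = wind ?N z" and b: "b \<in> carrier (Braid ?N)" "p = braid_embed ?N b"
    using U_subset P_subset up by blast
  have c: "u \<in> carrier (Braid ?M)" "p \<in> carrier (Braid ?M)" "S.desc ?N k \<in> carrier (Braid ?M)"
    using hom_in_carrier[OF wind_hom] hom_in_carrier[OF braid_embed_hom(1)] z b k S.desc_closed[of k ?N] by auto
  let ?a = "braid_to_bp ?N b"
  have a: "?a \<in> carrier (BP ?N)" using hom_in_carrier[OF braid_to_bp_hom(1) b(1)] .
  have w: "last_winding ?N (?b u) z" using wind_last_winding[OF z(1)] z(2) by simp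
  have bp: "?b p = bp_embed ?N ?a" using braid_to_bp_embed[OF b(1)] b(2) by simp
  have bc: "?b u \<in> carrier (BP ?M)" "bp_embed ?N ?a \<in> carrier (BP ?M)" "?b (S.desc ?N k) \<in> carrier (BP ?M)"
    using hom_in_carrier[OF braid_to_bp_hom(1)] c bp_embed_BP(1)[OF a] by auto
  have eq: "\<one>\<^bsub>BP ?M\<^esub> = ?b u \<otimes>\<^bsub>BP ?M\<^esub> (bp_embed ?N ?a \<otimes>\<^bsub>BP ?M\<^esub> ?b (S.desc ?N k))"
    using Suc.prems(2) c bc hom_mult[OF braid_to_bp_hom(1)] by (simp add: \<beta> bp B.m_assoc)
  have ap: "?b u (bp_embed ?N ?a (?b (S.desc ?N k) y)) = y" if "y \<in> carrier (FG ?M)" for y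
    using that arg_cong[OF eq, of "\<lambda>f. f y"] bc BP_hom_simps(1)[OF bc(3) that]
    by (simp add: BP_apply BP_one_apply)
  have kM: "k = ?M"
  proof -
    obtain Y where Y: "Y \<in> carrier (FG ?M)" "?b u (gen ?M ?M) = cj ?M (gen ?M ?M) Y"
      using w unfolding last_winding_def by blast
    have gk: "gen ?M k \<in> carrier (FG ?M)" using k by simp
    have "gen ?M k = cj ?M (gen ?M ?M) Y"
      using ap[OF gk] desc_apply(1)[OF k] bp_embed_facts(4)[OF a] Y by simp
    moreover obtain v where v: "v \<in> W ?M" "Y = cw ?M v" using Y(1) by (auto simp: FG_carrier)
    ultimately have "cw ?M (cjw k []) = cw ?M (cjw ?M (strip ?M v))"
      by (simp add: cw_cjw_strip cw_cjw[OF v(1)]) (simp add: cjw_def gen_eq)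
    then show ?thesis
      using cjw_inj(1)[of k "[]" ?M "strip ?M v" ?M] conj_reduced_strip strip_gwords[OF v(1)] k
      by (auto simp: conj_reduced_def)
  qed
  have one: "?b \<one>\<^bsub>Braid ?M\<^esub> = \<one>\<^bsub>BP ?M\<^esub>" "S.desc ?N k = \<one>\<^bsub>Braid ?M\<^esub>"
    using hom_one[OF braid_to_bp_hom(1) Braid_group BP_group] by (simp_all add: kM S.desc_last)
  have "?a = \<one>\<^bsub>BP ?N\<^esub>"
  proof (rule BP_eqI)
    fix i assume i: "i \<in> {1..?N}"
    then have g: "gen ?M i \<in> carrier (FG ?M)" "gen ?N i \<in> carrier (FG ?N)" by auto
    have ai: "?a (gen ?N i) \<in> carrier (FG ?N)" using BP_hom_simps(1)[OF a g(2)] .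
    have "?b u (incl ?N (?a (gen ?N i))) = gen ?M i"
      using ap[OF g(1)] i g by (simp add: one BP_one_apply bp_embed_facts(3)[OF a])
    then have "del_last ?N (incl ?N (?a (gen ?N i))) = gen ?N i"
      using last_winding_del_last[OF w, of "incl ?N (?a (gen ?N i))"] i ai FG_hom_simps(1)[OF incl_hom ai]
      by (simp add: del_last_gen)
    then show "?a (gen ?N i) = \<one>\<^bsub>BP ?N\<^esub> (gen ?N i)" using ai g by (simp add: del_last_incl BP_one_apply)
  qed (use a group.is_monoid[OF BP_group, THEN monoid.one_closed] in auto)
  then have "b = \<one>\<^bsub>Braid ?N\<^esub>" using Suc.IH[OF b(1)] by simp
  then have p1: "p = \<one>\<^bsub>Braid ?M\<^esub>" using b(2) hom_one[OF braid_embed_hom(1) Braid_group Braid_group] by simp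
  then have "bp_embed ?N ?a = \<one>\<^bsub>BP ?M\<^esub>" using bp one(1) by simp
  then have "?b u = \<one>\<^bsub>BP ?M\<^esub>" using eq[symmetric] bc one by simp
  then have "z = \<one>\<^bsub>FG ?N\<^esub>" using last_winding_one_iff w by simp
  then have "u = \<one>\<^bsub>Braid ?M\<^esub>" using z(2) hom_one[OF wind_hom FG_group Braid_group] by simp
  then show ?case using p1 one by (simp add: \<beta>)
qed

lemma braid_to_bp_inj: "inj_on (braid_to_bp (Suc n)) (carrier (Braid (Suc n)))"
  using inj_on_one_iff'[OF braid_to_bp_hom(1) Braid_group BP_group] braid_to_bp_trivial by blast

section \<open>The oriented braid algebra\<close>

lemma subst_add: "subst s (f + g) = subst s f + subst s g" and subst_0: "subst s 0 = 0"
  by (simp_all add: subst_def fun_eq_iff)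

lemma subst_sum: "subst s (\<Sum>x\<in>A. F x) = (\<Sum>x\<in>A. subst s (F x))"
proof (induction A rule: infinite_finite_induct)
  case (insert x A)
  then show ?case by (simp only: sum.insert[OF insert.hyps] subst_add)
qed (simp_all add: subst_0)

lemma subst_comp: "bij s \<Longrightarrow> bij t \<Longrightarrow> subst (s \<circ> t) f = subst s (subst t f)"
  unfolding subst_def by (simp only: o_inv_distrib map_prod.comp list.map_comp)

lemma subst_id: "subst id f = f"
  by (simp add: subst_def map_prod.id)

definition sym_carrier :: "nat \<Rightarrow> (nat \<Rightarrow> nat) set" where "sym_carrier n = {p. p permutes {1..n}}"

lemma sym_carrier_simps [simp]:
  "carrier (sym_group n) = sym_carrier n" "mult (sym_group n) = (\<circ>)" "one (sym_group n) = id"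
  by (auto simp: sym_carrier_def sym_group_carrier sym_group_mult sym_group_one)

lemma sym_carrier:
  "finite (sym_carrier n)" "id \<in> sym_carrier n" "p \<in> sym_carrier n \<Longrightarrow> q \<in> sym_carrier n \<Longrightarrow> p \<circ> q \<in> sym_carrier n"
  "p \<in> sym_carrier n \<Longrightarrow> inv_into UNIV p \<in> sym_carrier n" "p \<in> sym_carrier n \<Longrightarrow> inv_into UNIV p \<circ> p = id"
  "p \<in> sym_carrier n \<Longrightarrow> p \<circ> inv_into UNIV p = id" "p \<in> sym_carrier n \<Longrightarrow> bij p"
  by (auto simp: sym_carrier_def finite_permutations permutes_id permutes_compose permutes_inv permutes_inv_o permutes_bij)

text \<open>The product of the oriented braid algebra on families of representatives. As the representatives
are elements of a ring in the type-class sense, associativity is an identity between finite sums.\<close>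
definition star :: "nat \<Rightarrow> ((nat \<Rightarrow> nat) \<Rightarrow> idx ncps) \<Rightarrow> ((nat \<Rightarrow> nat) \<Rightarrow> idx ncps) \<Rightarrow> (nat \<Rightarrow> nat) \<Rightarrow> idx ncps" where
  "star n \<phi> \<psi> p = (\<Sum>x\<in>sym_carrier n. \<phi> x * subst x (\<psi> (inv_into UNIV x \<circ> p)))"

text \<open>Exchange the two sums, and substitute \<open>y = x z\<close> in the inner one.\<close>
lemma star_assoc:
  assumes p: "p \<in> sym_carrier n"
  shows "star n (star n \<phi> \<psi>) \<chi> p = star n \<phi> (star n \<psi> \<chi>) p"
proof -
  let ?i = "inv_into UNIV :: (nat \<Rightarrow> nat) \<Rightarrow> nat \<Rightarrow> nat" and ?G = "sym_carrier n"
  have inv_comp: "?i (x \<circ> z) = ?i z \<circ> ?i x" if "x \<in> ?G" "z \<in> ?G" for x z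
    using that sym_carrier(7) by (intro o_inv_distrib)
  have "star n (star n \<phi> \<psi>) \<chi> p =
      (\<Sum>y\<in>?G. \<Sum>x\<in>?G. \<phi> x * subst x (\<psi> (?i x \<circ> y)) * subst y (\<chi> (?i y \<circ> p)))"
    by (simp add: star_def sum_distrib_right)
  also have "\<dots> = (\<Sum>x\<in>?G. \<Sum>y\<in>?G. \<phi> x * subst x (\<psi> (?i x \<circ> y)) * subst y (\<chi> (?i y \<circ> p)))"
    by (rule sum.swap)
  also have "\<dots> = (\<Sum>x\<in>?G. \<phi> x * subst x (star n \<psi> \<chi> (?i x \<circ> p)))"
  proof (rule sum.cong[OF HOL.refl])
    fix x assume x: "x \<in> ?G"
    note bx = sym_carrier(7)[OF x]
    have "(\<Sum>y\<in>?G. \<phi> x * subst x (\<psi> (?i x \<circ> y)) * subst y (\<chi> (?i y \<circ> p))) =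
        (\<Sum>z\<in>?G. \<phi> x * subst x (\<psi> z) * subst (x \<circ> z) (\<chi> (?i (x \<circ> z) \<circ> p)))"
    proof (rule sum.reindex_bij_witness[of _ "\<lambda>z. x \<circ> z" "\<lambda>y. ?i x \<circ> y"])
      show "x \<circ> (?i x \<circ> y) = y" for y using sym_carrier(6)[OF x] by (simp add: o_assoc)
      show "?i x \<circ> (x \<circ> z) = z" for z using sym_carrier(5)[OF x] by (simp add: o_assoc)
      then show "\<phi> x * subst x (\<psi> (?i x \<circ> y)) * subst (x \<circ> (?i x \<circ> y)) (\<chi> (?i (x \<circ> (?i x \<circ> y)) \<circ> p)) =
          \<phi> x * subst x (\<psi> (?i x \<circ> y)) * subst y (\<chi> (?i y \<circ> p))" for y
        using \<open>\<And>y. x \<circ> (?i x \<circ> y) = y\<close>[of y] by simp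
    qed (use x sym_carrier in auto)
    also have "\<dots> = \<phi> x * (\<Sum>z\<in>?G. subst x (\<psi> z) * subst x (subst z (\<chi> (?i z \<circ> (?i x \<circ> p)))))"
      using x sym_carrier(7) by (auto simp: sum_distrib_left mult.assoc subst_comp inv_comp o_assoc intro!: sum.cong)
    also have "\<dots> = \<phi> x * subst x (star n \<psi> \<chi> (?i x \<circ> p))"
      by (simp add: star_def subst_sum subst_mult)
    finally show "(\<Sum>y\<in>?G. \<phi> x * subst x (\<psi> (?i x \<circ> y)) * subst y (\<chi> (?i y \<circ> p))) =
        \<phi> x * subst x (star n \<psi> \<chi> (?i x \<circ> p))" .
  qed
  finally show ?thesis by (simp add: star_def)
qed

definition single :: "(nat \<Rightarrow> nat) \<Rightarrow> idx ncps \<Rightarrow> (nat \<Rightarrow> nat) \<Rightarrow> idx ncps" where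
  "single s f p = (if p = s then f else 0)"

lemma star_single_left:
  assumes "s \<in> sym_carrier n"
  shows "star n (single s f) \<psi> p = f * subst s (\<psi> (inv_into UNIV s \<circ> p))"
proof -
  have "star n (single s f) \<psi> p = (\<Sum>x\<in>sym_carrier n. if x = s then f * subst s (\<psi> (inv_into UNIV s \<circ> p)) else 0)"
    unfolding star_def by (intro sum.cong) (auto simp: single_def)
  then show ?thesis using assms by (simp add: sym_carrier(1))
qed

lemma star_single_one:
  assumes p: "p \<in> sym_carrier n"
  shows "star n \<phi> (single id 1) p = \<phi> p"
proof -
  have "inv_into UNIV x \<circ> p = id \<longleftrightarrow> x = p" if "x \<in> sym_carrier n" for x
  proof
    assume "inv_into UNIV x \<circ> p = id"
    then have "x \<circ> (inv_into UNIV x \<circ> p) = x" by simp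
    then show "x = p" using sym_carrier(6)[OF that] by (simp add: o_assoc)
  qed (use sym_carrier(5) p in auto)
  then have "star n \<phi> (single id 1) p = (\<Sum>x\<in>sym_carrier n. if x = p then \<phi> p else 0)"
    unfolding star_def by (intro sum.cong) (auto simp: single_def subst_1 subst_0)
  then show ?thesis using p by (simp add: sym_carrier(1))
qed

lemma star_single_single:
  assumes s: "s \<in> sym_carrier n"
  shows "star n (single s f) (single t g) = single (s \<circ> t) (f * subst s g)"
proof
  fix p
  have "inv_into UNIV s \<circ> p = t \<longleftrightarrow> p = s \<circ> t"
    using sym_carrier(5,6)[OF s] by (auto simp: o_assoc)
  then show "star n (single s f) (single t g) p = single (s \<circ> t) (f * subst s g) p"
    by (simp add: star_single_left[OF s] single_def subst_0)
qed

definition family :: "nat \<Rightarrow> ((nat \<Rightarrow> nat) \<Rightarrow> idx ncps) \<Rightarrow> balg" where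
  "family n \<phi> = (\<lambda>p\<in>sym_carrier n. FA.cls n (\<phi> p))"

definition reps :: "nat \<Rightarrow> ((nat \<Rightarrow> nat) \<Rightarrow> idx ncps) set" where
  "reps n = {\<phi>. \<forall>p\<in>sym_carrier n. \<phi> p \<in> FA.C n}"

lemma family_cong: "(\<And>p. p \<in> sym_carrier n \<Longrightarrow> \<phi> p = \<psi> p) \<Longrightarrow> family n \<phi> = family n \<psi>"
  by (auto simp: family_def intro!: restrict_ext)

lemma star_reps: "\<phi> \<in> reps n \<Longrightarrow> \<psi> \<in> reps n \<Longrightarrow> star n \<phi> \<psi> \<in> reps n"
  unfolding reps_def star_def
  using sym_carrier by (auto intro!: FA.C_sum FA.C_mult subst_C simp: sym_carrier_def)

lemma single_reps: "f \<in> FA.C n \<Longrightarrow> single s f \<in> reps n"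
  by (auto simp: reps_def single_def)

lemma finsum_cls:
  assumes "finite A" "\<And>x. x \<in> A \<Longrightarrow> f x \<in> FA.C n"
  shows "finsum (OA n) (\<lambda>x. FA.cls n (f x)) A = FA.cls n (\<Sum>x\<in>A. f x)"
proof -
  have "ring (OA n)" using FA.ring_Q[of n] by (simp add: OA_eq)
  then interpret R: ring "OA n" .
  show ?thesis
    using assms
  proof (induction A rule: finite_induct)
    case empty
    then show ?case by (simp add: OA_simps)
  next
    case (insert x A)
    then have "(\<lambda>x. FA.cls n (f x)) \<in> A \<rightarrow> carrier (OA n)" "FA.cls n (f x) \<in> carrier (OA n)" by (auto simp: OA_simps)
    then have "finsum (OA n) (\<lambda>x. FA.cls n (f x)) (insert x A) = FA.cls n (f x) \<oplus>\<^bsub>OA n\<^esub> FA.cls n (\<Sum>x\<in>A. f x)"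
      using insert by simp
    moreover have "f x \<in> FA.C n" "(\<Sum>x\<in>A. f x) \<in> FA.C n" using insert FA.C_sum[of A f n] by auto
    moreover have "sum f (insert x A) = f x + sum f A" using insert by (intro sum.insert)
    ultimately show ?case by (simp only: OA_simps)
  qed
qed

lemma braid_algebra_simps:
  "carrier (braid_algebra n) = family n ` reps n"
  "\<one>\<^bsub>braid_algebra n\<^esub> = family n (single id 1)"
  "\<phi> \<in> reps n \<Longrightarrow> \<psi> \<in> reps n \<Longrightarrow> family n \<phi> \<otimes>\<^bsub>braid_algebra n\<^esub> family n \<psi> = family n (star n \<phi> \<psi>)"
proof -
  show "carrier (braid_algebra n) = family n ` reps n"
  proof
    show "carrier (braid_algebra n) \<subseteq> family n ` reps n"
    proof
      fix F assume F: "F \<in> carrier (braid_algebra n)"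
      have "\<exists>f\<in>FA.C n. F p = FA.cls n f" if "p \<in> sym_carrier n" for p
        using F that by (auto simp: braid_algebra_def OA_simps)
      then obtain \<phi> where \<phi>: "\<And>p. p \<in> sym_carrier n \<Longrightarrow> \<phi> p \<in> FA.C n \<and> F p = FA.cls n (\<phi> p)" by metis
      have "F = family n \<phi>"
        using F \<phi> by (auto simp: braid_algebra_def family_def PiE_def extensional_def fun_eq_iff)
      then show "F \<in> family n ` reps n" using \<phi> by (auto simp: reps_def)
    qed
    show "family n ` reps n \<subseteq> carrier (braid_algebra n)"
      by (auto simp: braid_algebra_def family_def reps_def OA_simps)
  qed
  show "\<one>\<^bsub>braid_algebra n\<^esub> = family n (single id 1)"
    by (auto simp: braid_algebra_def family_def single_def OA_simps fun_eq_iff)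
  show "family n \<phi> \<otimes>\<^bsub>braid_algebra n\<^esub> family n \<psi> = family n (star n \<phi> \<psi>)"
    if \<phi>: "\<phi> \<in> reps n" and \<psi>: "\<psi> \<in> reps n"
  proof -
    have "finsum (OA n) (\<lambda>x. family n \<phi> x \<otimes>\<^bsub>OA n\<^esub> o_act n x (family n \<psi> (inv\<^bsub>sym_group n\<^esub> x \<otimes>\<^bsub>sym_group n\<^esub> p))) (sym_carrier n)
        = FA.cls n (star n \<phi> \<psi> p)" if p: "p \<in> sym_carrier n" for p
    proof -
      have ring: "ring (OA n)" using FA.ring_Q[of n] by (simp add: OA_eq)
      then interpret R: ring "OA n" .
      have c: "\<phi> x \<in> FA.C n" "subst x (\<psi> (inv_into UNIV x \<circ> p)) \<in> FA.C n" "\<psi> (inv_into UNIV x \<circ> p) \<in> FA.C n"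
        "inv_into UNIV x \<circ> p \<in> sym_carrier n" "x permutes {1..n}" if "x \<in> sym_carrier n" for x
        using that p \<phi> \<psi> sym_carrier(3,4) by (auto simp: reps_def sym_carrier_def intro!: subst_C)
      have "finsum (OA n) (\<lambda>x. family n \<phi> x \<otimes>\<^bsub>OA n\<^esub> o_act n x (family n \<psi> (inv\<^bsub>sym_group n\<^esub> x \<otimes>\<^bsub>sym_group n\<^esub> p))) (sym_carrier n)
        = finsum (OA n) (\<lambda>x. FA.cls n (\<phi> x * subst x (\<psi> (inv_into UNIV x \<circ> p)))) (sym_carrier n)"
        using c by (intro R.finsum_cong') (auto simp: family_def o_act_cls OA_simps)
      also have "\<dots> = FA.cls n (star n \<phi> \<psi> p)"
        unfolding star_def using c by (intro finsum_cls sym_carrier(1)) auto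
      finally show ?thesis .
    qed
    then show ?thesis by (auto simp: braid_algebra_def family_def[of n "star n \<phi> \<psi>"] fun_eq_iff)
  qed
qed

lemma braid_algebra_monoid: "monoid (braid_algebra n)"
proof (rule monoidI)
  have one: "single id 1 \<in> reps n" by (rule single_reps) simp
  show "\<one>\<^bsub>braid_algebra n\<^esub> \<in> carrier (braid_algebra n)" using one by (simp add: braid_algebra_simps)
  fix F G H assume "F \<in> carrier (braid_algebra n)" "G \<in> carrier (braid_algebra n)" "H \<in> carrier (braid_algebra n)"
  then obtain \<phi> \<psi> \<chi> where r: "\<phi> \<in> reps n" "\<psi> \<in> reps n" "\<chi> \<in> reps n"
    and e: "F = family n \<phi>" "G = family n \<psi>" "H = family n \<chi>" by (auto simp: braid_algebra_simps(1))
  show "F \<otimes>\<^bsub>braid_algebra n\<^esub> G \<in> carrier (braid_algebra n)"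
    using r star_reps by (simp add: e braid_algebra_simps)
  show "F \<otimes>\<^bsub>braid_algebra n\<^esub> G \<otimes>\<^bsub>braid_algebra n\<^esub> H = F \<otimes>\<^bsub>braid_algebra n\<^esub> (G \<otimes>\<^bsub>braid_algebra n\<^esub> H)"
    using r star_reps star_assoc by (auto simp: e braid_algebra_simps intro!: family_cong)
  show "\<one>\<^bsub>braid_algebra n\<^esub> \<otimes>\<^bsub>braid_algebra n\<^esub> F = F"
    using r one by (auto simp: e braid_algebra_simps star_single_left[OF sym_carrier(2)] subst_id intro!: family_cong)
  show "F \<otimes>\<^bsub>braid_algebra n\<^esub> \<one>\<^bsub>braid_algebra n\<^esub> = F"
    using r one by (auto simp: e braid_algebra_simps star_single_one intro!: family_cong)
qed

lemma pure_elem_cls: "pure_elem n (FA.cls n f) s = family n (single s f)"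
  by (auto simp: pure_elem_def family_def single_def OA_simps fun_eq_iff)

lemma pure_elem_mult:
  assumes "f \<in> FA.C n" "g \<in> FA.C n" "s \<in> sym_carrier n"
  shows "pure_elem n (FA.cls n f) s \<otimes>\<^bsub>braid_algebra n\<^esub> pure_elem n (FA.cls n g) t =
    pure_elem n (FA.cls n (f * subst s g)) (s \<circ> t)"
  using assms by (simp add: pure_elem_cls braid_algebra_simps single_reps star_single_single)

lemma pure_elem_carrier: "f \<in> FA.C n \<Longrightarrow> pure_elem n (FA.cls n f) s \<in> carrier (braid_algebra n)"
  by (simp add: pure_elem_cls braid_algebra_simps single_reps)

text \<open>Group-like elements are nonzero because their constant term is one.\<close>
lemma pure_elem_inj:
  assumes "group_like n f" "group_like n g" "s \<in> sym_carrier n"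
    "pure_elem n (FA.cls n f) s = pure_elem n (FA.cls n g) t"
  shows "s = t" "FA.cls n f = FA.cls n g"
proof -
  have *: "FA.cls n f = (if s = t then FA.cls n g else FA.cls n 0)"
    using fun_cong[OF assms(4), of s] assms(3) by (auto simp: pure_elem_def OA_simps)
  have "FA.cls n f \<noteq> FA.cls n 0"
    using assms(1) eqJ_const[of n f 0] by (auto simp: FA.cls_eq_iff group_like_def)
  with * show "s = t" "FA.cls n f = FA.cls n g" by (auto split: if_splits)
qed

lemma exp_semidirect_eq:
  "exp_semidirect n = {pure_elem n (FA.cls n f) s | f s. group_like n f \<and> s \<in> sym_carrier n}"
  by (auto simp: exp_semidirect_def exp_lie_carrier)

text \<open>The inverse of \<open>u \<otimes> s\<close> is \<open>\<^bold>u \<otimes> s\<^sup>-\<^sup>1\<close>, where \<open>\<^bold>u\<close> is the inverse of \<open>u\<close> with the indices renamed by \<open>s\<^sup>-\<^sup>1\<close>.\<close>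
lemma pure_elem_inverse:
  assumes f: "group_like n f" and s: "s \<in> sym_carrier n"
  obtains g where "group_like n g"
    "pure_elem n (FA.cls n f) s \<otimes>\<^bsub>braid_algebra n\<^esub> pure_elem n (FA.cls n g) (inv_into UNIV s) = \<one>\<^bsub>braid_algebra n\<^esub>"
    "pure_elem n (FA.cls n g) (inv_into UNIV s) \<otimes>\<^bsub>braid_algebra n\<^esub> pure_elem n (FA.cls n f) s = \<one>\<^bsub>braid_algebra n\<^esub>"
proof -
  let ?i = "inv_into UNIV s"
  obtain h where h: "group_like n h" "f * h = 1" "h * f = 1" by (rule group_like_inverse[OF f])
  have i: "?i \<in> sym_carrier n" using sym_carrier(4)[OF s] .
  then have g: "group_like n (subst ?i h)" using h by (intro group_like_subst) (auto simp: sym_carrier_def)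
  have "subst s (subst ?i h) = h"
    using subst_comp[of s ?i h] sym_carrier(6,7) s i by (simp add: subst_id)
  moreover have "subst ?i h * subst ?i f = 1"
    using arg_cong[OF h(3), of "subst ?i"] by (simp add: subst_mult subst_1)
  ultimately show ?thesis
    using g h f s i sym_carrier(5,6)[OF s]
    by (intro that[OF g]) (simp_all add: pure_elem_mult group_like_C braid_algebra_simps pure_elem_cls[symmetric])
qed

lemma exp_semidirect_subgroup: "subgroup (exp_semidirect n) (units_of (braid_algebra n))"
proof -
  interpret M: monoid "braid_algebra n" by (rule braid_algebra_monoid)
  interpret U: group "units_of (braid_algebra n)" by (rule M.units_group)
  have inv: "\<exists>G\<in>exp_semidirect n. F \<otimes>\<^bsub>braid_algebra n\<^esub> G = \<one>\<^bsub>braid_algebra n\<^esub> \<and> G \<otimes>\<^bsub>braid_algebra n\<^esub> F = \<one>\<^bsub>braid_algebra n\<^esub>"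
    if F: "F \<in> exp_semidirect n" for F
  proof -
    obtain f s where f: "group_like n f" "s \<in> sym_carrier n" "F = pure_elem n (FA.cls n f) s"
      using F by (auto simp: exp_semidirect_eq)
    obtain g where g: "group_like n g"
      "F \<otimes>\<^bsub>braid_algebra n\<^esub> pure_elem n (FA.cls n g) (inv_into UNIV s) = \<one>\<^bsub>braid_algebra n\<^esub>"
      "pure_elem n (FA.cls n g) (inv_into UNIV s) \<otimes>\<^bsub>braid_algebra n\<^esub> F = \<one>\<^bsub>braid_algebra n\<^esub>"
      unfolding f(3) by (rule pure_elem_inverse[OF f(1,2)])
    moreover have "pure_elem n (FA.cls n g) (inv_into UNIV s) \<in> exp_semidirect n"
      using g(1) sym_carrier(4)[OF f(2)] by (auto simp: exp_semidirect_eq)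
    ultimately show ?thesis by (intro bexI conjI)
  qed
  have carr: "F \<in> carrier (braid_algebra n)" if "F \<in> exp_semidirect n" for F
    using that pure_elem_carrier group_like_C by (auto simp: exp_semidirect_eq)
  have sub: "exp_semidirect n \<subseteq> carrier (units_of (braid_algebra n))"
    using inv carr by (force simp: units_of_def Units_def)
  show ?thesis
  proof (rule U.subgroupI[OF sub])
    have "pure_elem n (FA.cls n 1) id \<in> exp_semidirect n"
      using group_like_1 sym_carrier(2) by (auto simp: exp_semidirect_eq)
    then show "exp_semidirect n \<noteq> {}" by blast
    show "inv\<^bsub>units_of (braid_algebra n)\<^esub> F \<in> exp_semidirect n" if F: "F \<in> exp_semidirect n" for F
    proof -
      obtain G where G: "G \<in> exp_semidirect n" "G \<otimes>\<^bsub>braid_algebra n\<^esub> F = \<one>\<^bsub>braid_algebra n\<^esub>"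
        using inv[OF F] by blast
      then have "inv\<^bsub>units_of (braid_algebra n)\<^esub> F = G"
        using F sub by (intro U.inv_equality) (auto simp: units_of_mult units_of_one)
      then show ?thesis using G by simp
    qed
    show "F \<otimes>\<^bsub>units_of (braid_algebra n)\<^esub> G \<in> exp_semidirect n" if FG: "F \<in> exp_semidirect n" "G \<in> exp_semidirect n" for F G
    proof -
      obtain f s g t where f: "group_like n f" "s \<in> sym_carrier n" "F = pure_elem n (FA.cls n f) s"
        and g: "group_like n g" "t \<in> sym_carrier n" "G = pure_elem n (FA.cls n g) t"
        using FG by (auto simp: exp_semidirect_eq)
      have "group_like n (f * subst s g)"
        using f g by (intro group_like_mult group_like_subst) (auto simp: sym_carrier_def)
      then show ?thesis
        using f g sym_carrier(3)[OF f(2) g(2)] by (auto simp: units_of_mult pure_elem_mult group_like_C exp_semidirect_eq)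
    qed
  qed
qed

lemma semidirect_perm_pure:
  assumes f: "group_like n f" and s: "s \<in> sym_carrier n"
  shows "semidirect_perm n (pure_elem n (FA.cls n f) s) = s"
  unfolding semidirect_perm_def
proof (rule the_equality)
  show "s \<in> carrier (sym_group n) \<and> (\<exists>u\<in>carrier (exp_lie n). pure_elem n (FA.cls n f) s = pure_elem n u s)"
    using assms by (auto simp: exp_lie_carrier)
  fix t assume "t \<in> carrier (sym_group n) \<and> (\<exists>u\<in>carrier (exp_lie n). pure_elem n (FA.cls n f) s = pure_elem n u t)"
  then obtain g where "group_like n g" "pure_elem n (FA.cls n f) s = pure_elem n (FA.cls n g) t"
    by (auto simp: exp_lie_carrier)
  then show "t = s" using pure_elem_inj(1)[OF f _ s] by blast
qed

section \<open>The representations of the braid-permutation groups and of the braid groups\<close>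

lemma BP_factor:
  assumes b: "b \<in> carrier (BP n)"
  defines "s \<equiv> bp_perm n b"
  defines "c \<equiv> b \<otimes>\<^bsub>BP n\<^esub> inv\<^bsub>BP n\<^esub> (perm_aut n s)"
  shows "s permutes {1..n}" "c \<in> carrier (BC n)" "b = c \<otimes>\<^bsub>BP n\<^esub> perm_aut n s"
proof -
  interpret B: group "BP n" by (rule BP_group)
  interpret p: group_hom "BP n" "sym_group n" "bp_perm n"
    by (intro group_hom.intro group_hom_axioms.intro BP_group sym_group_is_group bp_perm_hom)
  show s: "s permutes {1..n}" using b by (simp add: s_def bp_perm_permutes)
  have a: "perm_aut n s \<in> carrier (BP n)" using s by (rule perm_aut_BP)
  show "b = c \<otimes>\<^bsub>BP n\<^esub> perm_aut n s" using a b by (simp add: c_def B.m_assoc)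
  have "s \<in> sym_carrier n" using s by (simp add: sym_carrier_def)
  then have "bp_perm n c = id"
    using a b p.hom_mult[OF b B.inv_closed[OF a]] p.hom_inv[OF a] sym_carrier(6)
    by (simp add: c_def bp_perm_perm_aut[OF s]) (simp add: s_def)
  then show "c \<in> carrier (BC n)" using a b by (simp add: BC_carrier c_def)
qed

context
  fixes n :: nat and R :: "fg_aut \<Rightarrow> oalg"
  assumes R: "is_R n R"
begin

lemma R_hom: "R \<in> hom (BC n) (exp_lie n)"
  using R by (simp add: is_R_def)

lemma R_id_cls:
  assumes b: "b \<in> carrier (BP n)"
  obtains f where "group_like n f" "R_id n R b = pure_elem n (FA.cls n f) (bp_perm n b)" "bp_perm n b \<in> sym_carrier n"
    "R (b \<otimes>\<^bsub>BP n\<^esub> inv\<^bsub>BP n\<^esub> (perm_aut n (bp_perm n b))) = FA.cls n f"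
proof -
  note F = BP_factor[OF b]
  obtain f where "group_like n f" "R (b \<otimes>\<^bsub>BP n\<^esub> inv\<^bsub>BP n\<^esub> (perm_aut n (bp_perm n b))) = FA.cls n f"
    using hom_in_carrier[OF R_hom F(2)] by (auto simp: exp_lie_carrier)
  then show ?thesis using F(1) that by (simp add: R_id_def sym_carrier_def)
qed

lemma R_id_semidirect: "b \<in> carrier (BP n) \<Longrightarrow> R_id n R b \<in> exp_semidirect n"
  by (erule R_id_cls) (auto simp: exp_semidirect_eq)

lemma R_id_perm: "b \<in> carrier (BP n) \<Longrightarrow> semidirect_perm n (R_id n R b) = bp_perm n b"
  by (erule R_id_cls) (simp add: semidirect_perm_pure)

text \<open>For \<open>a = c p\<^sub>s\<close> and \<open>b = d p\<^sub>t\<close> the product is \<open>c (p\<^sub>s d p\<^sub>s\<^sup>-\<^sup>1) p\<^sub>s\<^sub>t\<close>; now \<open>R\<close> is equivariant.\<close>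
lemma R_id_hom: "R_id n R \<in> hom (BP n) (units_of (braid_algebra n))"
proof (rule homI)
  interpret B: group "BP n" by (rule BP_group)
  fix a b assume ab: "a \<in> carrier (BP n)" "b \<in> carrier (BP n)"
  show "R_id n R a \<in> carrier (units_of (braid_algebra n))"
    using R_id_semidirect[OF ab(1)] subgroup.mem_carrier[OF exp_semidirect_subgroup] by blast
  note A = BP_factor[OF ab(1)] and B' = BP_factor[OF ab(2)]
  let ?s = "bp_perm n a" and ?t = "bp_perm n b"
  let ?p = "perm_aut n ?s" and ?q = "perm_aut n ?t"
  let ?c = "a \<otimes>\<^bsub>BP n\<^esub> inv\<^bsub>BP n\<^esub> ?p" and ?d = "b \<otimes>\<^bsub>BP n\<^esub> inv\<^bsub>BP n\<^esub> ?q"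
  obtain f where f: "group_like n f" "R_id n R a = pure_elem n (FA.cls n f) ?s" "?s \<in> sym_carrier n" "R ?c = FA.cls n f"
    by (rule R_id_cls[OF ab(1)])
  obtain g where g: "group_like n g" "R_id n R b = pure_elem n (FA.cls n g) ?t" "?t \<in> sym_carrier n" "R ?d = FA.cls n g"
    by (rule R_id_cls[OF ab(2)])
  have pq: "?p \<in> carrier (BP n)" "?q \<in> carrier (BP n)" using A(1) B'(1) by (auto intro: perm_aut_BP)
  have perm: "bp_perm n (a \<otimes>\<^bsub>BP n\<^esub> b) = ?s \<circ> ?t" using hom_mult[OF bp_perm_hom ab] by simp
  let ?e = "?p \<otimes>\<^bsub>BP n\<^esub> ?d \<otimes>\<^bsub>BP n\<^esub> inv\<^bsub>BP n\<^esub> ?p"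
  have e: "?e \<in> carrier (BC n)" by (rule perm_conj_BC[OF A(1) B'(2)])
  have "a \<otimes>\<^bsub>BP n\<^esub> b \<otimes>\<^bsub>BP n\<^esub> inv\<^bsub>BP n\<^esub> (?p \<otimes>\<^bsub>BP n\<^esub> ?q) = ?c \<otimes>\<^bsub>BP n\<^esub> ?e"
  proof -
    have "inv\<^bsub>BP n\<^esub> ?p \<otimes>\<^bsub>BP n\<^esub> (?p \<otimes>\<^bsub>BP n\<^esub> (b \<otimes>\<^bsub>BP n\<^esub> (inv\<^bsub>BP n\<^esub> ?q \<otimes>\<^bsub>BP n\<^esub> inv\<^bsub>BP n\<^esub> ?p))) =
        b \<otimes>\<^bsub>BP n\<^esub> (inv\<^bsub>BP n\<^esub> ?q \<otimes>\<^bsub>BP n\<^esub> inv\<^bsub>BP n\<^esub> ?p)"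
      using ab pq by (simp add: B.m_assoc[symmetric])
    then show ?thesis using ab pq by (simp add: B.m_assoc B.inv_mult_group)
  qed
  then have "R_id n R (a \<otimes>\<^bsub>BP n\<^esub> b) = pure_elem n (R (?c \<otimes>\<^bsub>BP n\<^esub> ?e)) (?s \<circ> ?t)"
    by (simp add: R_id_def perm perm_aut_mult[OF A(1) B'(1), symmetric])
  moreover have "R (?c \<otimes>\<^bsub>BP n\<^esub> ?e) = FA.cls n (f * subst ?s g)"
    using hom_mult[OF R_hom A(2) e] R_equivariant[OF R A(1) B'(2)] f g
    by (simp add: o_act_cls[OF A(1)] OA_simps group_like_C subst_C[OF A(1)])
  ultimately show "R_id n R (a \<otimes>\<^bsub>BP n\<^esub> b) = R_id n R a \<otimes>\<^bsub>units_of (braid_algebra n)\<^esub> R_id n R b"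
    using f g by (simp add: units_of_mult pure_elem_mult group_like_C)
qed

lemma R_id_inj: "inj_on (R_id n R) (carrier (BP n))"
proof (rule inj_onI)
  fix a b assume ab: "a \<in> carrier (BP n)" "b \<in> carrier (BP n)" and eq: "R_id n R a = R_id n R b"
  note A = BP_factor[OF ab(1)] and B' = BP_factor[OF ab(2)]
  obtain f where f: "group_like n f" "R_id n R a = pure_elem n (FA.cls n f) (bp_perm n a)" "bp_perm n a \<in> sym_carrier n"
    "R (a \<otimes>\<^bsub>BP n\<^esub> inv\<^bsub>BP n\<^esub> (perm_aut n (bp_perm n a))) = FA.cls n f"
    by (rule R_id_cls[OF ab(1)])
  obtain g where g: "group_like n g" "R_id n R b = pure_elem n (FA.cls n g) (bp_perm n b)" "bp_perm n b \<in> sym_carrier n"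
    "R (b \<otimes>\<^bsub>BP n\<^esub> inv\<^bsub>BP n\<^esub> (perm_aut n (bp_perm n b))) = FA.cls n g"
    by (rule R_id_cls[OF ab(2)])
  note i = pure_elem_inj[OF f(1) g(1) f(3) eq[unfolded f(2) g(2)]]
  have "a \<otimes>\<^bsub>BP n\<^esub> inv\<^bsub>BP n\<^esub> (perm_aut n (bp_perm n a)) = b \<otimes>\<^bsub>BP n\<^esub> inv\<^bsub>BP n\<^esub> (perm_aut n (bp_perm n b))"
    by (rule inj_onD[OF R_inj[OF R] _ A(2) B'(2)]) (simp add: f(4) g(4) i(2))
  then show "a = b" using A(3) B'(3) i(1) by metis
qed

lemma R_id_BC: "c \<in> carrier (BC n) \<Longrightarrow> R_id n R c = pure_elem n (R c) id"
  using group.is_monoid[OF BP_group, of n]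
  by (simp add: R_id_def BC_carrier perm_aut_id monoid.inv_one monoid.r_one)

lemma R_id_mult_perm:
  assumes c: "c \<in> carrier (BC n)" and s: "s permutes {1..n}"
  shows "R_id n R (c \<otimes>\<^bsub>BP n\<^esub> perm_aut n s) = pure_elem n (R c) s"
proof -
  interpret B: group "BP n" by (rule BP_group)
  have cb: "c \<in> carrier (BP n)" "bp_perm n c = id" using c by (auto simp: BC_carrier)
  note p = perm_aut_BP[OF s]
  have "bp_perm n (c \<otimes>\<^bsub>BP n\<^esub> perm_aut n s) = s"
    using hom_mult[OF bp_perm_hom cb(1) p] by (simp add: cb(2) bp_perm_perm_aut[OF s])
  then show ?thesis using cb p by (simp add: R_id_def B.m_assoc)
qed

lemma R_id_stable:
  assumes R': "is_R (Suc n) R'" and b: "b \<in> carrier (BP n)"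
  shows "R_id (Suc n) R' (bp_embed n b) = algebra_embed n (R_id n R b)"
proof -
  interpret B: group "BP n" by (rule BP_group)
  interpret e: group_hom "BP n" "BP (Suc n)" "bp_embed n"
    by (intro group_hom.intro group_hom_axioms.intro BP_group bp_embed_hom)
  note F = BP_factor[OF b]
  let ?s = "bp_perm n b" let ?p = "perm_aut n ?s" let ?c = "b \<otimes>\<^bsub>BP n\<^esub> inv\<^bsub>BP n\<^esub> ?p"
  have p: "?p \<in> carrier (BP n)" using F(1) by (rule perm_aut_BP)
  have "bp_embed n b \<otimes>\<^bsub>BP (Suc n)\<^esub> inv\<^bsub>BP (Suc n)\<^esub> (perm_aut (Suc n) ?s) = bp_embed n ?c"
    using b p by (simp add: bp_embed_perm_aut[OF F(1), symmetric])
  then have 1: "R_id (Suc n) R' (bp_embed n b) = pure_elem (Suc n) (o_embed n (R ?c)) ?s"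
    using R_stable[OF R R' F(2)] by (simp add: R_id_def bp_embed_BP(2)[OF b])
  have sub: "sym_carrier n \<subseteq> sym_carrier (Suc n)"
    unfolding sym_carrier_def using permutes_subset[of _ "{1..n}" "{1..Suc n}"] by auto
  have "?s \<in> sym_carrier n" using F(1) by (simp add: sym_carrier_def)
  then have "pure_elem (Suc n) (o_embed n (R ?c)) ?s = algebra_embed n (pure_elem n (R ?c) ?s)"
  proof (intro ext)
    fix p assume s: "?s \<in> sym_carrier n"
    show "pure_elem (Suc n) (o_embed n (R ?c)) ?s p = algebra_embed n (pure_elem n (R ?c) ?s) p"
      by (cases "p = ?s") (use s sub o_embed_cls[of 0 n] in \<open>auto simp: pure_elem_def algebra_embed_def OA_simps\<close>)
  qed
  then show ?thesis using 1 by (simp add: R_id_def)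
qed

end

lemma const_term_cls: "f \<in> FA.C n \<Longrightarrow> const_term (FA.cls n f) = f []"
  and linear_part_cls: "f \<in> FA.C n \<Longrightarrow> linear_part (FA.cls n f) = (\<lambda>p. f [p])"
proof -
  assume f: "f \<in> FA.C n"
  have self: "f \<in> FA.cls n f" using FA.cls_mem[OF f] FA.eqJ_refl[OF f] by blast
  have "g [] = f []" "(\<lambda>p. g [p]) = (\<lambda>p. f [p])" if "g \<in> FA.cls n f" for g
    using that FA.cls_mem[OF f, of g] eqJ_const[of n g f] eqJ_linear[of n g f] by (blast, intro ext, blast)
  then have "(\<lambda>f. f []) ` FA.cls n f = (\<lambda>_. f []) ` FA.cls n f"
    "(\<lambda>f p. f [p]) ` FA.cls n f = (\<lambda>_. \<lambda>p. f [p]) ` FA.cls n f"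
    by (intro image_cong HOL.refl; blast)+
  then have "(\<lambda>f. f []) ` FA.cls n f = {f []}" "(\<lambda>f p. f [p]) ` FA.cls n f = {\<lambda>p. f [p]}"
    unfolding image_constant[OF self] .
  then show "const_term (FA.cls n f) = f []" "linear_part (FA.cls n f) = (\<lambda>p. f [p])"
    by (simp_all add: const_term_def linear_part_def)
qed

text \<open>The powers of \<open>v\<^sub>i\<^sub>j\<close> from the second on have no terms of degree less than two.\<close>
lemma o_exp_vgen_equiv2:
  assumes ij: "(i, j) \<in> pairs n"
  shows "o_exp n (vgen n i j) \<equiv>\<^sub>2 \<one>\<^bsub>OA n\<^esub> \<oplus>\<^bsub>OA n\<^esub> vgen n i j"
proof -
  have g: "gv i j \<in> FA.C n" using ij by (rule gen_carrier)
  have v: "vgen n i j = FA.cls n (gv i j)"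
    by (simp add: vgen_def FA.cls_def rel_ideal_eq ncps_ring_eq_sring)
  have e: "exps (gv i j) \<in> FA.C n" "exps (gv i j) [] = 1"
    using group_like_exps_gen[OF ij] by (auto simp: group_like_def)
  have "exps (gv i j) [p] = (1 + gv i j) [p]" for p
    by (simp add: exps_eq_ssum ssum_def sc_apply)
  moreover have "(1 + gv i j) [] = 1" by (simp add: ncps_gen_def)
  ultimately show ?thesis
    using e g by (simp add: equiv2_def o_exp_vgen[OF ij, unfolded v] v OA_simps const_term_cls linear_part_cls FA.C_closed)
qed

theorem theorem1p2:
  shows
    "(\<forall>n\<ge>1. \<exists>!R. R \<in> extensional (carrier (BC n)) \<and> is_R n R) \<and>
     (\<forall>R. (\<forall>n\<ge>1. is_R n (R n)) \<longrightarrow>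
       (\<forall>n\<ge>1.
         \<comment> \<open>(E)\<close>
         subgroup (exp_semidirect n) (units_of (braid_algebra n)) \<and>
         (\<forall>b\<in>carrier (BP n). R_id n (R n) b \<in> exp_semidirect n) \<and>
         (\<forall>\<beta>\<in>carrier (Braid n). rho' n (R n) \<beta> \<in> exp_semidirect n) \<and>
         \<comment> \<open>(Sigma)\<close>
         (\<forall>b\<in>carrier (BP n). semidirect_perm n (R_id n (R n) b) = bp_perm n b) \<and>
         (\<forall>\<beta>\<in>carrier (Braid n). semidirect_perm n (rho' n (R n) \<beta>) = braid_perm n \<beta>) \<and>
         \<comment> \<open>(S), from \<open>n\<close> to \<open>n + 1\<close>\<close>
         (\<forall>b\<in>carrier (BP n).
            R_id (Suc n) (R (Suc n)) (bp_embed n b) = algebra_embed n (R_id n (R n) b)) \<and>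
         (\<forall>\<beta>\<in>carrier (Braid n).
            rho' (Suc n) (R (Suc n)) (braid_embed n \<beta>) = algebra_embed n (rho' n (R n) \<beta>)) \<and>
         \<comment> \<open>faithful representations\<close>
         R_id n (R n) \<in> hom (BP n) (units_of (braid_algebra n)) \<and>
         inj_on (R_id n (R n)) (carrier (BP n)) \<and>
         rho' n (R n) \<in> hom (Braid n) (units_of (braid_algebra n)) \<and>
         inj_on (rho' n (R n)) (carrier (Braid n)) \<and>
         \<comment> \<open>normalization\<close>
         (\<forall>(i, j)\<in>pairs n. \<exists>u\<in>carrier (OA n).
            R_id n (R n) (aut_gen n i j) = pure_elem n u id \<and>
            u \<equiv>\<^sub>2 \<one>\<^bsub>OA n\<^esub> \<oplus>\<^bsub>OA n\<^esub> vgen n i j) \<and>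
         (\<forall>i\<in>{1..<n}. \<exists>u\<in>carrier (exp_lie n).
            rho' n (R n) (sigma n i) = pure_elem n u (transpose i (Suc i)) \<and>
            u \<equiv>\<^sub>2 \<one>\<^bsub>OA n\<^esub> \<oplus>\<^bsub>OA n\<^esub> vgen n i (Suc i))))"
proof (intro conjI allI impI)
  fix n :: nat assume "1 \<le> n"
  show "\<exists>!R. R \<in> extensional (carrier (BC n)) \<and> is_R n R" by (rule R_exists_unique)
next
  fix R :: "nat \<Rightarrow> fg_aut \<Rightarrow> oalg" and n :: nat
  assume "\<forall>n\<ge>1. is_R n (R n)" and n: "1 \<le> n"
  then have R: "is_R n (R n)" and R': "is_R (Suc n) (R (Suc n))" by auto
  obtain m where m: "n = Suc m" using n by (cases n) auto
  note bc = hom_in_carrier[OF braid_to_bp_hom(1)[of m], folded m]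
  show "subgroup (exp_semidirect n) (units_of (braid_algebra n))" by (rule exp_semidirect_subgroup)
  show "\<forall>b\<in>carrier (BP n). R_id n (R n) b \<in> exp_semidirect n" using R_id_semidirect[OF R] by blast
  then show "\<forall>\<beta>\<in>carrier (Braid n). rho' n (R n) \<beta> \<in> exp_semidirect n" using bc by (simp add: rho'_def)
  show "\<forall>b\<in>carrier (BP n). semidirect_perm n (R_id n (R n) b) = bp_perm n b" using R_id_perm[OF R] by blast
  then show "\<forall>\<beta>\<in>carrier (Braid n). semidirect_perm n (rho' n (R n) \<beta>) = braid_perm n \<beta>"
    using bc braid_perm_eq[of _ m, folded m] by (simp add: rho'_def)
  show "\<forall>b\<in>carrier (BP n). R_id (Suc n) (R (Suc n)) (bp_embed n b) = algebra_embed n (R_id n (R n) b)"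
    using R_id_stable[OF R R'] by blast
  then show "\<forall>\<beta>\<in>carrier (Braid n). rho' (Suc n) (R (Suc n)) (braid_embed n \<beta>) = algebra_embed n (rho' n (R n) \<beta>)"
    using bc braid_to_bp_embed[of _ m, folded m] by (simp add: rho'_def)
  show hom: "R_id n (R n) \<in> hom (BP n) (units_of (braid_algebra n))" by (rule R_id_hom[OF R])
  show inj: "inj_on (R_id n (R n)) (carrier (BP n))" by (rule R_id_inj[OF R])
  have comp: "rho' n (R n) = R_id n (R n) \<circ> braid_to_bp n" by (simp add: rho'_def fun_eq_iff)
  show "rho' n (R n) \<in> hom (Braid n) (units_of (braid_algebra n))"
    unfolding comp by (rule hom_compose[OF braid_to_bp_hom(1)[of m, folded m] hom])
  have "braid_to_bp n ` carrier (Braid n) \<subseteq> carrier (BP n)" using bc by blast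
  then show "inj_on (rho' n (R n)) (carrier (Braid n))"
    unfolding comp by (intro comp_inj_on braid_to_bp_inj[of m, folded m] inj_on_subset[OF inj])
  have gen: "aut_gen n i j \<in> carrier (BC n)" "R n (aut_gen n i j) = o_exp n (vgen n i j)"
    "o_exp n (vgen n i j) \<in> carrier (exp_lie n)" "o_exp n (vgen n i j) \<in> carrier (OA n)" if ij: "(i, j) \<in> pairs n" for i j
  proof -
    show "aut_gen n i j \<in> carrier (BC n)"
      using ij move_BC[of i n j True] by (auto simp: pairs_def aut_gen_eq_move)
    show "R n (aut_gen n i j) = o_exp n (vgen n i j)" using R ij by (auto simp: is_R_def)
    show "o_exp n (vgen n i j) \<in> carrier (exp_lie n)"
      using group_like_exps_gen[OF ij] by (simp add: o_exp_vgen[OF ij] exp_lie_carrier)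
    show "o_exp n (vgen n i j) \<in> carrier (OA n)"
      using group_like_C[OF group_like_exps_gen[OF ij]] by (simp add: o_exp_vgen[OF ij] OA_simps)
  qed
  show "\<forall>(i, j)\<in>pairs n. \<exists>u\<in>carrier (OA n).
      R_id n (R n) (aut_gen n i j) = pure_elem n u id \<and> u \<equiv>\<^sub>2 \<one>\<^bsub>OA n\<^esub> \<oplus>\<^bsub>OA n\<^esub> vgen n i j"
    using gen o_exp_vgen_equiv2 R_id_BC[OF R] by auto
  show "\<forall>i\<in>{1..<n}. \<exists>u\<in>carrier (exp_lie n).
      rho' n (R n) (sigma n i) = pure_elem n u (transpose i (Suc i)) \<and>
      u \<equiv>\<^sub>2 \<one>\<^bsub>OA n\<^esub> \<oplus>\<^bsub>OA n\<^esub> vgen n i (Suc i)"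
  proof
    fix i assume i: "i \<in> {1..<n}"
    then have p: "(i, Suc i) \<in> pairs n" and i': "i \<in> {1..n}" "Suc i \<in> {1..n}" by (auto simp: pairs_def)
    have "rho' n (R n) (sigma n i) = pure_elem n (o_exp n (vgen n i (Suc i))) (transpose i (Suc i))"
      using braid_to_bp_hom(2)[of i m, folded m] i gen[OF p]
        R_id_mult_perm[OF R gen(1)[OF p] transpose_permutes[OF i']] by (simp add: rho'_def m)
    then show "\<exists>u\<in>carrier (exp_lie n). rho' n (R n) (sigma n i) = pure_elem n u (transpose i (Suc i)) \<and>
        u \<equiv>\<^sub>2 \<one>\<^bsub>OA n\<^esub> \<oplus>\<^bsub>OA n\<^esub> vgen n i (Suc i)"
      using gen(3)[OF p] o_exp_vgen_equiv2[OF p] by blast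
  qed
qed

end
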